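(* The generalized flag manifold $SO(6)/(U(1)\times U(2))$ admits at least $3$ invariant almost complex structures up to equivalence and conjugation.
   Context: Here $U(1)\times U(2)\subset U(3)\subset SO(6)$ is embedded block-diagonally in $U(3)$, and $U(3)\subset SO(6)$ is the standard embedding. An invariant almost complex structure on $M=U/K$ is an almost complex structure $J$ (a $(1,1)$-tensor with $J^2=-\mathrm{Id}$) commuting with the differentials of the left action of $U$ on $M$ (here $U=SO(6)$). The conjugate of $J$ is $-J$. Two almost complex structures $J_1,J_2$ on $M$ are equivalent if there is a diffeomorphism $\phi:M\to M$ with $d\phi\circ J_1=J_2\circ d\phi$ (for integrable structures: $(M,J_1)$ and $(M,J_2)$ are biholomorphic). "Up to equivalence and conjugation" means modulo the equivalence relation generated by $J\sim -J$ and equivalence. *)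

theory Defs
  imports "HOL-Analysis.Analysis" "HOL-Algebra.Left_Coset"
begin

subsection \<open>Smooth functions on subsets of Euclidean spaces\<close>

text \<open>\<open>C_k_on k f S\<close> is meant for open \<open>S\<close>; the derivatives of order \<open>Suc k\<close> are those of order
  \<open>k\<close> of all directional derivatives.\<close>

primrec C_k_on :: "nat \<Rightarrow> ('a::euclidean_space \<Rightarrow> real) \<Rightarrow> 'a set \<Rightarrow> bool" where
  "C_k_on 0 f S \<longleftrightarrow> continuous_on S f"
| "C_k_on (Suc k) f S \<longleftrightarrow>
     (\<forall>x\<in>S. f differentiable (at x)) \<and>
     (\<forall>v. C_k_on k (\<lambda>x. frechet_derivative f (at x) v) S)"

text \<open>Smoothness on an arbitrary subset: local extendability to a smooth function on an open set.
  For an embedded submanifold \<open>S\<close> these are the smooth functions of the manifold \<open>S\<close>.\<close>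

definition smooth_fun_on :: "'a::euclidean_space set \<Rightarrow> ('a \<Rightarrow> real) \<Rightarrow> bool" where
  "smooth_fun_on S f \<longleftrightarrow>
     (\<forall>x\<in>S. \<exists>W h. open W \<and> x \<in> W \<and> (\<forall>k. C_k_on k h W) \<and> (\<forall>y\<in>S \<inter> W. h y = f y))"


subsection \<open>Manifolds presented by their algebra of smooth functions\<close>

text \<open>
  A smooth manifold is given by its point set \<open>M\<close> and its algebra \<open>F\<close> of globally defined smooth
  real functions, which determines the topology and the smooth atlas: a map is smooth iff it pulls
  smooth functions back to smooth functions, and tangent vectors are derivations.  Functions, maps and tensors are total functions of which only the restriction to
  \<open>M\<close> matters.  In particular the values of \<open>f \<in> F\<close> outside of \<open>M\<close> are arbitrary, but this does not
  influence derivations: if \<open>f \<in> F\<close> vanishes on \<open>M\<close>, then \<open>f = f * h\<close> where \<open>h \<in> F\<close> is the indicator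
  function of the complement of \<open>M\<close>, so the Leibniz rule at \<open>p \<in> M\<close> gives \<open>v f = 0\<close>.

  Tangent vectors at \<open>p\<close> are the derivations of \<open>F\<close> at \<open>p\<close>; they are normalised to be \<open>0\<close> outside
  of \<open>F\<close>, so that equal derivations are equal as HOL functions.
\<close>

type_synonym 'm tvec = "('m \<Rightarrow> real) \<Rightarrow> real"

definition tangent_space :: "('m \<Rightarrow> real) set \<Rightarrow> 'm \<Rightarrow> 'm tvec set" where
  "tangent_space F p = {v.
     (\<forall>f\<in>F. \<forall>g\<in>F. v (\<lambda>q. f q + g q) = v f + v g) \<and>
     (\<forall>c. \<forall>f\<in>F. v (\<lambda>q. c * f q) = c * v f) \<and>
     (\<forall>f\<in>F. \<forall>g\<in>F. v (\<lambda>q. f q * g q) = f p * v g + g p * v f) \<and>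
     (\<forall>f. f \<notin> F \<longrightarrow> v f = 0)}"

definition diffeomorphism_of :: "'m set \<Rightarrow> ('m \<Rightarrow> real) set \<Rightarrow> ('m \<Rightarrow> 'm) \<Rightarrow> bool" where
  "diffeomorphism_of M F \<phi> \<longleftrightarrow>
     bij_betw \<phi> M M \<and> (\<forall>f\<in>F. f \<circ> \<phi> \<in> F) \<and> (\<forall>f\<in>F. f \<circ> inv_into M \<phi> \<in> F)"

definition differential :: "('m \<Rightarrow> real) set \<Rightarrow> ('m \<Rightarrow> 'm) \<Rightarrow> 'm tvec \<Rightarrow> 'm tvec" where
  "differential F \<phi> v = (\<lambda>f. if f \<in> F then v (f \<circ> \<phi>) else 0)"

definition smooth_vector_field ::
    "'m set \<Rightarrow> ('m \<Rightarrow> real) set \<Rightarrow> ('m \<Rightarrow> 'm tvec) \<Rightarrow> bool" where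
  "smooth_vector_field M F X \<longleftrightarrow>
     (\<forall>p\<in>M. X p \<in> tangent_space F p) \<and> (\<forall>f\<in>F. (\<lambda>p. X p f) \<in> F)"

definition almost_complex_structure ::
    "'m set \<Rightarrow> ('m \<Rightarrow> real) set \<Rightarrow> ('m \<Rightarrow> 'm tvec \<Rightarrow> 'm tvec) \<Rightarrow> bool" where
  "almost_complex_structure M F J \<longleftrightarrow>
     (\<forall>p\<in>M. \<forall>v\<in>tangent_space F p.
        J p v \<in> tangent_space F p \<and>
        (\<forall>w\<in>tangent_space F p. J p (\<lambda>f. v f + w f) = (\<lambda>f. J p v f + J p w f)) \<and>
        (\<forall>c. J p (\<lambda>f. c * v f) = (\<lambda>f. c * J p v f)) \<and>
        J p (J p v) = (\<lambda>f. - v f)) \<and>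
     (\<forall>X. smooth_vector_field M F X \<longrightarrow> smooth_vector_field M F (\<lambda>p. J p (X p)))"

definition conjugate_acs :: "('m \<Rightarrow> 'm tvec \<Rightarrow> 'm tvec) \<Rightarrow> 'm \<Rightarrow> 'm tvec \<Rightarrow> 'm tvec" where
  "conjugate_acs J = (\<lambda>p v f. - J p v f)"

definition preserved_by ::
    "'m set \<Rightarrow> ('m \<Rightarrow> real) set \<Rightarrow> ('m \<Rightarrow> 'm) \<Rightarrow>
     ('m \<Rightarrow> 'm tvec \<Rightarrow> 'm tvec) \<Rightarrow> ('m \<Rightarrow> 'm tvec \<Rightarrow> 'm tvec) \<Rightarrow> bool" where
  "preserved_by M F \<phi> J\<^sub>1 J\<^sub>2 \<longleftrightarrow>
     (\<forall>p\<in>M. \<forall>v\<in>tangent_space F p.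
        differential F \<phi> (J\<^sub>1 p v) = J\<^sub>2 (\<phi> p) (differential F \<phi> v))"

definition equivalent_acs ::
    "'m set \<Rightarrow> ('m \<Rightarrow> real) set \<Rightarrow>
     ('m \<Rightarrow> 'm tvec \<Rightarrow> 'm tvec) \<Rightarrow> ('m \<Rightarrow> 'm tvec \<Rightarrow> 'm tvec) \<Rightarrow> bool" where
  "equivalent_acs M F J\<^sub>1 J\<^sub>2 \<longleftrightarrow>
     (\<exists>\<phi>. diffeomorphism_of M F \<phi> \<and> preserved_by M F \<phi> J\<^sub>1 J\<^sub>2)"


subsection \<open>Homogeneous spaces of closed matrix groups\<close>

text \<open>The smooth structure on \<open>G/K\<close> is the one for which the projection \<open>g \<mapsto> gK\<close> is a surjective
  submersion: a function on \<open>G/K\<close> is smooth iff its pullback to \<open>G\<close> is smooth.\<close>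

definition coset_smooth ::
    "(real^'n^'n) monoid \<Rightarrow> (real^'n^'n) set \<Rightarrow> ((real^'n^'n) set \<Rightarrow> real) set" where
  "coset_smooth G K = {f. smooth_fun_on (carrier G) (\<lambda>g. f (g <#\<^bsub>G\<^esub> K))}"

definition invariant_acs ::
    "(real^'n^'n) monoid \<Rightarrow> (real^'n^'n) set \<Rightarrow>
     ((real^'n^'n) set \<Rightarrow> (real^'n^'n) set tvec \<Rightarrow> (real^'n^'n) set tvec) set" where
  "invariant_acs G K = {J.
     almost_complex_structure (lcosets\<^bsub>G\<^esub> K) (coset_smooth G K) J \<and>
     (\<forall>g\<in>carrier G.
        preserved_by (lcosets\<^bsub>G\<^esub> K) (coset_smooth G K) (\<lambda>C. g <#\<^bsub>G\<^esub> C) J J)}"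

definition acs_relation ::
    "(real^'n^'n) monoid \<Rightarrow> (real^'n^'n) set \<Rightarrow>
     (((real^'n^'n) set \<Rightarrow> (real^'n^'n) set tvec \<Rightarrow> (real^'n^'n) set tvec) \<times>
      ((real^'n^'n) set \<Rightarrow> (real^'n^'n) set tvec \<Rightarrow> (real^'n^'n) set tvec)) set" where
  "acs_relation G K = {(J, J'). J \<in> invariant_acs G K \<and> J' \<in> invariant_acs G K \<and>
     equivclp (\<lambda>J\<^sub>1 J\<^sub>2. J\<^sub>1 \<in> invariant_acs G K \<and> J\<^sub>2 \<in> invariant_acs G K \<and>
        (J\<^sub>2 = conjugate_acs J\<^sub>1 \<or>
         equivalent_acs (lcosets\<^bsub>G\<^esub> K) (coset_smooth G K) J\<^sub>1 J\<^sub>2)) J J'}"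


subsection \<open>The groups\<close>

definition SO :: "(real^'n^'n) monoid" where
  "SO = \<lparr>carrier = {A. orthogonal_matrix A \<and> det A = 1}, mult = (**), one = mat 1\<rparr>"

definition conj_transpose :: "complex^'n^'n \<Rightarrow> complex^'n^'n" where
  "conj_transpose A = (\<chi> i j. cnj (A $ j $ i))"

definition unitary_mats :: "(complex^'n^'n) set" where
  "unitary_mats = {A. conj_transpose A ** A = mat 1 \<and> A ** conj_transpose A = mat 1}"

text \<open>The matrix with blocks \<open>A B\<close> in the upper row and \<open>C D\<close> in the lower one.  Sum types serve as
  index sets: \<open>'m + 'n\<close> is the index type of \<open>\<real>\<^sup>m \<oplus> \<real>\<^sup>n\<close>.\<close>

definition block_mat ::
    "'a^'m^'m \<Rightarrow> 'a^'n^'m \<Rightarrow> 'a^'m^'n \<Rightarrow> 'a^'n^'n \<Rightarrow> 'a^('m + 'n)^('m + 'n)" where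
  "block_mat A B C D = (\<chi> i j.
     case i of
       Inl i' \<Rightarrow> (case j of Inl j' \<Rightarrow> A $ i' $ j' | Inr j' \<Rightarrow> B $ i' $ j')
     | Inr i' \<Rightarrow> (case j of Inl j' \<Rightarrow> C $ i' $ j' | Inr j' \<Rightarrow> D $ i' $ j'))"

text \<open>The standard embedding \<open>U(n) \<rightarrow> SO(2n)\<close>, \<open>\<complex>\<^sup>n = \<real>\<^sup>n \<oplus> i\<real>\<^sup>n\<close>.\<close>

definition realify :: "complex^'n^'n \<Rightarrow> real^('n + 'n)^('n + 'n)" where
  "realify Z = block_mat (\<chi> i j. Re (Z $ i $ j)) (\<chi> i j. - Im (Z $ i $ j))
                         (\<chi> i j. Im (Z $ i $ j)) (\<chi> i j. Re (Z $ i $ j))"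

text \<open>\<open>SO(6)\<close>, with \<open>3 = 1 + 2\<close> and \<open>6 = 3 + 3\<close>.\<close>

type_synonym mat6 = "real^((1 + 2) + (1 + 2))^((1 + 2) + (1 + 2))"

definition SO6 :: "mat6 monoid" where
  "SO6 = SO"

definition U1xU2 :: "mat6 set" where
  "U1xU2 = {realify (block_mat u 0 0 v) | (u :: complex^1^1) (v :: complex^2^2).
              u \<in> unitary_mats \<and> v \<in> unitary_mats}"

end

theory Submission
  imports Defs
begin

text \<open>
  The three structures are those obtained from \<open>J_acs 0 1\<close> by changing signs on the three irreducible summands
  of the isotropy representation.  Two properties of almost complex structures, both stable under
  diffeomorphisms and conjugation, separate them.

  First, \<open>J_acs 0 1\<close> is integrable, and \<open>SO(6)/(U(1) \<times> U(2))\<close> projects holomorphically to the quadric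
  of isotropic lines in \<open>\<complex>\<^sup>6\<close>; quotients of homogeneous coordinates there are nonconstant
  holomorphic functions.  In contrast, the Nijenhuis tensor of \<open>J_acs (-1) 0\<close> has values spanning the
  tangent spaces, so that even its locally defined holomorphic functions are constant.

  Second, the first Chern class of \<open>J_acs 1 0\<close> is divisible by \<open>3\<close>, and those of the other two are not.
  Divisibility is expressed without characteristic classes: for \<open>J_acs 1 0\<close>, a loop of frames over one point
  that is null-homotopic in the frame bundle has a total winding number divisible by \<open>3\<close>, since
  the determinant of the frame, compared with a lift to \<open>SO(6)\<close>, is well defined up to the cube of a
  character of the stabilizer.  For the other two structures the square of a circle in \<open>SO(6)\<close> moves a frame
  along a null-homotopic loop with total winding number \<open>\<plusminus>2\<close>.
\<close>

text \<open>The manifold is known only through its smooth functions and a tangent vector is any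
  derivation, so the structures become computable only when every derivation at gK is known to be
  the velocity of an infinitesimal rotation. To this end the manifold is viewed as the orbit of the
  pair (\<open>B0\<close>, \<open>C0\<close>) under conjugation: a smooth local section makes smooth
  functions local functions of the pair, Hadamard's lemma reduces a derivation to its values on
  matrix entries, and Kato's formula turns these values into a generator.

  On the summand inside \<complex>^2 the sign is fixed; on the other two it is \<alpha> + \<beta>
  and \<alpha> - \<beta>. For a in U(1) and A in U(2) with determinant c, the isotropy
  representation has, up to conjugation, determinant c * (a^2 c) * (a^-2 c) = c^3 for
  \<open>J_acs 1 0\<close>. Each changed sign inverts a factor, which gives c a^4 for
  \<open>J_acs 0 1\<close> and c^-1 for \<open>J_acs (-1) 0\<close>. Neither is the cube of a
  character, and a circle with a = 1 along which c winds once detects both.\<close>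

section \<open>Calculus of \<open>C_k_on\<close>\<close>

lemma C_k_on_cong:
  assumes "open S" "\<And>x. x \<in> S \<Longrightarrow> f x = g x"
  shows "C_k_on k f S \<longleftrightarrow> C_k_on k g S"
  using assms(2)
proof (induction k arbitrary: f g)
  case 0
  then show ?case using continuous_on_cong[OF refl, of S f g] by simp
next
  case (Suc k)
  have d: "(f has_derivative D) (at x) \<longleftrightarrow> (g has_derivative D) (at x)" if "x \<in> S" for x D
    using has_derivative_transform_within_open[OF _ assms(1) that, of f D UNIV g]
      has_derivative_transform_within_open[OF _ assms(1) that, of g D UNIV f] Suc.prems by auto
  have fd: "frechet_derivative f (at x) = frechet_derivative g (at x)" if "x \<in> S" for x
    by (simp add: frechet_derivative_def d[OF that])
  have "C_k_on k (\<lambda>x. frechet_derivative f (at x) v) S \<longleftrightarrow> C_k_on k (\<lambda>x. frechet_derivative g (at x) v) S" for v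
    by (rule Suc.IH) (simp add: fd)
  moreover have "(\<forall>x\<in>S. f differentiable (at x)) \<longleftrightarrow> (\<forall>x\<in>S. g differentiable (at x))"
    by (auto simp: differentiable_def d)
  ultimately show ?case by simp
qed

lemma C_k_on_subset: "C_k_on k f S \<Longrightarrow> T \<subseteq> S \<Longrightarrow> C_k_on k f T"
  by (induction k arbitrary: f) (auto intro: continuous_on_subset)

lemma C_k_on_SucD: "C_k_on (Suc k) f S \<Longrightarrow> C_k_on k f S"
proof (induction k arbitrary: f)
  case 0
  then show ?case
    by (auto intro!: continuous_at_imp_continuous_on differentiable_imp_continuous_within)
qed auto

lemma C_k_on_Un:
  assumes "open S" "open T" "C_k_on k f S" "C_k_on k f T"
  shows "C_k_on k f (S \<union> T)"
  using assms(3,4) by (induction k arbitrary: f) (auto intro: continuous_on_open_Un assms)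

text \<open>The closure properties below are inductions on \<open>k\<close> through this rule, which
  allows the derivative to be given by an explicit expression \<open>D\<close> in place of
  \<open>frechet_derivative\<close>.\<close>

lemma C_k_on_SucI:
  assumes "open S" "\<And>x. x \<in> S \<Longrightarrow> (f has_derivative D x) (at x)" "\<And>v. C_k_on k (\<lambda>x. D x v) S"
  shows "C_k_on (Suc k) f S"
proof -
  have "C_k_on k (\<lambda>x. frechet_derivative f (at x) v) S" for v
    using C_k_on_cong[OF assms(1), of "\<lambda>x. frechet_derivative f (at x) v" "\<lambda>x. D x v" k] assms(2,3)
    by (metis frechet_derivative_at)
  then show ?thesis using assms(2) by (auto simp: differentiable_def)
qed

lemma C_k_on_Suc_has_derivative:
  "C_k_on (Suc k) f S \<Longrightarrow> x \<in> S \<Longrightarrow> (f has_derivative frechet_derivative f (at x)) (at x)"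
  by (simp flip: frechet_derivative_works)

lemma C_k_on_const: "open S \<Longrightarrow> C_k_on k (\<lambda>x. c) S"
proof (induction k arbitrary: c)
  case (Suc k)
  then show ?case by (intro C_k_on_SucI[where D = "\<lambda>_ _. 0"]) auto
qed simp

lemma C_k_on_bounded_linear:
  assumes "open S" "bounded_linear f"
  shows "C_k_on k f S"
proof (cases k)
  case 0
  then show ?thesis using assms by (simp add: linear_continuous_on)
next
  case (Suc j)
  then show ?thesis
    using C_k_on_SucI[OF assms(1), of f "\<lambda>_. f" j] assms
    by (simp add: C_k_on_const bounded_linear_imp_has_derivative del: C_k_on.simps)
qed

lemma C_k_on_add:
  assumes "open S"
  shows "C_k_on k f S \<Longrightarrow> C_k_on k g S \<Longrightarrow> C_k_on k (\<lambda>x. f x + g x) S"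
proof (induction k arbitrary: f g)
  case (Suc k)
  show ?case
  proof (rule C_k_on_SucI[OF assms])
    show "((\<lambda>x. f x + g x) has_derivative
      (\<lambda>v. frechet_derivative f (at x) v + frechet_derivative g (at x) v)) (at x)" if "x \<in> S" for x
      using Suc.prems that by (intro has_derivative_add C_k_on_Suc_has_derivative)
    show "C_k_on k (\<lambda>x. frechet_derivative f (at x) v + frechet_derivative g (at x) v) S" for v
      using Suc.prems by (intro Suc.IH) auto
  qed
qed (simp add: continuous_on_add)

lemma C_k_on_mult:
  assumes "open S"
  shows "C_k_on k f S \<Longrightarrow> C_k_on k g S \<Longrightarrow> C_k_on k (\<lambda>x. f x * g x) S"
proof (induction k arbitrary: f g)
  case (Suc k)
  show ?case
  proof (rule C_k_on_SucI[OF assms])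
    show "((\<lambda>x. f x * g x) has_derivative
      (\<lambda>v. f x * frechet_derivative g (at x) v + frechet_derivative f (at x) v * g x)) (at x)" if "x \<in> S" for x
      using Suc.prems that by (intro has_derivative_mult C_k_on_Suc_has_derivative)
    show "C_k_on k (\<lambda>x. f x * frechet_derivative g (at x) v + frechet_derivative f (at x) v * g x) S" for v
      using Suc.prems C_k_on_SucD[OF Suc.prems(1)] C_k_on_SucD[OF Suc.prems(2)]
      by (intro C_k_on_add[OF assms] Suc.IH) auto
  qed
qed (simp add: continuous_on_mult)

lemma C_k_on_sum:
  assumes "open S" "\<And>i. i \<in> I \<Longrightarrow> C_k_on k (f i) S"
  shows "C_k_on k (\<lambda>x. \<Sum>i\<in>I. f i x) S"
  using assms(2)
  by (induction I rule: infinite_finite_induct) (auto intro: C_k_on_const C_k_on_add assms(1))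

lemma C_k_on_minus: "open S \<Longrightarrow> C_k_on k f S \<Longrightarrow> C_k_on k (\<lambda>x. - f x) S"
  using C_k_on_mult[OF _ C_k_on_const[of S k "-1"], of f] by simp

lemma C_k_on_diff: "open S \<Longrightarrow> C_k_on k f S \<Longrightarrow> C_k_on k g S \<Longrightarrow> C_k_on k (\<lambda>x. f x - g x) S"
  using C_k_on_add[OF _ _ C_k_on_minus, of S k f g] by simp

text \<open>The chain rule writes a directional derivative of the composition as a finite sum of
  products, each of a derivative of a coordinate of \<open>u\<close> and a derivative of
  \<open>h\<close> composed with \<open>u\<close>; the induction hypothesis applies to the second
  factor.\<close>

lemma C_k_on_compose:
  fixes u :: "'a::euclidean_space \<Rightarrow> 'b::euclidean_space"
  assumes S: "open S" and T: "open T" and uT: "u ` S \<subseteq> T"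
  shows "C_k_on k h T \<Longrightarrow> (\<And>b. b \<in> Basis \<Longrightarrow> C_k_on k (\<lambda>x. u x \<bullet> b) S) \<Longrightarrow> C_k_on k (\<lambda>x. h (u x)) S"
proof (induction k arbitrary: h)
  case 0
  have "continuous_on S u"
    using 0(2) by (subst continuous_on_componentwise) auto
  then show ?case using 0 uT by (auto intro: continuous_on_compose2)
next
  case (Suc k)
  let ?u' = "\<lambda>x v. \<Sum>b\<in>Basis. frechet_derivative (\<lambda>x. u x \<bullet> b) (at x) v *\<^sub>R b"
  show ?case
  proof (rule C_k_on_SucI[OF S])
    fix x assume x: "x \<in> S"
    then have xT: "u x \<in> T" using uT by auto
    have "(u has_derivative ?u' x) (at x)"
      unfolding has_derivative_componentwise_within[of u]
      using Suc.prems(2) x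
      by (auto simp: inner_sum_left inner_Basis if_distrib sum.delta cong: if_cong
          intro!: C_k_on_Suc_has_derivative[where k = k])
    then have d: "((\<lambda>x. h (u x)) has_derivative (\<lambda>v. frechet_derivative h (at (u x)) (?u' x v))) (at x)"
      using has_derivative_compose C_k_on_Suc_has_derivative[OF Suc.prems(1) xT] by blast
    have lin: "linear (frechet_derivative h (at (u x)))"
      using Suc.prems(1) xT by (auto intro: linear_frechet_derivative)
    have "frechet_derivative h (at (u x)) (?u' x v) =
       (\<Sum>b\<in>Basis. frechet_derivative (\<lambda>x. u x \<bullet> b) (at x) v * frechet_derivative h (at (u x)) b)" for v
      by (simp add: linear_sum[OF lin] linear_cmul[OF lin])
    with d show "((\<lambda>x. h (u x)) has_derivative (\<lambda>v. \<Sum>b\<in>Basis.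
        frechet_derivative (\<lambda>x. u x \<bullet> b) (at x) v * frechet_derivative h (at (u x)) b)) (at x)"
      by simp
  next
    fix v
    have "C_k_on k (\<lambda>x. frechet_derivative h (at (u x)) b) S" for b
      by (rule Suc.IH) (use Suc.prems(1) in simp, rule C_k_on_SucD, fact Suc.prems(2))
    then show "C_k_on k (\<lambda>x. \<Sum>b\<in>Basis.
        frechet_derivative (\<lambda>x. u x \<bullet> b) (at x) v * frechet_derivative h (at (u x)) b) S"
      using Suc.prems(2) by (intro C_k_on_sum C_k_on_mult S) auto
  qed
qed

lemma C_k_on_real_SucI:
  fixes f :: "real \<Rightarrow> real"
  assumes "open S" "\<And>x. x \<in> S \<Longrightarrow> (f has_real_derivative f' x) (at x)" "C_k_on k f' S"
  shows "C_k_on (Suc k) f S"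
  by (rule C_k_on_SucI[OF assms(1)])
    (auto intro!: C_k_on_mult C_k_on_const assms(1,3) dest!: assms(2) simp: has_field_derivative_def)

lemma C_k_on_inverse:
  "C_k_on k (inverse :: real \<Rightarrow> real) (- {0})"
proof (induction k)
  case (Suc k)
  have *: "C_k_on k (\<lambda>x::real. - (inverse x * inverse x)) (- {0})"
    by (intro C_k_on_minus C_k_on_mult Suc) auto
  show ?case
    by (rule C_k_on_real_SucI[OF _ _ *]) (auto intro!: derivative_eq_intros)
qed (auto intro!: continuous_intros)

lemma C_k_on_sqrt: "C_k_on k sqrt {0<..}"
proof (induction k)
  case (Suc k)
  have inv: "C_k_on k inverse {0::real<..}"
    by (rule C_k_on_subset[OF C_k_on_inverse]) auto
  \<comment> \<open>The derivative is written as sqrt x / (2 x) and not as 1 / (2 sqrt x), so that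
    the induction hypothesis about \<open>sqrt\<close> applies to it.\<close>
  have *: "C_k_on k (\<lambda>x. (1/2) * (sqrt x * inverse x)) {0<..}"
    by (intro C_k_on_mult C_k_on_const Suc inv) auto
  show ?case
    by (rule C_k_on_real_SucI[OF _ _ *])
      (auto intro!: derivative_eq_intros simp: field_simps simp flip: real_sqrt_mult)
qed (auto intro!: continuous_intros)

lemma C_k_on_comp_real:
  fixes u :: "'a::euclidean_space \<Rightarrow> real"
  assumes "open S" "open T" "u ` S \<subseteq> T" "C_k_on k h T" "C_k_on k u S"
  shows "C_k_on k (\<lambda>x. h (u x)) S"
  using C_k_on_compose[OF assms(1-4)] assms(5) by simp

section \<open>A function that is flat at 0, for bump functions\<close>

lemma exp_inverse_power_tendsto_0:
  "((\<lambda>x::real. inverse x ^ n * exp (- inverse x)) \<longlongrightarrow> 0) (at_right 0)"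
proof -
  have "((\<lambda>y::real. y ^ n * exp (- y)) \<longlongrightarrow> 0) at_top"
    using tendsto_power_div_exp_0[of n] by (simp add: exp_minus divide_inverse)
  then show ?thesis
    by (rule filterlim_compose) (rule filterlim_inverse_at_top_right)
qed

text \<open>\<open>flat_fun 0\<close> is the classical exp (-1/x). Its derivatives produce powers of
  1/x; with these included, the family is closed under differentiation up to linear combinations,
  and smoothness is an induction over the whole family.\<close>

definition flat_fun :: "nat \<Rightarrow> real \<Rightarrow> real" where
  "flat_fun n x = (if x \<le> 0 then 0 else inverse x ^ n * exp (- inverse x))"

lemma flat_fun_tendsto_0: "(flat_fun n \<longlongrightarrow> 0) (at 0)"
  unfolding filterlim_at_split
proof
  show "(flat_fun n \<longlongrightarrow> 0) (at_left 0)"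
    by (rule tendsto_eventually) (auto simp: flat_fun_def eventually_at_filter)
  show "(flat_fun n \<longlongrightarrow> 0) (at_right 0)"
    by (rule Lim_transform_eventually[OF exp_inverse_power_tendsto_0[of n]])
      (auto simp: flat_fun_def eventually_at_filter)
qed

lemma flat_fun_has_derivative:
  "(flat_fun n has_real_derivative (flat_fun (Suc (Suc n)) x - real n * flat_fun (Suc n) x)) (at x)"
proof -
  consider "x < 0" | "x = 0" | "x > 0" by linarith
  then show ?thesis
  proof cases
    case 1
    have "((\<lambda>x. 0) has_real_derivative 0) (at x)" by simp
    then have "(flat_fun n has_real_derivative 0) (at x)"
      by (rule has_field_derivative_transform_within_open[of _ _ _ "{..<0}"])
        (use 1 in \<open>auto simp: flat_fun_def\<close>)
    with 1 show ?thesis by (simp add: flat_fun_def)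
  next
    case 2
    have "((\<lambda>h. flat_fun n h / h) \<longlongrightarrow> 0) (at 0)"
      by (rule Lim_transform_eventually[OF flat_fun_tendsto_0[of "Suc n"]])
        (auto simp: flat_fun_def eventually_at_filter field_simps)
    with 2 show ?thesis by (simp add: DERIV_def flat_fun_def)
  next
    case 3
    have "((\<lambda>x. inverse x ^ n * exp (- inverse x)) has_real_derivative
        (real n * (- (inverse x * inverse x) * inverse x ^ (n - 1)) * exp (- inverse x)
          + inverse x ^ n * (exp (- inverse x) * (inverse x * inverse x)))) (at x)"
      using 3 by (auto intro!: derivative_eq_intros)
    also have "real n * (- (inverse x * inverse x) * inverse x ^ (n - 1)) * exp (- inverse x)
          + inverse x ^ n * (exp (- inverse x) * (inverse x * inverse x))
        = flat_fun (Suc (Suc n)) x - real n * flat_fun (Suc n) x"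
      using 3 by (cases n) (simp_all add: flat_fun_def algebra_simps)
    finally have "((\<lambda>x. inverse x ^ n * exp (- inverse x)) has_real_derivative
        (flat_fun (Suc (Suc n)) x - real n * flat_fun (Suc n) x)) (at x)" .
    then show ?thesis
      by (rule has_field_derivative_transform_within_open[of _ _ _ "{0<..}"])
        (use 3 in \<open>auto simp: flat_fun_def\<close>)
  qed
qed

lemma C_k_on_flat_fun: "C_k_on k (flat_fun n) UNIV"
proof (induction k arbitrary: n)
  case 0
  show ?case
    using flat_fun_has_derivative
    by (auto intro!: continuous_at_imp_continuous_on DERIV_isCont)
next
  case (Suc k)
  show ?case
    by (rule C_k_on_real_SucI[OF _ flat_fun_has_derivative])
      (auto intro!: C_k_on_diff C_k_on_mult C_k_on_const Suc)
qed

section \<open>Hadamard's lemma\<close>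

lemma has_real_derivative_along_line:
  assumes "(h has_derivative D) (at (p + t *\<^sub>R X))"
  shows "((\<lambda>t. h (p + t *\<^sub>R X)) has_real_derivative D X) (at t)"
proof -
  have "((\<lambda>t. h (p + t *\<^sub>R X)) has_derivative (\<lambda>a. D (a *\<^sub>R X))) (at t)"
    by (rule has_derivative_compose[where f = "\<lambda>t. p + t *\<^sub>R X" and g = h and g' = D])
      (use assms in \<open>auto intro!: derivative_eq_intros\<close>)
  then show ?thesis
    by (simp add: has_field_derivative_def linear_cmul[OF has_derivative_linear[OF assms]] mult_commute_abs)
qed

text \<open>Differentiation under the integral sign. The weight \<open>t ^ n\<close> is carried
  along because each derivative in \<open>x\<close> contributes one more factor \<open>t\<close>; so
  the class of such integrals is closed under differentiation.\<close>

lemma ray_integral_has_derivative: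
  fixes \<psi> :: "'a::euclidean_space \<Rightarrow> real"
  assumes \<psi>: "C_k_on (Suc 0) \<psi> (ball x0 r)" and x: "x \<in> ball x0 r"
  shows "((\<lambda>x. integral {0..1} (\<lambda>t. t ^ n * \<psi> (x0 + t *\<^sub>R (x - x0)))) has_derivative
    (\<lambda>v. integral {0..1} (\<lambda>t. t ^ Suc n * frechet_derivative \<psi> (at (x0 + t *\<^sub>R (x - x0))) v))) (at x)"
proof -
  let ?p = "\<lambda>x t. x0 + t *\<^sub>R (x - x0)"
  let ?d = "\<lambda>x t v. t ^ Suc n * frechet_derivative \<psi> (at (?p x t)) v"
  \<comment> \<open>The Leibniz rule for parameter integrals asks for a derivative that is
    continuous as a bounded linear map, not only in each direction.\<close>
  let ?D = "\<lambda>x t. Blinfun (?d x t)"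
  have inb: "?p x t \<in> ball x0 r" if "x \<in> ball x0 r" "t \<in> {0..1}" for x t
  proof -
    have "norm (t *\<^sub>R (x - x0)) \<le> norm (x - x0)"
      using that by (simp add: mult_left_le_one_le)
    then show ?thesis using that by (simp add: dist_norm norm_minus_commute)
  qed
  have bl: "bounded_linear (?d x t)" if "x \<in> ball x0 r" "t \<in> {0..1}" for x t
    using C_k_on_Suc_has_derivative[OF \<psi> inb[OF that]]
    by (intro bounded_linear_const_mult has_derivative_bounded_linear)
  have app: "blinfun_apply (?D x t) = ?d x t" if "x \<in> ball x0 r" "t \<in> {0..1}" for x t
    using bl[OF that] by (simp add: bounded_linear_Blinfun_apply)
  have c\<psi>: "continuous_on (ball x0 r) \<psi>"
    using C_k_on_SucD[OF \<psi>] by simp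
  have c': "continuous_on (ball x0 r) (\<lambda>y. frechet_derivative \<psi> (at y) v)" for v
    using \<psi> by simp
  have der: "((\<lambda>x. t ^ n * \<psi> (?p x t)) has_derivative blinfun_apply (?D x t)) (at x within ball x0 r)"
    if xt: "x \<in> ball x0 r" "t \<in> cbox 0 1" for x t
  proof -
    have t: "t \<in> {0..1}" using xt by simp
    have "((\<lambda>x. \<psi> (?p x t)) has_derivative (\<lambda>v. frechet_derivative \<psi> (at (?p x t)) (t *\<^sub>R v))) (at x)"
      by (rule has_derivative_compose[where f = "\<lambda>x. ?p x t" and g = \<psi>,
            OF _ C_k_on_Suc_has_derivative[OF \<psi> inb[OF xt(1) t]]])
        (auto intro!: derivative_eq_intros)
    then have "((\<lambda>x. t ^ n * \<psi> (?p x t)) has_derivative (\<lambda>v. t ^ n * frechet_derivative \<psi> (at (?p x t)) (t *\<^sub>R v))) (at x)"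
      by (rule has_derivative_mult_right)
    also have "(\<lambda>v. t ^ n * frechet_derivative \<psi> (at (?p x t)) (t *\<^sub>R v)) = ?d x t"
      using linear_cmul[OF linear_frechet_derivative[of \<psi> "at (?p x t)"]] \<psi> inb[OF xt(1) t]
      by (auto simp: fun_eq_iff)
    finally show ?thesis
      unfolding app[OF xt(1) t] by (rule has_derivative_at_withinI)
  qed
  have int: "(\<lambda>t. t ^ n * \<psi> (?p x t)) integrable_on cbox 0 1" if "x \<in> ball x0 r" for x
    using inb[OF that] by (intro integrable_continuous continuous_intros continuous_on_compose2[OF c\<psi>]) auto
  have cont: "continuous_on (ball x0 r \<times> cbox 0 1) (\<lambda>(x, t). ?D x t)"
  proof (rule continuous_on_blinfun_componentwise)
    fix v :: 'a
    have "continuous_on (ball x0 r \<times> cbox 0 1) (\<lambda>z. ?d (fst z) (snd z) v)"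
      using inb by (intro continuous_intros continuous_on_compose2[OF c'[of v]]) auto
    then show "continuous_on (ball x0 r \<times> cbox 0 1) (\<lambda>z. blinfun_apply (case z of (x, t) \<Rightarrow> ?D x t) v)"
    proof (rule continuous_on_eq)
      fix z assume "z \<in> ball x0 r \<times> cbox (0 :: real) 1"
      then have "fst z \<in> ball x0 r" "snd z \<in> {0..1}" by auto
      then show "?d (fst z) (snd z) v = blinfun_apply (case z of (x, t) \<Rightarrow> ?D x t) v"
        by (simp only: split_beta app)
    qed
  qed
  have contx: "continuous_on {0..1} (?D x)"
  proof -
    have 1: "continuous_on {0..1} (Pair x)" and 2: "Pair x ` {0..1} \<subseteq> ball x0 r \<times> cbox (0::real) 1"
      using x by (auto intro!: continuous_intros)
    show ?thesis using continuous_on_compose2[OF cont 1 2] by simp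
  qed
  have A: "((\<lambda>x. integral (cbox 0 1) (\<lambda>t. t ^ n * \<psi> (?p x t))) has_derivative integral (cbox 0 1) (?D x)) (at x within ball x0 r)"
    by (rule leibniz_rule[OF der int cont x convex_ball]) auto
  have B: "blinfun_apply (integral (cbox 0 1) (?D x)) = (\<lambda>v. integral {0..1} (\<lambda>t. ?d x t v))"
  proof
    fix v
    have "?D x integrable_on {0..1}" by (rule integrable_continuous_real[OF contx])
    then have "blinfun_apply (integral {0..1} (?D x)) v = integral {0..1} (\<lambda>t. blinfun_apply (?D x t) v)"
      by (rule blinfun_apply_integral)
    also have "\<dots> = integral {0..1} (\<lambda>t. ?d x t v)"
      by (rule integral_cong) (simp only: app[OF x])
    finally show "blinfun_apply (integral (cbox 0 1) (?D x)) v = integral {0..1} (\<lambda>t. ?d x t v)"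
      by simp
  qed
  from A show ?thesis
    unfolding at_within_open[OF x open_ball] cbox_interval B[unfolded cbox_interval] .
qed

lemma C_k_on_ray_integral:
  fixes \<psi> :: "'a::euclidean_space \<Rightarrow> real"
  assumes "\<And>k. C_k_on k \<psi> (ball x0 r)"
  shows "C_k_on k (\<lambda>x. integral {0..1} (\<lambda>t. t ^ n * \<psi> (x0 + t *\<^sub>R (x - x0)))) (ball x0 r)"
  using assms
proof (induction k arbitrary: n \<psi>)
  case 0
  show ?case
    unfolding C_k_on.simps(1)
    using has_derivative_continuous[OF ray_integral_has_derivative[OF 0]]
    by (intro continuous_at_imp_continuous_on) blast
next
  case (Suc k)
  show ?case
  proof (rule C_k_on_SucI[OF open_ball ray_integral_has_derivative[OF Suc.prems]])
    fix v
    have "C_k_on j (\<lambda>y. frechet_derivative \<psi> (at y) v) (ball x0 r)" for j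
      using Suc.prems[of "Suc j"] by simp
    then show "C_k_on k (\<lambda>x. integral {0..1} (\<lambda>t. t ^ Suc n *
        frechet_derivative \<psi> (at (x0 + t *\<^sub>R (x - x0))) v)) (ball x0 r)"
      by (rule Suc.IH)
  qed
qed

text \<open>The fundamental theorem of calculus along the segment from \<open>x0\<close> to
  \<open>x\<close>: the factor \<open>G b\<close> is the integral of the partial derivative in
  direction \<open>b\<close> over this segment.\<close>

lemma hadamard:
  fixes \<Phi> :: "'a::euclidean_space \<Rightarrow> real"
  assumes \<Phi>: "\<And>k. C_k_on k \<Phi> (ball x0 r)"
  obtains G where "\<And>b k. C_k_on k (G b) (ball x0 r)"
    "\<And>b. G b x0 = frechet_derivative \<Phi> (at x0) b"
    "\<And>x. x \<in> ball x0 r \<Longrightarrow> \<Phi> x = \<Phi> x0 + (\<Sum>b\<in>Basis. ((x - x0) \<bullet> b) * G b x)"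
proof
  \<comment> \<open>The factor \<open>t ^ 0\<close> gives the integral the shape of
    \<open>C_k_on_ray_integral\<close>.\<close>
  let ?G = "\<lambda>b x. integral {0..1} (\<lambda>t. t ^ 0 * frechet_derivative \<Phi> (at (x0 + t *\<^sub>R (x - x0))) b)"
  have d: "C_k_on k (\<lambda>y. frechet_derivative \<Phi> (at y) v) (ball x0 r)" for k v
    using \<Phi>[of "Suc k"] by simp
  show "C_k_on k (?G b) (ball x0 r)" for b k
    by (rule C_k_on_ray_integral[OF d])
  show "?G b x0 = frechet_derivative \<Phi> (at x0) b" for b
    by simp
  fix x assume x: "x \<in> ball x0 r"
  let ?p = "\<lambda>t. x0 + t *\<^sub>R (x - x0)"
  have inb: "?p t \<in> ball x0 r" if "t \<in> {0..1}" for t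
  proof -
    have "norm (t *\<^sub>R (x - x0)) \<le> norm (x - x0)"
      using that by (simp add: mult_left_le_one_le)
    then show ?thesis using x by (simp add: dist_norm norm_minus_commute)
  qed
  have lin: "linear (frechet_derivative \<Phi> (at (?p t)))" if "t \<in> {0..1}" for t
    using \<Phi>[of "Suc 0"] inb[OF that] by (intro linear_frechet_derivative) simp
  have int: "(\<lambda>t. frechet_derivative \<Phi> (at (?p t)) b) integrable_on {0..1}" for b
  proof (rule integrable_continuous_real)
    have "continuous_on (ball x0 r) (\<lambda>y. frechet_derivative \<Phi> (at y) b)" using d[of 0 b] by simp
    moreover have "continuous_on {0..1} ?p" by (intro continuous_intros)
    ultimately show "continuous_on {0..1} (\<lambda>t. frechet_derivative \<Phi> (at (?p t)) b)"
      by (rule continuous_on_compose2) (use inb in blast)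
  qed
  have "((\<lambda>t. frechet_derivative \<Phi> (at (?p t)) (x - x0)) has_integral (\<Phi> (?p 1) - \<Phi> (?p 0))) {0..1}"
  proof (rule fundamental_theorem_of_calculus)
    fix t :: real assume t: "t \<in> {0..1}"
    have "((\<lambda>t. \<Phi> (?p t)) has_real_derivative frechet_derivative \<Phi> (at (?p t)) (x - x0)) (at t)"
      by (rule has_real_derivative_along_line[OF C_k_on_Suc_has_derivative[OF \<Phi>[of "Suc 0"] inb[OF t]]])
    then show "((\<lambda>t. \<Phi> (?p t)) has_vector_derivative frechet_derivative \<Phi> (at (?p t)) (x - x0)) (at t within {0..1})"
      by (simp add: has_real_derivative_iff_has_vector_derivative has_vector_derivative_at_within)
  qed simp
  then have "\<Phi> x - \<Phi> x0 = integral {0..1} (\<lambda>t. frechet_derivative \<Phi> (at (?p t)) (x - x0))"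
    by (simp add: integral_unique)
  also have "\<dots> = integral {0..1} (\<lambda>t. \<Sum>b\<in>Basis. ((x - x0) \<bullet> b) * frechet_derivative \<Phi> (at (?p t)) b)"
  proof (rule integral_cong)
    fix t :: real assume t: "t \<in> {0..1}"
    have "frechet_derivative \<Phi> (at (?p t)) (x - x0) =
      frechet_derivative \<Phi> (at (?p t)) (\<Sum>b\<in>Basis. ((x - x0) \<bullet> b) *\<^sub>R b)"
      by (simp only: euclidean_representation)
    also have "\<dots> = (\<Sum>b\<in>Basis. ((x - x0) \<bullet> b) * frechet_derivative \<Phi> (at (?p t)) b)"
      by (simp only: linear_sum[OF lin[OF t]] linear_cmul[OF lin[OF t]] real_scaleR_def)
    finally show "frechet_derivative \<Phi> (at (?p t)) (x - x0) =
      (\<Sum>b\<in>Basis. ((x - x0) \<bullet> b) * frechet_derivative \<Phi> (at (?p t)) b)" .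
  qed
  also have "\<dots> = (\<Sum>b\<in>Basis. ((x - x0) \<bullet> b) * integral {0..1} (\<lambda>t. frechet_derivative \<Phi> (at (?p t)) b))"
    by (subst integral_sum) (auto intro!: integrable_on_mult_right int)
  finally show "\<Phi> x = \<Phi> x0 + (\<Sum>b\<in>Basis. ((x - x0) \<bullet> b) * ?G b x)"
    by simp
qed

section \<open>Symmetry of second derivatives\<close>

text \<open>The mean value theorem is used twice, in the direction \<open>X\<close> for the
  increment in the direction \<open>Y\<close>, and in the direction \<open>Y\<close> for the
  resulting derivative. The left side is symmetric in \<open>X\<close> and \<open>Y\<close>, the
  right side is not visibly so.\<close>

lemma second_difference_mean_value:
  fixes h :: "'a::euclidean_space \<Rightarrow> real"
  assumes h: "C_k_on 2 h W" and s: "0 < s"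
    and W: "\<And>t u. t \<in> {0..s} \<Longrightarrow> u \<in> {0..s} \<Longrightarrow> x + t *\<^sub>R X + u *\<^sub>R Y \<in> W"
  shows "\<exists>t\<in>{0..s}. \<exists>u\<in>{0..s}. h (x + s *\<^sub>R X + s *\<^sub>R Y) - h (x + s *\<^sub>R X) - h (x + s *\<^sub>R Y) + h x =
    s\<^sup>2 * frechet_derivative (\<lambda>y. frechet_derivative h (at y) X) (at (x + t *\<^sub>R X + u *\<^sub>R Y)) Y"
proof -
  let ?hX = "\<lambda>y. frechet_derivative h (at y) X"
  have h1: "C_k_on (Suc 0) h W" and hX: "C_k_on (Suc 0) ?hX W"
    using h C_k_on_SucD[of "Suc 0" h W] by (simp_all add: numeral_2_eq_2)
  have dX: "((\<lambda>t. h (x + t *\<^sub>R X + u *\<^sub>R Y)) has_real_derivative ?hX (x + t *\<^sub>R X + u *\<^sub>R Y)) (at t)"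
    if "t \<in> {0..s}" "u \<in> {0..s}" for t u
  proof -
    have "x + u *\<^sub>R Y + t *\<^sub>R X \<in> W" using W[OF that] by (simp add: add_ac)
    then have "((\<lambda>t. h (x + u *\<^sub>R Y + t *\<^sub>R X)) has_real_derivative ?hX (x + u *\<^sub>R Y + t *\<^sub>R X)) (at t)"
      by (intro has_real_derivative_along_line C_k_on_Suc_has_derivative[OF h1])
    then show ?thesis by (simp add: add_ac)
  qed
  have dY: "((\<lambda>u. ?hX (x + t *\<^sub>R X + u *\<^sub>R Y)) has_real_derivative
      frechet_derivative ?hX (at (x + t *\<^sub>R X + u *\<^sub>R Y)) Y) (at u)"
    if "t \<in> {0..s}" "u \<in> {0..s}" for t u
    by (intro has_real_derivative_along_line C_k_on_Suc_has_derivative[OF hX W[OF that]])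
  have "\<exists>t. 0 < t \<and> t < s \<and>
     (h (x + s *\<^sub>R X + s *\<^sub>R Y) - h (x + s *\<^sub>R X + 0 *\<^sub>R Y)) - (h (x + 0 *\<^sub>R X + s *\<^sub>R Y) - h (x + 0 *\<^sub>R X + 0 *\<^sub>R Y))
      = (s - 0) * (?hX (x + t *\<^sub>R X + s *\<^sub>R Y) - ?hX (x + t *\<^sub>R X + 0 *\<^sub>R Y))"
    using s by (intro MVT2 DERIV_diff dX) auto
  then obtain t where t: "0 < t" "t < s"
    and 1: "h (x + s *\<^sub>R X + s *\<^sub>R Y) - h (x + s *\<^sub>R X) - h (x + s *\<^sub>R Y) + h x
      = s * (?hX (x + t *\<^sub>R X + s *\<^sub>R Y) - ?hX (x + t *\<^sub>R X + 0 *\<^sub>R Y))"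
    by (auto simp: algebra_simps)
  have "\<exists>u. 0 < u \<and> u < s \<and> ?hX (x + t *\<^sub>R X + s *\<^sub>R Y) - ?hX (x + t *\<^sub>R X + 0 *\<^sub>R Y)
      = (s - 0) * frechet_derivative ?hX (at (x + t *\<^sub>R X + u *\<^sub>R Y)) Y"
    using s t by (intro MVT2 dY) auto
  then show ?thesis using 1 t by (force simp: power2_eq_square)
qed

text \<open>Both mixed derivatives, taken at suitable points of a small parallelogram at
  \<open>x\<close>, equal the same second difference divided by the square of its size. Continuity
  carries the equality to \<open>x\<close>.\<close>

lemma frechet_derivative_commute:
  fixes h :: "'a::euclidean_space \<Rightarrow> real"
  assumes W: "open W" and h: "C_k_on 2 h W" and x: "x \<in> W"
  shows "frechet_derivative (\<lambda>y. frechet_derivative h (at y) X) (at x) Y =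
    frechet_derivative (\<lambda>y. frechet_derivative h (at y) Y) (at x) X"
proof -
  let ?F = "\<lambda>X Y y. frechet_derivative (\<lambda>y. frechet_derivative h (at y) X) (at y) Y"
  have cont: "isCont (?F X Y) x" for X Y
    using h x W by (simp add: numeral_2_eq_2 continuous_on_eq_continuous_at)
  have eps: "\<bar>?F X Y x - ?F Y X x\<bar> \<le> e" if e: "e > 0" for e
  proof -
    from W x obtain d0 where d0: "d0 > 0" "ball x d0 \<subseteq> W" by (auto elim: openE)
    from cont[of X Y] e obtain d1 where d1: "d1 > 0" "\<And>y. dist y x < d1 \<Longrightarrow> dist (?F X Y y) (?F X Y x) < e / 2"
      unfolding continuous_at_eps_delta by (meson half_gt_zero)
    from cont[of Y X] e obtain d2 where d2: "d2 > 0" "\<And>y. dist y x < d2 \<Longrightarrow> dist (?F Y X y) (?F Y X x) < e / 2"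
      unfolding continuous_at_eps_delta by (meson half_gt_zero)
    define d where "d = min d0 (min d1 d2)"
    \<comment> \<open>The summand 1 keeps \<open>N\<close> positive when \<open>X\<close> and
      \<open>Y\<close> vanish. With side \<open>s\<close> = d / (2 N) the parallelogram stays within
      distance d / 2 of \<open>x\<close>.\<close>
    define N where "N = norm X + norm Y + 1"
    have N: "N > 0" by (simp add: N_def add_nonneg_pos)
    define s where "s = d / (2 * N)"
    have d: "d > 0" using d0 d1 d2 by (simp add: d_def)
    then have s: "s > 0" using N by (simp add: s_def)
    have near: "dist (x + t *\<^sub>R X + u *\<^sub>R Y) x < d" if tu: "t \<in> {0..s}" "u \<in> {0..s}" for t u
    proof -
      have "norm (t *\<^sub>R X + u *\<^sub>R Y) \<le> s * norm X + s * norm Y"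
        using tu by (intro order_trans[OF norm_triangle_ineq] add_mono) (auto intro!: mult_right_mono)
      also have "\<dots> \<le> s * N"
        using s by (simp add: algebra_simps N_def)
      also have "\<dots> = d / 2"
        using N by (simp add: s_def)
      finally show ?thesis using d by (simp add: dist_norm add.assoc)
    qed
    have inW: "x + t *\<^sub>R X + u *\<^sub>R Y \<in> W" if "t \<in> {0..s}" "u \<in> {0..s}" for t u
      using near[OF that] d0 by (auto simp: d_def dist_commute)
    obtain t u where tu: "t \<in> {0..s}" "u \<in> {0..s}" and 1:
      "h (x + s *\<^sub>R X + s *\<^sub>R Y) - h (x + s *\<^sub>R X) - h (x + s *\<^sub>R Y) + h x = s\<^sup>2 * ?F X Y (x + t *\<^sub>R X + u *\<^sub>R Y)"
      using second_difference_mean_value[OF h s, of x X Y] inW by blast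
    have inW': "x + t *\<^sub>R Y + u *\<^sub>R X \<in> W" if "t \<in> {0..s}" "u \<in> {0..s}" for t u
      using inW[OF that(2,1)] by (simp add: add_ac)
    obtain t' u' where tu': "t' \<in> {0..s}" "u' \<in> {0..s}" and 2:
      "h (x + s *\<^sub>R Y + s *\<^sub>R X) - h (x + s *\<^sub>R Y) - h (x + s *\<^sub>R X) + h x = s\<^sup>2 * ?F Y X (x + t' *\<^sub>R Y + u' *\<^sub>R X)"
      using second_difference_mean_value[OF h s, of x Y X] inW' by blast
    have e: "x + s *\<^sub>R Y + s *\<^sub>R X = x + s *\<^sub>R X + s *\<^sub>R Y"
      "x + t' *\<^sub>R Y + u' *\<^sub>R X = x + u' *\<^sub>R X + t' *\<^sub>R Y"
      by simp_all
    from 1 2[unfolded e] have "s\<^sup>2 * ?F X Y (x + t *\<^sub>R X + u *\<^sub>R Y) = s\<^sup>2 * ?F Y X (x + u' *\<^sub>R X + t' *\<^sub>R Y)"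
      by linarith
    then have "?F X Y (x + t *\<^sub>R X + u *\<^sub>R Y) = ?F Y X (x + u' *\<^sub>R X + t' *\<^sub>R Y)"
      using s by simp
    moreover have "dist (?F X Y (x + t *\<^sub>R X + u *\<^sub>R Y)) (?F X Y x) < e / 2"
      using near[OF tu] by (intro d1) (simp add: d_def)
    moreover have "dist (?F Y X (x + u' *\<^sub>R X + t' *\<^sub>R Y)) (?F Y X x) < e / 2"
      using near[OF tu'(2,1)] by (intro d2) (simp add: d_def)
    ultimately show ?thesis unfolding dist_real_def by linarith
  qed
  have "\<bar>?F X Y x - ?F Y X x\<bar> \<le> 0"
    by (rule field_le_epsilon) (unfold add_0, rule eps)
  then show ?thesis unfolding abs_le_zero_iff right_minus_eq .
qed

lemma bounded_bilinear_matrix_mul: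
  "bounded_bilinear ((**) :: real^'n^'m \<Rightarrow> real^'p^'n \<Rightarrow> real^'p^'m)"
proof -
  have "bilinear ((**) :: real^'n^'m \<Rightarrow> real^'p^'n \<Rightarrow> real^'p^'m)"
    unfolding bilinear_def
    by (auto intro!: linearI simp: vec_eq_iff matrix_matrix_mult_def algebra_simps sum.distrib sum_distrib_left)
  then show ?thesis by (simp add: bilinear_conv_bounded_bilinear)
qed

text \<open>As simplification rules these expand sums and bracket products to the right. Relations
  between matrices are therefore also stated with a trailing factor \<open>X\<close>, as in
  \<open>base_mult_assoc\<close>.\<close>

lemmas matrix_algebra =
  bounded_bilinear.add_left[OF bounded_bilinear_matrix_mul]
  bounded_bilinear.add_right[OF bounded_bilinear_matrix_mul]
  bounded_bilinear.diff_left[OF bounded_bilinear_matrix_mul]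
  bounded_bilinear.diff_right[OF bounded_bilinear_matrix_mul]
  bounded_bilinear.minus_left[OF bounded_bilinear_matrix_mul]
  bounded_bilinear.minus_right[OF bounded_bilinear_matrix_mul]
  bounded_bilinear.scaleR_left[OF bounded_bilinear_matrix_mul]
  bounded_bilinear.scaleR_right[OF bounded_bilinear_matrix_mul]
  bounded_bilinear.zero_left[OF bounded_bilinear_matrix_mul]
  bounded_bilinear.zero_right[OF bounded_bilinear_matrix_mul]
  matrix_mul_assoc[symmetric]

lemmas has_derivative_matrix_mul = bounded_bilinear.FDERIV[OF bounded_bilinear_matrix_mul]
lemmas continuous_on_matrix_mul = bounded_bilinear.continuous_on[OF bounded_bilinear_matrix_mul]

lemma transpose_linear:
  fixes A B :: "real^'n^'m"
  shows "transpose (A + B) = transpose A + transpose B"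
    "transpose (A - B) = transpose A - transpose B"
    "transpose (- A) = - transpose A"
    "transpose (c *\<^sub>R A) = c *\<^sub>R transpose A"
    "transpose (0 :: real^'n^'m) = 0"
  by (simp_all add: transpose_def vec_eq_iff)

lemma matrix_transpose_mul_real:
  "transpose (A ** B) = transpose B ** transpose (A :: real^'n^'m)"
  by (rule matrix_transpose_mul)

subsection \<open>Smooth functions on a subset\<close>

text \<open>The data inside \<open>smooth_fun_on\<close>, given names so that derivatives on the
  group can be computed from a chosen extension.\<close>

definition local_ext :: "'a::euclidean_space set \<Rightarrow> ('a \<Rightarrow> real) \<Rightarrow> 'a \<Rightarrow> ('a \<Rightarrow> real) \<Rightarrow> 'a set \<Rightarrow> bool" where
  "local_ext S f x h W \<longleftrightarrow> open W \<and> x \<in> W \<and> (\<forall>k. C_k_on k h W) \<and> (\<forall>y\<in>S \<inter> W. h y = f y)"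

lemma smooth_fun_on_iff: "smooth_fun_on S f \<longleftrightarrow> (\<forall>x\<in>S. \<exists>h W. local_ext S f x h W)"
  by (fastforce simp: smooth_fun_on_def local_ext_def)

lemma smooth_fun_onE:
  assumes "smooth_fun_on S f" "x \<in> S"
  obtains h W where "local_ext S f x h W"
  using assms by (auto simp: smooth_fun_on_iff)

lemma local_ext_UNIV: "(\<And>k. C_k_on k h UNIV) \<Longrightarrow> (\<And>y. y \<in> S \<Longrightarrow> h y = f y) \<Longrightarrow> local_ext S f x h UNIV"
  by (simp add: local_ext_def)

lemma local_ext_add:
  "local_ext S f x h V \<Longrightarrow> local_ext S g x l W \<Longrightarrow> local_ext S (\<lambda>y. f y + g y) x (\<lambda>y. h y + l y) (V \<inter> W)"
proof -
  assume 1: "local_ext S f x h V" and 2: "local_ext S g x l W"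
  have "C_k_on k h (V \<inter> W)" "C_k_on k l (V \<inter> W)" for k
    using 1 2 unfolding local_ext_def by (blast intro: C_k_on_subset)+
  then show ?thesis
    using 1 2 unfolding local_ext_def by (auto intro!: C_k_on_add)
qed

lemma local_ext_mult:
  "local_ext S f x h V \<Longrightarrow> local_ext S g x l W \<Longrightarrow> local_ext S (\<lambda>y. f y * g y) x (\<lambda>y. h y * l y) (V \<inter> W)"
proof -
  assume 1: "local_ext S f x h V" and 2: "local_ext S g x l W"
  have "C_k_on k h (V \<inter> W)" "C_k_on k l (V \<inter> W)" for k
    using 1 2 unfolding local_ext_def by (blast intro: C_k_on_subset)+
  then show ?thesis
    using 1 2 unfolding local_ext_def by (auto intro!: C_k_on_mult)
qed

lemma smooth_fun_on_cong: "(\<And>x. x \<in> S \<Longrightarrow> f x = g x) \<Longrightarrow> smooth_fun_on S f \<longleftrightarrow> smooth_fun_on S g"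
  by (simp add: smooth_fun_on_def)

lemma smooth_fun_on_const: "smooth_fun_on S (\<lambda>x. c)"
  by (auto simp: smooth_fun_on_iff intro!: exI local_ext_UNIV C_k_on_const)

lemma smooth_fun_on_add: "smooth_fun_on S f \<Longrightarrow> smooth_fun_on S g \<Longrightarrow> smooth_fun_on S (\<lambda>x. f x + g x)"
  unfolding smooth_fun_on_iff by (blast intro: local_ext_add)

lemma smooth_fun_on_mult: "smooth_fun_on S f \<Longrightarrow> smooth_fun_on S g \<Longrightarrow> smooth_fun_on S (\<lambda>x. f x * g x)"
  unfolding smooth_fun_on_iff by (blast intro: local_ext_mult)

lemma smooth_fun_on_UNIV: "(\<And>k. C_k_on k h UNIV) \<Longrightarrow> smooth_fun_on S h"
  by (auto simp: smooth_fun_on_iff intro!: exI local_ext_UNIV)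

lemma local_ext_compose:
  fixes u :: "'a::euclidean_space \<Rightarrow> 'b::euclidean_space"
  assumes u: "\<And>b k. b \<in> Basis \<Longrightarrow> C_k_on k (\<lambda>x. u x \<bullet> b) UNIV" and uS: "u ` S \<subseteq> T"
    and f: "local_ext T f (u x) h W"
  shows "local_ext S (\<lambda>y. f (u y)) x (\<lambda>y. h (u y)) (u -` W)"
proof -
  have "continuous_on UNIV u"
    using u[of _ 0] by (subst continuous_on_componentwise) auto
  then have op: "open (u -` W)"
    using f by (auto simp: local_ext_def intro: open_vimage)
  moreover have "C_k_on k (\<lambda>y. h (u y)) (u -` W)" for k
    by (rule C_k_on_compose[where T = W and S = "u -` W" and u = u, OF op])
      (use f u in \<open>auto simp: local_ext_def intro: C_k_on_subset\<close>)
  ultimately show ?thesis using f uS by (auto simp: local_ext_def)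
qed

subsection \<open>Rotations\<close>

abbreviation SOn :: "(real^'n^'n) set" where "SOn \<equiv> carrier SO"

lemma mem_SO: "A \<in> SOn \<longleftrightarrow> orthogonal_matrix A \<and> det A = 1"
  by (simp add: SO_def)

lemma SO_orthogonal:
  "A \<in> SOn \<Longrightarrow> transpose A ** A = mat 1" "A \<in> SOn \<Longrightarrow> A ** transpose A = mat 1"
  "A \<in> SOn \<Longrightarrow> transpose A ** (A ** X) = X" "A \<in> SOn \<Longrightarrow> A ** (transpose A ** X) = X"
  by (simp_all add: mem_SO orthogonal_matrix_def matrix_mul_assoc)

lemma SO_closed:
  "mat 1 \<in> (SOn :: (real^'n^'n) set)" "A \<in> SOn \<Longrightarrow> B \<in> SOn \<Longrightarrow> A ** B \<in> SOn" "A \<in> SOn \<Longrightarrow> transpose A \<in> SOn"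
  by (simp_all add: mem_SO det_mul orthogonal_matrix_mul) (simp_all add: orthogonal_matrix_def)

lemma orthogonal_square_SO: "orthogonal_matrix A \<Longrightarrow> A ** A \<in> SOn"
  using det_orthogonal_matrix[of A] by (auto simp: mem_SO det_mul orthogonal_matrix_mul)

definition skew :: "real^'n^'n \<Rightarrow> bool" where "skew Y \<longleftrightarrow> transpose Y = - Y"

lemma skew_add: "skew X \<Longrightarrow> skew Y \<Longrightarrow> skew (X + Y)"
  and skew_diff: "skew X \<Longrightarrow> skew Y \<Longrightarrow> skew (X - Y)"
  and skew_scaleR: "skew X \<Longrightarrow> skew (c *\<^sub>R X)"
  and skew_minus: "skew X \<Longrightarrow> skew (- X)"
  and skew_0: "skew 0"
  and skew_conj: "skew X \<Longrightarrow> skew (A ** X ** transpose A)"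
  by (simp_all add: skew_def transpose_linear matrix_transpose_mul_real matrix_algebra)

lemma skew_sum: "(\<And>i. i \<in> I \<Longrightarrow> skew (f i)) \<Longrightarrow> skew (\<Sum>i\<in>I. f i)"
  by (induction I rule: infinite_finite_induct) (auto simp: skew_add skew_0)

lemma skew_nth: "skew Y \<Longrightarrow> Y $ i $ j = - Y $ j $ i"
proof -
  assume "skew Y"
  then have "transpose Y $ j $ i = (- Y) $ j $ i" by (simp only: skew_def)
  then show ?thesis by (simp add: transpose_def)
qed

text \<open>Rodrigues' formula.\<close>

definition rot :: "real^'n^'n \<Rightarrow> real \<Rightarrow> real^'n^'n" where
  "rot W t = mat 1 + sin t *\<^sub>R W + (1 - cos t) *\<^sub>R (W ** W)"

lemma rot_0: "rot W 0 = mat 1"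
  by (simp add: rot_def)

lemma rot_add:
  assumes "W ** (W ** W) = - W"
  shows "rot W s ** rot W t = rot W (s + t)"
proof -
  have 4: "W ** (W ** (W ** W)) = - (W ** W)"
    using assms by (simp add: matrix_algebra)
  show ?thesis
    unfolding rot_def sin_add cos_add
    by (simp add: matrix_algebra assms 4 algebra_simps)
qed

lemma transpose_rot: "skew W \<Longrightarrow> transpose (rot W t) = rot W (- t)"
  by (simp add: rot_def skew_def transpose_linear matrix_transpose_mul_real matrix_algebra)

lemma rot_orthogonal:
  assumes "skew W" "W ** (W ** W) = - W"
  shows "orthogonal_matrix (rot W t)"
  using rot_add[OF assms(2), of t "-t"] rot_add[OF assms(2), of "-t" t]
  by (simp add: orthogonal_matrix_def transpose_rot[OF assms(1)] rot_0)

text \<open>The determinant is 1 because the rotation is the square of the rotation by half the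
  angle.\<close>

lemma rot_SO:
  assumes "skew W" "W ** (W ** W) = - W"
  shows "rot W t \<in> SOn"
  using orthogonal_square_SO[OF rot_orthogonal[OF assms, of "t / 2"]] by (simp add: rot_add[OF assms(2)])

lemma rot_has_vector_derivative: "(rot W has_vector_derivative W) (at 0)"
proof -
  have "(rot W has_derivative (\<lambda>t. t *\<^sub>R W)) (at 0)"
    unfolding rot_def by (auto intro!: derivative_eq_intros)
  then show ?thesis by (simp add: has_vector_derivative_def)
qed

section \<open>Rank-one matrices and the Lie algebra of the rotation group\<close>

definition outer :: "real^'m \<Rightarrow> real^'n \<Rightarrow> real^'n^'m" where
  "outer x y = (\<chi> i j. x $ i * y $ j)"

lemma outer_simps:
  "A ** outer x y = outer (A *v x) y" "outer x y ** A = outer x (transpose A *v y)"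
  "outer (x + z) y = outer x y + outer z y" "outer x (y + w) = outer x y + outer x w"
  "outer (x - z) y = outer x y - outer z y" "outer x (y - w) = outer x y - outer x w"
  "outer (c *\<^sub>R x) y = c *\<^sub>R outer x y" "outer x (c *\<^sub>R y) = c *\<^sub>R outer x y"
  "outer (- x) y = - outer x y" "outer x (- y) = - outer x y" "outer 0 y = 0" "outer x 0 = 0"
  "transpose (outer x y) = outer y x" "outer x y *v z = (y \<bullet> z) *\<^sub>R x"
  by (simp_all add: vec_eq_iff outer_def matrix_matrix_mult_def matrix_vector_mult_def transpose_def
      inner_vec_def algebra_simps sum_distrib_left)

lemma outer_mult_outer: "outer x y ** outer z w = (y \<bullet> z) *\<^sub>R outer x (w :: real^'n)"
  for x y z :: "real^'n"
  by (simp add: outer_simps)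

definition wedge :: "real^'n \<Rightarrow> real^'n \<Rightarrow> real^'n^'n" where
  "wedge x y = outer x y - outer y x"

lemma wedge_nth: "wedge x y $ i $ j = x $ i * y $ j - y $ i * x $ j"
  by (simp add: wedge_def outer_def)

lemma skew_wedge: "skew (wedge x y)"
  by (simp add: skew_def wedge_def transpose_linear outer_simps)

lemma wedge_cube:
  assumes "x \<bullet> x = 1" "y \<bullet> y = 1" "x \<bullet> y = 0"
  shows "wedge x y ** (wedge x y ** wedge x y) = - wedge x y"
proof -
  have "y \<bullet> x = 0" using assms(3) by (simp add: inner_commute)
  then show ?thesis
    using assms by (simp add: wedge_def matrix_algebra outer_mult_outer)
qed

text \<open>Membership in the Lie algebra, tested by curves that need only be differentiable at 0.
  Products of curves give sums of velocities, so the rotations in coordinate planes generate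
  everything and no matrix exponential enters.\<close>

definition curve_dir :: "real^'n^'n \<Rightarrow> bool" where
  "curve_dir Y \<longleftrightarrow> (\<exists>c. (\<forall>t. c t \<in> SOn) \<and> c 0 = mat 1 \<and> (c has_vector_derivative Y) (at 0))"

lemma curve_dir_0: "curve_dir 0"
  unfolding curve_dir_def by (rule exI[of _ "\<lambda>t. mat 1"]) (auto simp: SO_closed)

lemma curve_dir_add:
  assumes "curve_dir X" "curve_dir Y"
  shows "curve_dir (X + Y)"
proof -
  obtain a b where a: "\<And>t. a t \<in> SOn" "a 0 = mat 1" "(a has_vector_derivative X) (at 0)"
    and b: "\<And>t. b t \<in> SOn" "b 0 = mat 1" "(b has_vector_derivative Y) (at 0)"
    using assms unfolding curve_dir_def by blast
  have "((\<lambda>t. a t ** b t) has_derivative (\<lambda>s. a 0 ** (s *\<^sub>R Y) + (s *\<^sub>R X) ** b 0)) (at 0)"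
    using a(3) b(3) by (intro has_derivative_matrix_mul) (auto simp: has_vector_derivative_def)
  then have "((\<lambda>t. a t ** b t) has_vector_derivative X + Y) (at 0)"
    using a(2) b(2) by (simp add: has_vector_derivative_def matrix_algebra algebra_simps)
  then show ?thesis
    unfolding curve_dir_def using a b by (intro exI[of _ "\<lambda>t. a t ** b t"]) (auto simp: SO_closed)
qed

lemma curve_dir_scaleR:
  assumes "curve_dir X"
  shows "curve_dir (r *\<^sub>R X)"
proof -
  obtain a where a: "\<And>t. a t \<in> SOn" "a 0 = mat 1" "(a has_vector_derivative X) (at 0)"
    using assms unfolding curve_dir_def by blast
  have "((\<lambda>t. a (r * t)) has_derivative (\<lambda>s. (r * s) *\<^sub>R X)) (at 0)"
    using a(3) by (intro has_derivative_compose[where f = "\<lambda>t. r * t" and g = a and g' = "\<lambda>s. s *\<^sub>R X"])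
      (auto simp: has_vector_derivative_def intro!: derivative_eq_intros)
  then have "((\<lambda>t. a (r * t)) has_vector_derivative r *\<^sub>R X) (at 0)"
    by (simp add: has_vector_derivative_def mult.commute)
  then show ?thesis
    unfolding curve_dir_def using a by (intro exI[of _ "\<lambda>t. a (r * t)"]) auto
qed

lemma curve_dir_sum: "(\<And>i. i \<in> I \<Longrightarrow> curve_dir (f i)) \<Longrightarrow> curve_dir (\<Sum>i\<in>I. f i)"
  by (induction I rule: infinite_finite_induct) (auto simp: curve_dir_add curve_dir_0)

lemma axis_mult_axis: "axis i (1::real) $ k * axis j 1 $ l = (if k = i \<and> l = j then 1 else 0)"
  by (simp add: axis_def)

text \<open>Every unordered pair of indices occurs twice in the double sum, hence the
  halves.\<close>

lemma skew_eq_sum_wedge: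
  assumes "skew (Y :: real^'n^'n)"
  shows "Y = (\<Sum>i\<in>UNIV. \<Sum>j\<in>UNIV. (Y $ i $ j / 2) *\<^sub>R wedge (axis i 1) (axis j 1))"
proof -
  have "(\<Sum>i\<in>UNIV. \<Sum>j\<in>UNIV. (Y $ i $ j / 2) *\<^sub>R wedge (axis i 1) (axis j 1)) $ k $ l = Y $ k $ l" for k l
  proof -
    have "(\<Sum>i\<in>UNIV. \<Sum>j\<in>UNIV. (Y $ i $ j / 2) *\<^sub>R wedge (axis i 1) (axis j 1)) $ k $ l =
      (\<Sum>i\<in>UNIV. \<Sum>j\<in>UNIV. (if i = k then if j = l then Y $ i $ j / 2 else 0 else 0)
        - (if i = l then if j = k then Y $ i $ j / 2 else 0 else 0))"
      by (auto simp: sum_component wedge_nth axis_mult_axis intro!: sum.cong)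
    also have "\<dots> = Y $ k $ l / 2 - Y $ l $ k / 2"
    proof -
      have "(\<Sum>i\<in>UNIV. \<Sum>j\<in>UNIV. if i = k then if j = l then Y $ i $ j / 2 else 0 else 0) = Y $ k $ l / 2" for k l
      proof -
        have "(\<Sum>j\<in>UNIV. if i = k then if j = l then Y $ i $ j / 2 else 0 else 0)
            = (if i = k then Y $ k $ l / 2 else 0)" for i
          by (simp add: sum.delta)
        then show ?thesis by (simp add: sum.delta)
      qed
      then show ?thesis unfolding sum_subtractf by (simp only:)
    qed
    also have "\<dots> = Y $ k $ l" using skew_nth[OF assms, of l k] by simp
    finally show ?thesis .
  qed
  then show ?thesis by (simp add: vec_eq_iff)
qed

lemma skew_curve_dir:
  assumes "skew (Y :: real^'n^'n)"
  shows "curve_dir Y"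
proof -
  have "curve_dir (wedge (axis i 1) (axis j 1))" for i j :: 'n
  proof (cases "i = j")
    case True
    then have "wedge (axis i 1) (axis j 1) = (0 :: real^'n^'n)" by (simp add: wedge_def)
    then show ?thesis by (simp add: curve_dir_0)
  next
    case False
    then have "wedge (axis i 1) (axis j 1) ** (wedge (axis i 1) (axis j 1) ** wedge (axis i 1) (axis j 1)) =
        - (wedge (axis i 1) (axis j 1) :: real^'n^'n)"
      by (intro wedge_cube) (auto simp: inner_axis_axis)
    then show ?thesis
      unfolding curve_dir_def using skew_wedge
      by (intro exI[of _ "rot (wedge (axis i 1) (axis j 1))"]) (auto intro!: rot_SO simp: rot_0 rot_has_vector_derivative)
  qed
  then show ?thesis
    by (subst skew_eq_sum_wedge[OF assms]) (intro curve_dir_sum curve_dir_scaleR)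
qed


subsection \<open>Fundamental vector fields on a homogeneous space\<close>

abbreviation coset :: "(real^'n^'n) set \<Rightarrow> real^'n^'n \<Rightarrow> (real^'n^'n) set" where
  "coset K g \<equiv> g <#\<^bsub>SO\<^esub> K"

abbreviation cosets :: "(real^'n^'n) set \<Rightarrow> (real^'n^'n) set set" where
  "cosets K \<equiv> lcosets\<^bsub>SO\<^esub> K"

abbreviation smooth_on_cosets :: "(real^'n^'n) set \<Rightarrow> ((real^'n^'n) set \<Rightarrow> real) set" where
  "smooth_on_cosets K \<equiv> coset_smooth SO K"

lemma coset_image: "coset K g = (\<lambda>k. g ** k) ` K"
  by (auto simp: l_coset_def SO_def)

lemma coset_assoc: "coset (coset K g) c = coset K (c ** g)"
  by (simp add: coset_image image_image matrix_mul_assoc)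

lemma cosets_iff: "p \<in> cosets K \<longleftrightarrow> (\<exists>g\<in>SOn. p = coset K g)"
  by (auto simp: LCOSETS_def)

lemma coset_mem: "g \<in> SOn \<Longrightarrow> coset K g \<in> cosets K"
  by (auto simp: cosets_iff)

lemma translate_mem: "a \<in> SOn \<Longrightarrow> p \<in> cosets K \<Longrightarrow> coset p a \<in> cosets K"
  by (auto simp: cosets_iff coset_assoc intro: SO_closed)

lemma smooth_on_cosets_iff: "f \<in> smooth_on_cosets K \<longleftrightarrow> smooth_fun_on SOn (\<lambda>g. f (coset K g))"
  by (simp add: coset_smooth_def)

lemma smooth_on_cosets_cong:
  "(\<And>p. p \<in> cosets K \<Longrightarrow> f p = f' p) \<Longrightarrow> f \<in> smooth_on_cosets K \<longleftrightarrow> f' \<in> smooth_on_cosets K"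
  unfolding smooth_on_cosets_iff by (rule smooth_fun_on_cong) (simp add: coset_mem)

lemma smooth_on_cosets_const: "(\<lambda>p. c) \<in> smooth_on_cosets K"
  and smooth_on_cosets_add: "f \<in> smooth_on_cosets K \<Longrightarrow> f' \<in> smooth_on_cosets K \<Longrightarrow> (\<lambda>p. f p + f' p) \<in> smooth_on_cosets K"
  and smooth_on_cosets_mult: "f \<in> smooth_on_cosets K \<Longrightarrow> f' \<in> smooth_on_cosets K \<Longrightarrow> (\<lambda>p. f p * f' p) \<in> smooth_on_cosets K"
  by (simp_all add: smooth_on_cosets_iff smooth_fun_on_const smooth_fun_on_add smooth_fun_on_mult)

lemma smooth_on_cosets_minus: "f \<in> smooth_on_cosets K \<Longrightarrow> (\<lambda>p. - f p) \<in> smooth_on_cosets K"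
  using smooth_on_cosets_mult[OF smooth_on_cosets_const[of "-1"]] by simp

lemma smooth_on_cosets_diff:
  "f \<in> smooth_on_cosets K \<Longrightarrow> f' \<in> smooth_on_cosets K \<Longrightarrow> (\<lambda>p. f p - f' p) \<in> smooth_on_cosets K"
  using smooth_on_cosets_add[OF _ smooth_on_cosets_minus] by simp

lemma smooth_on_cosets_sum:
  "(\<And>i. i \<in> I \<Longrightarrow> f i \<in> smooth_on_cosets K) \<Longrightarrow> (\<lambda>p. \<Sum>i\<in>I. f i p) \<in> smooth_on_cosets K"
  by (induction I rule: infinite_finite_induct) (auto intro: smooth_on_cosets_const smooth_on_cosets_add)

lemma matrix_mul_left_smooth:
  "b \<in> Basis \<Longrightarrow> C_k_on k (\<lambda>x. (A ** (x :: real^'n^'n)) \<bullet> b) UNIV"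
  by (intro C_k_on_bounded_linear bounded_linear_inner_left_comp
      bounded_bilinear.bounded_linear_right[OF bounded_bilinear_matrix_mul]) auto

lemma local_ext_translate:
  assumes a: "a \<in> SOn" and ext: "local_ext SOn (\<lambda>g. f (coset K g)) (a ** g) h W"
  shows "local_ext SOn (\<lambda>g. f (coset (coset K g) a)) g (\<lambda>x. h (a ** x)) ((\<lambda>x. a ** x) -` W)"
  unfolding coset_assoc
  by (rule local_ext_compose[where u = "\<lambda>x. a ** x" and T = SOn and f = "\<lambda>g. f (coset K g)"])
    (use assms in \<open>auto intro: SO_closed matrix_mul_left_smooth\<close>)

lemma smooth_on_cosets_translate:
  assumes a: "a \<in> SOn" and f: "f \<in> smooth_on_cosets K"
  shows "f \<circ> (\<lambda>p. coset p a) \<in> smooth_on_cosets K"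
  unfolding smooth_on_cosets_iff smooth_fun_on_iff o_def
proof
  fix g :: "real^'a^'a" assume "g \<in> SOn"
  then have "a ** g \<in> SOn" using a by (simp add: SO_closed)
  then obtain h W where ext: "local_ext SOn (\<lambda>g. f (coset K g)) (a ** g) h W"
    using f unfolding smooth_on_cosets_iff smooth_fun_on_iff by blast
  from local_ext_translate[OF a this]
  show "\<exists>h W. local_ext SOn (\<lambda>x. f (coset (coset K x) a)) g h W" by blast
qed

text \<open>The function being differentiated depends on \<open>f\<close> and the coset only, while
  the derivative is computed from \<open>g\<close> and \<open>h\<close>. This is what makes the
  choice in \<open>fund\<close> independent of the representative and of the extension.\<close>

lemma translate_has_derivative:
  assumes c: "\<And>t. c t \<in> SOn" "c 0 = mat 1" "(c has_vector_derivative Y) (at 0)"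
    and g: "g \<in> SOn" and ext: "local_ext SOn (\<lambda>g. f (coset K g)) g h W"
  shows "((\<lambda>t. f (coset (coset K g) (c t))) has_real_derivative frechet_derivative h (at g) (Y ** g)) (at 0)"
proof -
  have W: "open W" "g \<in> W" and h: "C_k_on (Suc 0) h W" and eq: "\<And>y. y \<in> SOn \<Longrightarrow> y \<in> W \<Longrightarrow> h y = f (coset K y)"
    using ext unfolding local_ext_def by blast+
  have dh: "(h has_derivative frechet_derivative h (at g)) (at g)"
    by (rule C_k_on_Suc_has_derivative[OF h W(2)])
  have dc: "((\<lambda>t. c t ** g) has_derivative (\<lambda>s. s *\<^sub>R (Y ** g))) (at 0)"
    using has_derivative_matrix_mul[of c "\<lambda>s. s *\<^sub>R Y" 0 UNIV "\<lambda>_. g" "\<lambda>_. 0"] c(3)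
    by (simp add: has_vector_derivative_def matrix_algebra)
  have "((\<lambda>t. h (c t ** g)) has_derivative (\<lambda>s. frechet_derivative h (at g) (s *\<^sub>R (Y ** g)))) (at 0)"
    by (rule has_derivative_compose[where f = "\<lambda>t. c t ** g" and g = h, OF dc]) (simp add: c(2) dh)
  then have 1: "((\<lambda>t. h (c t ** g)) has_real_derivative frechet_derivative h (at g) (Y ** g)) (at 0)"
    by (simp add: has_field_derivative_def linear_cmul[OF has_derivative_linear[OF dh]] mult_commute_abs)
  have "isCont (\<lambda>t. c t ** g) 0"
    using dc by (rule has_derivative_continuous)
  then have "((\<lambda>t. c t ** g) \<longlongrightarrow> c 0 ** g) (nhds 0)"
    by (simp only: isCont_def tendsto_at_iff_tendsto_nhds[of "\<lambda>t. c t ** g" 0])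
  then have "((\<lambda>t. c t ** g) \<longlongrightarrow> g) (nhds 0)"
    using c(2) by simp
  then have "\<forall>\<^sub>F t in nhds 0. c t ** g \<in> W"
    using W by (rule topological_tendstoD)
  then have ev: "\<forall>\<^sub>F t in nhds 0. h (c t ** g) = f (coset (coset K g) (c t))"
    by eventually_elim (use eq c g in \<open>auto simp: coset_assoc SO_closed\<close>)
  show ?thesis
    using DERIV_cong_ev[OF refl ev refl] 1 by simp
qed

text \<open>The derivative of \<open>f\<close> at \<open>p = gK\<close> along the flow of \<open>Y\<close>, computed from any local extension of
  the pullback of \<open>f\<close> to the group.\<close>

definition fund :: "(real^'n^'n) set \<Rightarrow> real^'n^'n \<Rightarrow> (real^'n^'n) set \<Rightarrow> (real^'n^'n) set tvec" where
  "fund K Y p f = (if f \<in> smooth_on_cosets K then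
     (SOME d. \<exists>g\<in>SOn. \<exists>h W. p = coset K g \<and> local_ext SOn (\<lambda>g. f (coset K g)) g h W \<and>
        d = frechet_derivative h (at g) (Y ** g)) else 0)"

lemma fund_eq:
  assumes Y: "skew Y" and g: "g \<in> SOn" and ext: "local_ext SOn (\<lambda>g. f (coset K g)) g h W"
    and f: "f \<in> smooth_on_cosets K"
  shows "fund K Y (coset K g) f = frechet_derivative h (at g) (Y ** g)"
proof -
  obtain c where c: "\<And>t. c t \<in> SOn" "c 0 = mat 1" "(c has_vector_derivative Y) (at 0)"
    using skew_curve_dir[OF Y] unfolding curve_dir_def by blast
  have "(SOME d. \<exists>g'\<in>SOn. \<exists>h W. coset K g = coset K g' \<and> local_ext SOn (\<lambda>g. f (coset K g)) g' h W \<and>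
        d = frechet_derivative h (at g') (Y ** g')) = frechet_derivative h (at g) (Y ** g)"
  proof (rule some_equality)
    show "\<exists>g'\<in>SOn. \<exists>h' W'. coset K g = coset K g' \<and> local_ext SOn (\<lambda>g. f (coset K g)) g' h' W' \<and>
        frechet_derivative h (at g) (Y ** g) = frechet_derivative h' (at g') (Y ** g')"
      using g ext by blast
    fix d assume "\<exists>g'\<in>SOn. \<exists>h W. coset K g = coset K g' \<and> local_ext SOn (\<lambda>g. f (coset K g)) g' h W \<and>
        d = frechet_derivative h (at g') (Y ** g')"
    then obtain g' h' W' where g': "g' \<in> SOn" "coset K g = coset K g'"
      "local_ext SOn (\<lambda>g. f (coset K g)) g' h' W'" and d: "d = frechet_derivative h' (at g') (Y ** g')"
      by blast
    have "((\<lambda>t. f (coset (coset K g) (c t))) has_real_derivative d) (at 0)"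
      unfolding d g'(2) by (rule translate_has_derivative[OF c g'(1,3)])
    then show "d = frechet_derivative h (at g) (Y ** g)"
      by (rule DERIV_unique[OF _ translate_has_derivative[OF c g ext]])
  qed
  then show ?thesis using f by (simp add: fund_def)
qed

lemma smooth_on_cosetsE:
  assumes "f \<in> smooth_on_cosets K" "g \<in> SOn"
  obtains h W where "local_ext SOn (\<lambda>g. f (coset K g)) g h W" "\<And>Y. skew Y \<Longrightarrow> fund K Y (coset K g) f = frechet_derivative h (at g) (Y ** g)"
    "(h has_derivative frechet_derivative h (at g)) (at g)"
proof -
  obtain h W where ext: "local_ext SOn (\<lambda>g. f (coset K g)) g h W"
    using assms unfolding smooth_on_cosets_iff by (rule smooth_fun_onE)
  then have h: "C_k_on (Suc 0) h W" "g \<in> W" unfolding local_ext_def by blast+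
  from that[OF ext fund_eq[OF _ assms(2) ext assms(1)] C_k_on_Suc_has_derivative[OF h]] show thesis .
qed

lemma fund_add:
  assumes "skew X" "skew Y" "p \<in> cosets K"
  shows "fund K (X + Y) p f = fund K X p f + fund K Y p f"
proof (cases "f \<in> smooth_on_cosets K")
  case True
  obtain g where g: "g \<in> SOn" "p = coset K g" using assms(3) by (auto simp: cosets_iff)
  obtain h W where h: "\<And>Y. skew Y \<Longrightarrow> fund K Y (coset K g) f = frechet_derivative h (at g) (Y ** g)"
    "(h has_derivative frechet_derivative h (at g)) (at g)"
    using smooth_on_cosetsE[OF True g(1)] by metis
  show ?thesis
    by (simp add: g(2) h(1) assms skew_add matrix_algebra linear_add[OF has_derivative_linear[OF h(2)]])
qed (simp add: fund_def)

lemma fund_scaleR: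
  assumes "skew X" "p \<in> cosets K"
  shows "fund K (c *\<^sub>R X) p f = c * fund K X p f"
proof (cases "f \<in> smooth_on_cosets K")
  case True
  obtain g where g: "g \<in> SOn" "p = coset K g" using assms(2) by (auto simp: cosets_iff)
  obtain h W where h: "\<And>Y. skew Y \<Longrightarrow> fund K Y (coset K g) f = frechet_derivative h (at g) (Y ** g)"
    "(h has_derivative frechet_derivative h (at g)) (at g)"
    using smooth_on_cosetsE[OF True g(1)] by metis
  show ?thesis
    by (simp add: g(2) h(1) assms skew_scaleR matrix_algebra linear_cmul[OF has_derivative_linear[OF h(2)]])
qed (simp add: fund_def)

lemma fund_0: "p \<in> cosets K \<Longrightarrow> fund K 0 p f = 0"
  using fund_scaleR[OF skew_0, of p K 0] by simp

lemma fund_minus: "skew X \<Longrightarrow> p \<in> cosets K \<Longrightarrow> fund K (- X) p f = - fund K X p f"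
  using fund_scaleR[of X p K "-1"] by simp

lemma fund_sum:
  assumes "p \<in> cosets K" "\<And>i. i \<in> I \<Longrightarrow> skew (Y i)"
  shows "fund K (\<Sum>i\<in>I. Y i) p f = (\<Sum>i\<in>I. fund K (Y i) p f)"
  using assms(2)
  by (induction I rule: infinite_finite_induct) (auto simp: fund_0[OF assms(1)] fund_add skew_sum assms(1))

lemma fund_tangent:
  assumes Y: "skew Y" and p: "p \<in> cosets K"
  shows "fund K Y p \<in> tangent_space (smooth_on_cosets K) p"
proof -
  obtain g where g: "g \<in> SOn" "p = coset K g" using p by (auto simp: cosets_iff)
  have add: "fund K Y p (\<lambda>q. f q + f' q) = fund K Y p f + fund K Y p f'"
    and mult: "fund K Y p (\<lambda>q. f q * f' q) = f p * fund K Y p f' + f' p * fund K Y p f"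
    if f: "f \<in> smooth_on_cosets K" "f' \<in> smooth_on_cosets K" for f f'
  proof -
    obtain h W where h: "local_ext SOn (\<lambda>g. f (coset K g)) g h W"
      "fund K Y p f = frechet_derivative h (at g) (Y ** g)"
      "(h has_derivative frechet_derivative h (at g)) (at g)"
      using smooth_on_cosetsE[OF f(1) g(1)] Y g(2) by metis
    obtain h' W' where h': "local_ext SOn (\<lambda>g. f' (coset K g)) g h' W'"
      "fund K Y p f' = frechet_derivative h' (at g) (Y ** g)"
      "(h' has_derivative frechet_derivative h' (at g)) (at g)"
      using smooth_on_cosetsE[OF f(2) g(1)] Y g(2) by metis
    have v: "h g = f p" "h' g = f' p"
      using h(1) h'(1) g unfolding local_ext_def by auto
    have "fund K Y p (\<lambda>q. f q + f' q) = frechet_derivative (\<lambda>y. h y + h' y) (at g) (Y ** g)"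
      unfolding g(2) by (rule fund_eq[OF Y g(1) local_ext_add[OF h(1) h'(1)] smooth_on_cosets_add[OF f]])
    then show "fund K Y p (\<lambda>q. f q + f' q) = fund K Y p f + fund K Y p f'"
      using frechet_derivative_at[OF has_derivative_add[OF h(3) h'(3)], symmetric] h(2) h'(2) by simp
    have "fund K Y p (\<lambda>q. f q * f' q) = frechet_derivative (\<lambda>y. h y * h' y) (at g) (Y ** g)"
      unfolding g(2) by (rule fund_eq[OF Y g(1) local_ext_mult[OF h(1) h'(1)] smooth_on_cosets_mult[OF f]])
    then show "fund K Y p (\<lambda>q. f q * f' q) = f p * fund K Y p f' + f' p * fund K Y p f"
      using frechet_derivative_at[OF has_derivative_mult[OF h(3) h'(3)], symmetric] h(2) h'(2) v by simp
  qed
  have const: "fund K Y p (\<lambda>q. c) = 0" for c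
  proof -
    have "local_ext SOn (\<lambda>g. c) g (\<lambda>y. c) UNIV" by (intro local_ext_UNIV C_k_on_const) auto
    then have "fund K Y p (\<lambda>q. c) = frechet_derivative (\<lambda>y. c) (at g) (Y ** g)"
      unfolding g(2) by (rule fund_eq[OF Y g(1)]) (rule smooth_on_cosets_const)
    then show ?thesis by simp
  qed
  show ?thesis
    unfolding tangent_space_def
    using add mult mult[OF smooth_on_cosets_const] const by (auto simp: fund_def)
qed

lemma fund_smooth:
  assumes Y: "skew Y" and f: "f \<in> smooth_on_cosets K"
  shows "(\<lambda>p. fund K Y p f) \<in> smooth_on_cosets K"
  unfolding smooth_on_cosets_iff smooth_fun_on_iff
proof
  fix g :: "real^'a^'a" assume g: "g \<in> SOn"
  obtain h W where ext: "local_ext SOn (\<lambda>g. f (coset K g)) g h W"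
    using smooth_on_cosetsE[OF f g] by metis
  let ?D = "\<lambda>x. frechet_derivative h (at x)"
  have W: "open W" "g \<in> W" and h: "\<And>k. C_k_on k h W" using ext unfolding local_ext_def by blast+
  have eq: "fund K Y (coset K x) f = (\<Sum>b\<in>Basis. ((Y ** x) \<bullet> b) * ?D x b)" if "x \<in> SOn" "x \<in> W" for x
  proof -
    have extx: "local_ext SOn (\<lambda>g. f (coset K g)) x h W"
      using ext that unfolding local_ext_def by blast
    have lin: "linear (?D x)"
      using C_k_on_Suc_has_derivative[OF h that(2)] by (rule has_derivative_linear)
    have "?D x (Y ** x) = ?D x (\<Sum>b\<in>Basis. ((Y ** x) \<bullet> b) *\<^sub>R b)"
      by (simp only: euclidean_representation)
    also have "\<dots> = (\<Sum>b\<in>Basis. ((Y ** x) \<bullet> b) * ?D x b)"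
      by (simp only: linear_sum[OF lin] linear_cmul[OF lin] real_scaleR_def)
    finally show ?thesis using fund_eq[OF Y that(1) extx f] by simp
  qed
  have "C_k_on k (\<lambda>x. \<Sum>b\<in>Basis. ((Y ** x) \<bullet> b) * ?D x b) W" for k
    using h[of "Suc k"] W
    by (intro C_k_on_sum C_k_on_mult C_k_on_subset[OF matrix_mul_left_smooth]) auto
  then have "local_ext SOn (\<lambda>g. fund K Y (coset K g) f) g (\<lambda>x. \<Sum>b\<in>Basis. ((Y ** x) \<bullet> b) * ?D x b) W"
    unfolding local_ext_def using W eq by auto
  then show "\<exists>h W. local_ext SOn (\<lambda>g. fund K Y (coset K g) f) g h W" by blast
qed

lemma fund_translate:
  assumes Y: "skew Y" and p: "p \<in> cosets K" and a: "a \<in> SOn" and f: "f \<in> smooth_on_cosets K"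
  shows "fund K Y p (f \<circ> (\<lambda>p. coset p a)) = fund K (a ** Y ** transpose a) (coset p a) f"
proof -
  obtain g where g: "g \<in> SOn" "p = coset K g" using p by (auto simp: cosets_iff)
  have ag: "a ** g \<in> SOn" using a g by (simp add: SO_closed)
  obtain h W where ext: "local_ext SOn (\<lambda>g. f (coset K g)) (a ** g) h W"
    and e: "\<And>Y. skew Y \<Longrightarrow> fund K Y (coset K (a ** g)) f = frechet_derivative h (at (a ** g)) (Y ** (a ** g))"
    and d: "(h has_derivative frechet_derivative h (at (a ** g))) (at (a ** g))"
    using smooth_on_cosetsE[OF f ag] by metis
  have "fund K Y p (f \<circ> (\<lambda>p. coset p a)) = frechet_derivative (\<lambda>x. h (a ** x)) (at g) (Y ** g)"
    unfolding g(2)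
    by (rule fund_eq[OF Y g(1) _ smooth_on_cosets_translate[OF a f]])
      (use local_ext_translate[OF a ext] in \<open>simp add: o_def\<close>)
  also have "((\<lambda>x. h (a ** x)) has_derivative (\<lambda>v. frechet_derivative h (at (a ** g)) (a ** v))) (at g)"
    by (rule has_derivative_compose[where f = "\<lambda>x. a ** x" and g = h, OF _ d])
      (intro bounded_linear_imp_has_derivative bounded_bilinear.bounded_linear_right[OF bounded_bilinear_matrix_mul])
  then have "frechet_derivative (\<lambda>x. h (a ** x)) (at g) = (\<lambda>v. frechet_derivative h (at (a ** g)) (a ** v))"
    by (rule frechet_derivative_at[symmetric])
  finally have "fund K Y p (f \<circ> (\<lambda>p. coset p a)) = frechet_derivative h (at (a ** g)) (a ** (Y ** g))" .
  also have "a ** (Y ** g) = (a ** Y ** transpose a) ** (a ** g)"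
    using a by (simp add: matrix_algebra SO_orthogonal)
  also have "frechet_derivative h (at (a ** g)) \<dots> = fund K (a ** Y ** transpose a) (coset p a) f"
    using e[OF skew_conj[OF Y, of a]] by (simp add: g(2) coset_assoc)
  finally show ?thesis .
qed

subsection \<open>Derivations\<close>

abbreviation tangents :: "(real^'n^'n) set \<Rightarrow> (real^'n^'n) set \<Rightarrow> (real^'n^'n) set tvec set" where
  "tangents K p \<equiv> tangent_space (smooth_on_cosets K) p"

lemma
  assumes "v \<in> tangents K p"
  shows tangent_add: "f \<in> smooth_on_cosets K \<Longrightarrow> f' \<in> smooth_on_cosets K \<Longrightarrow> v (\<lambda>q. f q + f' q) = v f + v f'"
    and tangent_scale: "f \<in> smooth_on_cosets K \<Longrightarrow> v (\<lambda>q. c * f q) = c * v f"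
    and tangent_mult: "f \<in> smooth_on_cosets K \<Longrightarrow> f' \<in> smooth_on_cosets K \<Longrightarrow> v (\<lambda>q. f q * f' q) = f p * v f' + f' p * v f"
    and tangent_outside: "f \<notin> smooth_on_cosets K \<Longrightarrow> v f = 0"
  using assms by (simp_all add: tangent_space_def)

lemma tangent_const:
  assumes "v \<in> tangents K p"
  shows "v (\<lambda>q. c) = 0"
proof -
  have "v (\<lambda>q. 1) = 0"
    using tangent_mult[OF assms smooth_on_cosets_const smooth_on_cosets_const, of 1 1] by simp
  then show ?thesis
    using tangent_scale[OF assms smooth_on_cosets_const, of c 1] by simp
qed

lemma tangent_sum:
  assumes v: "v \<in> tangents K p" and f: "\<And>i. i \<in> I \<Longrightarrow> f i \<in> smooth_on_cosets K"
  shows "v (\<lambda>q. \<Sum>i\<in>I. f i q) = (\<Sum>i\<in>I. v (f i))"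
  using f
  by (induction I rule: infinite_finite_induct)
    (auto simp: tangent_const[OF v] tangent_add[OF v] smooth_on_cosets_sum)

lemma tangent_cong:
  assumes v: "v \<in> tangents K p" and p: "p \<in> cosets K"
    and f: "f \<in> smooth_on_cosets K" and eq: "\<And>q. q \<in> cosets K \<Longrightarrow> f q = f' q"
  shows "v f = v f'"
proof -
  let ?d = "\<lambda>q. f q + (-1) * f' q" and ?h = "\<lambda>q. if q \<in> cosets K then 0 else 1 :: real"
  have f': "f' \<in> smooth_on_cosets K" using f smooth_on_cosets_cong[of K f f', OF eq] by blast
  have h: "?h \<in> smooth_on_cosets K"
    using smooth_on_cosets_cong[of K ?h "\<lambda>_. 0"] smooth_on_cosets_const by auto
  have mf': "(\<lambda>q. (-1) * f' q) \<in> smooth_on_cosets K"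
    by (intro smooth_on_cosets_mult smooth_on_cosets_const f')
  then have d: "?d \<in> smooth_on_cosets K" by (rule smooth_on_cosets_add[OF f])
  have "?d = (\<lambda>q. ?d q * ?h q)" using eq by auto
  then have "v ?d = v (\<lambda>q. ?d q * ?h q)" by (rule arg_cong)
  also have "\<dots> = 0" using tangent_mult[OF v d h] p eq[OF p] by simp
  finally have "v f + v (\<lambda>q. (-1) * f' q) = 0"
    using tangent_add[OF v f mf'] by simp
  then show ?thesis using tangent_scale[OF v f', of "-1"] by simp
qed

text \<open>Hadamard's lemma, cut off by a bump function so that it takes place among global functions.\<close>

lemma tangent_chain_rule:
  fixes emb :: "(real^'n^'n) set \<Rightarrow> 'e::euclidean_space"
  assumes p: "p \<in> cosets K"
    and emb: "\<And>\<psi>. (\<And>k. C_k_on k \<psi> UNIV) \<Longrightarrow> (\<lambda>q. \<psi> (emb q)) \<in> smooth_on_cosets K"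
    and f: "f \<in> smooth_on_cosets K"
    and U: "open U" "emb p \<in> U" and \<Phi>: "\<And>k. C_k_on k \<Phi> U"
    and eq: "\<And>q. q \<in> cosets K \<Longrightarrow> emb q \<in> U \<Longrightarrow> f q = \<Phi> (emb q)"
    and v: "v \<in> tangents K p"
  shows "v f = (\<Sum>b\<in>Basis. v (\<lambda>q. emb q \<bullet> b) * frechet_derivative \<Phi> (at (emb p)) b)"
proof -
  define x0 where "x0 = emb p"
  obtain r where r: "r > 0" "ball x0 r \<subseteq> U" using U unfolding x0_def by (auto elim: openE)
  have \<Phi>r: "C_k_on k \<Phi> (ball x0 r)" for k using C_k_on_subset[OF \<Phi> r(2)] .
  obtain G where G: "\<And>b k. C_k_on k (G b) (ball x0 r)"
    "\<And>b. G b x0 = frechet_derivative \<Phi> (at x0) b"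
    "\<And>x. x \<in> ball x0 r \<Longrightarrow> \<Phi> x = \<Phi> x0 + (\<Sum>b\<in>Basis. ((x - x0) \<bullet> b) * G b x)"
    using hadamard[OF \<Phi>r] by metis
  define \<beta> where "\<beta> x = flat_fun 0 (r\<^sup>2 / 4 - (\<Sum>b\<in>Basis. (x \<bullet> b - x0 \<bullet> b) * (x \<bullet> b - x0 \<bullet> b)))" for x
  have coord: "C_k_on k (\<lambda>x. x \<bullet> b) (UNIV :: 'e set)" for k b
    by (intro C_k_on_bounded_linear bounded_linear_inner_left) auto
  have \<beta>: "C_k_on k \<beta> UNIV" for k
    unfolding \<beta>_def
    by (rule C_k_on_comp_real[OF _ _ _ C_k_on_flat_fun])
      (auto intro!: C_k_on_diff C_k_on_const C_k_on_sum C_k_on_mult coord)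
  have dist2: "(\<Sum>b\<in>Basis. (x \<bullet> b - x0 \<bullet> b) * (x \<bullet> b - x0 \<bullet> b)) = (dist x x0)\<^sup>2" for x
    by (simp add: euclidean_dist_l2[of x] L2_set_def dist_real_def sum_nonneg power2_eq_square)
  have \<beta>0: "\<beta> x0 \<noteq> 0" using r by (simp add: \<beta>_def flat_fun_def)
  have \<beta>_out: "\<beta> x = 0" if "r / 2 \<le> dist x x0" for x
  proof -
    have "(r / 2)\<^sup>2 \<le> (dist x x0)\<^sup>2" using that r by (intro power_mono) auto
    then show ?thesis unfolding \<beta>_def dist2 by (simp add: flat_fun_def power_divide)
  qed
  \<comment> \<open>Extension by 0 is smooth because \<open>\<beta>\<close> already vanishes from
    distance r / 2 on, well inside the ball where \<open>G b\<close> is defined.\<close>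
  define \<psi> where "\<psi> b x = (if x \<in> ball x0 r then \<beta> x * G b x else 0)" for b x
  have \<psi>: "C_k_on k (\<psi> b) UNIV" for k b
  proof -
    have "C_k_on k (\<lambda>x. \<beta> x * G b x) (ball x0 r)"
      by (intro C_k_on_mult G(1) C_k_on_subset[OF \<beta>]) auto
    then have 1: "C_k_on k (\<psi> b) (ball x0 r)"
      by (subst C_k_on_cong[of _ _ "\<lambda>x. \<beta> x * G b x"]) (auto simp: \<psi>_def)
    have "C_k_on k (\<lambda>x. 0) (- cball x0 (r / 2))" by (intro C_k_on_const) auto
    then have 2: "C_k_on k (\<psi> b) (- cball x0 (r / 2))"
      by (subst C_k_on_cong[of _ _ "\<lambda>x. 0"]) (auto simp: \<psi>_def dist_commute intro!: \<beta>_out)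
    have "ball x0 r \<union> - cball x0 (r / 2) = UNIV" using r by auto
    then show ?thesis using C_k_on_Un[OF open_ball open_Compl[OF closed_cball] 1 2] by simp
  qed
  let ?F = "smooth_on_cosets K"
  let ?e = "\<lambda>b q. emb q \<bullet> b"
  have Fe: "?e b \<in> ?F" and F\<beta>: "(\<lambda>q. \<beta> (emb q)) \<in> ?F" and F\<psi>: "(\<lambda>q. \<psi> b (emb q)) \<in> ?F" for b
    by (rule emb, rule coord, rule emb, rule \<beta>, rule emb, rule \<psi>)
  have Fc: "(\<lambda>q. f q + - f p) \<in> ?F" and Fec: "(\<lambda>q. ?e b q + - (x0 \<bullet> b)) \<in> ?F" for b
    by (intro smooth_on_cosets_add smooth_on_cosets_const f Fe)+
  have F1: "(\<lambda>q. (?e b q + - (x0 \<bullet> b)) * \<beta> (emb q)) \<in> ?F" for b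
    by (intro smooth_on_cosets_mult Fec F\<beta>)
  \<comment> \<open>Both f - f p and the centred coordinates vanish at \<open>p\<close>. The Leibniz
    rule therefore leaves no derivative of the bump function or of \<open>G\<close>, and the common
    factor \<open>\<beta> x0 * \<beta> x0\<close> cancels.\<close>
  have "v (\<lambda>q. (f q + - f p) * (\<beta> (emb q) * \<beta> (emb q))) =
    v (\<lambda>q. \<Sum>b\<in>Basis. ((?e b q + - (x0 \<bullet> b)) * \<beta> (emb q)) * \<psi> b (emb q))"
  proof (rule tangent_cong[OF v p])
    show "(\<lambda>q. (f q + - f p) * (\<beta> (emb q) * \<beta> (emb q))) \<in> ?F"
      by (intro smooth_on_cosets_mult Fc F\<beta>)
    fix q assume q: "q \<in> cosets K"
    show "(f q + - f p) * (\<beta> (emb q) * \<beta> (emb q)) =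
       (\<Sum>b\<in>Basis. ((?e b q + - (x0 \<bullet> b)) * \<beta> (emb q)) * \<psi> b (emb q))"
    proof (cases "emb q \<in> ball x0 r")
      case True
      have "f q + - f p = (\<Sum>b\<in>Basis. ((emb q - x0) \<bullet> b) * G b (emb q))"
        using eq[OF q] eq[OF p U(2)] G(3)[OF True] r(2) True by (auto simp: x0_def)
      then show ?thesis
        using True by (simp add: \<psi>_def sum_distrib_left sum_distrib_right inner_diff_left mult_ac)
    next
      case False
      then have "\<beta> (emb q) = 0" using r by (intro \<beta>_out) (simp add: dist_commute)
      then show ?thesis by simp
    qed
  qed
  also have "\<dots> = (\<Sum>b\<in>Basis. v (\<lambda>q. ((?e b q + - (x0 \<bullet> b)) * \<beta> (emb q)) * \<psi> b (emb q)))"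
    by (rule tangent_sum[OF v]) (intro smooth_on_cosets_mult F1 F\<psi>)
  also have "\<dots> = (\<Sum>b\<in>Basis. \<beta> x0 * \<beta> x0 * (v (?e b) * frechet_derivative \<Phi> (at x0) b))"
  proof (rule sum.cong[OF refl])
    fix b
    have "v (\<lambda>q. ((?e b q + - (x0 \<bullet> b)) * \<beta> (emb q)) * \<psi> b (emb q)) =
      \<psi> b x0 * v (\<lambda>q. (?e b q + - (x0 \<bullet> b)) * \<beta> (emb q))"
      using tangent_mult[OF v F1 F\<psi>] by (simp add: x0_def)
    also have "v (\<lambda>q. (?e b q + - (x0 \<bullet> b)) * \<beta> (emb q)) = \<beta> x0 * v (\<lambda>q. ?e b q + - (x0 \<bullet> b))"
      using tangent_mult[OF v Fec F\<beta>] by (simp add: x0_def)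
    also have "v (\<lambda>q. ?e b q + - (x0 \<bullet> b)) = v (?e b)"
      using tangent_add[OF v Fe smooth_on_cosets_const, of b "- (x0 \<bullet> b)"] tangent_const[OF v, of "- (x0 \<bullet> b)"]
      by simp
    finally show "v (\<lambda>q. ((?e b q + - (x0 \<bullet> b)) * \<beta> (emb q)) * \<psi> b (emb q)) =
      \<beta> x0 * \<beta> x0 * (v (?e b) * frechet_derivative \<Phi> (at x0) b)"
      using r by (simp add: \<psi>_def G(2))
  qed
  finally have 1: "v (\<lambda>q. (f q + - f p) * (\<beta> (emb q) * \<beta> (emb q))) =
    \<beta> x0 * \<beta> x0 * (\<Sum>b\<in>Basis. v (?e b) * frechet_derivative \<Phi> (at x0) b)"
    by (simp add: sum_distrib_left)
  have "v (\<lambda>q. (f q + - f p) * (\<beta> (emb q) * \<beta> (emb q))) = \<beta> x0 * \<beta> x0 * v (\<lambda>q. f q + - f p)"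
    using tangent_mult[OF v Fc smooth_on_cosets_mult[OF F\<beta> F\<beta>]] by (simp add: x0_def)
  also have "v (\<lambda>q. f q + - f p) = v f"
    using tangent_add[OF v f smooth_on_cosets_const, of "- f p"] tangent_const[OF v, of "- f p"] by simp
  finally show ?thesis using 1 \<beta>0 by (simp add: x0_def)
qed

subsection \<open>Matrices of functions\<close>

definition smooth_mat :: "(real^'n^'n) set \<Rightarrow> ((real^'n^'n) set \<Rightarrow> real^'p^'m) \<Rightarrow> bool" where
  "smooth_mat K A \<longleftrightarrow> (\<forall>i j. (\<lambda>q. A q $ i $ j) \<in> smooth_on_cosets K)"

definition deriv_mat :: "(real^'n^'n) set tvec \<Rightarrow> ((real^'n^'n) set \<Rightarrow> real^'p^'m) \<Rightarrow> real^'p^'m" where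
  "deriv_mat v A = (\<chi> i j. v (\<lambda>q. A q $ i $ j))"

lemma smooth_mat_mul: "smooth_mat K A \<Longrightarrow> smooth_mat K B \<Longrightarrow> smooth_mat K (\<lambda>q. A q ** B q)"
  by (auto simp: smooth_mat_def matrix_matrix_mult_def intro!: smooth_on_cosets_sum smooth_on_cosets_mult)

lemma smooth_mat_add: "smooth_mat K A \<Longrightarrow> smooth_mat K B \<Longrightarrow> smooth_mat K (\<lambda>q. A q + B q)"
  by (auto simp: smooth_mat_def intro!: smooth_on_cosets_add)

lemma smooth_mat_diff: "smooth_mat K A \<Longrightarrow> smooth_mat K B \<Longrightarrow> smooth_mat K (\<lambda>q. A q - B q)"
  by (auto simp: smooth_mat_def intro!: smooth_on_cosets_diff)

lemma smooth_mat_scaleR: "smooth_mat K A \<Longrightarrow> smooth_mat K (\<lambda>q. c *\<^sub>R A q)"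
  by (auto simp: smooth_mat_def intro!: smooth_on_cosets_mult smooth_on_cosets_const)

lemma deriv_mat_mul:
  assumes v: "v \<in> tangents K p" and A: "smooth_mat K A" and B: "smooth_mat K B"
  shows "deriv_mat v (\<lambda>q. A q ** B q) = deriv_mat v A ** B p + A p ** deriv_mat v B"
proof -
  have "v (\<lambda>q. (A q ** B q) $ i $ j) = (\<Sum>k\<in>UNIV. v (\<lambda>q. A q $ i $ k * B q $ k $ j))" for i j
    unfolding matrix_matrix_mult_def vec_lambda_beta
    using A B by (intro tangent_sum[OF v]) (auto simp: smooth_mat_def intro!: smooth_on_cosets_mult)
  also have "\<dots> i j = (deriv_mat v A ** B p + A p ** deriv_mat v B) $ i $ j" for i j
    using A B
    by (simp add: tangent_mult[OF v] smooth_mat_def deriv_mat_def matrix_matrix_mult_def sum.distrib mult.commute)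
  finally show ?thesis by (simp add: vec_eq_iff deriv_mat_def)
qed

lemma deriv_mat_add:
  assumes v: "v \<in> tangents K p" and A: "smooth_mat K A" and B: "smooth_mat K B"
  shows "deriv_mat v (\<lambda>q. A q + B q) = deriv_mat v A + deriv_mat v B"
  using A B by (simp add: vec_eq_iff deriv_mat_def tangent_add[OF v] smooth_mat_def)

lemma deriv_mat_minus:
  assumes v: "v \<in> tangents K p" and A: "smooth_mat K A"
  shows "deriv_mat v (\<lambda>q. - A q) = - deriv_mat v A"
  using A tangent_scale[OF v, of _ "-1"] by (simp add: vec_eq_iff deriv_mat_def smooth_mat_def)

lemma deriv_mat_const: "v \<in> tangents K p \<Longrightarrow> deriv_mat v (\<lambda>q. A) = 0"
  by (simp add: vec_eq_iff deriv_mat_def tangent_const)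

lemma deriv_mat_cong:
  assumes v: "v \<in> tangents K p" and p: "p \<in> cosets K" and A: "smooth_mat K A"
    and eq: "\<And>q. q \<in> cosets K \<Longrightarrow> A q = B q"
  shows "deriv_mat v A = deriv_mat v B"
proof -
  have "v (\<lambda>q. A q $ i $ j) = v (\<lambda>q. B q $ i $ j)" for i j
    by (rule tangent_cong[OF v p]) (use A eq in \<open>auto simp: smooth_mat_def\<close>)
  then show ?thesis by (simp add: vec_eq_iff deriv_mat_def)
qed

lemma deriv_mat_transpose: "deriv_mat v (\<lambda>q. transpose (A q)) = transpose (deriv_mat v A)"
  by (simp add: vec_eq_iff deriv_mat_def transpose_def)

lemma smooth_mat_transpose: "smooth_mat K A \<Longrightarrow> smooth_mat K (\<lambda>q. transpose (A q))"
  by (simp add: smooth_mat_def transpose_def)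

subsection \<open>The stabilizer\<close>

lemma UNIV_6: "(UNIV :: ((1 + 2) + (1 + 2)) set) =
  {Inl (Inl 1), Inl (Inr 1), Inl (Inr 2), Inr (Inl 1), Inr (Inr 1), Inr (Inr 2)}"
proof -
  have "i \<in> {Inl (Inl 1), Inl (Inr 1), Inl (Inr 2), Inr (Inl 1), Inr (Inr 1), Inr (Inr 2)}"
    for i :: "(1 + 2) + (1 + 2)"
  proof -
    have "j \<in> {Inl 1, Inr 1, Inr 2}" for j :: "1 + 2"
      by (cases j) (use exhaust_2 in \<open>auto simp: num1_eq1\<close>)
    then show ?thesis by (cases i) auto
  qed
  then show ?thesis by blast
qed

lemma sum_6: "sum f (UNIV :: ((1 + 2) + (1 + 2)) set) =
  f (Inl (Inl 1)) + f (Inl (Inr 1)) + f (Inl (Inr 2)) + f (Inr (Inl 1)) + f (Inr (Inr 1)) + f (Inr (Inr 2))"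
  by (simp add: UNIV_6 add.assoc)

lemma forall_6: "(\<forall>i :: (1 + 2) + (1 + 2). P i) \<longleftrightarrow>
  P (Inl (Inl 1)) \<and> P (Inl (Inr 1)) \<and> P (Inl (Inr 2)) \<and> P (Inr (Inl 1)) \<and> P (Inr (Inr 1)) \<and> P (Inr (Inr 2))"
proof -
  have "(\<forall>i :: (1 + 2) + (1 + 2). P i) \<longleftrightarrow> (\<forall>i\<in>UNIV. P i)" by simp
  then show ?thesis unfolding UNIV_6 by simp
qed

abbreviation xa :: "real^((1 + 2) + (1 + 2))" where "xa \<equiv> axis (Inl (Inl 1)) 1"
abbreviation xb :: "real^((1 + 2) + (1 + 2))" where "xb \<equiv> axis (Inl (Inr 1)) 1"
abbreviation xc :: "real^((1 + 2) + (1 + 2))" where "xc \<equiv> axis (Inl (Inr 2)) 1"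
abbreviation ya :: "real^((1 + 2) + (1 + 2))" where "ya \<equiv> axis (Inr (Inl 1)) 1"
abbreviation yb :: "real^((1 + 2) + (1 + 2))" where "yb \<equiv> axis (Inr (Inr 1)) 1"
abbreviation yc :: "real^((1 + 2) + (1 + 2))" where "yc \<equiv> axis (Inr (Inr 2)) 1"

text \<open>The complex structures of the summands \<open>\<complex>\<^sup>2\<close> and \<open>\<complex>\<close> of \<open>\<complex> \<oplus> \<complex>\<^sup>2\<close>, extended by \<open>0\<close>, and the
  orthogonal projections onto these summands.\<close>

definition B0 :: mat6 where "B0 = wedge yb xb + wedge yc xc"
definition C0 :: mat6 where "C0 = wedge ya xa"
definition Q0 :: mat6 where "Q0 = outer xa xa + outer ya ya"
definition R0 :: mat6 where "R0 = outer xb xb + outer xc xc + outer yb yb + outer yc yc"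

lemma base_mult:
  "B0 ** B0 = - R0" "C0 ** C0 = - Q0" "B0 ** C0 = 0" "C0 ** B0 = 0"
  "B0 ** R0 = B0" "R0 ** B0 = B0" "B0 ** Q0 = 0" "Q0 ** B0 = 0"
  "C0 ** Q0 = C0" "Q0 ** C0 = C0" "C0 ** R0 = 0" "R0 ** C0 = 0"
  "Q0 ** Q0 = Q0" "R0 ** R0 = R0" "Q0 ** R0 = 0" "R0 ** Q0 = 0"
  by (simp_all add: B0_def C0_def Q0_def R0_def wedge_def matrix_algebra outer_mult_outer inner_axis_axis)

lemma base_mult_assoc:
  "B0 ** (B0 ** X) = - (R0 ** X)" "C0 ** (C0 ** X) = - (Q0 ** X)" "B0 ** (C0 ** X) = 0" "C0 ** (B0 ** X) = 0"
  "B0 ** (R0 ** X) = B0 ** X" "R0 ** (B0 ** X) = B0 ** X" "B0 ** (Q0 ** X) = 0" "Q0 ** (B0 ** X) = 0"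
  "C0 ** (Q0 ** X) = C0 ** X" "Q0 ** (C0 ** X) = C0 ** X" "C0 ** (R0 ** X) = 0" "R0 ** (C0 ** X) = 0"
  "Q0 ** (Q0 ** X) = Q0 ** X" "R0 ** (R0 ** X) = R0 ** X" "Q0 ** (R0 ** X) = 0" "R0 ** (Q0 ** X) = 0"
  by (simp_all only: matrix_mul_assoc base_mult matrix_algebra(5,9))

lemma base_transpose:
  "transpose B0 = - B0" "transpose C0 = - C0" "transpose Q0 = Q0" "transpose R0 = R0"
  by (simp_all add: B0_def C0_def Q0_def R0_def wedge_def transpose_linear outer_simps)

lemma skew_base: "skew B0" "skew C0"
  by (simp_all add: skew_def base_transpose)

lemma Q0_R0: "Q0 + R0 = mat 1"
  by (simp add: vec_eq_iff forall_6 Q0_def R0_def outer_def mat_def axis_def)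

lemma B0_nth: "B0 $ i $ j = (if i = Inr (Inr 1) \<and> j = Inl (Inr 1) \<or> i = Inr (Inr 2) \<and> j = Inl (Inr 2) then 1
    else if i = Inl (Inr 1) \<and> j = Inr (Inr 1) \<or> i = Inl (Inr 2) \<and> j = Inr (Inr 2) then -1 else 0)"
  by (auto simp: B0_def wedge_nth axis_def)

lemma C0_nth: "C0 $ i $ j = (if i = Inr (Inl 1) \<and> j = Inl (Inl 1) then 1
    else if i = Inl (Inl 1) \<and> j = Inr (Inl 1) then -1 else 0)"
  by (auto simp: C0_def wedge_nth axis_def)

lemma Q0_nth: "Q0 $ i $ j = (if i = j \<and> (i = Inl (Inl 1) \<or> i = Inr (Inl 1)) then 1 else 0)"
  by (auto simp: Q0_def outer_def axis_def)

lemma R0_nth: "R0 $ i $ j = (if i = j \<and> (i = Inl (Inr 1) \<or> i = Inr (Inr 1) \<or> i = Inl (Inr 2) \<or> i = Inr (Inr 2)) then 1 else 0)"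
  by (auto simp: R0_def outer_def axis_def)

lemma base_mult_nth:
  "(X ** B0) $ i $ Inl (Inr m) = X $ i $ Inr (Inr m)" "(X ** B0) $ i $ Inr (Inr m) = - X $ i $ Inl (Inr m)"
  "(X ** B0) $ i $ Inl (Inl 1) = 0" "(X ** B0) $ i $ Inr (Inl 1) = 0"
  "(B0 ** X) $ Inl (Inr m) $ j = - X $ Inr (Inr m) $ j" "(B0 ** X) $ Inr (Inr m) $ j = X $ Inl (Inr m) $ j"
  "(B0 ** X) $ Inl (Inl 1) $ j = 0" "(B0 ** X) $ Inr (Inl 1) $ j = 0"
  "(X ** C0) $ i $ Inl (Inr m) = 0" "(X ** C0) $ i $ Inr (Inr m) = 0"
  "(X ** C0) $ i $ Inl (Inl 1) = X $ i $ Inr (Inl 1)" "(X ** C0) $ i $ Inr (Inl 1) = - X $ i $ Inl (Inl 1)"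
  "(C0 ** X) $ Inl (Inr m) $ j = 0" "(C0 ** X) $ Inr (Inr m) $ j = 0"
  "(C0 ** X) $ Inl (Inl 1) $ j = - X $ Inr (Inl 1) $ j" "(C0 ** X) $ Inr (Inl 1) $ j = X $ Inl (Inl 1) $ j"
  using exhaust_2[of m] by (auto simp: matrix_matrix_mult_def sum_6 B0_nth C0_nth)

text \<open>Commuting with both matrices means preserving the splitting into \<complex> and
  \<complex>^2 and being complex linear on each summand; then the columns over the real basis
  vectors determine the rest.\<close>

lemma commutant_nth:
  fixes k :: mat6
  assumes "k ** B0 = B0 ** k" "k ** C0 = C0 ** k"
  shows "k $ Inr (Inl 1) $ Inr (Inl 1) = k $ Inl (Inl 1) $ Inl (Inl 1)"
    "k $ Inl (Inl 1) $ Inr (Inl 1) = - k $ Inr (Inl 1) $ Inl (Inl 1)"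
    "k $ Inr (Inr i) $ Inr (Inr j) = k $ Inl (Inr i) $ Inl (Inr j)"
    "k $ Inl (Inr i) $ Inr (Inr j) = - k $ Inr (Inr i) $ Inl (Inr j)"
    "k $ Inl (Inl 1) $ Inl (Inr i) = 0" "k $ Inl (Inl 1) $ Inr (Inr i) = 0"
    "k $ Inr (Inl 1) $ Inl (Inr i) = 0" "k $ Inr (Inl 1) $ Inr (Inr i) = 0"
    "k $ Inl (Inr i) $ Inl (Inl 1) = 0" "k $ Inl (Inr i) $ Inr (Inl 1) = 0"
    "k $ Inr (Inr i) $ Inl (Inl 1) = 0" "k $ Inr (Inr i) $ Inr (Inl 1) = 0"
proof -
  have b: "(k ** B0) $ l $ m = (B0 ** k) $ l $ m" and c: "(k ** C0) $ l $ m = (C0 ** k) $ l $ m" for l m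
    using assms by simp_all
  show "k $ Inr (Inl 1) $ Inr (Inl 1) = k $ Inl (Inl 1) $ Inl (Inl 1)"
    using c[of "Inr (Inl 1)" "Inl (Inl 1)"] by (simp add: base_mult_nth)
  show "k $ Inl (Inl 1) $ Inr (Inl 1) = - k $ Inr (Inl 1) $ Inl (Inl 1)"
    using c[of "Inl (Inl 1)" "Inl (Inl 1)"] by (simp add: base_mult_nth)
  show "k $ Inr (Inr i) $ Inr (Inr j) = k $ Inl (Inr i) $ Inl (Inr j)"
    using b[of "Inr (Inr i)" "Inl (Inr j)"] by (simp add: base_mult_nth)
  show "k $ Inl (Inr i) $ Inr (Inr j) = - k $ Inr (Inr i) $ Inl (Inr j)"
    using b[of "Inl (Inr i)" "Inl (Inr j)"] by (simp add: base_mult_nth)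
  show "k $ Inl (Inl 1) $ Inl (Inr i) = 0" "k $ Inl (Inl 1) $ Inr (Inr i) = 0"
    using b[of "Inl (Inl 1)" "Inr (Inr i)"] b[of "Inl (Inl 1)" "Inl (Inr i)"] by (simp_all add: base_mult_nth)
  show "k $ Inr (Inl 1) $ Inl (Inr i) = 0" "k $ Inr (Inl 1) $ Inr (Inr i) = 0"
    using b[of "Inr (Inl 1)" "Inr (Inr i)"] b[of "Inr (Inl 1)" "Inl (Inr i)"] by (simp_all add: base_mult_nth)
  show "k $ Inl (Inr i) $ Inl (Inl 1) = 0" "k $ Inl (Inr i) $ Inr (Inl 1) = 0"
    using b[of "Inr (Inr i)" "Inl (Inl 1)"] b[of "Inr (Inr i)" "Inr (Inl 1)"] by (simp_all add: base_mult_nth)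
  show "k $ Inr (Inr i) $ Inl (Inl 1) = 0" "k $ Inr (Inr i) $ Inr (Inl 1) = 0"
    using b[of "Inl (Inr i)" "Inl (Inl 1)"] b[of "Inl (Inr i)" "Inr (Inl 1)"] by (simp_all add: base_mult_nth)
qed

lemma sum_UNIV_Plus:
  "sum f (UNIV :: ('a::finite + 'b::finite) set) = (\<Sum>i\<in>UNIV. f (Inl i)) + (\<Sum>j\<in>UNIV. f (Inr j))"
  using sum.Plus[of "UNIV :: 'a set" "UNIV :: 'b set" f] by (simp add: UNIV_Plus_UNIV)

lemma realify_nth:
  "realify Z $ Inl i $ Inl j = Re (Z $ i $ j)" "realify Z $ Inl i $ Inr j = - Im (Z $ i $ j)"
  "realify Z $ Inr i $ Inl j = Im (Z $ i $ j)" "realify Z $ Inr i $ Inr j = Re (Z $ i $ j)"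
  by (simp_all add: realify_def block_mat_def)

lemma block_mat_nth:
  "block_mat A B C D $ Inl i $ Inl i' = A $ i $ i'" "block_mat A B C D $ Inl i $ Inr j' = B $ i $ j'"
  "block_mat A B C D $ Inr j $ Inl i' = C $ j $ i'" "block_mat A B C D $ Inr j $ Inr j' = D $ j $ j'"
  by (simp_all add: block_mat_def)

lemma realify_mult: "realify (Z ** W) = realify Z ** realify W"
  unfolding vec_eq_iff split_sum_all
  by (simp add: realify_nth matrix_matrix_mult_def sum_UNIV_Plus sum.distrib sum_subtractf sum_negf algebra_simps)

lemma realify_conj_transpose: "realify (conj_transpose Z) = transpose (realify Z)"
  unfolding vec_eq_iff split_sum_all by (simp add: realify_nth conj_transpose_def transpose_def)

lemma realify_mat_1: "realify (mat 1) = mat 1"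
  unfolding vec_eq_iff split_sum_all by (simp add: realify_nth mat_def)

lemma realify_inj: "realify Z = realify W \<longleftrightarrow> Z = W"
  unfolding vec_eq_iff split_sum_all by (auto simp: realify_nth complex_eq_iff)

lemma block_diag_unitary:
  fixes u :: "complex^'m^'m" and v :: "complex^'n^'n"
  shows "block_mat u 0 0 v \<in> unitary_mats \<longleftrightarrow> u \<in> unitary_mats \<and> v \<in> unitary_mats"
proof -
  have "conj_transpose (block_mat u 0 0 v) = block_mat (conj_transpose u) 0 0 (conj_transpose v)"
    unfolding vec_eq_iff split_sum_all by (simp add: block_mat_nth conj_transpose_def)
  moreover have "block_mat u 0 0 v ** block_mat u' 0 0 v' = block_mat (u ** u') 0 0 (v ** v')"
    for u u' :: "complex^'m^'m" and v v' :: "complex^'n^'n"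
    unfolding vec_eq_iff split_sum_all by (simp add: block_mat_nth matrix_matrix_mult_def sum_UNIV_Plus)
  moreover have "block_mat u 0 0 v = mat 1 \<longleftrightarrow> u = mat 1 \<and> v = mat 1"
    for u :: "complex^'m^'m" and v :: "complex^'n^'n"
    unfolding vec_eq_iff split_sum_all by (auto simp: block_mat_nth mat_def)
  ultimately show ?thesis by (auto simp: unitary_mats_def)
qed

lemma realify_orthogonal: "orthogonal_matrix (realify Z) \<longleftrightarrow> Z \<in> unitary_mats"
  unfolding orthogonal_matrix_def unitary_mats_def
  by (simp flip: realify_mult realify_conj_transpose realify_mat_1 add: realify_inj)

text \<open>The stabilizer is described by equations instead of blocks: it is the centralizer of
  \<open>B0\<close> and \<open>C0\<close> among orthogonal matrices. The homogeneous space thereby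
  becomes the orbit of this pair under conjugation.\<close>

lemma U1xU2_iff: "k \<in> U1xU2 \<longleftrightarrow> orthogonal_matrix k \<and> k ** B0 = B0 ** k \<and> k ** C0 = C0 ** k"
proof
  assume "k \<in> U1xU2"
  then obtain u :: "complex^1^1" and v :: "complex^2^2" where k: "k = realify (block_mat u 0 0 v)"
    and u: "u \<in> unitary_mats" "v \<in> unitary_mats"
    by (auto simp: U1xU2_def)
  have eqI: "M = N" if "\<And>i j. j \<in> {Inl (Inl 1), Inl (Inr 1), Inl (Inr 2), Inr (Inl 1), Inr (Inr 1), Inr (Inr 2)} \<Longrightarrow>
      i \<in> {Inl (Inl 1), Inl (Inr 1), Inl (Inr 2), Inr (Inl 1), Inr (Inr 1), Inr (Inr 2)} \<Longrightarrow> M $ i $ j = N $ i $ j"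
    for M N :: mat6
    using that unfolding vec_eq_iff UNIV_6[symmetric] by simp
  have "k ** B0 = B0 ** k"
    by (rule eqI) (auto simp: base_mult_nth k realify_nth block_mat_nth)
  moreover have "k ** C0 = C0 ** k"
    by (rule eqI) (auto simp: base_mult_nth k realify_nth block_mat_nth)
  ultimately show "orthogonal_matrix k \<and> k ** B0 = B0 ** k \<and> k ** C0 = C0 ** k"
    using u by (simp add: k realify_orthogonal block_diag_unitary)
next
  assume k: "orthogonal_matrix k \<and> k ** B0 = B0 ** k \<and> k ** C0 = C0 ** k"
  then have kn: "k ** B0 = B0 ** k" "k ** C0 = C0 ** k" by blast+
  note n = commutant_nth[OF kn]
  define u :: "complex^1^1" where "u = (\<chi> i j. Complex (k $ Inl (Inl 1) $ Inl (Inl 1)) (k $ Inr (Inl 1) $ Inl (Inl 1)))"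
  define v :: "complex^2^2" where "v = (\<chi> i j. Complex (k $ Inl (Inr i) $ Inl (Inr j)) (k $ Inr (Inr i) $ Inl (Inr j)))"
  have "k = realify (block_mat u 0 0 v)"
    unfolding vec_eq_iff forall_6 by (simp add: realify_nth block_mat_nth u_def v_def n)
  then show "k \<in> U1xU2"
    using k unfolding U1xU2_def by (auto simp: realify_orthogonal block_diag_unitary)
qed

subsection \<open>The embedding\<close>

text \<open>The point gK is recorded by the conjugates of \<open>B0\<close> and \<open>C0\<close>
  under g. By \<open>coset_eq_iff\<close> they do not depend on the chosen representative.\<close>

definition embB :: "mat6 set \<Rightarrow> mat6" where
  "embB p = (SOME A. \<exists>g\<in>SOn. p = coset U1xU2 g \<and> A = g ** B0 ** transpose g)"

definition embC :: "mat6 set \<Rightarrow> mat6" where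
  "embC p = (SOME A. \<exists>g\<in>SOn. p = coset U1xU2 g \<and> A = g ** C0 ** transpose g)"

lemma conj_eq_iff:
  assumes "g \<in> SOn" "g' \<in> SOn"
  shows "g ** A ** transpose g = g' ** A ** transpose g' \<longleftrightarrow>
    (transpose g ** g') ** A = A ** (transpose g ** g')"
proof
  assume "g ** A ** transpose g = g' ** A ** transpose g'"
  then have "transpose g ** (g ** A ** transpose g) ** g' = transpose g ** (g' ** A ** transpose g') ** g'"
    by simp
  then show "(transpose g ** g') ** A = A ** (transpose g ** g')"
    using assms by (simp add: matrix_algebra SO_orthogonal)
next
  assume "(transpose g ** g') ** A = A ** (transpose g ** g')"
  then have "g ** ((transpose g ** g') ** A) ** transpose g' = g ** (A ** (transpose g ** g')) ** transpose g'"
    by simp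
  then show "g ** A ** transpose g = g' ** A ** transpose g'"
    using assms by (simp add: matrix_algebra SO_orthogonal)
qed

lemma orthogonal_commute_transpose:
  fixes k :: "real^'n^'n"
  assumes k: "orthogonal_matrix k" and eq: "k ** A = A ** k"
  shows "transpose k ** A = A ** transpose k"
proof -
  have kk: "transpose k ** k = mat 1" "k ** transpose k = mat 1"
    using k by (simp_all add: orthogonal_matrix_def)
  have "transpose k ** A = transpose k ** (A ** k) ** transpose k"
    by (simp add: matrix_mul_assoc[symmetric] kk)
  also have "\<dots> = A ** transpose k"
    unfolding eq[symmetric] by (simp add: matrix_mul_assoc kk)
  finally show ?thesis .
qed

text \<open>One direction makes \<open>embB\<close> and \<open>embC\<close> well defined, the other
  makes the pair of them injective.\<close>

lemma coset_eq_iff: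
  assumes g: "g \<in> SOn" "g' \<in> SOn"
  shows "coset U1xU2 g = coset U1xU2 g' \<longleftrightarrow>
    g ** B0 ** transpose g = g' ** B0 ** transpose g' \<and> g ** C0 ** transpose g = g' ** C0 ** transpose g'"
proof -
  let ?k = "transpose g ** g'"
  have orth: "orthogonal_matrix ?k"
    using SO_closed(2)[OF SO_closed(3)[OF g(1)] g(2)] by (simp add: mem_SO)
  have kinv: "transpose ?k ** (?k ** x) = x" "?k ** (transpose ?k ** x) = x" for x
    using orth by (simp_all add: orthogonal_matrix_def matrix_mul_assoc)
  have g': "g' = g ** ?k" using g by (simp add: SO_orthogonal)
  have "coset U1xU2 g = coset U1xU2 g' \<longleftrightarrow> ?k \<in> U1xU2"
  proof
    assume eq: "coset U1xU2 g = coset U1xU2 g'"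
    have "mat 1 \<in> U1xU2" by (simp add: U1xU2_iff orthogonal_matrix)
    then have "g' ** mat 1 \<in> coset U1xU2 g" unfolding eq unfolding coset_image by blast
    then obtain k where "k \<in> U1xU2" "g' = g ** k" unfolding coset_image by auto
    then show "?k \<in> U1xU2" using g by (simp add: SO_orthogonal)
  next
    assume k: "?k \<in> U1xU2"
    then have kt: "transpose ?k \<in> U1xU2"
    proof -
      have "transpose ?k ** A = A ** transpose ?k" if "?k ** A = A ** ?k" for A
        by (rule orthogonal_commute_transpose[OF orth that])
      then show ?thesis using k orth by (simp add: U1xU2_iff)
    qed
    have mul: "k1 ** k2 \<in> U1xU2" if "k1 \<in> U1xU2" "k2 \<in> U1xU2" for k1 k2
    proof -
      have "k1 ** k2 ** A = A ** (k1 ** k2)" if "k1 ** A = A ** k1" "k2 ** A = A ** k2" for A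
        by (simp only: matrix_mul_assoc[symmetric] that(2)) (simp only: matrix_mul_assoc that(1))
      then show ?thesis using that by (simp add: U1xU2_iff orthogonal_matrix_mul)
    qed
    have "coset U1xU2 g' \<subseteq> coset U1xU2 g"
      unfolding coset_image using mul[OF k] g' by (force simp: matrix_mul_assoc)
    moreover have "coset U1xU2 g \<subseteq> coset U1xU2 g'"
    proof -
      have "g ** x = g' ** (transpose ?k ** x)" for x
        using kinv(2)[of x] g' by (metis matrix_mul_assoc)
      then show ?thesis unfolding coset_image using mul[OF kt] by blast
    qed
    ultimately show "coset U1xU2 g = coset U1xU2 g'" by blast
  qed
  then show ?thesis
    unfolding conj_eq_iff[OF g] using orth by (simp only: U1xU2_iff) simp
qed

lemma emb_coset:
  assumes "g \<in> SOn"
  shows "embB (coset U1xU2 g) = g ** B0 ** transpose g" "embC (coset U1xU2 g) = g ** C0 ** transpose g"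
  unfolding embB_def embC_def using assms coset_eq_iff by (blast intro!: some_equality)+


lemma emb_relations:
  assumes "p \<in> cosets U1xU2"
  shows "embB p ** (embB p ** embB p) = - embB p" "embC p ** (embC p ** embC p) = - embC p"
    "embB p ** embC p = 0" "embC p ** embB p = 0" "embB p ** embB p + embC p ** embC p = - mat 1"
    "transpose (embB p) = - embB p" "transpose (embC p) = - embC p"
proof -
  obtain g where g: "g \<in> SOn" "p = coset U1xU2 g" using assms by (auto simp: cosets_iff)
  show "embB p ** (embB p ** embB p) = - embB p" "embC p ** (embC p ** embC p) = - embC p"
    "embB p ** embC p = 0" "embC p ** embB p = 0"
    using g(1) by (simp_all add: g(2) emb_coset matrix_algebra SO_orthogonal base_mult base_mult_assoc)
  show "transpose (embB p) = - embB p" "transpose (embC p) = - embC p"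
    using g(1) by (simp_all add: g(2) emb_coset matrix_algebra matrix_transpose_mul_real base_transpose)
  have "embB p ** embB p + embC p ** embC p = g ** (- (Q0 + R0)) ** transpose g"
    using g(1) by (simp add: g(2) emb_coset matrix_algebra SO_orthogonal base_mult base_mult_assoc)
  then show "embB p ** embB p + embC p ** embC p = - mat 1"
    using g(1) by (simp add: Q0_R0 matrix_algebra SO_orthogonal)
qed

subsection \<open>A local section\<close>

text \<open>On the orbit this is twice the sum of the products of corresponding spectral projections
  of (\<open>B\<close>, \<open>C\<close>) and (\<open>B0\<close>, \<open>C0\<close>): the standard
  intertwiner, with \<open>T ** B0 = B ** T\<close> and \<open>T ** C0 = C ** T\<close>, and equal
  to 2 at the base pair. Since it is not orthogonal, the section takes the orthogonal factor of its
  polar decomposition, for which \<open>secH\<close> is the square of the positive factor.\<close>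

definition secT :: "mat6 \<Rightarrow> mat6 \<Rightarrow> mat6" where
  "secT B C = - (C ** C ** Q0) - C ** C0 - B ** B ** R0 - B ** B0"

definition secH :: "mat6 \<Rightarrow> mat6 \<Rightarrow> mat6" where
  "secH B C = transpose (secT B C) ** secT B C"

text \<open>For a symmetric matrix commuting with \<open>B0\<close> and \<open>C0\<close>, these are
  the scalar by which it acts on \<complex>, and the trace and determinant of its Hermitian block on
  \<complex>^2. As polynomials in the entries they are smooth on all matrices.\<close>

abbreviation (input) hh :: "mat6 \<Rightarrow> real" where "hh H \<equiv> H $ Inl (Inl 1) $ Inl (Inl 1)"
abbreviation (input) tt :: "mat6 \<Rightarrow> real" where
  "tt H \<equiv> H $ Inl (Inr 1) $ Inl (Inr 1) + H $ Inl (Inr 2) $ Inl (Inr 2)"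
abbreviation (input) dd :: "mat6 \<Rightarrow> real" where
  "dd H \<equiv> H $ Inl (Inr 1) $ Inl (Inr 1) * H $ Inl (Inr 2) $ Inl (Inr 2)
    - H $ Inl (Inr 1) $ Inl (Inr 2) * H $ Inl (Inr 1) $ Inl (Inr 2)
    - H $ Inl (Inr 1) $ Inr (Inr 2) * H $ Inl (Inr 1) $ Inr (Inr 2)"

text \<open>The inverse square root of a positive matrix commuting with \<open>B0\<close> and \<open>C0\<close>: on \<open>\<complex>\<^sup>2\<close>, the square
  root of a Hermitian \<open>2 \<times> 2\<close> matrix \<open>H\<close> of trace \<open>t\<close> and determinant \<open>\<delta>\<^sup>2\<close> is \<open>(H + \<delta>) / sqrt (t + 2 \<delta>)\<close>.\<close>

definition inv_sqrt :: "mat6 \<Rightarrow> mat6" where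
  "inv_sqrt H = inverse (sqrt (hh H)) *\<^sub>R Q0
    + inverse (sqrt (dd H) * sqrt (tt H + 2 * sqrt (dd H))) *\<^sub>R ((tt H + sqrt (dd H)) *\<^sub>R R0 - H ** R0)"

lemma mat6_eqI:
  assumes "\<And>i j. j \<in> {Inl (Inl 1), Inl (Inr 1), Inl (Inr 2), Inr (Inl 1), Inr (Inr 1), Inr (Inr 2)} \<Longrightarrow>
      i \<in> {Inl (Inl 1), Inl (Inr 1), Inl (Inr 2), Inr (Inl 1), Inr (Inr 1), Inr (Inr 2)} \<Longrightarrow> M $ i $ j = N $ i $ j"
  shows "M = (N :: mat6)"
  using assms unfolding vec_eq_iff UNIV_6[symmetric] by simp

lemma base_proj_nth:
  "(X ** Q0) $ i $ Inl (Inl 1) = X $ i $ Inl (Inl 1)" "(X ** Q0) $ i $ Inr (Inl 1) = X $ i $ Inr (Inl 1)"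
  "(X ** Q0) $ i $ Inl (Inr m) = 0" "(X ** Q0) $ i $ Inr (Inr m) = 0"
  "(Q0 ** X) $ Inl (Inl 1) $ i = X $ Inl (Inl 1) $ i" "(Q0 ** X) $ Inr (Inl 1) $ i = X $ Inr (Inl 1) $ i"
  "(Q0 ** X) $ Inl (Inr m) $ i = 0" "(Q0 ** X) $ Inr (Inr m) $ i = 0"
  "(X ** R0) $ i $ Inl (Inl 1) = 0" "(X ** R0) $ i $ Inr (Inl 1) = 0"
  "(X ** R0) $ i $ Inl (Inr m) = X $ i $ Inl (Inr m)" "(X ** R0) $ i $ Inr (Inr m) = X $ i $ Inr (Inr m)"
  "(R0 ** X) $ Inl (Inl 1) $ i = 0" "(R0 ** X) $ Inr (Inl 1) $ i = 0"
  "(R0 ** X) $ Inl (Inr m) $ i = X $ Inl (Inr m) $ i" "(R0 ** X) $ Inr (Inr m) $ i = X $ Inr (Inr m) $ i"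
  using exhaust_2[of m] by (auto simp: matrix_matrix_mult_def sum_6 Q0_nth R0_nth)

lemma inv_sqrt:
  assumes comm: "H ** B0 = B0 ** H" "H ** C0 = C0 ** H" and sym: "transpose H = H"
    and pos: "hh H > 0" "tt H > 0" "dd H > 0"
  shows "transpose (inv_sqrt H) = inv_sqrt H" "inv_sqrt H ** H ** inv_sqrt H = mat 1"
    "inv_sqrt H ** B0 = B0 ** inv_sqrt H" "inv_sqrt H ** C0 = C0 ** inv_sqrt H"
proof -
  define N where "N = H ** R0"
  define t where "t = tt H"
  define \<delta> where "\<delta> = sqrt (dd H)"
  define \<tau> where "\<tau> = sqrt (t + 2 * \<delta>)"
  note n = commutant_nth[OF comm]
  have "transpose H $ i $ j = H $ i $ j" for i j by (simp add: sym)
  then have s: "H $ j $ i = H $ i $ j" for i j by (simp add: transpose_def)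
  have s': "H $ Inl (Inr 2) $ Inl (Inr 1) = H $ Inl (Inr 1) $ Inl (Inr 2)"
    "H $ Inr (Inl 1) $ Inl (Inl 1) = 0" "H $ Inr (Inr m) $ Inl (Inr m) = 0"
    "H $ Inr (Inr 1) $ Inl (Inr 2) = - H $ Inr (Inr 2) $ Inl (Inr 1)" for m
    using n(2,4) s[of "Inl (Inr 2)" "Inl (Inr 1)"] s[of "Inl (Inl 1)" "Inr (Inl 1)"]
      s[of "Inl (Inr m)" "Inr (Inr m)"] s[of "Inl (Inr 2)" "Inr (Inr 1)"] n(4)[of m m] n(4)[of 2 1]
    by simp_all
  have HQ: "H ** Q0 = hh H *\<^sub>R Q0" "Q0 ** H = hh H *\<^sub>R Q0"
    by (rule mat6_eqI; auto simp: base_proj_nth n s' Q0_nth)+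
  have RH: "R0 ** H = N"
    unfolding N_def by (rule mat6_eqI) (auto simp: base_proj_nth n s')
  \<comment> \<open>The Cayley-Hamilton identity for the Hermitian block. It gives (H + \<delta>)
    ((t + \<delta>) - H) = \<delta> (t + 2 \<delta>), which is why the inverse of the square root is
    again linear in H.\<close>
  have NN: "N ** N = t *\<^sub>R N - (\<delta> * \<delta>) *\<^sub>R R0"
  proof (rule mat6_eqI)
    fix i j :: "(1 + 2) + (1 + 2)"
    assume ij: "j \<in> {Inl (Inl 1), Inl (Inr 1), Inl (Inr 2), Inr (Inl 1), Inr (Inr 1), Inr (Inr 2)}"
      "i \<in> {Inl (Inl 1), Inl (Inr 1), Inl (Inr 2), Inr (Inl 1), Inr (Inr 1), Inr (Inr 2)}"
    have "\<delta> * \<delta> = dd H" using pos by (simp add: \<delta>_def)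
    moreover have "(N ** N) $ i $ j = (\<Sum>k\<in>UNIV. N $ i $ k * N $ k $ j)"
      by (simp add: matrix_matrix_mult_def)
    ultimately show "(N ** N) $ i $ j = (t *\<^sub>R N - (\<delta> * \<delta>) *\<^sub>R R0) $ i $ j"
      using ij unfolding sum_6 N_def t_def
      by (auto simp: base_proj_nth n s' R0_nth algebra_simps)
  qed
  have NR: "N ** R0 = N" "R0 ** N = N" "N ** Q0 = 0" "Q0 ** N = 0"
    unfolding N_def by (simp_all add: matrix_algebra base_mult matrix_mul_assoc RH[unfolded N_def] HQ)
  have \<delta>: "\<delta> > 0" using pos by (simp add: \<delta>_def)
  have \<tau>: "\<tau> > 0" "\<tau> * \<tau> = t + 2 * \<delta>" using pos(2) \<delta> by (simp_all add: \<tau>_def t_def)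
  have S: "inv_sqrt H = inverse (sqrt (hh H)) *\<^sub>R Q0 + inverse (\<delta> * \<tau>) *\<^sub>R ((t + \<delta>) *\<^sub>R R0 - N)"
    by (simp add: inv_sqrt_def N_def t_def \<delta>_def \<tau>_def)
  have NT: "transpose N = N"
    unfolding N_def by (simp add: matrix_transpose_mul_real sym base_transpose RH[unfolded N_def])
  show "transpose (inv_sqrt H) = inv_sqrt H"
    unfolding S by (simp add: transpose_linear base_transpose NT)
  have NB: "N ** B0 = B0 ** N" "N ** C0 = C0 ** N"
  proof -
    have "N ** B0 = H ** B0" "N ** C0 = 0"
      by (simp_all only: N_def matrix_mul_assoc[symmetric] base_mult matrix_algebra(10))
    moreover have "B0 ** N = H ** (B0 ** R0)" "C0 ** N = H ** (C0 ** R0)"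
      by (simp_all only: N_def matrix_mul_assoc comm)
    ultimately show "N ** B0 = B0 ** N" "N ** C0 = C0 ** N"
      by (simp_all only: base_mult matrix_algebra(10))
  qed
  show "inv_sqrt H ** B0 = B0 ** inv_sqrt H" "inv_sqrt H ** C0 = C0 ** inv_sqrt H"
    unfolding S using NB by (simp_all add: matrix_algebra base_mult)
  have HS: "H ** inv_sqrt H = (inverse (sqrt (hh H)) * hh H) *\<^sub>R Q0 + inverse (\<delta> * \<tau>) *\<^sub>R ((t + \<delta>) *\<^sub>R N - N ** N)"
  proof -
    have "H ** N = H ** (R0 ** N)" by (simp add: NR)
    also have "\<dots> = N ** N" by (simp add: N_def matrix_mul_assoc)
    finally have "H ** N = N ** N" .
    then show ?thesis unfolding S by (simp add: matrix_algebra HQ flip: N_def)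
  qed
  have N2: "(t + \<delta>) *\<^sub>R N - N ** N = \<delta> *\<^sub>R N + (\<delta> * \<delta>) *\<^sub>R R0"
    unfolding NN by (simp add: algebra_simps)
  have "inv_sqrt H ** (H ** inv_sqrt H) =
      (inverse (sqrt (hh H)) * (inverse (sqrt (hh H)) * hh H)) *\<^sub>R Q0
      + (inverse (\<delta> * \<tau>) * inverse (\<delta> * \<tau>)) *\<^sub>R (((t + \<delta>) *\<^sub>R R0 - N) ** (\<delta> *\<^sub>R N + (\<delta> * \<delta>) *\<^sub>R R0))"
    unfolding HS N2 unfolding S by (simp add: matrix_algebra base_mult NR scaleR_add_right mult_ac)
  also have "((t + \<delta>) *\<^sub>R R0 - N) ** (\<delta> *\<^sub>R N + (\<delta> * \<delta>) *\<^sub>R R0) = (\<delta> * \<delta> * (\<tau> * \<tau>)) *\<^sub>R R0"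
    unfolding \<tau> by (simp only: matrix_algebra base_mult NR NN) (simp add: vec_eq_iff algebra_simps)
  also have "inverse (sqrt (hh H)) * (inverse (sqrt (hh H)) * hh H) = 1"
    using pos(1) by (simp add: field_simps)
  finally show "inv_sqrt H ** H ** inv_sqrt H = mat 1"
    using \<delta> \<tau>(1) by (simp add: Q0_R0 matrix_algebra field_simps)
qed

definition section_map :: "mat6 \<times> mat6 \<Rightarrow> mat6" where
  "section_map x = secT (fst x) (snd x) ** inv_sqrt (secH (fst x) (snd x))"

definition section_dom :: "(mat6 \<times> mat6) set" where
  "section_dom = {x. hh (secH (fst x) (snd x)) > 0 \<and> tt (secH (fst x) (snd x)) > 0
     \<and> dd (secH (fst x) (snd x)) > 0}"

text \<open>The inverse square root commutes with \<open>B0\<close> and \<open>C0\<close> because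
  \<open>secH\<close> does, so the polar factor still intertwines the two pairs. It is orthogonal,
  and a positive determinant then places it in the group; a rotation carrying the base pair to
  \<open>x\<close> lies in the coset of \<open>g\<close>.\<close>

lemma section_map:
  assumes g: "g \<in> SOn" and x: "x = (g ** B0 ** transpose g, g ** C0 ** transpose g)" "x \<in> section_dom"
    and det: "det (section_map x) > 0"
  shows "section_map x \<in> SOn" "coset U1xU2 (section_map x) = coset U1xU2 g"
proof -
  define B where "B = fst x"
  define C where "C = snd x"
  note BC = B_def[unfolded x(1) fst_conv] C_def[unfolded x(1) snd_conv]
  let ?T = "secT B C" and ?H = "secH B C"
  let ?S = "inv_sqrt ?H"
  have rel: "B ** (B ** B) = - B" "C ** (C ** C) = - C" "B ** C = 0" "C ** B = 0"
    "transpose B = - B" "transpose C = - C" "B ** (C ** X) = 0" "C ** (B ** X) = 0"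
    "B ** (B ** (B ** X)) = - (B ** X)" "C ** (C ** (C ** X)) = - (C ** X)" for X
    using g by (simp_all add: BC matrix_algebra SO_orthogonal base_mult base_mult_assoc
        matrix_transpose_mul_real base_transpose)
  have TB: "?T ** B0 = B ** ?T" "?T ** C0 = C ** ?T"
    by (simp_all add: secT_def matrix_algebra rel base_mult base_mult_assoc)
  have "transpose (?T ** B0) = transpose (B ** ?T)" "transpose (?T ** C0) = transpose (C ** ?T)"
    by (simp_all only: TB)
  then have TB': "B0 ** transpose ?T = transpose ?T ** B" "C0 ** transpose ?T = transpose ?T ** C"
    by (simp_all add: matrix_transpose_mul_real rel base_transpose matrix_algebra)
  have comm: "?H ** B0 = B0 ** ?H" "?H ** C0 = C0 ** ?H"
    by (simp_all only: secH_def matrix_mul_assoc[symmetric] TB)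
      (simp_all only: matrix_mul_assoc TB')
  have sym: "transpose ?H = ?H" by (simp add: secH_def matrix_transpose_mul_real)
  have pos: "hh ?H > 0" "tt ?H > 0" "dd ?H > 0" using x(2) by (simp_all add: section_dom_def B_def C_def)
  note S = inv_sqrt[OF comm sym pos]
  have sec: "section_map x = ?T ** ?S" by (simp add: section_map_def B_def C_def)
  have "transpose (section_map x) ** section_map x = ?S ** ?H ** ?S"
    unfolding sec matrix_transpose_mul_real S(1) by (simp only: secH_def matrix_mul_assoc)
  then have orth: "orthogonal_matrix (section_map x)"
    by (simp add: orthogonal_matrix S(2))
  then show SO: "section_map x \<in> SOn"
    using det det_orthogonal_matrix[OF orth] by (auto simp: mem_SO)
  have "section_map x ** B0 = B ** section_map x" "section_map x ** C0 = C ** section_map x"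
    unfolding sec
    by (simp_all only: S(3,4) matrix_mul_assoc[symmetric]) (simp_all only: TB matrix_mul_assoc)
  then have "section_map x ** B0 ** transpose (section_map x) = B"
    "section_map x ** C0 ** transpose (section_map x) = C"
    using SO by (simp_all add: SO_orthogonal matrix_algebra)
  then show "coset U1xU2 (section_map x) = coset U1xU2 g"
    unfolding coset_eq_iff[OF SO g] by (simp add: BC)
qed

section \<open>Smoothness of the section\<close>

definition C_mat :: "('a::euclidean_space \<Rightarrow> real^'n^'m) \<Rightarrow> 'a set \<Rightarrow> bool" where
  "C_mat u W \<longleftrightarrow> (\<forall>k i j. C_k_on k (\<lambda>x. u x $ i $ j) W)"

lemma C_mat_const: "open W \<Longrightarrow> C_mat (\<lambda>x. A) W"
  by (simp add: C_mat_def C_k_on_const)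

lemma C_mat_mul: "open W \<Longrightarrow> C_mat u W \<Longrightarrow> C_mat v W \<Longrightarrow> C_mat (\<lambda>x. u x ** v x) W"
  by (auto simp: C_mat_def matrix_matrix_mult_def intro!: C_k_on_sum C_k_on_mult)

lemma C_mat_add: "open W \<Longrightarrow> C_mat u W \<Longrightarrow> C_mat v W \<Longrightarrow> C_mat (\<lambda>x. u x + v x) W"
  by (auto simp: C_mat_def intro!: C_k_on_add)

lemma C_mat_diff: "open W \<Longrightarrow> C_mat u W \<Longrightarrow> C_mat v W \<Longrightarrow> C_mat (\<lambda>x. u x - v x) W"
  by (auto simp: C_mat_def intro!: C_k_on_diff)

lemma C_mat_minus: "open W \<Longrightarrow> C_mat u W \<Longrightarrow> C_mat (\<lambda>x. - u x) W"
  by (auto simp: C_mat_def intro!: C_k_on_minus)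

lemma C_mat_scaleR: "open W \<Longrightarrow> (\<And>k. C_k_on k c W) \<Longrightarrow> C_mat u W \<Longrightarrow> C_mat (\<lambda>x. c x *\<^sub>R u x) W"
  by (auto simp: C_mat_def intro!: C_k_on_mult)

lemma C_mat_transpose: "C_mat u W \<Longrightarrow> C_mat (\<lambda>x. transpose (u x)) W"
  by (simp add: C_mat_def transpose_def)

lemma C_mat_subset: "C_mat u W \<Longrightarrow> V \<subseteq> W \<Longrightarrow> C_mat u V"
  unfolding C_mat_def by (blast intro: C_k_on_subset)

lemma C_mat_nth: "C_mat u W \<Longrightarrow> C_k_on k (\<lambda>x. u x $ i $ j) W"
  by (simp add: C_mat_def)

lemma C_mat_bounded_linear: "open W \<Longrightarrow> bounded_linear u \<Longrightarrow> C_mat u W"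
  unfolding C_mat_def
  by (intro allI C_k_on_bounded_linear bounded_linear_compose[OF bounded_linear_vec_nth]
      bounded_linear_compose[OF bounded_linear_vec_nth, of "\<lambda>x. u x $ i" for i]) auto

lemma C_mat_inner: "open W \<Longrightarrow> C_mat u W \<Longrightarrow> C_k_on k (\<lambda>x. u x \<bullet> b) W"
  unfolding inner_vec_def inner_real_def
  by (intro C_k_on_sum C_k_on_mult C_k_on_const C_mat_nth)

lemma C_mat_continuous_on: "open W \<Longrightarrow> C_mat u W \<Longrightarrow> continuous_on W u"
  by (subst continuous_on_componentwise) (use C_mat_inner[of W u 0] in simp)

lemma C_mat_fst_snd: "C_mat (fst :: mat6 \<times> mat6 \<Rightarrow> mat6) UNIV" "C_mat (snd :: mat6 \<times> mat6 \<Rightarrow> mat6) UNIV"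
  by (intro C_mat_bounded_linear bounded_linear_fst bounded_linear_snd open_UNIV)+

lemma C_mat_secT: "C_mat (\<lambda>x. secT (fst x) (snd x)) UNIV"
  unfolding secT_def
  by (intro C_mat_diff C_mat_minus C_mat_mul C_mat_const C_mat_fst_snd open_UNIV)

lemma C_mat_secH: "C_mat (\<lambda>x. secH (fst x) (snd x)) UNIV"
  unfolding secH_def by (intro C_mat_mul C_mat_transpose C_mat_secT open_UNIV)

lemma open_section_dom: "open section_dom"
proof -
  have "C_k_on 0 (\<lambda>x. secH (fst x) (snd x) $ i $ j) UNIV" for i j
    by (rule C_mat_nth[OF C_mat_secH])
  then have c: "continuous_on UNIV (\<lambda>x. secH (fst x) (snd x) $ i $ j)" for i j by simp
  show ?thesis
    unfolding section_dom_def
    by (intro open_Collect_conj open_Collect_less continuous_on_add continuous_on_diff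
        continuous_on_mult continuous_on_const c)
qed

lemma C_mat_section_map: "C_mat section_map section_dom"
proof -
  have H: "C_k_on k (\<lambda>x. secH (fst x) (snd x) $ i $ j) section_dom" for k i j
    by (rule C_mat_nth[OF C_mat_subset[OF C_mat_secH]]) simp
  have dd: "C_k_on k (\<lambda>x. dd (secH (fst x) (snd x))) section_dom" and tt: "C_k_on k (\<lambda>x. tt (secH (fst x) (snd x))) section_dom" for k
    by (intro C_k_on_add C_k_on_diff C_k_on_mult H open_section_dom)+
  have sd: "C_k_on k (\<lambda>x. sqrt (dd (secH (fst x) (snd x)))) section_dom" for k
    by (rule C_k_on_comp_real[OF open_section_dom _ _ C_k_on_sqrt dd]) (auto simp: section_dom_def)
  have tau: "C_k_on k (\<lambda>x. sqrt (tt (secH (fst x) (snd x)) + 2 * sqrt (dd (secH (fst x) (snd x))))) section_dom" for k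
  proof (rule C_k_on_comp_real[OF open_section_dom _ _ C_k_on_sqrt])
    have "tt H + 2 * sqrt (dd H) > 0" if "tt H > 0" "dd H > 0" for H
    proof -
      have "sqrt (dd H) > 0" using that by simp
      with that(1) show ?thesis by linarith
    qed
    then show "(\<lambda>x. tt (secH (fst x) (snd x)) + 2 * sqrt (dd (secH (fst x) (snd x)))) ` section_dom \<subseteq> {0<..}"
      unfolding section_dom_def by force
  qed (auto intro!: C_k_on_add C_k_on_mult C_k_on_const tt sd open_section_dom)
  have hs: "C_k_on k (\<lambda>x. sqrt (hh (secH (fst x) (snd x)))) section_dom" for k
    by (rule C_k_on_comp_real[OF open_section_dom _ _ C_k_on_sqrt H]) (auto simp: section_dom_def)
  have 1: "C_k_on k (\<lambda>x. inverse (sqrt (hh (secH (fst x) (snd x))))) section_dom" for k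
    by (rule C_k_on_comp_real[OF open_section_dom _ _ C_k_on_inverse hs]) (auto simp: section_dom_def)
  have 2: "C_k_on k (\<lambda>x. inverse (sqrt (dd (secH (fst x) (snd x)))
      * sqrt (tt (secH (fst x) (snd x)) + 2 * sqrt (dd (secH (fst x) (snd x)))))) section_dom" for k
  proof (rule C_k_on_comp_real[OF open_section_dom _ _ C_k_on_inverse])
    have "tt H + 2 * sqrt (dd H) > 0" if "tt H > 0" "dd H > 0" for H
    proof -
      have "sqrt (dd H) > 0" using that by simp
      with that(1) show ?thesis by linarith
    qed
    then show "(\<lambda>x. sqrt (dd (secH (fst x) (snd x))) * sqrt (tt (secH (fst x) (snd x)) + 2 * sqrt (dd (secH (fst x) (snd x)))))
        ` section_dom \<subseteq> - {0}"
      unfolding section_dom_def by force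
  qed (auto intro!: C_k_on_mult sd tau open_section_dom)
  show ?thesis
    unfolding section_map_def inv_sqrt_def
    by (intro C_mat_mul C_mat_add C_mat_diff C_mat_scaleR C_mat_const C_mat_subset[OF C_mat_secT]
        C_mat_subset[OF C_mat_secH] open_section_dom 1 2 C_k_on_add tt sd subset_UNIV)
qed

section \<open>Smooth functions are locally functions of the embedding\<close>

definition base :: "mat6 \<times> mat6" where "base = (B0, C0)"

definition conj_pair :: "mat6 \<Rightarrow> mat6 \<times> mat6 \<Rightarrow> mat6 \<times> mat6" where
  "conj_pair a x = (a ** fst x ** transpose a, a ** snd x ** transpose a)"

definition emb :: "mat6 set \<Rightarrow> mat6 \<times> mat6" where "emb p = (embB p, embC p)"

lemma emb_eq: "g \<in> SOn \<Longrightarrow> emb (coset U1xU2 g) = conj_pair g base"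
  by (simp add: emb_def conj_pair_def base_def emb_coset)

lemma conj_pair_mult: "conj_pair (a ** b) x = conj_pair a (conj_pair b x)"
  by (simp add: conj_pair_def matrix_transpose_mul_real matrix_algebra)

definition section_nbhd :: "(mat6 \<times> mat6) set" where
  "section_nbhd = {x \<in> section_dom. det (section_map x) > 0}"

lemma continuous_on_section_map: "continuous_on section_dom section_map"
  by (rule C_mat_continuous_on[OF open_section_dom C_mat_section_map])

lemma open_section_nbhd: "open section_nbhd"
proof -
  have "continuous_on section_dom (\<lambda>x. section_map x $ i $ j)" for i j
    using C_mat_nth[OF C_mat_section_map, of 0] by simp
  then have "continuous_on section_dom (\<lambda>x. det (section_map x))"
    unfolding det_def
    by (intro continuous_on_sum continuous_on_mult continuous_on_const continuous_on_prod)
  then have "open (section_dom \<inter> (\<lambda>x. det (section_map x)) -` {0<..})"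
    by (rule continuous_open_preimage[OF _ open_section_dom open_greaterThan])
  also have "section_dom \<inter> (\<lambda>x. det (section_map x)) -` {0<..} = section_nbhd"
    by (auto simp: section_nbhd_def)
  finally show ?thesis .
qed

lemma section_base: "base \<in> section_nbhd" "section_map base = mat 1"
proof -
  have T: "secT B0 C0 = 2 *\<^sub>R mat 1"
  proof -
    have "secT B0 C0 = 2 *\<^sub>R (Q0 + R0)"
      by (simp add: secT_def base_mult base_mult_assoc matrix_algebra scaleR_2)
    then show ?thesis by (simp add: Q0_R0)
  qed
  have H: "secH B0 C0 = 4 *\<^sub>R mat 1"
    unfolding secH_def T by (simp add: transpose_linear matrix_algebra)
  \<comment> \<open>At H = 4 the values are hh = 4, dd = 16 and tt + 2 sqrt dd = 8 + 8 = 16, which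
    explains the two roots.\<close>
  have s16: "sqrt 16 = (4::real)" by (rule real_sqrt_unique) auto
  have s4: "sqrt 4 = (2::real)" by (rule real_sqrt_unique) auto
  have "inv_sqrt (4 *\<^sub>R mat 1) = (1 / 2) *\<^sub>R (Q0 + R0)"
    by (simp add: inv_sqrt_def mat_def[of "1::real"] s16 s4)
      (simp add: matrix_algebra vec_eq_iff flip: mat_def)
  then show 1: "section_map base = mat 1"
    by (simp add: section_map_def base_def T H Q0_R0 matrix_algebra)
  show "base \<in> section_nbhd"
    by (simp add: section_nbhd_def section_dom_def 1) (simp add: base_def H mat_def)
qed

lemma section_nbhd_coset:
  assumes "g \<in> SOn" "conj_pair g base \<in> section_nbhd"
  shows "section_map (conj_pair g base) \<in> SOn" "coset U1xU2 (section_map (conj_pair g base)) = coset U1xU2 g"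
  using section_map[OF assms(1), of "conj_pair g base"] assms(2)
  by (auto simp: section_nbhd_def conj_pair_def base_def)

lemma bounded_linear_conj_pair: "bounded_linear (conj_pair a)"
  unfolding conj_pair_def
  by (intro bounded_linear_Pair
      bounded_linear_compose[OF bounded_bilinear.bounded_linear_left[OF bounded_bilinear_matrix_mul]]
      bounded_linear_compose[OF bounded_bilinear.bounded_linear_right[OF bounded_bilinear_matrix_mul]]
      bounded_linear_fst bounded_linear_snd)

lemma C_k_on_pair_linear:
  fixes u :: "mat6 \<times> mat6 \<Rightarrow> mat6 \<times> mat6"
  shows "bounded_linear u \<Longrightarrow> C_k_on k (\<lambda>x. u x \<bullet> b) UNIV"
  by (intro C_k_on_bounded_linear bounded_linear_inner_left_comp) auto

text \<open>Conjugation by the transpose of \<open>g\<close> moves the point to the base pair, so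
  that the single section near \<open>base\<close> serves all points. There \<open>f\<close> is its
  extension \<open>h\<close> composed with \<open>g\<close> times the section.\<close>

lemma smooth_factors_through_emb:
  assumes f: "f \<in> smooth_on_cosets U1xU2" and g: "g \<in> SOn"
  obtains U \<Phi> where "open U" "emb (coset U1xU2 g) \<in> U" "\<And>k. C_k_on k \<Phi> U"
    "\<And>q. q \<in> cosets U1xU2 \<Longrightarrow> emb q \<in> U \<Longrightarrow> f q = \<Phi> (emb q)"
proof -
  obtain h W where ext: "local_ext SOn (\<lambda>g. f (coset U1xU2 g)) g h W"
    using smooth_on_cosetsE[OF f g] by metis
  then have W: "open W" "g \<in> W" "\<And>k. C_k_on k h W" "\<And>y. y \<in> SOn \<Longrightarrow> y \<in> W \<Longrightarrow> h y = f (coset U1xU2 y)"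
    unfolding local_ext_def by blast+
  let ?s = "\<lambda>y. g ** section_map y"
  define V where "V = section_nbhd \<inter> ?s -` W"
  have sub: "section_nbhd \<subseteq> section_dom" by (auto simp: section_nbhd_def)
  have s: "C_mat ?s section_nbhd"
    by (intro C_mat_mul C_mat_const open_section_nbhd C_mat_subset[OF C_mat_section_map sub])
  have oV: "open V"
    unfolding V_def
    by (rule continuous_open_preimage[OF C_mat_continuous_on[OF open_section_nbhd s] open_section_nbhd W(1)])
  have hV: "C_k_on k (\<lambda>y. h (?s y)) V" for k
    by (rule C_k_on_compose[where T = W, OF oV W(1) _ W(3)])
      (auto simp: V_def intro!: C_k_on_subset[OF C_mat_inner[OF open_section_nbhd s]])
  let ?c = "conj_pair (transpose g)"
  have cont: "continuous_on UNIV ?c" by (rule linear_continuous_on[OF bounded_linear_conj_pair])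
  have oU: "open (?c -` V)" by (rule open_vimage[OF oV cont])
  have cc: "?c (conj_pair g' x) = conj_pair (transpose g ** g') x" for g' x by (simp add: conj_pair_mult)
  have c1: "conj_pair (mat 1) x = x" for x by (simp add: conj_pair_def)
  show thesis
  proof (rule that[OF oU])
    show "emb (coset U1xU2 g) \<in> ?c -` V"
      using g section_base W(2) by (simp add: emb_eq V_def cc SO_orthogonal c1)
    show "C_k_on k (\<lambda>x. h (?s (?c x))) (?c -` V)" for k
      by (rule C_k_on_compose[where T = V and h = "\<lambda>y. h (?s y)", OF oU oV _ hV])
        (auto intro!: C_k_on_subset[OF C_k_on_pair_linear[OF bounded_linear_conj_pair]])
    fix q assume q: "q \<in> cosets U1xU2" "emb q \<in> ?c -` V"
    obtain a where a: "a \<in> SOn" "q = coset U1xU2 a" using q(1) by (auto simp: cosets_iff)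
    have ga: "transpose g ** a \<in> SOn" using g a by (simp add: SO_closed)
    let ?y = "?c (emb q)"
    have y: "?y = conj_pair (transpose g ** a) base" by (simp add: a emb_eq cc)
    have yn: "?y \<in> section_nbhd" "?s ?y \<in> W" using q(2) by (simp_all add: V_def)
    note sy = section_nbhd_coset[OF ga yn(1)[unfolded y], folded y]
    have "coset U1xU2 (?s ?y) = coset (coset U1xU2 (transpose g ** a)) g"
      by (simp add: sy(2) flip: coset_assoc)
    also have "\<dots> = q" using g by (simp add: coset_assoc a(2) SO_orthogonal)
    finally show "f q = h (?s (?c (emb q)))"
      using W(4)[OF SO_closed(2)[OF g sy(1)] yn(2)] by simp
  qed
qed

lemma smooth_emb:
  assumes "\<And>k. C_k_on k \<psi> UNIV"
  shows "(\<lambda>q. \<psi> (emb q)) \<in> smooth_on_cosets U1xU2"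
proof -
  have "C_mat (\<lambda>g. g ** A ** transpose g) UNIV" for A :: mat6
    by (intro C_mat_mul C_mat_transpose C_mat_const C_mat_bounded_linear bounded_linear_ident open_UNIV)
  then have "C_k_on k (\<lambda>g. conj_pair g base \<bullet> b) UNIV" for k b
    unfolding conj_pair_def inner_prod_def base_def fst_conv snd_conv
    by (intro C_k_on_add C_mat_inner open_UNIV)
  then have "C_k_on k (\<lambda>g. \<psi> (conj_pair g base)) UNIV" for k
    by (rule C_k_on_compose[where u = "\<lambda>g. conj_pair g base", OF open_UNIV open_UNIV subset_UNIV assms])
  then have "smooth_fun_on SOn (\<lambda>g. \<psi> (conj_pair g base))" by (rule smooth_fun_on_UNIV)
  then show ?thesis
    unfolding smooth_on_cosets_iff by (subst smooth_fun_on_cong) (auto simp: emb_eq)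
qed

lemma smooth_mat_emb: "smooth_mat U1xU2 embB" "smooth_mat U1xU2 embC"
proof -
  have "C_k_on k (\<lambda>x :: mat6 \<times> mat6. fst x $ i $ j) UNIV" "C_k_on k (\<lambda>x :: mat6 \<times> mat6. snd x $ i $ j) UNIV" for k i j
    by (rule C_mat_nth, rule C_mat_fst_snd)+
  from smooth_emb[OF this(1)] smooth_emb[OF this(2)] show "smooth_mat U1xU2 embB" "smooth_mat U1xU2 embC"
    by (simp_all add: smooth_mat_def emb_def)
qed

text \<open>Locally every smooth function is a smooth function of the matrix entries, and the chain
  rule determines a derivation from its values on them.\<close>

lemma tangent_eqI:
  assumes p: "p \<in> cosets U1xU2" and v: "v \<in> tangents U1xU2 p" and w: "w \<in> tangents U1xU2 p"
    and eq: "deriv_mat v embB = deriv_mat w embB" "deriv_mat v embC = deriv_mat w embC"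
  shows "v = w"
proof
  fix f
  show "v f = w f"
  proof (cases "f \<in> smooth_on_cosets U1xU2")
    case True
    obtain g where g: "g \<in> SOn" "p = coset U1xU2 g" using p by (auto simp: cosets_iff)
    obtain U \<Phi> where U: "open U" "emb p \<in> U" "\<And>k. C_k_on k \<Phi> U"
      "\<And>q. q \<in> cosets U1xU2 \<Longrightarrow> emb q \<in> U \<Longrightarrow> f q = \<Phi> (emb q)"
      using smooth_factors_through_emb[OF True g(1)] unfolding g(2) by blast
    have nth: "\<exists>i j. \<forall>A :: mat6. A \<bullet> b = A $ i $ j" if "b \<in> Basis" for b :: mat6
      using that unfolding Basis_vec_def by (auto simp: inner_axis) blast
    have ev: "v (\<lambda>q. emb q \<bullet> b) = w (\<lambda>q. emb q \<bullet> b)" if "b \<in> Basis" for b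
    proof -
      have ent: "v (\<lambda>q. embB q $ i $ j) = w (\<lambda>q. embB q $ i $ j)" "v (\<lambda>q. embC q $ i $ j) = w (\<lambda>q. embC q $ i $ j)" for i j
        using eq by (simp_all add: deriv_mat_def vec_eq_iff)
      from that consider b1 where "b1 \<in> Basis" "b = (b1, 0)" | b2 where "b2 \<in> Basis" "b = (0, b2)"
        by (auto simp: Basis_prod_def)
      then show ?thesis
      proof cases
        case 1
        obtain i j where "\<And>A :: mat6. A \<bullet> b1 = A $ i $ j" using nth[OF 1(1)] by blast
        with 1 ent show ?thesis by (simp add: emb_def inner_prod_def)
      next
        case 2
        obtain i j where "\<And>A :: mat6. A \<bullet> b2 = A $ i $ j" using nth[OF 2(1)] by blast
        with 2 ent show ?thesis by (simp add: emb_def inner_prod_def)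
      qed
    qed
    have cr: "u f = (\<Sum>b\<in>Basis. u (\<lambda>q. emb q \<bullet> b) * frechet_derivative \<Phi> (at (emb p)) b)"
      if u: "u \<in> tangents U1xU2 p" for u
    proof (rule tangent_chain_rule[where emb = emb, OF p _ True U(1) U(2) _ _ u])
      show "(\<lambda>q. \<psi> (emb q)) \<in> smooth_on_cosets U1xU2" if "\<And>k. C_k_on k \<psi> UNIV" for \<psi>
        using that by (rule smooth_emb)
    qed (fact U(3), fact U(4))
    show ?thesis unfolding cr[OF v] cr[OF w] by (rule sum.cong) (simp_all add: ev)
  qed (simp add: tangent_outside[OF v] tangent_outside[OF w])
qed

section \<open>Tangent vectors are infinitesimal rotations\<close>

lemma fund_conj_nth:
  assumes Y: "skew Y" and g: "g \<in> SOn" and A: "\<And>g. g \<in> SOn \<Longrightarrow> A (coset U1xU2 g) = g ** A0 ** transpose g"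
    and smooth: "smooth_mat U1xU2 A"
  shows "deriv_mat (fund U1xU2 Y (coset U1xU2 g)) A = Y ** A (coset U1xU2 g) - A (coset U1xU2 g) ** Y"
proof -
  have "fund U1xU2 Y (coset U1xU2 g) (\<lambda>q. A q $ i $ j) = (Y ** A (coset U1xU2 g) - A (coset U1xU2 g) ** Y) $ i $ j" for i j
  proof -
    let ?u = "\<lambda>x :: mat6. x ** A0 ** transpose x"
    have "C_mat ?u UNIV"
      by (intro C_mat_mul C_mat_transpose C_mat_const C_mat_bounded_linear bounded_linear_ident open_UNIV)
    then have "local_ext SOn (\<lambda>g. A (coset U1xU2 g) $ i $ j) g (\<lambda>x. ?u x $ i $ j) UNIV"
      by (intro local_ext_UNIV) (auto simp: A C_mat_nth)
    then have 1: "fund U1xU2 Y (coset U1xU2 g) (\<lambda>q. A q $ i $ j) = frechet_derivative (\<lambda>x. ?u x $ i $ j) (at g) (Y ** g)"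
      using smooth by (intro fund_eq[OF Y g]) (auto simp: smooth_mat_def)
    have tr: "(transpose has_derivative transpose) (at x)" for x :: mat6
    proof -
      have "linear (transpose :: mat6 \<Rightarrow> mat6)" by (intro linearI) (simp_all add: transpose_linear)
      then show ?thesis by (simp add: linear_conv_bounded_linear bounded_linear_imp_has_derivative)
    qed
    have "((\<lambda>x. x ** A0) has_derivative (\<lambda>v. v ** A0)) (at g)"
      by (intro bounded_linear_imp_has_derivative bounded_bilinear.bounded_linear_left[OF bounded_bilinear_matrix_mul])
    then have "(?u has_derivative (\<lambda>v. (g ** A0) ** transpose v + (v ** A0) ** transpose g)) (at g)"
      by (rule has_derivative_matrix_mul[OF _ tr])
    then have "((\<lambda>x. ?u x $ i $ j) has_derivative (\<lambda>v. ((g ** A0) ** transpose v + (v ** A0) ** transpose g) $ i $ j)) (at g)"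
      by (intro bounded_linear.has_derivative[OF bounded_linear_vec_nth])
    from frechet_derivative_at[OF this, symmetric] show ?thesis
      using Y unfolding 1 by (simp add: A[OF g] matrix_transpose_mul_real skew_def matrix_algebra)
  qed
  then show ?thesis by (simp add: vec_eq_iff deriv_mat_def)
qed

lemma deriv_mat_fund:
  assumes "skew Y" "p \<in> cosets U1xU2"
  shows "deriv_mat (fund U1xU2 Y p) embB = Y ** embB p - embB p ** Y"
    "deriv_mat (fund U1xU2 Y p) embC = Y ** embC p - embC p ** Y"
  using assms(2) fund_conj_nth[OF assms(1) _ emb_coset(1) smooth_mat_emb(1)]
    fund_conj_nth[OF assms(1) _ emb_coset(2) smooth_mat_emb(2)]
  by (auto simp: cosets_iff)

text \<open>Given the velocities \<open>b\<close>, \<open>c\<close> of \<open>B\<close>, \<open>C\<close>, this is half the sum of \<open>\<Pi>' \<Pi>\<close> over the spectral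
  projections \<open>\<Pi>\<close> of \<open>B + 2 C\<close>, the generator of Kato's parallel transport.\<close>

definition kato :: "mat6 \<Rightarrow> mat6 \<Rightarrow> mat6 \<Rightarrow> mat6 \<Rightarrow> mat6" where
  "kato B C b c = (1/2) *\<^sub>R (C ** c ** C ** C + B ** b ** B ** B) - c ** C - b ** B"

text \<open>The hypotheses \<open>b3\<close> and \<open>bc\<close> are the derivatives of B^3 = -B
  and B C = 0. They suffice to exhibit the velocity \<open>b\<close> as the commutator of an
  algebraically given generator with \<open>B\<close>.\<close>

lemma kato_commutator:
  assumes B3: "B ** (B ** B) = - B" and BC: "B ** C = 0" "C ** B = 0" and sum: "B ** B + C ** C = - mat 1"
    and b3: "b ** (B ** B) + B ** (b ** B) + B ** (B ** b) = - b"
    and bc: "b ** C + B ** c = 0"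
  shows "kato B C b c ** B - B ** kato B C b c = b"
proof -
  have CC: "C ** C = - mat 1 - B ** B" using sum by (simp add: algebra_simps)
  have B3': "B ** (B ** (B ** X)) = - (B ** X)" "B ** (C ** X) = 0" "C ** (B ** X) = 0" for X
    by (simp_all only: matrix_mul_assoc B3[unfolded matrix_mul_assoc] BC matrix_algebra(5,9))
  have Bc: "B ** c = - (b ** C)" using bc by (simp add: eq_neg_iff_add_eq_0 add.commute)
  have Bc': "B ** (c ** X) = - (b ** (C ** X))" for X
    by (simp only: matrix_mul_assoc Bc matrix_algebra(5))
  have "B ** (B ** (b ** (B ** B))) = B ** (B ** (- b - B ** (b ** B) - B ** (B ** b)))"
    unfolding b3[symmetric] by (simp add: algebra_simps)
  also have "\<dots> = B ** (b ** B)"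
    by (simp add: matrix_algebra B3 B3')
  finally have r: "B ** (B ** (b ** (B ** B))) = B ** (b ** B)" .
  have "kato B C b c ** B - B ** kato B C b c = - (b ** (B ** B)) - b ** (C ** C)"
    unfolding kato_def
    by (simp add: matrix_algebra BC B3 B3' Bc' r algebra_simps)
  also have "\<dots> = b" by (simp add: CC matrix_algebra)
  finally show ?thesis .
qed

text \<open>A derivation differentiates each of the relations in \<open>emb_relations\<close>. The
  differentiated relations make Kato's generator skew and give it the right commutators with both
  matrices, so its fundamental vector agrees with \<open>v\<close> on all entries.\<close>

lemma tangent_eq_fund:
  assumes p: "p \<in> cosets U1xU2" and v: "v \<in> tangents U1xU2 p"
  defines "Y \<equiv> kato (embB p) (embC p) (deriv_mat v embB) (deriv_mat v embC)"
  shows "skew Y" "v = fund U1xU2 Y p"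
proof -
  let ?B = "embB p" and ?C = "embC p" and ?b = "deriv_mat v embB" and ?c = "deriv_mat v embC"
  note rel = emb_relations[OF p]
  note sm = smooth_mat_emb smooth_mat_mul smooth_mat_add smooth_mat_transpose
  note dm = deriv_mat_mul[OF v] deriv_mat_add[OF v] deriv_mat_minus[OF v] deriv_mat_const[OF v] deriv_mat_transpose
  have b3: "?b ** (?B ** ?B) + ?B ** (?b ** ?B) + ?B ** (?B ** ?b) = - ?b"
  proof -
    have "deriv_mat v (\<lambda>q. embB q ** (embB q ** embB q)) = deriv_mat v (\<lambda>q. - embB q)"
      by (rule deriv_mat_cong[OF v p]) (auto intro!: sm simp: emb_relations)
    then show ?thesis by (simp add: dm sm matrix_algebra add.assoc)
  qed
  have c3: "?c ** (?C ** ?C) + ?C ** (?c ** ?C) + ?C ** (?C ** ?c) = - ?c"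
  proof -
    have "deriv_mat v (\<lambda>q. embC q ** (embC q ** embC q)) = deriv_mat v (\<lambda>q. - embC q)"
      by (rule deriv_mat_cong[OF v p]) (auto intro!: sm simp: emb_relations)
    then show ?thesis by (simp add: dm sm matrix_algebra add.assoc)
  qed
  have bc: "?b ** ?C + ?B ** ?c = 0" "?c ** ?B + ?C ** ?b = 0"
  proof -
    have "deriv_mat v (\<lambda>q. embB q ** embC q) = deriv_mat v (\<lambda>q. 0)"
      "deriv_mat v (\<lambda>q. embC q ** embB q) = deriv_mat v (\<lambda>q. 0)"
      by (rule deriv_mat_cong[OF v p]; auto intro!: sm simp: emb_relations)+
    then show "?b ** ?C + ?B ** ?c = 0" "?c ** ?B + ?C ** ?b = 0" by (simp_all add: dm sm)
  qed
  have s: "(?b ** ?B + ?B ** ?b) + (?c ** ?C + ?C ** ?c) = 0"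
  proof -
    have "deriv_mat v (\<lambda>q. embB q ** embB q + embC q ** embC q) = deriv_mat v (\<lambda>q. - mat 1)"
      by (rule deriv_mat_cong[OF v p]) (auto intro!: sm simp: emb_relations)
    then show ?thesis by (simp add: dm sm)
  qed
  have t: "transpose ?b = - ?b" "transpose ?c = - ?c"
  proof -
    have "deriv_mat v (\<lambda>q. transpose (embB q)) = deriv_mat v (\<lambda>q. - embB q)"
      "deriv_mat v (\<lambda>q. transpose (embC q)) = deriv_mat v (\<lambda>q. - embC q)"
      by (rule deriv_mat_cong[OF v p]; auto intro!: sm simp: emb_relations)+
    then show "transpose ?b = - ?b" "transpose ?c = - ?c" by (simp_all add: dm sm)
  qed
  \<comment> \<open>The derivative of B^2 + C^2 = -1 is multiplied by the same matrix on both sides;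
    since B C = C B = 0, the terms of the other matrix disappear.\<close>
  have z: "?C ** (?C ** (?c ** ?C)) = - (?C ** (?c ** (?C ** ?C)))" "?B ** (?B ** (?b ** ?B)) = - (?B ** (?b ** (?B ** ?B)))"
  proof -
    have BCX: "?B ** (?C ** X) = 0" "?C ** (?B ** X) = 0" for X
      using rel(3,4) by (simp_all add: matrix_mul_assoc matrix_algebra(9))
    have "?C ** ((?b ** ?B + ?B ** ?b) + (?c ** ?C + ?C ** ?c)) ** ?C = 0"
      "?B ** ((?b ** ?B + ?B ** ?b) + (?c ** ?C + ?C ** ?c)) ** ?B = 0"
      by (simp_all add: s matrix_algebra)
    then show "?C ** (?C ** (?c ** ?C)) = - (?C ** (?c ** (?C ** ?C)))" "?B ** (?B ** (?b ** ?B)) = - (?B ** (?b ** (?B ** ?B)))"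
      by (simp_all add: matrix_algebra rel(3,4) BCX eq_neg_iff_add_eq_0 add.commute)
  qed
  show Y: "skew Y"
    unfolding skew_def Y_def kato_def
    using s by (simp add: transpose_linear matrix_transpose_mul_real t rel matrix_algebra z algebra_simps eq_neg_iff_add_eq_0)
      (simp add: add_eq_0_iff algebra_simps)
  have YB: "Y ** ?B - ?B ** Y = ?b"
    unfolding Y_def using rel b3 bc by (intro kato_commutator) auto
  have sym: "kato B C b c = kato C B c b" for B C b c
    by (simp add: kato_def algebra_simps)
  have YC: "Y ** ?C - ?C ** Y = ?c"
    unfolding Y_def using rel c3 bc by (subst (1 2) sym, intro kato_commutator) (auto simp: add.commute)
  show "v = fund U1xU2 Y p"
    by (rule tangent_eqI[OF p v fund_tangent[OF Y p]]) (simp_all add: deriv_mat_fund[OF Y p] YB YC)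
qed

subsection \<open>The invariant almost complex structures\<close>

text \<open>The isotropy representation is the sum of three irreducible representations: the part of
  \<open>R Y R\<close> anticommuting with \<open>B\<close>, and two summands of the off-diagonal part \<open>Q Y R + R Y Q\<close>, on which
  \<open>ad B\<close> has the eigenvalues \<open>\<plusminus>\<i>\<close> and \<open>ad C\<close> the eigenvalues \<open>\<plusminus>\<i>\<close>, of opposite relative sign.\<close>

definition Jop :: "real \<Rightarrow> real \<Rightarrow> mat6 \<Rightarrow> mat6 \<Rightarrow> mat6 \<Rightarrow> mat6" where
  "Jop \<alpha> \<beta> B C Y = (1/2) *\<^sub>R ((B ** B) ** Y ** B - B ** Y ** (B ** B))
    + \<alpha> *\<^sub>R ((C ** C) ** Y ** B - B ** Y ** (C ** C)) + \<beta> *\<^sub>R ((B ** B) ** Y ** C - C ** Y ** (B ** B))"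

abbreviation J0 :: "real \<Rightarrow> real \<Rightarrow> mat6 \<Rightarrow> mat6" where "J0 \<alpha> \<beta> \<equiv> Jop \<alpha> \<beta> B0 C0"

lemma J0_eq: "J0 \<alpha> \<beta> Y = (1/2) *\<^sub>R (B0 ** Y ** R0 - R0 ** Y ** B0)
    + \<alpha> *\<^sub>R (B0 ** Y ** Q0 - Q0 ** Y ** B0) + \<beta> *\<^sub>R (C0 ** Y ** R0 - R0 ** Y ** C0)"
  by (simp add: Jop_def base_mult matrix_algebra)

lemma Jop_conj:
  assumes "g \<in> SOn"
  shows "Jop \<alpha> \<beta> (g ** B ** transpose g) (g ** C ** transpose g) (g ** Y ** transpose g) = g ** Jop \<alpha> \<beta> B C Y ** transpose g"
  using assms by (simp add: Jop_def matrix_algebra SO_orthogonal)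

lemma Jop_linear:
  "Jop \<alpha> \<beta> B C (X + Y) = Jop \<alpha> \<beta> B C X + Jop \<alpha> \<beta> B C Y"
  "Jop \<alpha> \<beta> B C (X - Y) = Jop \<alpha> \<beta> B C X - Jop \<alpha> \<beta> B C Y"
  "Jop \<alpha> \<beta> B C (c *\<^sub>R X) = c *\<^sub>R Jop \<alpha> \<beta> B C X"
  by (simp_all add: Jop_def matrix_algebra algebra_simps)

lemma skew_Jop: "skew B \<Longrightarrow> skew C \<Longrightarrow> skew Y \<Longrightarrow> skew (Jop \<alpha> \<beta> B C Y)"
  by (simp add: skew_def Jop_def transpose_linear matrix_transpose_mul_real matrix_algebra algebra_simps)

text \<open>Generators of the stabilizer are annihilated, so that \<open>Jop\<close> descends from
  skew matrices to tangent vectors.\<close>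

lemma J0_kernel:
  assumes "Y ** B0 = B0 ** Y" "Y ** C0 = C0 ** Y"
  shows "J0 \<alpha> \<beta> Y = 0"
proof -
  have "B0 ** Y ** X = Y ** (B0 ** X)" "C0 ** Y ** X = Y ** (C0 ** X)" for X :: mat6
    using assms by (simp_all add: matrix_mul_assoc)
  moreover have "R0 ** Y ** B0 = Y ** B0" "Q0 ** Y ** B0 = 0" "R0 ** Y ** C0 = 0"
    using assms by (simp_all add: base_mult base_mult_assoc matrix_algebra)
  ultimately show ?thesis by (simp add: J0_eq base_mult matrix_algebra)
qed

lemma Q0_skew_Q0:
  assumes "skew Y"
  shows "Q0 ** Y ** Q0 = Y $ Inr (Inl 1) $ Inl (Inl 1) *\<^sub>R C0"
proof -
  have "Y $ i $ i = 0" for i using skew_nth[OF assms, of i i] by simp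
  then show ?thesis
    using skew_nth[OF assms, of "Inl (Inl 1)" "Inr (Inl 1)"]
    by (intro mat6_eqI) (auto simp: base_proj_nth C0_nth)
qed

text \<open>The hypotheses say exactly that the two signs \<alpha> + \<beta> and \<alpha> - \<beta>
  square to 1. For skew \<open>Y\<close> the terms other than -Y lie in the stabilizer algebra, so
  on tangent vectors the square is -1.\<close>

lemma J0_square:
  assumes "\<alpha> * \<beta> = 0" "\<alpha> * \<alpha> + \<beta> * \<beta> = 1"
  shows "J0 \<alpha> \<beta> (J0 \<alpha> \<beta> Y) = Q0 ** Y ** Q0 + (1/2) *\<^sub>R (R0 ** Y ** R0 - B0 ** Y ** B0) - Y"
proof -
  have "Y = (Q0 + R0) ** Y ** (Q0 + R0)" by (simp add: Q0_R0)
  then have Y: "Y = Q0 ** Y ** Q0 + Q0 ** Y ** R0 + R0 ** Y ** Q0 + R0 ** Y ** R0"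
    by (simp add: matrix_algebra algebra_simps)
  have "J0 \<alpha> \<beta> (J0 \<alpha> \<beta> Y) = (- 1/2) *\<^sub>R (R0 ** Y ** R0 + B0 ** Y ** B0)
     - (\<alpha> * \<alpha> + \<beta> * \<beta>) *\<^sub>R (Q0 ** Y ** R0 + R0 ** Y ** Q0) - (2 * (\<alpha> * \<beta>)) *\<^sub>R (B0 ** Y ** C0 + C0 ** Y ** B0)"
    unfolding J0_eq
    by (simp add: matrix_algebra base_mult base_mult_assoc) (simp add: vec_eq_iff algebra_simps)
  also have "\<dots> = Q0 ** Y ** Q0 + (1/2) *\<^sub>R (R0 ** Y ** R0 - B0 ** Y ** B0)
      - (Q0 ** Y ** Q0 + Q0 ** Y ** R0 + R0 ** Y ** Q0 + R0 ** Y ** R0)"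
    unfolding assms by (simp add: vec_eq_iff) (simp add: field_simps)
  finally show ?thesis using Y by simp
qed

lemma J0_square_commutes:
  assumes "\<alpha> * \<beta> = 0" "\<alpha> * \<alpha> + \<beta> * \<beta> = 1" "skew Y"
  shows "(J0 \<alpha> \<beta> (J0 \<alpha> \<beta> Y) + Y) ** B0 = B0 ** (J0 \<alpha> \<beta> (J0 \<alpha> \<beta> Y) + Y)"
    "(J0 \<alpha> \<beta> (J0 \<alpha> \<beta> Y) + Y) ** C0 = C0 ** (J0 \<alpha> \<beta> (J0 \<alpha> \<beta> Y) + Y)"
  unfolding J0_square[OF assms(1,2)] Q0_skew_Q0[OF assms(3)]
  by (simp_all add: matrix_algebra base_mult base_mult_assoc algebra_simps)

lemma emb_translate:
  assumes "a \<in> SOn" "p \<in> cosets U1xU2"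
  shows "embB (coset p a) = a ** embB p ** transpose a" "embC (coset p a) = a ** embC p ** transpose a"
  using assms by (auto simp: cosets_iff coset_assoc emb_coset SO_closed matrix_transpose_mul_real matrix_algebra)

lemma skew_emb: "p \<in> cosets U1xU2 \<Longrightarrow> skew (embB p)" "p \<in> cosets U1xU2 \<Longrightarrow> skew (embC p)"
  by (simp_all add: skew_def emb_relations)

lemma fund_eqI:
  assumes X: "skew X" and Y: "skew Y" and p: "p \<in> cosets U1xU2"
    and comm: "(X - Y) ** embB p = embB p ** (X - Y)" "(X - Y) ** embC p = embC p ** (X - Y)"
  shows "fund U1xU2 X p = fund U1xU2 Y p"
proof (rule tangent_eqI[OF p fund_tangent[OF X p] fund_tangent[OF Y p]])
  show "deriv_mat (fund U1xU2 X p) embB = deriv_mat (fund U1xU2 Y p) embB"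
    "deriv_mat (fund U1xU2 X p) embC = deriv_mat (fund U1xU2 Y p) embC"
    using comm by (simp_all add: deriv_mat_fund[OF X p] deriv_mat_fund[OF Y p] matrix_algebra algebra_simps)
qed

lemma fund_eqD:
  assumes X: "skew X" and Y: "skew Y" and p: "p \<in> cosets U1xU2" and eq: "fund U1xU2 X p = fund U1xU2 Y p"
  shows "(X - Y) ** embB p = embB p ** (X - Y)" "(X - Y) ** embC p = embC p ** (X - Y)"
proof -
  have "X ** embB p - embB p ** X = Y ** embB p - embB p ** Y" "X ** embC p - embC p ** X = Y ** embC p - embC p ** Y"
    using deriv_mat_fund[OF X p] deriv_mat_fund[OF Y p] eq by simp_all
  then show "(X - Y) ** embB p = embB p ** (X - Y)" "(X - Y) ** embC p = embC p ** (X - Y)"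
    by (simp_all add: matrix_algebra algebra_simps)
qed

text \<open>One generator among many for a given vector. Being polynomial in the embedding and the
  derivatives of its entries, it inherits their smoothness along vector fields and their continuity
  along families.\<close>

definition velocity :: "mat6 set \<Rightarrow> mat6 set tvec \<Rightarrow> mat6" where
  "velocity p v = kato (embB p) (embC p) (deriv_mat v embB) (deriv_mat v embC)"

definition J_acs :: "real \<Rightarrow> real \<Rightarrow> mat6 set \<Rightarrow> mat6 set tvec \<Rightarrow> mat6 set tvec" where
  "J_acs \<alpha> \<beta> p v = fund U1xU2 (Jop \<alpha> \<beta> (embB p) (embC p) (velocity p v)) p"

lemma velocity:
  assumes "p \<in> cosets U1xU2" "v \<in> tangents U1xU2 p"
  shows "skew (velocity p v)" "fund U1xU2 (velocity p v) p = v"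
  using tangent_eq_fund[OF assms] by (simp_all add: velocity_def)

lemma Jop_kernel:
  assumes p: "p \<in> cosets U1xU2"
    and comm: "Y ** embB p = embB p ** Y" "Y ** embC p = embC p ** Y"
  shows "Jop \<alpha> \<beta> (embB p) (embC p) Y = 0"
proof -
  obtain g where g: "g \<in> SOn" "p = coset U1xU2 g" using p by (auto simp: cosets_iff)
  let ?Y = "transpose g ** Y ** g"
  have Y: "Y = g ** ?Y ** transpose g" using g by (simp add: matrix_algebra SO_orthogonal)
  have "transpose g ** (Y ** (g ** A ** transpose g)) ** g = transpose g ** ((g ** A ** transpose g) ** Y) ** g
      \<Longrightarrow> ?Y ** A = A ** ?Y" for A
    using g by (simp add: matrix_algebra SO_orthogonal)
  then have "J0 \<alpha> \<beta> ?Y = 0"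
    using comm unfolding g(2) emb_coset[OF g(1)] by (intro J0_kernel) auto
  then show ?thesis
    unfolding g(2) emb_coset[OF g(1)] using Jop_conj[OF g(1), of \<alpha> \<beta> B0 C0 ?Y] Y by (simp add: matrix_algebra)
qed

text \<open>Two generators of the same vector differ by a matrix commuting with the pair at
  \<open>p\<close>, which \<open>Jop\<close> annihilates. Hence any generator may replace the one
  chosen by \<open>velocity\<close>.\<close>

lemma J_fund:
  assumes Y: "skew Y" and p: "p \<in> cosets U1xU2"
  shows "J_acs \<alpha> \<beta> p (fund U1xU2 Y p) = fund U1xU2 (Jop \<alpha> \<beta> (embB p) (embC p) Y) p"
proof -
  let ?X = "velocity p (fund U1xU2 Y p)"
  note X = velocity[OF p fund_tangent[OF Y p]]
  have "Jop \<alpha> \<beta> (embB p) (embC p) (?X - Y) = 0"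
    by (rule Jop_kernel[OF p fund_eqD[OF X(1) Y p X(2)]])
  then show ?thesis by (simp add: J_acs_def Jop_linear)
qed

lemma J_fund_coset:
  assumes Y: "skew Y" and g: "g \<in> SOn"
  shows "J_acs \<alpha> \<beta> (coset U1xU2 g) (fund U1xU2 (g ** Y ** transpose g) (coset U1xU2 g)) =
    fund U1xU2 (g ** J0 \<alpha> \<beta> Y ** transpose g) (coset U1xU2 g)"
  unfolding J_fund[OF skew_conj[OF Y] coset_mem[OF g]] emb_coset[OF g] Jop_conj[OF g] ..

lemma tangent_eq_fund_coset:
  assumes g: "g \<in> SOn" and v: "v \<in> tangents U1xU2 (coset U1xU2 g)"
  obtains Y where "skew Y" "v = fund U1xU2 (g ** Y ** transpose g) (coset U1xU2 g)"
proof
  let ?X = "velocity (coset U1xU2 g) v"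
  note X = velocity[OF coset_mem[OF g] v]
  show "skew (transpose g ** ?X ** g)" using skew_conj[OF X(1), of "transpose g"] by simp
  have "g ** (transpose g ** ?X ** g) ** transpose g = ?X"
    using g by (simp add: matrix_algebra SO_orthogonal)
  then show "v = fund U1xU2 (g ** (transpose g ** ?X ** g) ** transpose g) (coset U1xU2 g)"
    using X(2) by simp
qed

lemma fund_conj_eqI:
  assumes X: "skew X" "skew Y" and g: "g \<in> SOn"
    and comm: "(X - Y) ** B0 = B0 ** (X - Y)" "(X - Y) ** C0 = C0 ** (X - Y)"
  shows "fund U1xU2 (g ** X ** transpose g) (coset U1xU2 g) = fund U1xU2 (g ** Y ** transpose g) (coset U1xU2 g)"
proof (rule fund_eqI[OF skew_conj[OF X(1)] skew_conj[OF X(2)] coset_mem[OF g]])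
  have "(g ** X ** transpose g - g ** Y ** transpose g) ** (g ** A ** transpose g) =
      (g ** A ** transpose g) ** (g ** X ** transpose g - g ** Y ** transpose g)"
    if "(X - Y) ** A = A ** (X - Y)" for A
  proof -
    have "(g ** X ** transpose g - g ** Y ** transpose g) ** (g ** A ** transpose g) = g ** ((X - Y) ** A) ** transpose g"
      using g by (simp add: matrix_algebra SO_orthogonal)
    also have "\<dots> = (g ** A ** transpose g) ** (g ** X ** transpose g - g ** Y ** transpose g)"
      unfolding that using g by (simp add: matrix_algebra SO_orthogonal)
    finally show ?thesis .
  qed
  from this[OF comm(1)] this[OF comm(2)]
  show "(g ** X ** transpose g - g ** Y ** transpose g) ** embB (coset U1xU2 g) =
      embB (coset U1xU2 g) ** (g ** X ** transpose g - g ** Y ** transpose g)"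
    "(g ** X ** transpose g - g ** Y ** transpose g) ** embC (coset U1xU2 g) =
      embC (coset U1xU2 g) ** (g ** X ** transpose g - g ** Y ** transpose g)"
    by (simp_all only: emb_coset[OF g])
qed

lemma skew_Jop_emb: "p \<in> cosets U1xU2 \<Longrightarrow> skew Y \<Longrightarrow> skew (Jop \<alpha> \<beta> (embB p) (embC p) Y)"
  by (intro skew_Jop skew_emb)

lemma skew_J0: "skew Y \<Longrightarrow> skew (J0 \<alpha> \<beta> Y)"
  by (intro skew_Jop skew_base)

lemma J_acs_smooth:
  assumes X: "smooth_vector_field (cosets U1xU2) (smooth_on_cosets U1xU2) X"
  shows "smooth_vector_field (cosets U1xU2) (smooth_on_cosets U1xU2) (\<lambda>p. J_acs \<alpha> \<beta> p (X p))"
proof -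
  have Xt: "X p \<in> tangents U1xU2 p" if "p \<in> cosets U1xU2" for p
    using X that by (simp add: smooth_vector_field_def)
  let ?Y = "\<lambda>p. Jop \<alpha> \<beta> (embB p) (embC p) (velocity p (X p))"
  have skewY: "skew (?Y p)" if "p \<in> cosets U1xU2" for p
    by (rule skew_Jop_emb[OF that velocity(1)[OF that Xt[OF that]]])
  have der: "smooth_mat U1xU2 (\<lambda>p. deriv_mat (X p) A)" if "smooth_mat U1xU2 A" for A :: "mat6 set \<Rightarrow> mat6"
    using X that by (simp add: smooth_mat_def deriv_mat_def smooth_vector_field_def)
  have smY: "smooth_mat U1xU2 ?Y"
    unfolding Jop_def velocity_def kato_def
    by (intro smooth_mat_add smooth_mat_diff smooth_mat_scaleR smooth_mat_mul smooth_mat_emb der)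
  show ?thesis
    unfolding smooth_vector_field_def
  proof (intro conjI ballI)
    fix p assume p: "p \<in> cosets U1xU2"
    show "J_acs \<alpha> \<beta> p (X p) \<in> tangents U1xU2 p"
      unfolding J_acs_def by (rule fund_tangent[OF skewY[OF p] p])
  next
    fix f assume f: "f \<in> smooth_on_cosets U1xU2"
    let ?w = "\<lambda>i j. wedge (axis i 1) (axis j 1) :: mat6"
    \<comment> \<open>The fundamental fields of the coordinate wedges are global smooth fields that
      span every tangent space; smoothness of the image field is thus smoothness of the entries of
      \<open>?Y\<close>.\<close>
    have eq: "J_acs \<alpha> \<beta> p (X p) f = (\<Sum>i\<in>UNIV. \<Sum>j\<in>UNIV. (1 / 2) * ?Y p $ i $ j * fund U1xU2 (?w i j) p f)"
      if p: "p \<in> cosets U1xU2" for p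
    proof -
      have "J_acs \<alpha> \<beta> p (X p) f = fund U1xU2 (\<Sum>i\<in>UNIV. \<Sum>j\<in>UNIV. (?Y p $ i $ j / 2) *\<^sub>R ?w i j) p f"
        unfolding J_acs_def by (simp flip: skew_eq_sum_wedge[OF skewY[OF p]])
      also have "\<dots> = (\<Sum>i\<in>UNIV. \<Sum>j\<in>UNIV. fund U1xU2 ((?Y p $ i $ j / 2) *\<^sub>R ?w i j) p f)"
        by (subst fund_sum[OF p], intro skew_sum skew_scaleR skew_wedge, intro sum.cong refl fund_sum[OF p] skew_scaleR skew_wedge)
      finally show ?thesis by (simp add: fund_scaleR[OF skew_wedge p])
    qed
    have sm: "(\<lambda>p. \<Sum>i\<in>UNIV. \<Sum>j\<in>UNIV. (1 / 2) * ?Y p $ i $ j * fund U1xU2 (?w i j) p f) \<in> smooth_on_cosets U1xU2"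
      using smY unfolding smooth_mat_def
      by (intro smooth_on_cosets_sum smooth_on_cosets_mult smooth_on_cosets_const fund_smooth skew_wedge f) blast
    show "(\<lambda>p. J_acs \<alpha> \<beta> p (X p) f) \<in> smooth_on_cosets U1xU2"
      by (rule smooth_on_cosets_cong[THEN iffD2, OF _ sm]) (rule eq)
  qed
qed

lemma J_acs_almost_complex:
  assumes ab: "\<alpha> * \<beta> = 0" "\<alpha> * \<alpha> + \<beta> * \<beta> = 1"
  shows "almost_complex_structure (cosets U1xU2) (smooth_on_cosets U1xU2) (J_acs \<alpha> \<beta>)"
  unfolding almost_complex_structure_def
proof (intro conjI ballI allI impI)
  fix p v assume p: "p \<in> cosets U1xU2" and v: "v \<in> tangents U1xU2 p"
  obtain g where g: "g \<in> SOn" "p = coset U1xU2 g" using p by (auto simp: cosets_iff)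
  note V = velocity[OF p v]
  show "J_acs \<alpha> \<beta> p v \<in> tangents U1xU2 p"
    unfolding J_acs_def by (intro fund_tangent skew_Jop_emb p V)
  show "J_acs \<alpha> \<beta> p (\<lambda>f. c * v f) = (\<lambda>f. c * J_acs \<alpha> \<beta> p v f)" for c
  proof -
    have "(\<lambda>f. c * v f) = fund U1xU2 (c *\<^sub>R velocity p v) p"
      by (rule ext) (simp add: fund_scaleR[OF V(1) p] V(2))
    then have "J_acs \<alpha> \<beta> p (\<lambda>f. c * v f) = fund U1xU2 (c *\<^sub>R Jop \<alpha> \<beta> (embB p) (embC p) (velocity p v)) p"
      by (simp only: J_fund[OF skew_scaleR[OF V(1)] p] Jop_linear)
    then show ?thesis
      by (simp add: fun_eq_iff fund_scaleR[OF skew_Jop_emb[OF p V(1)] p]) (simp add: J_acs_def)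
  qed
  show "J_acs \<alpha> \<beta> p (J_acs \<alpha> \<beta> p v) = (\<lambda>f. - v f)"
  proof -
    obtain Y where Y: "skew Y" "v = fund U1xU2 (g ** Y ** transpose g) (coset U1xU2 g)"
      using tangent_eq_fund_coset[OF g(1)] v g(2) by blast
    have "J_acs \<alpha> \<beta> p (J_acs \<alpha> \<beta> p v) = fund U1xU2 (g ** J0 \<alpha> \<beta> (J0 \<alpha> \<beta> Y) ** transpose g) p"
      unfolding g(2) Y(2) J_fund_coset[OF Y(1) g(1)] J_fund_coset[OF skew_J0[OF Y(1)] g(1)] ..
    also have "\<dots> = fund U1xU2 (g ** (- Y) ** transpose g) p"
      unfolding g(2) using J0_square_commutes[OF ab Y(1)]
      by (intro fund_conj_eqI skew_J0 skew_minus Y g) simp_all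
    also have "g ** (- Y) ** transpose g = - (g ** Y ** transpose g)" by (simp add: matrix_algebra)
    also have "fund U1xU2 \<dots> p = (\<lambda>f. - v f)"
      unfolding Y(2) g(2) using fund_minus[OF skew_conj[OF Y(1)] coset_mem[OF g(1)]] by blast
    finally show ?thesis .
  qed
  fix w assume w: "w \<in> tangents U1xU2 p"
  note W = velocity[OF p w]
  have "(\<lambda>f. v f + w f) = fund U1xU2 (velocity p v + velocity p w) p"
    by (rule ext) (simp add: fund_add[OF V(1) W(1) p] V(2) W(2))
  then have "J_acs \<alpha> \<beta> p (\<lambda>f. v f + w f) = fund U1xU2 (Jop \<alpha> \<beta> (embB p) (embC p) (velocity p v)
      + Jop \<alpha> \<beta> (embB p) (embC p) (velocity p w)) p"
    by (simp only: J_fund[OF skew_add[OF V(1) W(1)] p] Jop_linear)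
  then show "J_acs \<alpha> \<beta> p (\<lambda>f. v f + w f) = (\<lambda>f. J_acs \<alpha> \<beta> p v f + J_acs \<alpha> \<beta> p w f)"
    by (simp add: fun_eq_iff fund_add[OF skew_Jop_emb[OF p V(1)] skew_Jop_emb[OF p W(1)] p])
      (simp add: J_acs_def)
qed (rule J_acs_smooth)

lemma differential_translate:
  assumes "skew Y" "p \<in> cosets K" "a \<in> SOn"
  shows "differential (smooth_on_cosets K) (\<lambda>p. coset p a) (fund K Y p) = fund K (a ** Y ** transpose a) (coset p a)"
proof
  fix f
  show "differential (smooth_on_cosets K) (\<lambda>p. coset p a) (fund K Y p) f = fund K (a ** Y ** transpose a) (coset p a) f"
    using fund_translate[OF assms] by (cases "f \<in> smooth_on_cosets K") (auto simp: differential_def fund_def)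
qed

lemma J_acs_invariant:
  assumes ab: "\<alpha> * \<beta> = 0" "\<alpha> * \<alpha> + \<beta> * \<beta> = 1"
  shows "J_acs \<alpha> \<beta> \<in> invariant_acs SO6 U1xU2"
  unfolding invariant_acs_def SO6_def
proof (intro CollectI conjI ballI J_acs_almost_complex[OF ab])
  fix a :: mat6 assume a: "a \<in> SOn"
  show "preserved_by (cosets U1xU2) (smooth_on_cosets U1xU2) (\<lambda>C. coset C a) (J_acs \<alpha> \<beta>) (J_acs \<alpha> \<beta>)"
    unfolding preserved_by_def
  proof (intro ballI)
    fix p v assume p: "p \<in> cosets U1xU2" and v: "v \<in> tangents U1xU2 p"
    note V = velocity[OF p v]
    have 1: "differential (smooth_on_cosets U1xU2) (\<lambda>C. coset C a) v =
        fund U1xU2 (a ** velocity p v ** transpose a) (coset p a)"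
      by (subst V(2)[symmetric]) (rule differential_translate[OF V(1) p a])
    show "differential (smooth_on_cosets U1xU2) (\<lambda>C. coset C a) (J_acs \<alpha> \<beta> p v) =
        J_acs \<alpha> \<beta> (coset p a) (differential (smooth_on_cosets U1xU2) (\<lambda>C. coset C a) v)"
      unfolding 1 J_fund[OF skew_conj[OF V(1)] translate_mem[OF a p]] emb_translate[OF a p] Jop_conj[OF a]
      unfolding J_acs_def by (rule differential_translate[OF skew_Jop_emb[OF p V(1)] p a])
  qed
qed

subsection \<open>Invariants of almost complex structures\<close>

lemma differential_tangent:
  assumes \<phi>: "diffeomorphism_of (cosets K) (smooth_on_cosets K) \<phi>" and v: "v \<in> tangents K p"
  shows "differential (smooth_on_cosets K) \<phi> v \<in> tangents K (\<phi> p)"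
proof -
  have F: "(\<lambda>q. f (\<phi> q)) \<in> smooth_on_cosets K" if "f \<in> smooth_on_cosets K" for f
    using \<phi> that by (auto simp: diffeomorphism_of_def o_def)
  show ?thesis
    unfolding tangent_space_def differential_def
    using tangent_add[OF v F F] tangent_scale[OF v F] tangent_mult[OF v F F]
    by (auto simp: o_def smooth_on_cosets_add smooth_on_cosets_mult smooth_on_cosets_const)
qed

lemma differential_inverse:
  assumes p: "p \<in> cosets K" and v: "v \<in> tangents K p"
    and \<psi>: "\<And>f. f \<in> smooth_on_cosets K \<Longrightarrow> f \<circ> \<psi> \<in> smooth_on_cosets K"
    and id: "\<And>q. q \<in> cosets K \<Longrightarrow> \<psi> (\<phi> q) = q"
  shows "differential (smooth_on_cosets K) \<psi> (differential (smooth_on_cosets K) \<phi> v) = v"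
proof
  fix f
  show "differential (smooth_on_cosets K) \<psi> (differential (smooth_on_cosets K) \<phi> v) f = v f"
  proof (cases "f \<in> smooth_on_cosets K")
    case True
    have "v f = v (f \<circ> \<psi> \<circ> \<phi>)"
      by (rule tangent_cong[OF v p True]) (simp add: id)
    then show ?thesis using True \<psi>[OF True] by (simp add: differential_def)
  qed (simp add: differential_def tangent_outside[OF v])
qed

lemma equivalent_acs_sym:
  assumes J1: "almost_complex_structure (cosets K) (smooth_on_cosets K) J\<^sub>1"
    and eq: "equivalent_acs (cosets K) (smooth_on_cosets K) J\<^sub>1 J\<^sub>2"
  shows "equivalent_acs (cosets K) (smooth_on_cosets K) J\<^sub>2 J\<^sub>1"
proof -
  let ?M = "cosets K" and ?F = "smooth_on_cosets K"
  obtain \<phi> where \<phi>: "diffeomorphism_of ?M ?F \<phi>" and pres: "preserved_by ?M ?F \<phi> J\<^sub>1 J\<^sub>2"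
    using eq by (auto simp: equivalent_acs_def)
  define \<psi> where "\<psi> = inv_into ?M \<phi>"
  have bij: "bij_betw \<phi> ?M ?M" using \<phi> by (simp add: diffeomorphism_of_def)
  have \<psi>M: "\<psi> q \<in> ?M" and \<psi>\<phi>: "\<psi> (\<phi> q) = q" and \<phi>\<psi>: "\<phi> (\<psi> q) = q" and \<phi>M: "\<phi> q \<in> ?M" if "q \<in> ?M" for q
    using bij that unfolding \<psi>_def
    by (auto simp: bij_betw_inv_into_left bij_betw_inv_into_right bij_betwE bij_betw_inv_into[THEN bij_betwE, rule_format])
  have F\<phi>: "f \<circ> \<phi> \<in> ?F" and F\<psi>: "f \<circ> \<psi> \<in> ?F" if "f \<in> ?F" for f
    using \<phi> that by (simp_all add: diffeomorphism_of_def \<psi>_def)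
  have "f \<circ> inv_into ?M \<psi> \<in> ?F" if "f \<in> ?F" for f
  proof -
    have "(f \<circ> inv_into ?M \<psi>) q = (f \<circ> \<phi>) q" if "q \<in> ?M" for q
      using inv_into_inv_into_eq[OF bij that] by (simp add: \<psi>_def)
    then show ?thesis using smooth_on_cosets_cong[of K "f \<circ> inv_into ?M \<psi>" "f \<circ> \<phi>"] F\<phi>[OF that] by blast
  qed
  then have \<psi>: "diffeomorphism_of ?M ?F \<psi>"
    using F\<psi> bij_betw_inv_into[OF bij] by (simp add: diffeomorphism_of_def \<psi>_def)
  have "preserved_by ?M ?F \<psi> J\<^sub>2 J\<^sub>1"
    unfolding preserved_by_def
  proof (intro ballI)
    fix p v assume p: "p \<in> ?M" and v: "v \<in> tangents K p"
    let ?w = "differential ?F \<psi> v"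
    have w: "?w \<in> tangents K (\<psi> p)" by (rule differential_tangent[OF \<psi> v])
    have Jw: "J\<^sub>1 (\<psi> p) ?w \<in> tangents K (\<psi> p)"
      using J1 \<psi>M[OF p] w by (simp add: almost_complex_structure_def)
    have "differential ?F \<phi> ?w = v" by (rule differential_inverse[OF p v F\<phi> \<phi>\<psi>])
    then have "differential ?F \<phi> (J\<^sub>1 (\<psi> p) ?w) = J\<^sub>2 p v"
      using pres \<psi>M[OF p] w \<phi>\<psi>[OF p] by (simp add: preserved_by_def)
    then have "differential ?F \<psi> (J\<^sub>2 p v) = differential ?F \<psi> (differential ?F \<phi> (J\<^sub>1 (\<psi> p) ?w))" by simp
    also have "\<dots> = J\<^sub>1 (\<psi> p) ?w" by (rule differential_inverse[OF \<psi>M[OF p] Jw F\<psi> \<psi>\<phi>])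
    finally show "differential ?F \<psi> (J\<^sub>2 p v) = J\<^sub>1 (\<psi> p) ?w" .
  qed
  then show ?thesis using \<psi> by (auto simp: equivalent_acs_def)
qed

text \<open>The generated equivalence also uses its steps backwards. Conjugation is an involution
  and equivalence is symmetric, so one implication per kind of step is enough.\<close>

lemma acs_relation_invariant:
  assumes conj: "\<And>J. J \<in> invariant_acs SO K \<Longrightarrow> P J \<Longrightarrow> P (conjugate_acs J)"
    and equiv: "\<And>J\<^sub>1 J\<^sub>2. J\<^sub>1 \<in> invariant_acs SO K \<Longrightarrow> J\<^sub>2 \<in> invariant_acs SO K \<Longrightarrow>
        equivalent_acs (cosets K) (smooth_on_cosets K) J\<^sub>1 J\<^sub>2 \<Longrightarrow> P J\<^sub>1 \<Longrightarrow> P J\<^sub>2"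
    and rel: "(J, J') \<in> acs_relation SO K"
  shows "P J \<longleftrightarrow> P J'"
proof -
  let ?R = "\<lambda>J\<^sub>1 J\<^sub>2. J\<^sub>1 \<in> invariant_acs SO K \<and> J\<^sub>2 \<in> invariant_acs SO K \<and>
        (J\<^sub>2 = conjugate_acs J\<^sub>1 \<or> equivalent_acs (cosets K) (smooth_on_cosets K) J\<^sub>1 J\<^sub>2)"
  have step: "P J\<^sub>1 \<longleftrightarrow> P J\<^sub>2" if R: "?R J\<^sub>1 J\<^sub>2" for J\<^sub>1 J\<^sub>2
  proof (cases "J\<^sub>2 = conjugate_acs J\<^sub>1")
    case True
    then have "J\<^sub>1 = conjugate_acs J\<^sub>2" by (simp add: conjugate_acs_def)
    then show ?thesis using True R conj by metis
  next
    case False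
    then have e: "equivalent_acs (cosets K) (smooth_on_cosets K) J\<^sub>1 J\<^sub>2" using R by blast
    have "almost_complex_structure (cosets K) (smooth_on_cosets K) J\<^sub>1"
      using R by (simp add: invariant_acs_def)
    from equivalent_acs_sym[OF this e] show ?thesis using e R equiv by blast
  qed
  have "equivclp ?R J J'" using rel by (simp add: acs_relation_def)
  then show ?thesis
    by (induction rule: equivclp_induct) (use step in blast)+
qed

subsection \<open>Quotients of holomorphic sections\<close>

definition cder :: "(real^'n^'n) set tvec \<Rightarrow> ((real^'n^'n) set \<Rightarrow> complex) \<Rightarrow> complex" where
  "cder v f = Complex (v (\<lambda>q. Re (f q))) (v (\<lambda>q. Im (f q)))"

definition csmooth :: "(real^'n^'n) set \<Rightarrow> ((real^'n^'n) set \<Rightarrow> complex) \<Rightarrow> bool" where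
  "csmooth K f \<longleftrightarrow> (\<lambda>q. Re (f q)) \<in> smooth_on_cosets K \<and> (\<lambda>q. Im (f q)) \<in> smooth_on_cosets K"

text \<open>\<open>f / g\<close> is \<open>J\<close>-holomorphic where it is defined, and somewhere not locally constant.  Allowing
  quotients makes it possible to take \<open>f\<close> and \<open>g\<close> smooth on all of the compact manifold.\<close>

definition has_holomorphic_quotient ::
    "(real^'n^'n) set \<Rightarrow> ((real^'n^'n) set \<Rightarrow> (real^'n^'n) set tvec \<Rightarrow> (real^'n^'n) set tvec) \<Rightarrow> bool" where
  "has_holomorphic_quotient K J \<longleftrightarrow> (\<exists>f g. csmooth K f \<and> csmooth K g \<and>
     (\<forall>p\<in>cosets K. \<forall>v\<in>tangents K p.
        g p * (cder v f + \<i> * cder (J p v) f) = f p * (cder v g + \<i> * cder (J p v) g)) \<and>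
     (\<exists>p\<in>cosets K. \<exists>v\<in>tangents K p. g p \<noteq> 0 \<and> g p * cder v f \<noteq> f p * cder v g))"

lemma has_holomorphic_quotient_conjugate:
  assumes J: "J \<in> invariant_acs SO K" and h: "has_holomorphic_quotient K J"
  shows "has_holomorphic_quotient K (conjugate_acs J)"
proof -
  obtain f g where s: "csmooth K f" "csmooth K g"
    and eq: "\<And>p v. p \<in> cosets K \<Longrightarrow> v \<in> tangents K p \<Longrightarrow>
        g p * (cder v f + \<i> * cder (J p v) f) = f p * (cder v g + \<i> * cder (J p v) g)"
    and ne: "\<exists>p\<in>cosets K. \<exists>v\<in>tangents K p. g p \<noteq> 0 \<and> g p * cder v f \<noteq> f p * cder v g"
    using h unfolding has_holomorphic_quotient_def by blast
  have Jt: "J p v \<in> tangents K p" if "p \<in> cosets K" "v \<in> tangents K p" for p v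
    using J that by (simp add: invariant_acs_def almost_complex_structure_def)
  have c: "csmooth K (\<lambda>q. cnj (f q))" "csmooth K (\<lambda>q. cnj (g q))"
    using s by (auto simp: csmooth_def intro: smooth_on_cosets_minus)
  have d: "cder v (\<lambda>q. cnj (h q)) = cnj (cder v h)" if "v \<in> tangents K p" "csmooth K h" for v p h
    using tangent_scale[OF that(1), of "\<lambda>q. Im (h q)" "-1"] that(2) by (simp add: cder_def csmooth_def complex_eq_iff)
  have dc: "cder (conjugate_acs J p v) h = - cder (J p v) h" for p v h
    by (simp add: cder_def conjugate_acs_def complex_eq_iff)
  show ?thesis
    unfolding has_holomorphic_quotient_def
  proof (intro exI conjI ballI)
    fix p v assume p: "p \<in> cosets K" and v: "v \<in> tangents K p"
    have "cnj (g p * (cder v f + \<i> * cder (J p v) f)) = cnj (f p * (cder v g + \<i> * cder (J p v) g))"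
      using eq[OF p v] by simp
    then show "cnj (g p) * (cder v (\<lambda>q. cnj (f q)) + \<i> * cder (conjugate_acs J p v) (\<lambda>q. cnj (f q))) =
        cnj (f p) * (cder v (\<lambda>q. cnj (g q)) + \<i> * cder (conjugate_acs J p v) (\<lambda>q. cnj (g q)))"
      by (simp add: dc d[OF v s(1)] d[OF v s(2)] d[OF Jt[OF p v] s(1)] d[OF Jt[OF p v] s(2)])
  next
    from ne obtain p v where pv: "p \<in> cosets K" "v \<in> tangents K p" "g p \<noteq> 0" "g p * cder v f \<noteq> f p * cder v g"
      by blast
    have "cnj (g p * cder v f) \<noteq> cnj (f p * cder v g)" using pv(4) by (simp only: complex_cnj_cancel_iff not_False_eq_True)
    then show "\<exists>p\<in>cosets K. \<exists>v\<in>tangents K p. cnj (g p) \<noteq> 0 \<and>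
        cnj (g p) * cder v (\<lambda>q. cnj (f q)) \<noteq> cnj (f p) * cder v (\<lambda>q. cnj (g q))"
      using pv(3)
      by (intro bexI[OF _ pv(1)] bexI[OF _ pv(2)])
        (simp only: d[OF pv(2) s(1)] d[OF pv(2) s(2)] complex_cnj_mult complex_cnj_zero_iff, simp)
  qed (use c in auto)
qed

lemma has_holomorphic_quotient_pullback:
  assumes eqv: "equivalent_acs (cosets K) (smooth_on_cosets K) J\<^sub>1 J\<^sub>2"
    and h: "has_holomorphic_quotient K J\<^sub>2"
  shows "has_holomorphic_quotient K J\<^sub>1"
proof -
  let ?M = "cosets K" and ?F = "smooth_on_cosets K"
  obtain \<phi> where \<phi>: "diffeomorphism_of ?M ?F \<phi>" and pres: "preserved_by ?M ?F \<phi> J\<^sub>1 J\<^sub>2"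
    using eqv by (auto simp: equivalent_acs_def)
  have bij: "bij_betw \<phi> ?M ?M" and F\<phi>: "\<And>f. f \<in> ?F \<Longrightarrow> f \<circ> \<phi> \<in> ?F"
    and F\<psi>: "\<And>f. f \<in> ?F \<Longrightarrow> f \<circ> inv_into ?M \<phi> \<in> ?F" using \<phi> by (simp_all add: diffeomorphism_of_def)
  obtain f g where s: "csmooth K f" "csmooth K g"
    and eq: "\<And>p v. p \<in> cosets K \<Longrightarrow> v \<in> tangents K p \<Longrightarrow>
        g p * (cder v f + \<i> * cder (J\<^sub>2 p v) f) = f p * (cder v g + \<i> * cder (J\<^sub>2 p v) g)"
    and ne: "\<exists>p\<in>cosets K. \<exists>v\<in>tangents K p. g p \<noteq> 0 \<and> g p * cder v f \<noteq> f p * cder v g"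
    using h unfolding has_holomorphic_quotient_def by blast
  have d: "cder (differential ?F \<phi> v) h = cder v (\<lambda>q. h (\<phi> q))" if "csmooth K h" for v h
    using that by (simp add: cder_def differential_def csmooth_def o_def)
  show ?thesis
    unfolding has_holomorphic_quotient_def
  proof (intro exI conjI ballI)
    show "csmooth K (\<lambda>q. f (\<phi> q))" "csmooth K (\<lambda>q. g (\<phi> q))"
      using s F\<phi> by (auto simp: csmooth_def o_def)
    fix p v assume p: "p \<in> ?M" and v: "v \<in> tangents K p"
    have \<phi>p: "\<phi> p \<in> ?M" using bij p by (auto dest: bij_betwE)
    have "differential ?F \<phi> (J\<^sub>1 p v) = J\<^sub>2 (\<phi> p) (differential ?F \<phi> v)"
      using pres p v by (simp add: preserved_by_def)
    with eq[OF \<phi>p differential_tangent[OF \<phi> v]]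
    show "g (\<phi> p) * (cder v (\<lambda>q. f (\<phi> q)) + \<i> * cder (J\<^sub>1 p v) (\<lambda>q. f (\<phi> q))) =
        f (\<phi> p) * (cder v (\<lambda>q. g (\<phi> q)) + \<i> * cder (J\<^sub>1 p v) (\<lambda>q. g (\<phi> q)))"
      by (simp only: d[OF s(1), symmetric] d[OF s(2), symmetric])
  next
    from ne obtain p v where pv: "p \<in> ?M" "v \<in> tangents K p" "g p \<noteq> 0" "g p * cder v f \<noteq> f p * cder v g"
      by blast
    let ?\<psi> = "inv_into ?M \<phi>" and ?w = "differential ?F (inv_into ?M \<phi>) v"
    have \<phi>\<psi>: "\<phi> (?\<psi> q) = q" if "q \<in> ?M" for q using bij that by (simp add: bij_betw_inv_into_right)
    have \<psi>p: "?\<psi> p \<in> ?M" using bij_betw_inv_into[OF bij] pv(1) by (auto dest: bij_betwE)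
    have F\<psi>': "(\<lambda>q. f (?\<psi> q)) \<in> ?F" if "f \<in> ?F" for f using F\<psi>[OF that] by (simp add: o_def)
    have w: "?w \<in> tangents K (?\<psi> p)"
      unfolding tangent_space_def differential_def
      using tangent_add[OF pv(2) F\<psi>' F\<psi>'] tangent_scale[OF pv(2) F\<psi>'] tangent_mult[OF pv(2) F\<psi>' F\<psi>']
      by (auto simp: o_def smooth_on_cosets_add smooth_on_cosets_mult smooth_on_cosets_const)
    have "differential ?F \<phi> ?w = v" by (rule differential_inverse[OF pv(1,2) F\<phi> \<phi>\<psi>])
    then have "cder ?w (\<lambda>q. f (\<phi> q)) = cder v f" "cder ?w (\<lambda>q. g (\<phi> q)) = cder v g"
      using d[OF s(1), of ?w] d[OF s(2), of ?w] by simp_all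
    then show "\<exists>p\<in>?M. \<exists>v\<in>tangents K p. g (\<phi> p) \<noteq> 0 \<and>
        g (\<phi> p) * cder v (\<lambda>q. f (\<phi> q)) \<noteq> f (\<phi> p) * cder v (\<lambda>q. g (\<phi> q))"
      using pv \<phi>\<psi>[OF pv(1)] by (intro bexI[OF _ \<psi>p] bexI[OF _ w]) simp
  qed
qed

lemma base_vector:
  "B0 *v xa = 0" "B0 *v xb = yb" "B0 *v xc = yc" "B0 *v ya = 0" "B0 *v yb = - xb" "B0 *v yc = - xc"
  "C0 *v xa = ya" "C0 *v xb = 0" "C0 *v xc = 0" "C0 *v ya = - xa" "C0 *v yb = 0" "C0 *v yc = 0"
  "Q0 *v xa = xa" "Q0 *v xb = 0" "Q0 *v xc = 0" "Q0 *v ya = ya" "Q0 *v yb = 0" "Q0 *v yc = 0"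
  "R0 *v xa = 0" "R0 *v xb = xb" "R0 *v xc = xc" "R0 *v ya = 0" "R0 *v yb = yb" "R0 *v yc = yc"
  by (simp_all add: B0_def C0_def Q0_def R0_def wedge_def matrix_vector_mult_add_rdistrib
      matrix_vector_mult_diff_rdistrib outer_simps inner_axis_axis)

text \<open>The two parts of this lemma are the real and imaginary part of the antiholomorphic
  derivative of Q + \<i> C at the base point. Together they are (Q0 + \<i> C0) A, and Q0 + \<i> C0
  is the product of the column z = xa + \<i> ya with its conjugate transpose; so the left factor z
  is not differentiated.\<close>

lemma J1_dbar:
  assumes "skew Y"
  defines "A \<equiv> (Y ** Q0 - Q0 ** Y) - (J0 0 1 Y ** C0 - C0 ** J0 0 1 Y)"
  shows "A = (- 2) *\<^sub>R (Q0 ** Y ** R0)"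
    "(Y ** C0 - C0 ** Y) + (J0 0 1 Y ** Q0 - Q0 ** J0 0 1 Y) = C0 ** A"
proof -
  have Y: "Y ** X = Q0 ** Y ** X + R0 ** Y ** X" "X ** Y = X ** Y ** Q0 + X ** Y ** R0" for X
  proof -
    show "Y ** X = Q0 ** Y ** X + R0 ** Y ** X"
      by (simp add: Q0_R0 flip: matrix_algebra(1))
    show "X ** Y = X ** Y ** Q0 + X ** Y ** R0"
      by (simp add: Q0_R0 flip: matrix_algebra(2))
  qed
  have c: "Q0 ** Y ** C0 = C0 ** Y ** Q0"
  proof -
    have e: "Q0 ** Y ** C0 = (Q0 ** Y ** Q0) ** C0" "C0 ** Y ** Q0 = C0 ** (Q0 ** Y ** Q0)"
      by (simp_all add: matrix_algebra base_mult base_mult_assoc)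
    show ?thesis unfolding e Q0_skew_Q0[OF assms(1)] by (simp add: matrix_algebra)
  qed
  have double: "- X - X = (- 2) *\<^sub>R X" for X :: mat6
    by (simp add: vec_eq_iff)
  have "A = ((Q0 ** Y ** Q0 + R0 ** Y ** Q0) - (Q0 ** Y ** Q0 + Q0 ** Y ** R0)) - (J0 0 1 Y ** C0 - C0 ** J0 0 1 Y)"
    unfolding A_def Y(1)[symmetric] Y(2)[symmetric] ..
  also have "\<dots> = - (Q0 ** Y ** R0) - Q0 ** Y ** R0"
    unfolding J0_eq by (simp add: matrix_algebra base_mult base_mult_assoc)
  also have "\<dots> = (- 2) *\<^sub>R (Q0 ** Y ** R0)" by (rule double)
  finally show A: "A = (- 2) *\<^sub>R (Q0 ** Y ** R0)" .
  have "(Y ** C0 - C0 ** Y) + (J0 0 1 Y ** Q0 - Q0 ** J0 0 1 Y) =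
      ((Q0 ** Y ** C0 + R0 ** Y ** C0) - (C0 ** Y ** Q0 + C0 ** Y ** R0)) + (J0 0 1 Y ** Q0 - Q0 ** J0 0 1 Y)"
    unfolding Y(1)[symmetric] Y(2)[symmetric] ..
  also have "\<dots> = - (C0 ** Y ** R0) - C0 ** Y ** R0"
    unfolding c J0_eq by (simp add: matrix_algebra base_mult base_mult_assoc)
  also have "\<dots> = C0 ** A"
    unfolding A double by (simp only: matrix_algebra base_mult_assoc)
  finally show "(Y ** C0 - C0 ** Y) + (J0 0 1 Y ** Q0 - Q0 ** J0 0 1 Y) = C0 ** A" .
qed

lemma J1_has_holomorphic_quotient: "has_holomorphic_quotient U1xU2 (J_acs 0 1)"
proof -
  \<comment> \<open>For z = g (xa + \<i> ya), the homogeneous coordinates of the point of the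
    quadric, \<open>H i j\<close> is z_i times the conjugate of z_j. The conjugate factor makes it
    independent of the phase of z, hence a function on the quotient, and cancels in
    \<open>H ?i ?j / H ?j ?j\<close> = z_i / z_j.\<close>
  define H where "H i j q = Complex (- ((embC q ** embC q) $ i $ j)) (embC q $ i $ j)" for i j q
  let ?i = "Inl (Inr 1) :: (1 + 2) + (1 + 2)" and ?j = "Inl (Inl 1) :: (1 + 2) + (1 + 2)"
  have smQ: "smooth_mat U1xU2 (\<lambda>q. embC q ** embC q)" by (intro smooth_mat_mul smooth_mat_emb)
  have sm: "csmooth U1xU2 (H i j)" for i j
    using smQ smooth_mat_emb(2) by (auto simp: csmooth_def H_def smooth_mat_def intro: smooth_on_cosets_minus)
  have cd: "cder (fund U1xU2 (g ** Y ** transpose g) (coset U1xU2 g)) (H i j) =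
      Complex ((g ** (Y ** Q0 - Q0 ** Y) ** transpose g) $ i $ j) ((g ** (Y ** C0 - C0 ** Y) ** transpose g) $ i $ j)"
    if g: "g \<in> SOn" and Y: "skew Y" for g Y i j
  proof -
    let ?v = "fund U1xU2 (g ** Y ** transpose g) (coset U1xU2 g)"
    note sk = skew_conj[OF Y, of g] and gM = coset_mem[OF g, of U1xU2]
    note vt = fund_tangent[OF sk gM]
    have C: "deriv_mat ?v embC = g ** (Y ** C0 - C0 ** Y) ** transpose g"
      unfolding deriv_mat_fund[OF sk gM] emb_coset[OF g] using g by (simp add: matrix_algebra SO_orthogonal)
    have "deriv_mat ?v (\<lambda>q. - (embC q ** embC q)) = - (deriv_mat ?v embC ** embC (coset U1xU2 g) + embC (coset U1xU2 g) ** deriv_mat ?v embC)"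
      by (simp add: deriv_mat_minus[OF vt smQ] deriv_mat_mul[OF vt smooth_mat_emb(2) smooth_mat_emb(2)])
    also have "\<dots> = g ** (Y ** Q0 - Q0 ** Y) ** transpose g"
      unfolding C emb_coset[OF g] using g by (simp add: matrix_algebra SO_orthogonal base_mult base_mult_assoc)
    finally have Q: "deriv_mat ?v (\<lambda>q. - (embC q ** embC q)) = g ** (Y ** Q0 - Q0 ** Y) ** transpose g" .
    have "?v (\<lambda>q. - (embC q ** embC q) $ i $ j) = deriv_mat ?v (\<lambda>q. - (embC q ** embC q)) $ i $ j"
      "?v (\<lambda>q. embC q $ i $ j) = deriv_mat ?v embC $ i $ j" by (simp_all add: deriv_mat_def)
    then show ?thesis unfolding Q C by (simp add: cder_def H_def)
  qed
  have val: "H i j (coset U1xU2 g) =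
      Complex ((g *v xa) $ i) ((g *v ya) $ i) * Complex ((g *v xa) $ j) (- (g *v ya) $ j)"
    if g: "g \<in> SOn" for g i j
  proof -
    have E1: "g ** C0 ** transpose g = outer (g *v ya) (g *v xa) - outer (g *v xa) (g *v ya)"
      by (simp add: C0_def wedge_def matrix_algebra outer_simps)
    have E2: "- ((g ** C0 ** transpose g) ** (g ** C0 ** transpose g)) = outer (g *v xa) (g *v xa) + outer (g *v ya) (g *v ya)"
    proof -
      have "- ((g ** C0 ** transpose g) ** (g ** C0 ** transpose g)) = g ** Q0 ** transpose g"
        using g by (simp add: matrix_algebra SO_orthogonal base_mult base_mult_assoc)
      then show ?thesis by (simp add: Q0_def matrix_algebra outer_simps)
    qed
    have "(g ** C0 ** transpose g) $ i $ j = (g *v ya) $ i * (g *v xa) $ j - (g *v xa) $ i * (g *v ya) $ j"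
      "- ((g ** C0 ** transpose g) ** (g ** C0 ** transpose g)) $ i $ j = (g *v xa) $ i * (g *v xa) $ j + (g *v ya) $ i * (g *v ya) $ j"
      using arg_cong[OF E1, of "\<lambda>M. M $ i $ j"] arg_cong[OF E2, of "\<lambda>M. M $ i $ j"] by (simp_all add: outer_def)
    then show ?thesis by (simp add: H_def emb_coset[OF g] complex_eq_iff)
  qed
  show ?thesis
    unfolding has_holomorphic_quotient_def
  proof (intro exI conjI ballI)
    show "csmooth U1xU2 (H ?i ?j)" "csmooth U1xU2 (H ?j ?j)" by (rule sm)+
    fix p v assume p: "p \<in> cosets U1xU2" and v: "v \<in> tangents U1xU2 p"
    obtain g where g: "g \<in> SOn" "p = coset U1xU2 g" using p by (auto simp: cosets_iff)
    obtain Y where Y: "skew Y" "v = fund U1xU2 (g ** Y ** transpose g) (coset U1xU2 g)"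
      using tangent_eq_fund_coset[OF g(1)] v g(2) by blast
    define a where "a = (- 2) *\<^sub>R (g *v (transpose R0 *v (transpose Y *v xa)))"
    define b where "b = (- 2) *\<^sub>R (g *v (transpose R0 *v (transpose Y *v ya)))"
    \<comment> \<open>The antiholomorphic derivative of \<open>H i j\<close> is z_i times a factor
      depending on j alone. With equal second index, the equation for a quotient is then
      commutativity of multiplication.\<close>
    have dbar: "cder v (H i j) + \<i> * cder (J_acs 0 1 p v) (H i j) =
        Complex ((g *v xa) $ i) ((g *v ya) $ i) * Complex (a $ j) (- b $ j)" for i j
    proof -
      let ?A = "(Y ** Q0 - Q0 ** Y) - (J0 0 1 Y ** C0 - C0 ** J0 0 1 Y)"
      let ?B = "(Y ** C0 - C0 ** Y) + (J0 0 1 Y ** Q0 - Q0 ** J0 0 1 Y)"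
      have "g ** ?A ** transpose g = outer (g *v xa) a + outer (g *v ya) b"
        unfolding J1_dbar(1)[OF Y(1)] unfolding a_def b_def Q0_def
        by (simp add: matrix_algebra outer_simps scaleR_add_right)
      moreover have "g ** ?B ** transpose g = outer (g *v ya) a - outer (g *v xa) b"
      proof -
        have "C0 ** Q0 = outer ya xa - outer xa ya" unfolding base_mult by (simp add: C0_def wedge_def)
        then have "C0 ** (Q0 ** X) = (outer ya xa - outer xa ya) ** X" for X :: mat6
          by (metis matrix_mul_assoc)
        then show ?thesis
          unfolding J1_dbar(2)[OF Y(1)] unfolding J1_dbar(1)[OF Y(1)] unfolding a_def b_def
          by (simp add: matrix_algebra outer_simps scaleR_diff_right vector_matrix_mul_assoc)
      qed
      ultimately have "(g ** ?A ** transpose g) $ i $ j = (g *v xa) $ i * a $ j + (g *v ya) $ i * b $ j"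
        "(g ** ?B ** transpose g) $ i $ j = (g *v ya) $ i * a $ j - (g *v xa) $ i * b $ j"
        by (simp_all add: outer_def)
      moreover have "cder v (H i j) + \<i> * cder (J_acs 0 1 p v) (H i j) =
          Complex ((g ** ?A ** transpose g) $ i $ j) ((g ** ?B ** transpose g) $ i $ j)"
        unfolding Y(2) g(2) J_fund_coset[OF Y(1) g(1)] cd[OF g(1) Y(1)] cd[OF g(1) skew_J0[OF Y(1)]]
        by (simp add: complex_eq_iff matrix_algebra)
      ultimately show ?thesis by (simp add: complex_eq_iff algebra_simps)
    qed
    show "H ?j ?j p * (cder v (H ?i ?j) + \<i> * cder (J_acs 0 1 p v) (H ?i ?j)) =
        H ?i ?j p * (cder v (H ?j ?j) + \<i> * cder (J_acs 0 1 p v) (H ?j ?j))"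
      unfolding dbar unfolding g(2) val[OF g(1)] by (simp only: mult_ac)
  next
    have 1: "mat 1 \<in> (SOn :: mat6 set)" by (rule SO_closed)
    \<comment> \<open>This rotation moves \<open>xa\<close> in the direction \<open>xb\<close>, so
      it changes the coordinate z_i in first order from its value 0.\<close>
    have sk: "skew (wedge xb xa)" by (rule skew_wedge)
    have "cder (fund U1xU2 (mat 1 ** wedge xb xa ** transpose (mat 1)) (coset U1xU2 (mat 1))) (H ?i ?j) \<noteq> 0"
      unfolding cd[OF 1 sk] by (simp add: complex_eq_iff wedge_def matrix_algebra outer_simps base_vector base_transpose)
        (simp add: outer_def axis_def)
    moreover have "H ?j ?j (coset U1xU2 (mat 1)) = 1" "H ?i ?j (coset U1xU2 (mat 1)) = 0"
      unfolding val[OF 1] by (simp_all add: axis_def complex_eq_iff)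
    moreover have "fund U1xU2 (mat 1 ** wedge xb xa ** transpose (mat 1)) (coset U1xU2 (mat 1)) \<in> tangents U1xU2 (coset U1xU2 (mat 1))"
      by (intro fund_tangent skew_conj sk coset_mem 1)
    ultimately show "\<exists>p\<in>cosets U1xU2. \<exists>v\<in>tangents U1xU2 p. H ?j ?j p \<noteq> 0 \<and> H ?j ?j p * cder v (H ?i ?j) \<noteq> H ?i ?j p * cder v (H ?j ?j)"
      by (intro bexI[OF _ coset_mem[OF 1]] bexI) auto
  qed
qed

subsection \<open>The Nijenhuis tensor\<close>

text \<open>The bracket of the left-invariant fields x \<mapsto> x X is given by the matrix
  commutator. Both second-order terms cancel by \<open>frechet_derivative_commute\<close>, and what
  remains comes from differentiating the coefficients x X.\<close>

lemma lie_derivative_commutator: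
  fixes r :: "real^'n^'n \<Rightarrow> real"
  assumes W: "open W" and r: "\<And>k. C_k_on k r W" and x: "x \<in> W"
  defines "u \<equiv> \<lambda>X x. frechet_derivative r (at x) (x ** X)"
  shows "C_k_on k (u X) W"
    "frechet_derivative (u X) (at x) (x ** Y) - frechet_derivative (u Y) (at x) (x ** X) =
      frechet_derivative r (at x) (x ** (Y ** X - X ** Y))"
proof -
  let ?D = "\<lambda>x. frechet_derivative r (at x)"
  have D1: "C_k_on k (\<lambda>x. ?D x b) W" for k b using r[of "Suc k"] by simp
  have lin: "linear (?D y)" if "y \<in> W" for y
    using C_k_on_Suc_has_derivative[OF r that] by (rule has_derivative_linear)
  have exp: "?D y V = (\<Sum>b\<in>Basis. (V \<bullet> b) * ?D y b)" if "y \<in> W" for y V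
  proof -
    have "?D y V = ?D y (\<Sum>b\<in>Basis. (V \<bullet> b) *\<^sub>R b)" by (simp only: euclidean_representation)
    also have "\<dots> = (\<Sum>b\<in>Basis. (V \<bullet> b) * ?D y b)"
      by (simp only: linear_sum[OF lin[OF that]] linear_cmul[OF lin[OF that]] real_scaleR_def)
    finally show ?thesis .
  qed
  have blX: "bounded_linear (\<lambda>x. (x ** X) \<bullet> b)" for X b :: "real^'n^'n"
    by (intro bounded_linear_inner_left_comp bounded_bilinear.bounded_linear_left[OF bounded_bilinear_matrix_mul])
  have u_eq: "u X y = (\<Sum>b\<in>Basis. ((y ** X) \<bullet> b) * ?D y b)" if "y \<in> W" for y X
    unfolding u_def by (rule exp[OF that])
  have "C_k_on k (\<lambda>y. \<Sum>b\<in>Basis. ((y ** X) \<bullet> b) * ?D y b) W"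
    by (intro C_k_on_sum C_k_on_mult C_k_on_bounded_linear blX D1 W)
  then show "C_k_on k (u X) W"
    using C_k_on_cong[OF W, of "u X" "\<lambda>y. \<Sum>b\<in>Basis. ((y ** X) \<bullet> b) * ?D y b" k] u_eq by simp
  have du: "frechet_derivative (u X) (at x) (x ** Y) =
      ?D x (x ** (Y ** X)) + frechet_derivative (\<lambda>y. ?D y (x ** X)) (at x) (x ** Y)" for X Y
  proof -
    let ?D2 = "\<lambda>b. frechet_derivative (\<lambda>y. ?D y b) (at x)"
    have d1: "((\<lambda>y. (y ** X) \<bullet> b) has_derivative (\<lambda>v. (v ** X) \<bullet> b)) (at x)" for b
      by (rule bounded_linear_imp_has_derivative[OF blX])
    have d2: "((\<lambda>y. ?D y b) has_derivative ?D2 b) (at x)" for b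
      by (rule C_k_on_Suc_has_derivative[OF D1 x])
    have "((\<lambda>y. \<Sum>b\<in>Basis. ((y ** X) \<bullet> b) * ?D y b) has_derivative
        (\<lambda>v. \<Sum>b\<in>Basis. ((x ** X) \<bullet> b) * ?D2 b v + ((v ** X) \<bullet> b) * ?D x b)) (at x)"
      by (intro has_derivative_sum has_derivative_mult d1 d2)
    then have "(u X has_derivative
        (\<lambda>v. \<Sum>b\<in>Basis. ((x ** X) \<bullet> b) * ?D2 b v + ((v ** X) \<bullet> b) * ?D x b)) (at x)"
      by (rule has_derivative_transform_within_open[OF _ W x]) (simp add: u_eq)
    then have "frechet_derivative (u X) (at x) =
        (\<lambda>v. \<Sum>b\<in>Basis. ((x ** X) \<bullet> b) * ?D2 b v + ((v ** X) \<bullet> b) * ?D x b)"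
      by (rule frechet_derivative_at[symmetric])
    then have "frechet_derivative (u X) (at x) (x ** Y) =
        (\<Sum>b\<in>Basis. ((x ** X) \<bullet> b) * ?D2 b (x ** Y)) + (\<Sum>b\<in>Basis. ((x ** Y ** X) \<bullet> b) * ?D x b)"
      by (simp add: sum.distrib)
    also have "(\<Sum>b\<in>Basis. ((x ** Y ** X) \<bullet> b) * ?D x b) = ?D x (x ** (Y ** X))"
      by (simp only: exp[OF x, symmetric] matrix_mul_assoc)
    also have "(\<Sum>b\<in>Basis. ((x ** X) \<bullet> b) * ?D2 b (x ** Y)) =
        (\<Sum>b\<in>Basis. ((x ** X) \<bullet> b) * frechet_derivative (\<lambda>y. ?D y (x ** Y)) (at x) b)"
      by (rule sum.cong[OF refl]) (simp only: frechet_derivative_commute[OF W r x, of _ "x ** Y"])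
    also have "\<dots> = frechet_derivative (\<lambda>y. ?D y (x ** Y)) (at x) (x ** X)"
    proof -
      have l: "linear (frechet_derivative (\<lambda>y. ?D y (x ** Y)) (at x))"
        using C_k_on_Suc_has_derivative[OF D1 x] by (rule has_derivative_linear)
      have "frechet_derivative (\<lambda>y. ?D y (x ** Y)) (at x) (x ** X) =
          frechet_derivative (\<lambda>y. ?D y (x ** Y)) (at x) (\<Sum>b\<in>Basis. ((x ** X) \<bullet> b) *\<^sub>R b)"
        by (simp only: euclidean_representation)
      then show ?thesis by (simp only: linear_sum[OF l] linear_cmul[OF l] real_scaleR_def)
    qed
    also have "\<dots> = frechet_derivative (\<lambda>y. ?D y (x ** X)) (at x) (x ** Y)"
      by (rule frechet_derivative_commute[OF W r x])
    finally show ?thesis by simp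
  qed
  show "frechet_derivative (u X) (at x) (x ** Y) - frechet_derivative (u Y) (at x) (x ** X) =
      frechet_derivative r (at x) (x ** (Y ** X - X ** Y))"
    unfolding du[of X Y] du[of Y X] frechet_derivative_commute[OF W r x, of "x ** X" "x ** Y"]
    by (simp add: matrix_algebra linear_diff[OF lin[OF x]])
qed

text \<open>Equations between extensions hold only on the group, inside the open set
  \<open>W\<close> of matrices. They may still be differentiated along left-invariant fields, which
  are tangent to the group.\<close>

lemma tangential_derivative_zero:
  assumes W: "open W" and U: "C_k_on (Suc 0) U W" and zero: "\<And>y. y \<in> SOn \<Longrightarrow> y \<in> W \<Longrightarrow> U y = 0"
    and x: "x \<in> SOn" "x \<in> W" and Y: "skew Y"
  shows "frechet_derivative U (at x) (x ** Y) = 0"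
proof -
  obtain c where c: "\<And>t. c t \<in> SOn" "c 0 = mat 1" "(c has_vector_derivative Y) (at 0)"
    using skew_curve_dir[OF Y] unfolding curve_dir_def by blast
  have dU: "(U has_derivative frechet_derivative U (at x)) (at x)"
    by (rule C_k_on_Suc_has_derivative[OF U x(2)])
  have dc: "((\<lambda>t. x ** c t) has_derivative (\<lambda>s. s *\<^sub>R (x ** Y))) (at 0)"
    using has_derivative_matrix_mul[of "\<lambda>_. x" "\<lambda>_. 0" 0 UNIV c "\<lambda>s. s *\<^sub>R Y"] c(3)
    by (simp add: has_vector_derivative_def matrix_algebra)
  have "((\<lambda>t. U (x ** c t)) has_derivative (\<lambda>s. frechet_derivative U (at x) (s *\<^sub>R (x ** Y)))) (at 0)"
    by (rule has_derivative_compose[where f = "\<lambda>t. x ** c t" and g = U, OF dc]) (simp add: c(2) dU)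
  then have 1: "((\<lambda>t. U (x ** c t)) has_real_derivative frechet_derivative U (at x) (x ** Y)) (at 0)"
    by (simp add: has_field_derivative_def linear_cmul[OF has_derivative_linear[OF dU]] mult_commute_abs)
  have "isCont (\<lambda>t. x ** c t) 0" using dc by (rule has_derivative_continuous)
  then have "((\<lambda>t. x ** c t) \<longlongrightarrow> x ** c 0) (nhds 0)"
    by (simp only: isCont_def tendsto_at_iff_tendsto_nhds[of "\<lambda>t. x ** c t" 0])
  then have "\<forall>\<^sub>F t in nhds 0. x ** c t \<in> W"
    using W x(2) c(2) by (intro topological_tendstoD) auto
  then have ev: "\<forall>\<^sub>F t in nhds 0. U (x ** c t) = 0"
    by eventually_elim (use zero c x in \<open>auto simp: SO_closed\<close>)
  have "((\<lambda>t. 0) has_real_derivative frechet_derivative U (at x) (x ** Y)) (at 0)"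
    using DERIV_cong_ev[OF refl ev refl] 1 by simp
  then show ?thesis using DERIV_unique[OF _ DERIV_const] by blast
qed

text \<open>The differential of a holomorphic r1 + \<i> r2 is of type (1,0). Differentiating the
  Cauchy-Riemann equations along a second field and antisymmetrizing gives four bracket identities,
  whose combination is the vanishing on the Nijenhuis tensor. \<open>J\<close> acts on the
  generators of left-invariant fields on the group.\<close>

lemma nijenhuis_annihilates:
  fixes J :: "real^'n^'n \<Rightarrow> real^'n^'n"
  assumes W: "open W" and r: "\<And>k. C_k_on k r1 W" "\<And>k. C_k_on k r2 W"
    and J: "\<And>X. skew X \<Longrightarrow> skew (J X)"
    and cr: "\<And>y X. y \<in> SOn \<Longrightarrow> y \<in> W \<Longrightarrow> skew X \<Longrightarrow>
        frechet_derivative r1 (at y) (y ** X) = frechet_derivative r2 (at y) (y ** J X)"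
      "\<And>y X. y \<in> SOn \<Longrightarrow> y \<in> W \<Longrightarrow> skew X \<Longrightarrow>
        frechet_derivative r2 (at y) (y ** X) = - frechet_derivative r1 (at y) (y ** J X)"
    and x: "x \<in> SOn" "x \<in> W" and XY: "skew X" "skew Y"
  defines "br \<equiv> \<lambda>X Y. X ** Y - Y ** X"
  shows "frechet_derivative r1 (at x) (x ** (br X Y - br (J X) (J Y) + J (br (J X) Y + br X (J Y)))) = 0"
proof -
  define u where "u r X y = frechet_derivative r (at y) (y ** X)" for r :: "real^'n^'n \<Rightarrow> real" and X y
  define D where "D r X Y = frechet_derivative (u r X) (at x) (x ** Y)" for r X Y
  have us: "C_k_on (Suc 0) (u r X) W" if "\<And>k. C_k_on k r W" for r X
    unfolding u_def by (rule lie_derivative_commutator(1)[OF W that x(2)])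
  have comm: "D r X Y - D r Y X = - u r (br X Y) x" if "\<And>k. C_k_on k r W" for r X Y
  proof -
    have lin: "linear (frechet_derivative r (at x))"
      using C_k_on_Suc_has_derivative[OF that x(2)] by (rule has_derivative_linear)
    have "x ** (Y ** X - X ** Y) = - (x ** br X Y)" by (simp add: br_def matrix_algebra)
    then show ?thesis
      using lie_derivative_commutator(2)[OF W that x(2), of X Y]
      unfolding D_def u_def by (simp add: linear_neg[OF lin])
  qed
  have ud: "(u r X has_derivative frechet_derivative (u r X) (at x)) (at x)" if "\<And>k. C_k_on k r W" for r X
    by (rule C_k_on_Suc_has_derivative[OF us[OF that] x(2)])
  have d1: "D r1 X Y = D r2 (J X) Y" and d2: "D r2 X Y = - D r1 (J X) Y" if X: "skew X" and Y: "skew Y" for X Y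
  proof -
    have "frechet_derivative (\<lambda>y. u r1 X y - u r2 (J X) y) (at x) (x ** Y) = 0"
      by (rule tangential_derivative_zero[OF W C_k_on_diff[OF W us[OF r(1)] us[OF r(2)]] _ x Y])
        (simp add: u_def cr(1)[OF _ _ X])
    moreover have "frechet_derivative (\<lambda>y. u r1 X y - u r2 (J X) y) (at x) =
        (\<lambda>v. frechet_derivative (u r1 X) (at x) v - frechet_derivative (u r2 (J X)) (at x) v)"
      by (rule frechet_derivative_at[symmetric, OF has_derivative_diff[OF ud[OF r(1)] ud[OF r(2)]]])
    ultimately show "D r1 X Y = D r2 (J X) Y" by (simp add: D_def)
    have "frechet_derivative (\<lambda>y. u r2 X y + u r1 (J X) y) (at x) (x ** Y) = 0"
      by (rule tangential_derivative_zero[OF W C_k_on_add[OF W us[OF r(2)] us[OF r(1)]] _ x Y])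
        (simp add: u_def cr(2)[OF _ _ X])
    moreover have "frechet_derivative (\<lambda>y. u r2 X y + u r1 (J X) y) (at x) =
        (\<lambda>v. frechet_derivative (u r2 X) (at x) v + frechet_derivative (u r1 (J X)) (at x) v)"
      by (rule frechet_derivative_at[symmetric, OF has_derivative_add[OF ud[OF r(2)] ud[OF r(1)]]])
    ultimately show "D r2 X Y = - D r1 (J X) Y" by (simp add: D_def)
  qed
  have skew_br: "skew (br X Y)" if "skew X" "skew Y" for X Y
    using that by (simp add: skew_def br_def transpose_linear matrix_transpose_mul_real matrix_algebra)
  note JX = J[OF XY(1)] and JY = J[OF XY(2)]
  let ?Z = "br (J X) Y + br X (J Y)"
  have Z: "skew ?Z" by (intro skew_add skew_br XY JX JY)
  have l1: "linear (frechet_derivative r1 (at x))" and l2: "linear (frechet_derivative r2 (at x))"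
    using C_k_on_Suc_has_derivative[OF r(1) x(2)] C_k_on_Suc_has_derivative[OF r(2) x(2)]
    by (auto dest: has_derivative_linear)
  have "u r1 (br X Y) x - u r1 (br (J X) (J Y)) x = u r2 (br (J X) Y) x + u r2 (br X (J Y)) x"
    using comm[OF r(1), of X Y] comm[OF r(1), of "J X" "J Y"] comm[OF r(2), of "J X" Y] comm[OF r(2), of X "J Y"]
      d1[OF XY] d1[OF XY(2,1)] d2[OF XY(1) JY] d2[OF XY(2) JX] by linarith
  also have "\<dots> = u r2 ?Z x" by (simp add: u_def matrix_algebra linear_add[OF l2])
  also have "\<dots> = - u r1 (J ?Z) x" unfolding u_def by (rule cr(2)[OF x Z])
  finally show ?thesis
    unfolding u_def by (simp add: matrix_algebra linear_add[OF l1] linear_diff[OF l1])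
qed

text \<open>The Nijenhuis tensor of \<open>J_acs (-1) 0\<close>, evaluated on left-invariant lifts
  to the group; this turns it into an algebraic expression in skew matrices.\<close>

definition nij :: "mat6 \<Rightarrow> mat6 \<Rightarrow> mat6" where
  "nij X Y = (X ** Y - Y ** X) - (J0 (-1) 0 X ** J0 (-1) 0 Y - J0 (-1) 0 Y ** J0 (-1) 0 X)
    + J0 (-1) 0 ((J0 (-1) 0 X ** Y - Y ** J0 (-1) 0 X) + (X ** J0 (-1) 0 Y - J0 (-1) 0 Y ** X))"

lemma matrix_vector_mult_uminus:
  fixes A :: "real^'n^'m"
  shows "(- A) *v x = - (A *v x)" "A *v (- x) = - (A *v x)"
  by (simp_all add: vec_eq_iff matrix_vector_mult_def sum_negf)

lemma base_outer:
  "B0 ** outer x y = outer (B0 *v x) y" "C0 ** outer x y = outer (C0 *v x) y"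
  "Q0 ** outer x y = outer (Q0 *v x) y" "R0 ** outer x y = outer (R0 *v x) y"
  "outer x y ** B0 = - outer x (B0 *v y)" "outer x y ** C0 = - outer x (C0 *v y)"
  "outer x y ** Q0 = outer x (Q0 *v y)" "outer x y ** R0 = outer x (R0 *v y)"
  by (simp_all only: outer_simps base_transpose matrix_vector_mult_uminus(1))

lemma J0_wedge:
  assumes "Q0 *v a = a" "R0 *v a = 0" "B0 *v a = 0" "Q0 *v u = 0" "R0 *v u = u" "Q0 *v w = 0" "R0 *v w = w"
  shows "J0 \<alpha> 0 (wedge a u) = \<alpha> *\<^sub>R wedge a (B0 *v u)"
    "J0 \<alpha> 0 (wedge u w) = (1/2) *\<^sub>R (wedge (B0 *v u) w + wedge u (B0 *v w))"
  by (simp_all add: J0_eq wedge_def matrix_algebra base_outer assms outer_simps(11,12) algebra_simps)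

text \<open>Here \<open>a\<close> is a unit vector of \<complex>, while \<open>u\<close> and
  \<open>w\<close> lie in orthogonal complex lines of \<complex>^2, with images \<open>u'\<close>
  and \<open>w'\<close> under \<open>B0\<close>. The first value is of mixed type, the second in the
  summand inside \<complex>^2; with their nonzero coefficients they reach all isotropy
  summands.\<close>

lemma nij_wedge:
  fixes a u w u' w' :: "real^((1 + 2) + (1 + 2))"
  assumes a: "Q0 *v a = a" "R0 *v a = 0" "B0 *v a = 0" "a \<bullet> a = 1"
    and Q: "Q0 *v u = 0" "Q0 *v w = 0" "Q0 *v u' = 0" "Q0 *v w' = 0"
    and R: "R0 *v u = u" "R0 *v w = w" "R0 *v u' = u'" "R0 *v w' = w'"
    and B: "B0 *v u = u'" "B0 *v w = w'" "B0 *v u' = - u" "B0 *v w' = - w"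
    and orth: "u \<bullet> u = 1" "u' \<bullet> u' = 1" "u \<bullet> w = 0" "u \<bullet> w' = 0" "u' \<bullet> w = 0" "u' \<bullet> w' = 0" "u \<bullet> u' = 0"
      "w \<bullet> w' = 0" "a \<bullet> u = 0" "a \<bullet> w = 0" "a \<bullet> u' = 0" "a \<bullet> w' = 0"
  shows "nij (wedge u w - wedge u' w') (wedge a u) = (- 4) *\<^sub>R wedge a w"
    "nij (wedge a u) (wedge a w) = (- 2) *\<^sub>R (wedge u w - wedge u' w')"
proof -
  have o: "w \<bullet> u = 0" "w' \<bullet> u = 0" "w \<bullet> u' = 0" "w' \<bullet> u' = 0" "u' \<bullet> u = 0" "w' \<bullet> w = 0"
    "u \<bullet> a = 0" "w \<bullet> a = 0" "u' \<bullet> a = 0" "w' \<bullet> a = 0"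
    using orth by (simp_all add: inner_commute)
  note comp = wedge_def matrix_algebra outer_mult_outer orth o a(4)
  have m: "wedge x (- y) = - wedge x y" "wedge (- x) y = - wedge x y" for x y :: "real^((1 + 2) + (1 + 2))"
    by (simp_all add: wedge_def outer_simps(9,10))
  note Ja = J0_wedge(1)[OF a(1-3)] and Jr = J0_wedge(2)[OF a(1-3)]
  have J: "J0 (-1) 0 (wedge a u) = - wedge a u'" "J0 (-1) 0 (wedge a w) = - wedge a w'"
    "J0 (-1) 0 (wedge a w') = wedge a w"
    using Ja[of u u "-1"] Ja[of w w "-1"] Ja[of w' w' "-1"] by (simp_all add: Q R B m)
  have JX: "J0 (-1) 0 (wedge u w - wedge u' w') = wedge u' w + wedge u w'"
    using Jr[of u w "-1"] Jr[of u' w' "-1"]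
    by (simp add: Jop_linear Q R B m) (simp add: vec_eq_iff field_simps)
  have JX': "J0 (-1) 0 (wedge u' w + wedge u w') = - (wedge u w - wedge u' w')"
    using Jr[of u' w "-1"] Jr[of u w' "-1"]
    by (simp add: Jop_linear Q R B m) (simp add: vec_eq_iff field_simps)
  let ?X = "wedge u w - wedge u' w'" and ?JX = "wedge u' w + wedge u w'"
  have c1: "?X ** wedge a u - wedge a u ** ?X = - wedge a w"
    by (simp add: comp)
  have c2: "?JX ** (- wedge a u') - (- wedge a u') ** ?JX = wedge a w"
    by (simp add: comp)
  have c3: "(?JX ** wedge a u - wedge a u ** ?JX) + (?X ** (- wedge a u') - (- wedge a u') ** ?X) = (- 2) *\<^sub>R wedge a w'"
    by (simp add: comp) (simp add: vec_eq_iff)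
  show "nij ?X (wedge a u) = (- 4) *\<^sub>R wedge a w"
    unfolding nij_def JX J c1 c2 c3 unfolding Jop_linear J by (simp add: vec_eq_iff)
  have e1: "wedge a u ** wedge a w - wedge a w ** wedge a u = - wedge u w"
    by (simp add: comp)
  have e2: "(- wedge a u') ** (- wedge a w') - (- wedge a w') ** (- wedge a u') = - wedge u' w'"
    by (simp add: comp)
  have e3: "((- wedge a u') ** wedge a w - wedge a w ** (- wedge a u')) + (wedge a u ** (- wedge a w') - (- wedge a w') ** wedge a u)
      = wedge u' w + wedge u w'"
    by (simp add: comp)
  show "nij (wedge a u) (wedge a w) = (- 2) *\<^sub>R ?X"
    unfolding nij_def J e1 e2 e3 JX' by (simp add: vec_eq_iff)
qed

text \<open>Averaging a wedge over \<open>B0\<close> puts it into the stabilizer algebra. Together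
  with the difference that occurs in \<open>nij_wedge\<close> this recovers the wedge
  itself.\<close>

lemma wedge_commutes:
  assumes "R0 *v u = u" "R0 *v w = w" "B0 *v (B0 *v u) = - u" "B0 *v (B0 *v w) = - w" "C0 *v u = 0" "C0 *v w = 0"
    "C0 *v (B0 *v u) = 0" "C0 *v (B0 *v w) = 0"
  shows "(wedge u w + wedge (B0 *v u) (B0 *v w)) ** B0 = B0 ** (wedge u w + wedge (B0 *v u) (B0 *v w))"
    "(wedge u w + wedge (B0 *v u) (B0 *v w)) ** C0 = C0 ** (wedge u w + wedge (B0 *v u) (B0 *v w))"
  by (simp_all add: wedge_def matrix_algebra base_outer assms outer_simps(9-12) algebra_simps)

lemma wedge_swap: "wedge x y = - wedge y x" and wedge_self: "wedge x x = 0"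
  by (simp_all add: wedge_def)

text \<open>Mixed wedges are multiples of values of \<open>nij\<close>. For a wedge inside
  \<complex>^2, the difference with its image under \<open>B0\<close> is such a multiple or zero,
  and the sum lies in the stabilizer algebra.\<close>

lemma nij_spans:
  fixes l :: "mat6 \<Rightarrow> real"
  assumes lin: "linear l" and n: "\<And>X Y. skew X \<Longrightarrow> skew Y \<Longrightarrow> l (nij X Y) = 0"
    and k: "\<And>X. skew X \<Longrightarrow> X ** B0 = B0 ** X \<Longrightarrow> X ** C0 = C0 ** X \<Longrightarrow> l X = 0"
    and Y: "skew Y"
  shows "l Y = 0"
proof -
  have neg: "l (- X) = - l X" and sc: "l (c *\<^sub>R X) = c * l X" for X c
    using linear_neg[OF lin] linear_cmul[OF lin] by auto
  have mixed: "l (wedge a w) = 0" if a: "a \<in> {xa, ya}" and w: "w \<in> {xb, xc, yb, yc}" for a w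
  proof -
    \<comment> \<open>A basis vector from the complex line that does not contain
      \<open>w\<close>.\<close>
    define u where "u = (if w = xb \<or> w = yb then xc else xb)"
    have "nij (wedge u w - wedge (B0 *v u) (B0 *v w)) (wedge a u) = (- 4) *\<^sub>R wedge a w"
      by (rule nij_wedge(1))
        (use a w in \<open>auto simp: u_def base_vector matrix_vector_mult_uminus inner_axis_axis axis_eq_axis\<close>)
    with n[of "wedge u w - wedge (B0 *v u) (B0 *v w)" "wedge a u"]
    show ?thesis by (simp add: skew_wedge skew_diff sc neg)
  qed
  have half: "l (wedge u w) = 0"
    if uw: "u \<in> {xb, xc, yb, yc}" "w \<in> {xb, xc, yb, yc}"
      and d: "l (wedge u w - wedge (B0 *v u) (B0 *v w)) = 0" for u w
  proof -
    have "l (wedge u w + wedge (B0 *v u) (B0 *v w)) = 0"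
      by (rule k[OF skew_add[OF skew_wedge skew_wedge]]; rule wedge_commutes)
        (use uw in \<open>auto simp: base_vector matrix_vector_mult_uminus\<close>)
    then show ?thesis using d by (simp add: linear_add[OF lin] linear_diff[OF lin])
  qed
  have same: "l (wedge u w) = 0" if uw: "u \<in> {xb, yb}" "w \<in> {xc, yc}" for u w
  proof (rule half)
    have "nij (wedge xa u) (wedge xa w) = (- 2) *\<^sub>R (wedge u w - wedge (B0 *v u) (B0 *v w))"
      by (rule nij_wedge(2)) (use uw in \<open>auto simp: base_vector matrix_vector_mult_uminus inner_axis_axis\<close>)
    then show "l (wedge u w - wedge (B0 *v u) (B0 *v w)) = 0"
      using n[of "wedge xa u" "wedge xa w"] by (simp add: skew_wedge sc neg)
  qed (use uw in auto)
  have "wedge (B0 *v xb) (B0 *v yb) = wedge xb yb" "wedge (B0 *v xc) (B0 *v yc) = wedge xc yc"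
    by (simp_all add: wedge_def base_vector outer_simps(9,10))
  then have diag: "l (wedge xb yb) = 0" "l (wedge xc yc) = 0"
    using linear_0[OF lin] by (auto intro!: half)
  have "l C0 = 0"
    by (rule k[OF skew_base(2)]) (simp_all add: base_mult)
  then have C: "l (wedge ya xa) = 0" by (simp add: C0_def)
  have swap: "l (wedge u w) = 0 \<Longrightarrow> l (wedge w u) = 0" for u w
    using wedge_swap[of w u] neg by simp
  have self: "l (wedge u u) = 0" for u using linear_0[OF lin] by (simp add: wedge_self)
  have "\<forall>i j. l (wedge (axis i 1) (axis j 1)) = 0"
    unfolding forall_6
    by (intro conjI self) (rule mixed same diag C swap[OF mixed] swap[OF same] swap[OF diag(1)] swap[OF diag(2)] swap[OF C]; simp)+
  then show ?thesis
    by (subst skew_eq_sum_wedge[OF Y]) (simp add: linear_sum[OF lin] sc)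
qed

lemma J3_no_holomorphic_quotient: "\<not> has_holomorphic_quotient U1xU2 (J_acs (-1) 0)"
proof
  assume "has_holomorphic_quotient U1xU2 (J_acs (-1) 0)"
  then obtain f g p v where s: "csmooth U1xU2 f" "csmooth U1xU2 g"
    and eq: "\<And>p v. p \<in> cosets U1xU2 \<Longrightarrow> v \<in> tangents U1xU2 p \<Longrightarrow>
        g p * (cder v f + \<i> * cder (J_acs (-1) 0 p v) f) = f p * (cder v g + \<i> * cder (J_acs (-1) 0 p v) g)"
    and p: "p \<in> cosets U1xU2" and v: "v \<in> tangents U1xU2 p"
    and gp: "g p \<noteq> 0" and ne: "g p * cder v f \<noteq> f p * cder v g"
    unfolding has_holomorphic_quotient_def by blast
  obtain a where a: "a \<in> SOn" "p = coset U1xU2 a" using p by (auto simp: cosets_iff)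
  obtain Y where Y: "skew Y" "v = fund U1xU2 (a ** Y ** transpose a) (coset U1xU2 a)"
    using tangent_eq_fund_coset[OF a(1)] v a(2) by blast
  note sf = s[unfolded csmooth_def]
  obtain h1 W1 where h1: "local_ext SOn (\<lambda>x. Re (f (coset U1xU2 x))) a h1 W1"
    using smooth_on_cosetsE[OF conjunct1[OF sf(1)] a(1)] by metis
  obtain h2 W2 where h2: "local_ext SOn (\<lambda>x. Im (f (coset U1xU2 x))) a h2 W2"
    using smooth_on_cosetsE[OF conjunct2[OF sf(1)] a(1)] by metis
  obtain l1 W3 where l1: "local_ext SOn (\<lambda>x. Re (g (coset U1xU2 x))) a l1 W3"
    using smooth_on_cosetsE[OF conjunct1[OF sf(2)] a(1)] by metis
  obtain l2 W4 where l2: "local_ext SOn (\<lambda>x. Im (g (coset U1xU2 x))) a l2 W4"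
    using smooth_on_cosetsE[OF conjunct2[OF sf(2)] a(1)] by metis
  define W' where "W' = W1 \<inter> W2 \<inter> W3 \<inter> W4"
  \<comment> \<open>On \<open>W\<close> the denominator does not vanish, so the quotient r1 + \<i>
    r2 of the two extensions is a smooth function on an open set of matrices around
    \<open>a\<close>.\<close>
  define W where "W = W' \<inter> (\<lambda>x. l1 x * l1 x + l2 x * l2 x) -` (- {0})"
  have W': "open W'" "a \<in> W'"
    using h1 h2 l1 l2 unfolding W'_def local_ext_def by (auto intro!: open_Int)
  have sm': "C_k_on k h1 W'" "C_k_on k h2 W'" "C_k_on k l1 W'" "C_k_on k l2 W'" for k
    using h1 h2 l1 l2 unfolding local_ext_def W'_def by (blast intro: C_k_on_subset)+
  have nsm: "C_k_on k (\<lambda>x. l1 x * l1 x + l2 x * l2 x) W'" for k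
    by (intro C_k_on_add C_k_on_mult sm' W')
  have oW: "open W"
    unfolding W_def
    by (rule continuous_open_preimage[OF _ W'(1)]) (use nsm[of 0] in auto)
  have WW': "W \<subseteq> W'" by (auto simp: W_def)
  have sm: "C_k_on k h1 W" "C_k_on k h2 W" "C_k_on k l1 W" "C_k_on k l2 W" for k
    by (rule C_k_on_subset[OF sm'(1) WW'], rule C_k_on_subset[OF sm'(2) WW'],
        rule C_k_on_subset[OF sm'(3) WW'], rule C_k_on_subset[OF sm'(4) WW'])
  have val: "f (coset U1xU2 x) = Complex (h1 x) (h2 x)" "g (coset U1xU2 x) = Complex (l1 x) (l2 x)"
    if "x \<in> SOn" "x \<in> W" for x
    using h1 h2 l1 l2 that WW' unfolding local_ext_def W'_def by (auto simp: complex_eq_iff)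
  have aW: "a \<in> W"
  proof -
    have "h1 a = Re (f p)" "h2 a = Im (f p)" "l1 a = Re (g p)" "l2 a = Im (g p)"
      using h1 h2 l1 l2 a unfolding local_ext_def by auto
    then show ?thesis
      using gp W'(2) unfolding W_def by (simp add: complex_eq_iff sum_squares_eq_zero_iff)
  qed
  define n where "n x = inverse (l1 x * l1 x + l2 x * l2 x)" for x
  have nW: "C_k_on k n W" for k
    unfolding n_def
    by (rule C_k_on_comp_real[OF oW _ _ C_k_on_inverse C_k_on_subset[OF nsm WW']]) (auto simp: W_def)
  define r1 where "r1 x = (h1 x * l1 x + h2 x * l2 x) * n x" for x
  define r2 where "r2 x = (h2 x * l1 x - h1 x * l2 x) * n x" for x
  have r: "C_k_on k r1 W" "C_k_on k r2 W" for k
    unfolding r1_def r2_def by (intro C_k_on_mult C_k_on_add C_k_on_diff sm nW oW)+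
  have rel: "h1 x = r1 x * l1 x - r2 x * l2 x" "h2 x = r1 x * l2 x + r2 x * l1 x" if "x \<in> W" for x
  proof -
    have 1: "(l1 x * l1 x + l2 x * l2 x) * n x = 1" using that by (simp add: n_def W_def)
    have "r1 x * l1 x - r2 x * l2 x = h1 x * ((l1 x * l1 x + l2 x * l2 x) * n x)"
      "r1 x * l2 x + r2 x * l1 x = h2 x * ((l1 x * l1 x + l2 x * l2 x) * n x)"
      by (simp_all add: r1_def r2_def algebra_simps)
    then show "h1 x = r1 x * l1 x - r2 x * l2 x" "h2 x = r1 x * l2 x + r2 x * l1 x"
      by (simp_all only: 1 mult_1_right)
  qed
  let ?d = "\<lambda>r x V. frechet_derivative r (at x) V"
  have der: "(q has_derivative ?d q x) (at x)" if "x \<in> W" "\<And>k. C_k_on k q W" for q x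
    by (rule C_k_on_Suc_has_derivative[OF that(2) that(1)])
  have drel: "?d h1 x V = ?d r1 x V * l1 x + r1 x * ?d l1 x V - (?d r2 x V * l2 x + r2 x * ?d l2 x V)"
    "?d h2 x V = ?d r1 x V * l2 x + r1 x * ?d l2 x V + (?d r2 x V * l1 x + r2 x * ?d l1 x V)"
    if x: "x \<in> W" for x V
  proof -
    have "((\<lambda>x. r1 x * l1 x - r2 x * l2 x) has_derivative
        (\<lambda>V. (r1 x * ?d l1 x V + ?d r1 x V * l1 x) - (r2 x * ?d l2 x V + ?d r2 x V * l2 x))) (at x)"
      by (intro has_derivative_diff has_derivative_mult der x r sm)
    then have "(h1 has_derivative
        (\<lambda>V. (r1 x * ?d l1 x V + ?d r1 x V * l1 x) - (r2 x * ?d l2 x V + ?d r2 x V * l2 x))) (at x)"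
      by (rule has_derivative_transform_within_open[OF _ oW x]) (simp add: rel)
    from frechet_derivative_at[OF this, symmetric]
    show "?d h1 x V = ?d r1 x V * l1 x + r1 x * ?d l1 x V - (?d r2 x V * l2 x + r2 x * ?d l2 x V)" by simp
    have "((\<lambda>x. r1 x * l2 x + r2 x * l1 x) has_derivative
        (\<lambda>V. (r1 x * ?d l2 x V + ?d r1 x V * l2 x) + (r2 x * ?d l1 x V + ?d r2 x V * l1 x))) (at x)"
      by (intro has_derivative_add has_derivative_mult der x r sm)
    then have "(h2 has_derivative
        (\<lambda>V. (r1 x * ?d l2 x V + ?d r1 x V * l2 x) + (r2 x * ?d l1 x V + ?d r2 x V * l1 x))) (at x)"
      by (rule has_derivative_transform_within_open[OF _ oW x]) (simp add: rel)
    from frechet_derivative_at[OF this, symmetric]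
    show "?d h2 x V = ?d r1 x V * l2 x + r1 x * ?d l2 x V + (?d r2 x V * l1 x + r2 x * ?d l1 x V)" by simp
  qed
  have cd: "cder (fund U1xU2 (x ** X ** transpose x) (coset U1xU2 x)) f = Complex (?d h1 x (x ** X)) (?d h2 x (x ** X))"
    "cder (fund U1xU2 (x ** X ** transpose x) (coset U1xU2 x)) g = Complex (?d l1 x (x ** X)) (?d l2 x (x ** X))"
    if x: "x \<in> SOn" "x \<in> W" and X: "skew X" for x X
  proof -
    have e: "x ** X ** transpose x ** x = x ** X" using x(1) by (simp add: matrix_algebra SO_orthogonal)
    have ext: "local_ext SOn (\<lambda>x. Re (f (coset U1xU2 x))) x h1 W1" "local_ext SOn (\<lambda>x. Im (f (coset U1xU2 x))) x h2 W2"
      "local_ext SOn (\<lambda>x. Re (g (coset U1xU2 x))) x l1 W3" "local_ext SOn (\<lambda>x. Im (g (coset U1xU2 x))) x l2 W4"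
      using h1 h2 l1 l2 x(2) WW' unfolding local_ext_def W'_def by auto
    note fe = fund_eq[OF skew_conj[OF X, of x] x(1), unfolded e]
    show "cder (fund U1xU2 (x ** X ** transpose x) (coset U1xU2 x)) f = Complex (?d h1 x (x ** X)) (?d h2 x (x ** X))"
      unfolding cder_def using fe[OF ext(1)] fe[OF ext(2)] sf(1) by simp
    show "cder (fund U1xU2 (x ** X ** transpose x) (coset U1xU2 x)) g = Complex (?d l1 x (x ** X)) (?d l2 x (x ** X))"
      unfolding cder_def using fe[OF ext(3)] fe[OF ext(4)] sf(2) by simp
  qed
  have dq: "Complex (?d h1 x V) (?d h2 x V) = Complex (?d r1 x V) (?d r2 x V) * Complex (l1 x) (l2 x)
      + Complex (r1 x) (r2 x) * Complex (?d l1 x V) (?d l2 x V)" if "x \<in> W" for x V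
    using drel[OF that] by (simp add: complex_eq_iff algebra_simps)
  have q: "Complex (h1 x) (h2 x) = Complex (r1 x) (r2 x) * Complex (l1 x) (l2 x)" if "x \<in> W" for x
    using rel[OF that] by (simp add: complex_eq_iff)
  have cr: "?d r1 x (x ** X) = ?d r2 x (x ** J0 (-1) 0 X)" "?d r2 x (x ** X) = - ?d r1 x (x ** J0 (-1) 0 X)"
    if x: "x \<in> SOn" "x \<in> W" and X: "skew X" for x X
  proof -
    let ?G = "Complex (l1 x) (l2 x)" and ?R = "Complex (r1 x) (r2 x)"
    let ?dR = "\<lambda>X. Complex (?d r1 x (x ** X)) (?d r2 x (x ** X))" and ?dG = "\<lambda>X. Complex (?d l1 x (x ** X)) (?d l2 x (x ** X))"
    let ?J = "J0 (-1) 0 X"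
    have G0: "?G \<noteq> 0"
      using x(2) by (auto simp: W_def complex_eq_iff)
    \<comment> \<open>With f = R G substituted, the quotient equation reduces to G^2 times the
      antiholomorphic derivative of R, as the terms with derivatives of G cancel.\<close>
    have "?G * ((?dR X * ?G + ?R * ?dG X) + \<i> * (?dR ?J * ?G + ?R * ?dG ?J)) = ?R * ?G * (?dG X + \<i> * ?dG ?J)"
      using eq[OF coset_mem[OF x(1)] fund_tangent[OF skew_conj[OF X] coset_mem[OF x(1)]], of x]
      unfolding J_fund_coset[OF X x(1)] cd[OF x X] cd[OF x skew_J0[OF X]] val[OF x] dq[OF x(2)] q[OF x(2)] .
    then have "?G * ?G * (?dR X + \<i> * ?dR ?J) = 0" by (simp add: algebra_simps)
    then have "?dR X + \<i> * ?dR ?J = 0" using G0 by simp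
    then show "?d r1 x (x ** X) = ?d r2 x (x ** ?J)" "?d r2 x (x ** X) = - ?d r1 x (x ** ?J)"
      by (simp_all add: complex_eq_iff)
  qed
  have lin: "linear (?d q a)" if "\<And>k. C_k_on k q W" for q
    using has_derivative_linear[OF der[OF aW that]] .
  have linl: "linear (\<lambda>V. ?d q a (a ** V))" if "\<And>k. C_k_on k q W" for q
    using lin[OF that] by (auto intro!: linearI simp: matrix_algebra linear_add linear_cmul)
  have J0k: "J0 (-1) 0 X = 0" if "X ** B0 = B0 ** X" "X ** C0 = C0 ** X" for X
    by (rule J0_kernel[OF that])
  have z1: "?d r1 a (a ** Y) = 0"
  proof (rule nij_spans[OF linl[OF r(1)] _ _ Y(1)])
    show "?d r1 a (a ** nij X Z) = 0" if "skew X" "skew Z" for X Z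
      unfolding nij_def by (rule nijenhuis_annihilates[OF oW r skew_J0 cr a(1) aW that])
    show "?d r1 a (a ** X) = 0" if "skew X" "X ** B0 = B0 ** X" "X ** C0 = C0 ** X" for X
      using cr(1)[OF a(1) aW that(1)] J0k[OF that(2,3)] linear_0[OF lin[OF r(2)]] by (simp add: matrix_algebra)
  qed
  \<comment> \<open>\<open>nijenhuis_annihilates\<close> speaks about the real part only. For the
    imaginary part it is applied to r2 - \<i> r1, which is -\<i> times the quotient and satisfies
    the same equations.\<close>
  have z2: "?d r2 a (a ** Y) = 0"
  proof (rule nij_spans[OF linl[OF r(2)] _ _ Y(1)])
    have m: "C_k_on k (\<lambda>x. - r1 x) W" for k by (intro C_k_on_minus oW r)
    have dm: "?d (\<lambda>x. - r1 x) x V = - ?d r1 x V" if "x \<in> W" for x V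
      using frechet_derivative_at[OF has_derivative_minus[OF der[OF that r(1)]], symmetric] by simp
    have cr': "?d r2 x (x ** X) = ?d (\<lambda>x. - r1 x) x (x ** J0 (-1) 0 X)"
      "?d (\<lambda>x. - r1 x) x (x ** X) = - ?d r2 x (x ** J0 (-1) 0 X)" if "x \<in> SOn" "x \<in> W" "skew X" for x X
      using cr[OF that] dm[OF that(2)] by simp_all
    show "?d r2 a (a ** nij X Z) = 0" if "skew X" "skew Z" for X Z
      unfolding nij_def by (rule nijenhuis_annihilates[OF oW r(2) m skew_J0 cr' a(1) aW that])
    show "?d r2 a (a ** X) = 0" if "skew X" "X ** B0 = B0 ** X" "X ** C0 = C0 ** X" for X
      using cr(2)[OF a(1) aW that(1)] J0k[OF that(2,3)] linear_0[OF lin[OF r(1)]] by (simp add: matrix_algebra)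
  qed
  have "g p * cder v f = f p * cder v g"
    unfolding a(2) Y(2) cd[OF a(1) aW Y(1)] val[OF a(1) aW] dq[OF aW] q[OF aW] z1 z2
    by (simp add: algebra_simps complex_eq_iff)
  then show False using ne by simp
qed

subsection \<open>Null-homotopic loops of frames\<close>

text \<open>A loop of \<open>J\<close>-complex frames over a point which rotates the \<open>i\<close>-th vector \<open>w i\<close> times, and
  which is null-homotopic in the bundle of frames.  The homotopy is a family over the unit square,
  constant for \<open>s = 1\<close>.\<close>

abbreviation unit_square :: "(real \<times> real) set" where "unit_square \<equiv> {0..1} \<times> {0..1}"

definition frame_family ::
    "(real^'n^'n) set \<Rightarrow> ((real^'n^'n) set \<Rightarrow> (real^'n^'n) set tvec \<Rightarrow> (real^'n^'n) set tvec) \<Rightarrow> (5 \<Rightarrow> int) \<Rightarrow>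
     (real \<times> real \<Rightarrow> (real^'n^'n) set) \<Rightarrow> (5 \<Rightarrow> real \<times> real \<Rightarrow> (real^'n^'n) set tvec) \<Rightarrow> bool" where
  "frame_family K J w H v \<longleftrightarrow>
     (\<forall>x\<in>unit_square. H x \<in> cosets K) \<and>
     (\<forall>x\<in>unit_square. \<forall>i. v i x \<in> tangents K (H x)) \<and>
     (\<forall>x\<in>unit_square. \<forall>a b.
        (\<forall>f\<in>smooth_on_cosets K. (\<Sum>i\<in>UNIV. a i * v i x f + b i * J (H x) (v i x) f) = 0) \<longrightarrow>
        (\<forall>i. a i = 0 \<and> b i = 0)) \<and>
     (\<forall>f\<in>smooth_on_cosets K. continuous_on unit_square (\<lambda>x. f (H x))) \<and>
     (\<forall>f\<in>smooth_on_cosets K. \<forall>i. continuous_on unit_square (\<lambda>x. v i x f)) \<and>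
     (\<forall>t\<in>{0..1}. H (0, t) = H (0, 0)) \<and>
     (\<forall>t\<in>{0..1}. \<forall>i. v i (0, t) = (\<lambda>f. cos (2 * pi * w i * t) * v i (0, 0) f
        + sin (2 * pi * w i * t) * J (H (0, 0)) (v i (0, 0)) f)) \<and>
     (\<forall>s\<in>{0..1}. H (s, 1) = H (s, 0)) \<and> (\<forall>s\<in>{0..1}. \<forall>i. v i (s, 1) = v i (s, 0)) \<and>
     (\<forall>t\<in>{0..1}. H (1, t) = H (1, 0)) \<and> (\<forall>t\<in>{0..1}. \<forall>i. v i (1, t) = v i (1, 0))"

lemma frame_familyD:
  assumes "frame_family K J w H v"
  shows "x \<in> unit_square \<Longrightarrow> H x \<in> cosets K"
    "x \<in> unit_square \<Longrightarrow> v i x \<in> tangents K (H x)"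
    "x \<in> unit_square \<Longrightarrow> \<forall>f\<in>smooth_on_cosets K. (\<Sum>i\<in>UNIV. a i * v i x f + b i * J (H x) (v i x) f) = 0 \<Longrightarrow>
        a i = 0 \<and> b i = 0"
    "f \<in> smooth_on_cosets K \<Longrightarrow> continuous_on unit_square (\<lambda>x. f (H x))"
    "f \<in> smooth_on_cosets K \<Longrightarrow> continuous_on unit_square (\<lambda>x. v i x f)"
    "t \<in> {0..1} \<Longrightarrow> H (0, t) = H (0, 0)"
    "t \<in> {0..1} \<Longrightarrow> v i (0, t) = (\<lambda>f. cos (2 * pi * w i * t) * v i (0, 0) f
        + sin (2 * pi * w i * t) * J (H (0, 0)) (v i (0, 0)) f)"
    "t \<in> {0..1} \<Longrightarrow> H (t, 1) = H (t, 0)" "t \<in> {0..1} \<Longrightarrow> v i (t, 1) = v i (t, 0)"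
    "t \<in> {0..1} \<Longrightarrow> H (1, t) = H (1, 0)" "t \<in> {0..1} \<Longrightarrow> v i (1, t) = v i (1, 0)"
proof -
  note c1 = assms[unfolded frame_family_def]
  note c2 = c1[THEN conjunct2]
  note c3 = c2[THEN conjunct2]
  note c4 = c3[THEN conjunct2]
  note c5 = c4[THEN conjunct2]
  note c6 = c5[THEN conjunct2]
  note c7 = c6[THEN conjunct2]
  note c8 = c7[THEN conjunct2]
  note c9 = c8[THEN conjunct2]
  note c10 = c9[THEN conjunct2]
  note c11 = c10[THEN conjunct2]
  show "x \<in> unit_square \<Longrightarrow> H x \<in> cosets K"
    by (rule c1[THEN conjunct1, rule_format])
  show "x \<in> unit_square \<Longrightarrow> v i x \<in> tangents K (H x)"
    by (rule c2[THEN conjunct1, rule_format])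
  show "x \<in> unit_square \<Longrightarrow> \<forall>f\<in>smooth_on_cosets K. (\<Sum>i\<in>UNIV. a i * v i x f + b i * J (H x) (v i x) f) = 0 \<Longrightarrow>
        a i = 0 \<and> b i = 0"
    by (rule c3[THEN conjunct1, rule_format]) blast+
  show "f \<in> smooth_on_cosets K \<Longrightarrow> continuous_on unit_square (\<lambda>x. f (H x))"
    by (rule c4[THEN conjunct1, rule_format])
  show "f \<in> smooth_on_cosets K \<Longrightarrow> continuous_on unit_square (\<lambda>x. v i x f)"
    by (rule c5[THEN conjunct1, rule_format])
  show "t \<in> {0..1} \<Longrightarrow> H (0, t) = H (0, 0)"
    by (rule c6[THEN conjunct1, rule_format])
  show "t \<in> {0..1} \<Longrightarrow> v i (0, t) = (\<lambda>f. cos (2 * pi * w i * t) * v i (0, 0) f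
        + sin (2 * pi * w i * t) * J (H (0, 0)) (v i (0, 0)) f)"
    by (rule c7[THEN conjunct1, rule_format])
  show "t \<in> {0..1} \<Longrightarrow> H (t, 1) = H (t, 0)"
    by (rule c8[THEN conjunct1, rule_format])
  show "t \<in> {0..1} \<Longrightarrow> v i (t, 1) = v i (t, 0)"
    by (rule c9[THEN conjunct1, rule_format])
  show "t \<in> {0..1} \<Longrightarrow> H (1, t) = H (1, 0)"
    by (rule c10[THEN conjunct1, rule_format])
  show "t \<in> {0..1} \<Longrightarrow> v i (1, t) = v i (1, 0)"
    by (rule c11[rule_format])
qed

text \<open>In the homotopy sequence of the frame bundle, the loops of the fibre that become trivial
  in the total space are the boundaries of spheres in the base, and the winding of their determinant
  is the first Chern class evaluated on the sphere. A total winding prime to 3 thus witnesses that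
  this class is not divisible by 3.\<close>

definition has_nullhomotopic_frame ::
    "(real^'n^'n) set \<Rightarrow> ((real^'n^'n) set \<Rightarrow> (real^'n^'n) set tvec \<Rightarrow> (real^'n^'n) set tvec) \<Rightarrow> bool" where
  "has_nullhomotopic_frame K J \<longleftrightarrow> (\<exists>w H v. frame_family K J w H v \<and> \<not> 3 dvd (\<Sum>i\<in>UNIV. w i))"

lemma frame_family_conjugate:
  assumes fam: "frame_family K J w H v"
  shows "frame_family K (conjugate_acs J) (\<lambda>i. - w i) H v"
proof -
  have ind: "a i = 0 \<and> b i = 0" if "x \<in> unit_square"
    "\<forall>f\<in>smooth_on_cosets K. (\<Sum>i\<in>UNIV. a i * v i x f + b i * conjugate_acs J (H x) (v i x) f) = 0" for x a b i
    using frame_familyD(3)[OF fam that(1), of a "\<lambda>i. - b i" i] that(2) by (simp add: conjugate_acs_def)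
  show ?thesis
    unfolding frame_family_def
  proof (intro conjI ballI allI impI)
    fix x a b i assume "x \<in> unit_square"
      "\<forall>f\<in>smooth_on_cosets K. (\<Sum>i\<in>UNIV. a i * v i x f + b i * conjugate_acs J (H x) (v i x) f) = 0"
    from ind[OF this] show "a i = 0" "b i = 0" by blast+
  next
    fix t :: real and i assume "t \<in> {0..1}"
    from frame_familyD(7)[OF fam this] show "v i (0, t) = (\<lambda>f. cos (2 * pi * (- w i) * t) * v i (0, 0) f
        + sin (2 * pi * (- w i) * t) * conjugate_acs J (H (0, 0)) (v i (0, 0)) f)"
      by (simp add: conjugate_acs_def)
  qed ((rule frame_familyD(1,2,4,5,6,8-11)[OF fam]; assumption)+)
qed

lemma has_nullhomotopic_frame_conjugate:
  assumes "has_nullhomotopic_frame K J"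
  shows "has_nullhomotopic_frame K (conjugate_acs J)"
proof -
  obtain w H v where fam: "frame_family K J w H v" and "\<not> 3 dvd (\<Sum>i\<in>UNIV. w i)"
    using assms unfolding has_nullhomotopic_frame_def by (elim exE conjE)
  then have nd: "\<not> 3 dvd (\<Sum>i\<in>UNIV. - w i)" by (simp add: sum_negf)
  show ?thesis
    unfolding has_nullhomotopic_frame_def
    by (rule exI[of _ "\<lambda>i. - w i"], rule exI[of _ H], rule exI[of _ v])
      (rule conjI[OF frame_family_conjugate[OF fam] nd])
qed

lemma frame_family_equivalent:
  assumes fam: "frame_family K J\<^sub>1 w H v" and J1: "almost_complex_structure (cosets K) (smooth_on_cosets K) J\<^sub>1"
    and \<phi>: "diffeomorphism_of (cosets K) (smooth_on_cosets K) \<phi>"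
    and pres: "preserved_by (cosets K) (smooth_on_cosets K) \<phi> J\<^sub>1 J\<^sub>2"
  shows "frame_family K J\<^sub>2 w (\<lambda>x. \<phi> (H x)) (\<lambda>i x. differential (smooth_on_cosets K) \<phi> (v i x))"
proof -
  let ?M = "cosets K" and ?F = "smooth_on_cosets K"
  note D = frame_familyD[OF fam]
  have bij: "bij_betw \<phi> ?M ?M" and F\<phi>: "\<And>f. f \<in> ?F \<Longrightarrow> f \<circ> \<phi> \<in> ?F"
    and F\<psi>: "\<And>f. f \<in> ?F \<Longrightarrow> f \<circ> inv_into ?M \<phi> \<in> ?F" using \<phi> by (simp_all add: diffeomorphism_of_def)
  let ?d = "differential ?F \<phi>"
  have J1t: "J\<^sub>1 p u \<in> tangents K p" if "p \<in> ?M" "u \<in> tangents K p" for p u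
    using J1 that by (simp add: almost_complex_structure_def)
  have dJ: "J\<^sub>2 (\<phi> (H x)) (?d (v i x)) = ?d (J\<^sub>1 (H x) (v i x))" if "x \<in> unit_square" for x i
    using pres D(1)[OF that] D(2)[OF that] by (simp add: preserved_by_def)
  have ind2: "a i = 0 \<and> b i = 0" if x: "x \<in> unit_square"
    and z: "\<forall>f\<in>?F. (\<Sum>i\<in>UNIV. a i * ?d (v i x) f + b i * J\<^sub>2 (\<phi> (H x)) (?d (v i x)) f) = 0" for x a b i
  proof (rule D(3)[OF x], rule ballI)
    fix f assume f: "f \<in> ?F"
    let ?f = "f \<circ> inv_into ?M \<phi>"
    have "?d u ?f = u f" if "u \<in> tangents K (H x)" for u
    proof -
      have "u f = u (?f \<circ> \<phi>)"
        by (rule tangent_cong[OF that D(1)[OF x] f]) (simp add: bij_betw_inv_into_left[OF bij])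
      then show ?thesis using F\<psi>[OF f] by (simp add: differential_def)
    qed
    then have "(\<Sum>i\<in>UNIV. a i * v i x f + b i * J\<^sub>1 (H x) (v i x) f) =
        (\<Sum>i\<in>UNIV. a i * ?d (v i x) ?f + b i * J\<^sub>2 (\<phi> (H x)) (?d (v i x)) ?f)"
      using D(2)[OF x] J1t[OF D(1)[OF x] D(2)[OF x]] by (simp add: dJ[OF x])
    then show "(\<Sum>i\<in>UNIV. a i * v i x f + b i * J\<^sub>1 (H x) (v i x) f) = 0"
      using z F\<psi>[OF f] by simp
  qed
  have cont2: "continuous_on (unit_square) (\<lambda>x. ?d (v i x) f)" if f: "f \<in> ?F" for f i
    using D(5)[OF F\<phi>[OF f]] f by (simp add: differential_def)
  have cont1: "continuous_on (unit_square) (\<lambda>x. f (\<phi> (H x)))" if f: "f \<in> ?F" for f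
    using D(4)[OF F\<phi>[OF f]] by (simp add: o_def)
  have zero: "(0, 0) \<in> unit_square" by simp
  have s02: "?d (v i (0, t)) = (\<lambda>f. cos (2 * pi * w i * t) * ?d (v i (0, 0)) f + sin (2 * pi * w i * t) * J\<^sub>2 (\<phi> (H (0, 0))) (?d (v i (0, 0))) f)"
    if "t \<in> {0..1}" for t i
    unfolding dJ[OF zero] by (subst D(7)[OF that]) (auto simp: differential_def)
  show ?thesis
    unfolding frame_family_def
  proof (intro conjI ballI allI impI)
    fix x assume x: "x \<in> unit_square"
    show "\<phi> (H x) \<in> ?M" using bij D(1)[OF x] by (auto dest: bij_betwE)
    show "?d (v i x) \<in> tangents K (\<phi> (H x))" for i by (rule differential_tangent[OF \<phi> D(2)[OF x]])
    show "a i = 0" "b i = 0"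
      if "\<forall>f\<in>?F. (\<Sum>i\<in>UNIV. a i * ?d (v i x) f + b i * J\<^sub>2 (\<phi> (H x)) (?d (v i x)) f) = 0" for a b i
      using ind2[OF x that] by blast+
  next
    fix f i assume f: "f \<in> ?F"
    show "continuous_on unit_square (\<lambda>x. f (\<phi> (H x)))" by (rule cont1[OF f])
    show "continuous_on unit_square (\<lambda>x. ?d (v i x) f)" by (rule cont2[OF f])
  next
    fix t :: real and i assume t: "t \<in> {0..1}"
    show "\<phi> (H (0, t)) = \<phi> (H (0, 0))" "\<phi> (H (t, 1)) = \<phi> (H (t, 0))" "\<phi> (H (1, t)) = \<phi> (H (1, 0))"
      by (simp_all only: D(6)[OF t] D(8)[OF t] D(10)[OF t])
    show "?d (v i (t, 1)) = ?d (v i (t, 0))" "?d (v i (1, t)) = ?d (v i (1, 0))"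
      by (simp_all only: D(9)[OF t] D(11)[OF t])
    show "?d (v i (0, t)) = (\<lambda>f. cos (2 * pi * w i * t) * ?d (v i (0, 0)) f + sin (2 * pi * w i * t) * J\<^sub>2 (\<phi> (H (0, 0))) (?d (v i (0, 0))) f)"
      by (rule s02[OF t])
  qed
qed

lemma has_nullhomotopic_frame_equivalent:
  assumes "has_nullhomotopic_frame K J\<^sub>1" "almost_complex_structure (cosets K) (smooth_on_cosets K) J\<^sub>1"
    "equivalent_acs (cosets K) (smooth_on_cosets K) J\<^sub>1 J\<^sub>2"
  shows "has_nullhomotopic_frame K J\<^sub>2"
proof -
  obtain w H v where fam: "frame_family K J\<^sub>1 w H v" and nd: "\<not> 3 dvd (\<Sum>i\<in>UNIV. w i)"
    using assms(1) unfolding has_nullhomotopic_frame_def by (elim exE conjE)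
  obtain \<phi> where \<phi>: "diffeomorphism_of (cosets K) (smooth_on_cosets K) \<phi>"
    "preserved_by (cosets K) (smooth_on_cosets K) \<phi> J\<^sub>1 J\<^sub>2"
    using assms(3) by (auto simp: equivalent_acs_def)
  show ?thesis
    unfolding has_nullhomotopic_frame_def
    by (rule exI[of _ w], rule exI, rule exI) (rule conjI[OF frame_family_equivalent[OF fam assms(2) \<phi>] nd])
qed

lemma smooth_fun_on_imp_continuous_on:
  assumes "smooth_fun_on S f"
  shows "continuous_on S f"
proof -
  have "continuous (at x within S) f" if x: "x \<in> S" for x
  proof -
    obtain h W where "local_ext S f x h W" using smooth_fun_onE[OF assms x] .
    then have W: "open W" "x \<in> W" "C_k_on 0 h W" "\<And>y. y \<in> S \<Longrightarrow> y \<in> W \<Longrightarrow> h y = f y"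
      unfolding local_ext_def by blast+
    then have "continuous (at x within S) h"
      by (simp add: continuous_on_eq_continuous_at continuous_at_imp_continuous_at_within)
    then show ?thesis
      by (rule continuous_transform_within_openin[where S = "S \<inter> W"])
        (use W x in \<open>auto intro: openin_open_Int\<close>)
  qed
  then show ?thesis by (simp add: continuous_on_eq_continuous_within)
qed

text \<open>Unlike in \<open>fund_smooth\<close> the generator turns with \<open>g\<close>. On the
  group this is the derivative along the left-invariant field of \<open>X\<close>, hence smooth
  although it need not descend to cosets.\<close>

lemma fund_conj_smooth:
  assumes f: "f \<in> smooth_on_cosets K" and X: "skew X"
  shows "smooth_fun_on SOn (\<lambda>g. fund K (g ** X ** transpose g) (coset K g) f)"
  unfolding smooth_fun_on_iff
proof
  fix g :: "real^'a^'a" assume g: "g \<in> SOn"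
  obtain h W where ext: "local_ext SOn (\<lambda>g. f (coset K g)) g h W"
    using smooth_on_cosetsE[OF f g] by metis
  then have W: "open W" "g \<in> W" "\<And>k. C_k_on k h W" unfolding local_ext_def by blast+
  have "frechet_derivative h (at y) (y ** X) = fund K (y ** X ** transpose y) (coset K y) f"
    if y: "y \<in> SOn" "y \<in> W" for y
  proof -
    have "local_ext SOn (\<lambda>g. f (coset K g)) y h W" using ext y unfolding local_ext_def by blast
    from fund_eq[OF skew_conj[OF X] y(1) this f] show ?thesis
      using y by (simp add: matrix_algebra SO_orthogonal)
  qed
  moreover have "C_k_on k (\<lambda>y. frechet_derivative h (at y) (y ** X)) W" for k
    by (rule lie_derivative_commutator(1)[OF W(1,3,2)])
  ultimately have "local_ext SOn (\<lambda>g. fund K (g ** X ** transpose g) (coset K g) f) g (\<lambda>y. frechet_derivative h (at y) (y ** X)) W"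
    unfolding local_ext_def using W by auto
  then show "\<exists>h W. local_ext SOn (\<lambda>g. fund K (g ** X ** transpose g) (coset K g) f) g h W" by blast
qed

section \<open>A null-homotopic loop of frames\<close>

lemma exhaust_5: "(x :: 5) = 1 \<or> x = 2 \<or> x = 3 \<or> x = 4 \<or> x = 5"
proof (induct x)
  case (of_int z)
  then have "z = 0 \<or> z = 1 \<or> z = 2 \<or> z = 3 \<or> z = 4" by simp arith
  then show ?case by auto
qed

lemma UNIV_5: "(UNIV :: 5 set) = {1, 2, 3, 4, 5}"
  using exhaust_5 by auto

lemma forall_5: "(\<forall>i :: 5. P i) \<longleftrightarrow> P 1 \<and> P 2 \<and> P 3 \<and> P 4 \<and> P 5"
  by (metis exhaust_5)

lemma sum_5: "sum f (UNIV :: 5 set) = f 1 + f 2 + f 3 + f 4 + f 5"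
  unfolding UNIV_5 by (simp add: add.assoc)

text \<open>A complex basis adapted to the isotropy summands: the vector 1 spans the part inside
  \<complex>^2, the vectors 2 and 4 the summand with sign \<alpha> + \<beta>, the vectors 3 and 5
  the one with sign \<alpha> - \<beta>.\<close>

definition base_frame :: "5 \<Rightarrow> mat6" where
  "base_frame i = (if i = 1 then wedge xb xc - wedge yb yc
     else if i = 2 then wedge xa xb - wedge ya yb
     else if i = 3 then wedge xa xb + wedge ya yb
     else if i = 4 then wedge xa xc - wedge ya yc
     else wedge xa xc + wedge ya yc)"

lemma base_frame_simps:
  "base_frame 1 = wedge xb xc - wedge yb yc" "base_frame 2 = wedge xa xb - wedge ya yb"
  "base_frame 3 = wedge xa xb + wedge ya yb" "base_frame 4 = wedge xa xc - wedge ya yc"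
  "base_frame 5 = wedge xa xc + wedge ya yc"
  by (simp_all add: base_frame_def)

lemma skew_base_frame: "skew (base_frame i)"
  by (simp add: base_frame_def skew_add skew_diff skew_wedge)

lemma J0_base_frame:
  "J0 \<alpha> \<beta> (base_frame 1) = wedge yb xc + wedge xb yc"
  "J0 \<alpha> \<beta> (base_frame 2) = (\<alpha> + \<beta>) *\<^sub>R (wedge xa yb + wedge ya xb)"
  "J0 \<alpha> \<beta> (base_frame 3) = (\<alpha> - \<beta>) *\<^sub>R (wedge xa yb - wedge ya xb)"
  "J0 \<alpha> \<beta> (base_frame 4) = (\<alpha> + \<beta>) *\<^sub>R (wedge xa yc + wedge ya xc)"
  "J0 \<alpha> \<beta> (base_frame 5) = (\<alpha> - \<beta>) *\<^sub>R (wedge xa yc - wedge ya xc)"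
  unfolding J0_eq base_frame_simps
  by (simp_all add: wedge_def matrix_algebra base_outer base_vector outer_simps(9-12))
    (simp_all add: vec_eq_iff algebra_simps)

lemma base_frame_independent:
  assumes ab: "\<alpha> + \<beta> \<noteq> 0" "\<alpha> - \<beta> \<noteq> 0"
    and comm: "Y ** B0 = B0 ** Y" "Y ** C0 = C0 ** Y"
    and Y: "Y = (\<Sum>i\<in>UNIV. a i *\<^sub>R base_frame i + b i *\<^sub>R J0 \<alpha> \<beta> (base_frame i))"
  shows "a i = 0 \<and> b i = 0"
proof -
  note n = commutant_nth[OF comm]
  have e: "Y $ Inl (Inl 1) $ Inl (Inr 1) = a 2 + a 3" "Y $ Inr (Inl 1) $ Inr (Inr 1) = - a 2 + a 3"
    "Y $ Inl (Inl 1) $ Inl (Inr 2) = a 4 + a 5" "Y $ Inr (Inl 1) $ Inr (Inr 2) = - a 4 + a 5"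
    "Y $ Inl (Inl 1) $ Inr (Inr 1) = b 2 * (\<alpha> + \<beta>) + b 3 * (\<alpha> - \<beta>)" "Y $ Inr (Inl 1) $ Inl (Inr 1) = b 2 * (\<alpha> + \<beta>) - b 3 * (\<alpha> - \<beta>)"
    "Y $ Inl (Inl 1) $ Inr (Inr 2) = b 4 * (\<alpha> + \<beta>) + b 5 * (\<alpha> - \<beta>)" "Y $ Inr (Inl 1) $ Inl (Inr 2) = b 4 * (\<alpha> + \<beta>) - b 5 * (\<alpha> - \<beta>)"
    "Y $ Inl (Inr 1) $ Inl (Inr 2) = a 1" "Y $ Inr (Inr 1) $ Inr (Inr 2) = - a 1"
    "Y $ Inl (Inr 1) $ Inr (Inr 2) = b 1" "Y $ Inr (Inr 1) $ Inl (Inr 2) = b 1"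
    unfolding Y sum_5 J0_base_frame unfolding base_frame_simps by (simp_all add: wedge_nth axis_def)
  have "a 2 = 0" "a 3 = 0" "a 4 = 0" "a 5 = 0" using e(1-4) n by simp_all
  moreover have "b 2 * (\<alpha> + \<beta>) = 0" "b 3 * (\<alpha> - \<beta>) = 0" "b 4 * (\<alpha> + \<beta>) = 0" "b 5 * (\<alpha> - \<beta>) = 0"
  proof -
    have "b 2 * (\<alpha> + \<beta>) + b 3 * (\<alpha> - \<beta>) = 0" "b 2 * (\<alpha> + \<beta>) - b 3 * (\<alpha> - \<beta>) = 0"
      "b 4 * (\<alpha> + \<beta>) + b 5 * (\<alpha> - \<beta>) = 0" "b 4 * (\<alpha> + \<beta>) - b 5 * (\<alpha> - \<beta>) = 0"
      by (simp_all only: e(5-8)[symmetric] n)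
    then show "b 2 * (\<alpha> + \<beta>) = 0" "b 3 * (\<alpha> - \<beta>) = 0" "b 4 * (\<alpha> + \<beta>) = 0" "b 5 * (\<alpha> - \<beta>) = 0"
      by linarith+
  qed
  moreover have "a 1 = 0" "b 1 = 0" using e(9-12) n(3,4)[of 1 2] by simp_all
  ultimately have "\<forall>i. a i = 0 \<and> b i = 0" unfolding forall_5 using ab by simp
  then show ?thesis by blast
qed

text \<open>Twice the circle of rotations in the plane of \<open>xb\<close> and \<open>yb\<close>,
  one copy being conjugated by rotations in the plane of \<open>yb\<close> and \<open>yc\<close>. At
  s = 1 this is the half turn, which fixes \<open>xb\<close> and negates \<open>yb\<close>; it
  reverses the circle, and the two copies cancel. At s = 0 the square of the circle remains.\<close>

definition homotopy_map :: "real \<times> real \<Rightarrow> mat6" where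
  "homotopy_map x = rot (wedge yb yc) (pi * fst x) ** rot (wedge yb xb) (2 * pi * snd x)
     ** transpose (rot (wedge yb yc) (pi * fst x)) ** rot (wedge yb xb) (2 * pi * snd x)"

lemma rot_axis_SO:
  "rot (wedge yb yc) t \<in> SOn" "rot (wedge yb xb) t \<in> SOn"
  by (intro rot_SO skew_wedge wedge_cube; simp add: inner_axis_axis)+

lemma rot_wedge_yb_xb_add: "rot (wedge yb xb) s ** rot (wedge yb xb) t = rot (wedge yb xb) (s + t)"
  by (intro rot_add wedge_cube; simp add: inner_axis_axis)

lemma homotopy_map_SO: "homotopy_map x \<in> SOn"
  unfolding homotopy_map_def by (intro SO_closed rot_axis_SO)

lemma continuous_on_homotopy_map: "continuous_on S homotopy_map"
  unfolding homotopy_map_def transpose_rot[OF skew_wedge] unfolding rot_def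
  by (intro continuous_on_matrix_mul continuous_intros)

lemma rot_2pi: "rot W (2 * pi) = mat 1"
  by (simp add: rot_def)

lemma homotopy_map_boundary:
  "homotopy_map (s, 0) = mat 1" "homotopy_map (s, 1) = mat 1" "homotopy_map (1, t) = mat 1"
  "homotopy_map (0, t) = rot (wedge yb xb) (4 * pi * t)"
proof -
  show "homotopy_map (s, 0) = mat 1" "homotopy_map (s, 1) = mat 1"
    by (simp_all add: homotopy_map_def rot_0 rot_2pi SO_orthogonal[OF rot_axis_SO(1)])
  show "homotopy_map (0, t) = rot (wedge yb xb) (4 * pi * t)"
    by (simp add: homotopy_map_def rot_0 rot_wedge_yb_xb_add mult.assoc)
  let ?U = "rot (wedge yb yc) pi" and ?W = "wedge yb xb"
  have U: "?U = mat 1 - 2 *\<^sub>R outer yb yb - 2 *\<^sub>R outer yc yc"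
    by (simp add: rot_def wedge_def matrix_algebra outer_mult_outer inner_axis_axis algebra_simps)
  have Ut: "transpose ?U = ?U"
    unfolding U by (simp add: transpose_linear outer_simps(13))
  have UW: "?U ** ?W ** ?U = - ?W"
    unfolding U by (simp add: wedge_def matrix_algebra outer_mult_outer inner_axis_axis) (simp add: vec_eq_iff)
  have UU: "?U ** ?U = mat 1" using SO_orthogonal(1)[OF rot_axis_SO(1), of pi] by (simp add: Ut)
  have "?U ** rot ?W \<theta> ** ?U = rot ?W (- \<theta>)" for \<theta>
  proof -
    have "?U ** (?W ** ?W) ** ?U = (?U ** ?W ** ?U) ** (?U ** ?W ** ?U)"
    proof -
      have "(?U ** ?W ** ?U) ** (?U ** ?W ** ?U) = ?U ** (?W ** ((?U ** ?U) ** (?W ** ?U)))"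
        by (simp only: matrix_mul_assoc)
      then show ?thesis by (simp add: UU matrix_mul_assoc)
    qed
    then have UWW: "?U ** (?W ** ?W) ** ?U = ?W ** ?W" unfolding UW by (simp add: matrix_algebra)
    have "?U ** rot ?W \<theta> ** ?U = ?U ** ?U + sin \<theta> *\<^sub>R (?U ** ?W ** ?U) + (1 - cos \<theta>) *\<^sub>R (?U ** (?W ** ?W) ** ?U)"
      unfolding rot_def[of ?W] by (simp add: matrix_algebra)
    then show ?thesis unfolding UU UW UWW by (simp add: rot_def)
  qed
  then show "homotopy_map (1, t) = mat 1"
    by (simp add: homotopy_map_def Ut rot_wedge_yb_xb_add rot_0)
qed

lemma rot_vector:
  "rot (wedge yb xb) \<theta> *v xa = xa" "rot (wedge yb xb) \<theta> *v ya = ya" "rot (wedge yb xb) \<theta> *v xc = xc"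
  "rot (wedge yb xb) \<theta> *v yc = yc" "rot (wedge yb xb) \<theta> *v xb = cos \<theta> *\<^sub>R xb + sin \<theta> *\<^sub>R yb"
  "rot (wedge yb xb) \<theta> *v yb = cos \<theta> *\<^sub>R yb - sin \<theta> *\<^sub>R xb"
  by (simp_all add: rot_def wedge_def matrix_algebra outer_mult_outer inner_axis_axis matrix_vector_mult_add_rdistrib
      matrix_vector_mult_diff_rdistrib scaleR_matrix_vector_assoc[symmetric] outer_simps(14) matrix_vector_mult_uminus
      algebra_simps)

lemma conj_wedge: "A ** wedge x y ** transpose A = wedge (A *v x) (A *v y)"
  for A :: "real^'n^'n"
  by (simp add: wedge_def matrix_algebra outer_simps)

text \<open>The circle is a phase rotation of the first complex line of \<complex>^2. It turns the
  vectors 1, 2 and 3, which involve that line, in the sense given by the sign of the structure, and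
  fixes 4 and 5; since the circle is run through twice, the windings are even.\<close>

lemma rot_base_frame:
  assumes "\<alpha> + \<beta> = \<epsilon>" "\<alpha> - \<beta> = \<epsilon>'" "\<epsilon> \<in> {1, -1}" "\<epsilon>' \<in> {1, -1}"
  defines "w \<equiv> (\<lambda>i :: 5. if i = 1 then 2 else if i = 2 then 2 * \<epsilon> else if i = 3 then 2 * \<epsilon>' else 0)"
  shows "rot (wedge yb xb) (4 * pi * t) ** base_frame i ** transpose (rot (wedge yb xb) (4 * pi * t)) =
    cos (2 * pi * w i * t) *\<^sub>R base_frame i + sin (2 * pi * w i * t) *\<^sub>R J0 \<alpha> \<beta> (base_frame i)"
proof -
  let ?k = "rot (wedge yb xb) (4 * pi * t)" and ?\<theta> = "4 * pi * t"
  have ang: "2 * pi * w 1 * t = ?\<theta>" "2 * pi * w 2 * t = \<epsilon> * ?\<theta>" "2 * pi * w 3 * t = \<epsilon>' * ?\<theta>"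
    "2 * pi * w 4 * t = 0" "2 * pi * w 5 * t = 0"
    by (simp_all add: w_def)
  have tr: "cos (\<epsilon> * ?\<theta>) = cos ?\<theta>" "cos (\<epsilon>' * ?\<theta>) = cos ?\<theta>" "sin (\<epsilon> * ?\<theta>) = \<epsilon> * sin ?\<theta>" "sin (\<epsilon>' * ?\<theta>) = \<epsilon>' * sin ?\<theta>"
    and sq: "\<epsilon> * \<epsilon> = 1" "\<epsilon>' * \<epsilon>' = 1"
    using assms(3,4) by auto
  have lin: "?k ** (X + Y) ** transpose ?k = ?k ** X ** transpose ?k + ?k ** Y ** transpose ?k"
    "?k ** (X - Y) ** transpose ?k = ?k ** X ** transpose ?k - ?k ** Y ** transpose ?k" for X Y
    by (simp_all add: matrix_algebra)
  have wl: "wedge (x + y) z = wedge x z + wedge y z" "wedge (x - y) z = wedge x z - wedge y z" "wedge (c *\<^sub>R x) z = c *\<^sub>R wedge x z"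
    "wedge z (x + y) = wedge z x + wedge z y" "wedge z (x - y) = wedge z x - wedge z y" "wedge z (c *\<^sub>R x) = c *\<^sub>R wedge z x"
    for x y z :: "real^((1 + 2) + (1 + 2))" and c
    by (simp_all add: wedge_def outer_simps algebra_simps)
  have "\<forall>i. ?k ** base_frame i ** transpose ?k =
    cos (2 * pi * w i * t) *\<^sub>R base_frame i + sin (2 * pi * w i * t) *\<^sub>R J0 \<alpha> \<beta> (base_frame i)"
    unfolding forall_5 ang tr J0_base_frame assms(1,2) scaleR_scaleR unfolding base_frame_simps lin conj_wedge rot_vector wl
    using sq by (simp add: mult.assoc mult.left_commute[of \<epsilon>] mult.left_commute[of \<epsilon>'] scaleR_add_right scaleR_diff_right)
  then show ?thesis by blast
qed

lemma J_frame_family: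
  assumes ab: "\<alpha> + \<beta> = \<epsilon>" "\<alpha> - \<beta> = \<epsilon>'" "\<epsilon> = of_int m" "\<epsilon>' = of_int m'" "m \<in> {1, -1}" "m' \<in> {1, -1}"
  shows "frame_family U1xU2 (J_acs \<alpha> \<beta>) (\<lambda>i. if i = 1 then 2 else if i = 2 then 2 * m else if i = 3 then 2 * m' else 0)
     (\<lambda>x. coset U1xU2 (homotopy_map x))
     (\<lambda>i x. fund U1xU2 (homotopy_map x ** base_frame i ** transpose (homotopy_map x)) (coset U1xU2 (homotopy_map x)))"
proof -
  let ?w = "\<lambda>i :: 5. if i = 1 then 2 else if i = 2 then 2 * m else if i = 3 then 2 * m' else 0 :: int"
  have wr: "real_of_int (?w i) = (if i = 1 then 2 else if i = 2 then 2 * \<epsilon> else if i = 3 then 2 * \<epsilon>' else 0)" for i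
    by (simp add: ab)
  have eps: "\<epsilon> \<in> {1, -1}" "\<epsilon>' \<in> {1, -1}" "\<alpha> + \<beta> \<noteq> 0" "\<alpha> - \<beta> \<noteq> 0" using ab by auto
  let ?H = "\<lambda>x. coset U1xU2 (homotopy_map x)"
  let ?v = "\<lambda>i x. fund U1xU2 (homotopy_map x ** base_frame i ** transpose (homotopy_map x)) (?H x)"
  have Jv: "J_acs \<alpha> \<beta> (?H x) (?v i x) = fund U1xU2 (homotopy_map x ** J0 \<alpha> \<beta> (base_frame i) ** transpose (homotopy_map x)) (?H x)" for i x
    by (rule J_fund_coset[OF skew_base_frame homotopy_map_SO])
  note HM = coset_mem[OF homotopy_map_SO, where K = U1xU2]
  have ind: "\<forall>i. a i = 0 \<and> b i = 0"
    if z: "\<forall>f\<in>smooth_on_cosets U1xU2. (\<Sum>i\<in>UNIV. a i * ?v i x f + b i * J_acs \<alpha> \<beta> (?H x) (?v i x) f) = 0" for x a b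
  proof
    fix i
    define g where "g = homotopy_map x"
    have g: "g \<in> SOn" by (simp add: g_def homotopy_map_SO)
    let ?Y = "\<Sum>i\<in>UNIV. a i *\<^sub>R base_frame i + b i *\<^sub>R J0 \<alpha> \<beta> (base_frame i)"
    have skt: "skew (a i *\<^sub>R base_frame i)" "skew (b i *\<^sub>R J0 \<alpha> \<beta> (base_frame i))" for i
      by (intro skew_scaleR skew_base_frame skew_J0)+
    have Y: "skew ?Y" by (intro skew_sum skew_add skt)
    have dist: "g ** (\<Sum>i\<in>I. Z i) ** transpose g = (\<Sum>i\<in>I. g ** Z i ** transpose g)" for Z and I :: "5 set"
      by (induction I rule: infinite_finite_induct) (simp_all add: matrix_algebra)
    have "fund U1xU2 (g ** ?Y ** transpose g) (coset U1xU2 g) f = 0" for f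
    proof (cases "f \<in> smooth_on_cosets U1xU2")
      case True
      let ?S = "\<Sum>i\<in>UNIV. a i *\<^sub>R (g ** base_frame i ** transpose g) + b i *\<^sub>R (g ** J0 \<alpha> \<beta> (base_frame i) ** transpose g)"
      have e1: "g ** ?Y ** transpose g = (\<Sum>i\<in>UNIV. a i *\<^sub>R (g ** base_frame i ** transpose g) + b i *\<^sub>R (g ** J0 \<alpha> \<beta> (base_frame i) ** transpose g))"
        unfolding dist by (rule sum.cong) (simp_all add: matrix_algebra)
      have e2: "fund U1xU2 ?S (coset U1xU2 g) f = (\<Sum>i\<in>UNIV. a i * ?v i x f + b i * J_acs \<alpha> \<beta> (?H x) (?v i x) f)"
      proof (subst fund_sum[OF coset_mem[OF g]])
        show "skew (a i *\<^sub>R (g ** base_frame i ** transpose g) + b i *\<^sub>R (g ** J0 \<alpha> \<beta> (base_frame i) ** transpose g))" for i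
          by (intro skew_add skew_scaleR skew_conj skew_base_frame skew_J0)
      qed (rule sum.cong[OF refl], unfold Jv g_def,
          simp add: fund_add[OF _ _ HM] fund_scaleR[OF _ HM] skew_scaleR skew_conj skew_base_frame skew_J0)
      show ?thesis unfolding e1 e2 by (rule bspec[OF z True])
    qed (simp add: fund_def)
    then have "fund U1xU2 (g ** ?Y ** transpose g) (coset U1xU2 g) = fund U1xU2 0 (coset U1xU2 g)"
      by (intro ext) (simp only: fund_0[OF coset_mem[OF g]])
    from fund_eqD[OF skew_conj[OF Y] skew_0 coset_mem[OF g] this]
    have c: "(g ** ?Y ** transpose g) ** (g ** B0 ** transpose g) = (g ** B0 ** transpose g) ** (g ** ?Y ** transpose g)"
      "(g ** ?Y ** transpose g) ** (g ** C0 ** transpose g) = (g ** C0 ** transpose g) ** (g ** ?Y ** transpose g)"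
      by (simp_all add: emb_coset[OF g])
    have c': "?Y ** A = A ** ?Y"
      if eq: "(g ** ?Y ** transpose g) ** (g ** A ** transpose g) = (g ** A ** transpose g) ** (g ** ?Y ** transpose g)" for A
    proof -
      have "transpose g ** ((g ** ?Y ** transpose g) ** (g ** A ** transpose g)) ** g = ?Y ** A"
        "transpose g ** ((g ** A ** transpose g) ** (g ** ?Y ** transpose g)) ** g = A ** ?Y"
        using g by (simp_all only: matrix_mul_assoc[symmetric] SO_orthogonal matrix_mul_rid)
      then show ?thesis using eq by simp
    qed
    show "a i = 0 \<and> b i = 0"
      by (rule base_frame_independent[OF eps(3,4) c'[OF c(1)] c'[OF c(2)] refl])
  qed
  \<comment> \<open>The circle consists of elements of the stabilizer, so on the side s = 0 only the
    frame moves, not the point.\<close>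
  have coset_rot: "coset U1xU2 (rot (wedge yb xb) \<theta>) = coset U1xU2 (mat 1)" for \<theta>
  proof -
    have cs: "cos \<theta> * (cos \<theta> * z) + sin \<theta> * (sin \<theta> * z) = z" for z
      by (simp only: mult.assoc[symmetric] distrib_right[symmetric] sin_cos_squared_add3 mult_1_left)
    have "rot (wedge yb xb) \<theta> ** B0 ** transpose (rot (wedge yb xb) \<theta>) = B0"
      "rot (wedge yb xb) \<theta> ** C0 ** transpose (rot (wedge yb xb) \<theta>) = C0"
    proof -
      have "rot (wedge yb xb) \<theta> ** B0 ** transpose (rot (wedge yb xb) \<theta>) =
        wedge (cos \<theta> *\<^sub>R yb - sin \<theta> *\<^sub>R xb) (cos \<theta> *\<^sub>R xb + sin \<theta> *\<^sub>R yb) + wedge yc xc"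
        unfolding B0_def matrix_add_ldistrib bounded_bilinear.add_left[OF bounded_bilinear_matrix_mul] conj_wedge rot_vector ..
      also have "wedge (cos \<theta> *\<^sub>R yb - sin \<theta> *\<^sub>R xb) (cos \<theta> *\<^sub>R xb + sin \<theta> *\<^sub>R yb) =
          (cos \<theta> * cos \<theta> + sin \<theta> * sin \<theta>) *\<^sub>R wedge yb xb"
        by (simp add: vec_eq_iff wedge_nth algebra_simps cs)
      finally show "rot (wedge yb xb) \<theta> ** B0 ** transpose (rot (wedge yb xb) \<theta>) = B0"
        by (simp add: B0_def flip: power2_eq_square)
      show "rot (wedge yb xb) \<theta> ** C0 ** transpose (rot (wedge yb xb) \<theta>) = C0"
        unfolding C0_def conj_wedge rot_vector ..
    qed
    then show ?thesis by (simp add: coset_eq_iff[OF rot_axis_SO(2) SO_closed(1)])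
  qed
  have H0: "?H (0, t) = coset U1xU2 (mat 1)" for t
    by (simp add: homotopy_map_boundary coset_rot)
  have v0: "?v i (0, t) = (\<lambda>f. cos (2 * pi * ?w i * t) * ?v i (0, 0) f + sin (2 * pi * ?w i * t) * J_acs \<alpha> \<beta> (?H (0, 0)) (?v i (0, 0)) f)" for i t
  proof -
    let ?p = "coset U1xU2 (mat 1)"
    have p: "?p \<in> cosets U1xU2" by (intro coset_mem SO_closed)
    have "?v i (0, t) = fund U1xU2 (cos (2 * pi * ?w i * t) *\<^sub>R base_frame i + sin (2 * pi * ?w i * t) *\<^sub>R J0 \<alpha> \<beta> (base_frame i)) ?p"
      unfolding homotopy_map_boundary(4) coset_rot wr rot_base_frame[OF ab(1,2) eps(1,2)] ..
    moreover have "?v i (0, 0) = fund U1xU2 (base_frame i) ?p"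
      by (simp add: homotopy_map_boundary(1))
    moreover have "J_acs \<alpha> \<beta> (?H (0, 0)) (?v i (0, 0)) = fund U1xU2 (J0 \<alpha> \<beta> (base_frame i)) ?p"
      unfolding Jv by (simp add: homotopy_map_boundary(1))
    ultimately show ?thesis
      by (auto simp: fund_add[OF _ _ p] fund_scaleR[OF _ p] skew_scaleR skew_base_frame skew_J0)
  qed
  have cH: "continuous_on S (\<lambda>x. f (?H x))" if "f \<in> smooth_on_cosets U1xU2" for f S
  proof -
    have "continuous_on SOn (\<lambda>g. f (coset U1xU2 g))"
      using that unfolding smooth_on_cosets_iff by (rule smooth_fun_on_imp_continuous_on)
    then show ?thesis
      by (rule continuous_on_compose2[OF _ continuous_on_homotopy_map]) (use homotopy_map_SO in auto)
  qed
  have cv: "continuous_on S (\<lambda>x. ?v i x f)" if "f \<in> smooth_on_cosets U1xU2" for f S i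
    by (rule continuous_on_compose2[OF smooth_fun_on_imp_continuous_on[OF fund_conj_smooth[OF that skew_base_frame]]
          continuous_on_homotopy_map]) (use homotopy_map_SO in auto)
  show ?thesis
    unfolding frame_family_def
  proof (intro conjI ballI allI impI)
    fix x :: "real \<times> real"
    show "?H x \<in> cosets U1xU2" by (rule HM)
    show "?v i x \<in> tangents U1xU2 (?H x)" for i by (intro fund_tangent skew_conj skew_base_frame HM)
    show "a i = 0" "b i = 0" if "\<forall>f\<in>smooth_on_cosets U1xU2. (\<Sum>i\<in>UNIV. a i * ?v i x f + b i * J_acs \<alpha> \<beta> (?H x) (?v i x) f) = 0" for a b i
      using ind[OF that] by blast+
  next
    fix t :: real and i
    show "?v i (0, t) = (\<lambda>f. cos (2 * pi * ?w i * t) * ?v i (0, 0) f + sin (2 * pi * ?w i * t) * J_acs \<alpha> \<beta> (?H (0, 0)) (?v i (0, 0)) f)"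
      by (rule v0)
  qed (simp_all only: H0 homotopy_map_boundary(1-3) cH cv)
qed

subsection \<open>Lifting a square to the group\<close>

lemma inner_conj_SO:
  assumes a: "a \<in> SOn"
  shows "(a ** A ** transpose a) \<bullet> (a ** A ** transpose a) = A \<bullet> (A :: real^'n^'n)"
proof -
  have tr: "M \<bullet> M = trace (transpose M ** M)" for M :: "real^'n^'n"
    unfolding inner_vec_def trace_def matrix_matrix_mult_def transpose_def inner_real_def
    by (simp add: sum.swap[of "\<lambda>i j. M $ i $ j * M $ i $ j"])
  have "trace (transpose (a ** A ** transpose a) ** (a ** A ** transpose a)) = trace (a ** (transpose A ** A ** transpose a))"
    using a by (simp add: matrix_transpose_mul_real matrix_algebra SO_orthogonal)
  also have "\<dots> = trace ((transpose A ** A ** transpose a) ** a)" by (rule trace_mul_sym)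
  also have "\<dots> = trace (transpose A ** A)" using a by (simp add: matrix_algebra SO_orthogonal)
  finally show ?thesis by (simp only: tr)
qed

text \<open>Conjugation being isometric, one radius for the domain of the section works at every
  point of the orbit.\<close>

lemma dist_conj_pair:
  assumes a: "a \<in> SOn"
  shows "dist (conj_pair a x) (conj_pair a y) = dist x y"
proof -
  have "conj_pair a x - conj_pair a y = conj_pair a (x - y)"
    by (simp add: linear_diff[OF bounded_linear.linear[OF bounded_linear_conj_pair]])
  moreover have "norm (conj_pair a z) = norm z" for z
    unfolding conj_pair_def norm_Pair norm_prod_def by (simp add: power2_norm_eq_inner inner_conj_SO[OF a])
  ultimately show ?thesis by (simp add: dist_norm)
qed

lemma continuous_on_mat_iff: "continuous_on S A \<longleftrightarrow> (\<forall>i j. continuous_on S (\<lambda>x. A x $ i $ j))"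
  for A :: "'a::topological_space \<Rightarrow> real^'n^'m"
proof
  assume "continuous_on S A"
  then show "\<forall>i j. continuous_on S (\<lambda>x. A x $ i $ j)" by (auto intro!: continuous_on_component)
next
  assume "\<forall>i j. continuous_on S (\<lambda>x. A x $ i $ j)"
  then have "continuous_on S (\<lambda>x. \<chi> i j. A x $ i $ j)" by (intro continuous_on_vec_lambda) auto
  then show "continuous_on S A" by simp
qed

lemma continuous_on_transpose: "continuous_on S A \<Longrightarrow> continuous_on S (\<lambda>x. transpose (A x))"
  for A :: "'a::topological_space \<Rightarrow> real^'n^'m"
  by (simp add: continuous_on_mat_iff transpose_def)

text \<open>The square is shrunk to its corner: the maps x \<mapsto> H (k x / N) lead from a
  constant to \<open>H\<close>, and consecutive ones are uniformly close. A lift of one becomes a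
  lift of the next by right multiplication with the section, after moving back to the base pair by
  the transposed lift.\<close>

lemma continuous_lift:
  fixes H :: "real \<times> real \<Rightarrow> mat6 set"
  assumes H: "\<And>x. x \<in> unit_square \<Longrightarrow> H x \<in> cosets U1xU2"
    and cont: "\<And>f. f \<in> smooth_on_cosets U1xU2 \<Longrightarrow> continuous_on unit_square (\<lambda>x. f (H x))"
  obtains g where "continuous_on unit_square g" "\<And>x. x \<in> unit_square \<Longrightarrow> g x \<in> SOn"
    "\<And>x. x \<in> unit_square \<Longrightarrow> coset U1xU2 (g x) = H x"
proof -
  let ?P = "\<lambda>x. emb (H x)"
  have "continuous_on unit_square (\<lambda>x. ?P x \<bullet> b)" for b
    by (rule cont, rule smooth_emb, intro C_k_on_bounded_linear bounded_linear_inner_left) auto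
  then have cP: "continuous_on unit_square ?P" by (subst continuous_on_componentwise) auto
  have compact: "compact unit_square" by (intro compact_Times compact_Icc)
  obtain e where e: "e > 0" "ball base e \<subseteq> section_nbhd"
    using open_section_nbhd section_base(1) by (auto elim: openE)
  obtain d where d: "d > 0" "\<And>x y. x \<in> unit_square \<Longrightarrow> y \<in> unit_square \<Longrightarrow> dist y x < d \<Longrightarrow> dist (?P y) (?P x) < e"
    using compact_uniformly_continuous[OF cP compact, unfolded uniformly_continuous_on_def, rule_format, OF e(1)]
    by (elim exE conjE) (rule that, assumption, blast)
  \<comment> \<open>Points of the square have norm at most 2, so consecutive dilations by k / N move
    them by at most 2 / N.\<close>
  obtain N where N: "real N > 2 / d" using reals_Archimedean2 by blast
  have N0: "real N > 0" by (rule less_trans[OF _ N]) (use d(1) in simp)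
  let ?c = "\<lambda>k x. (real k / real N) *\<^sub>R (x :: real \<times> real)"
  have cQ: "?c k x \<in> unit_square" if "k \<le> N" "x \<in> unit_square" for k x
  proof -
    have "0 \<le> real k / real N" "real k / real N \<le> 1" using that N0 by auto
    then have "0 \<le> real k / real N * z \<and> real k / real N * z \<le> 1" if "z \<in> {0..1}" for z
      using that by (auto intro!: mult_le_one simp del: times_divide_eq_left)
    from this[of "fst x"] this[of "snd x"] show ?thesis using that(2) by (simp add: mem_Times_iff)
  qed
  have cd: "dist (?c (Suc k) x) (?c k x) < d" if x: "x \<in> unit_square" for k x
  proof -
    have "?c (Suc k) x - ?c k x = (1 / real N) *\<^sub>R x"
      by (simp add: add_divide_distrib scaleR_add_left)
    then have "dist (?c (Suc k) x) (?c k x) = norm x / real N" by (simp add: dist_norm)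
    also have "norm x \<le> 2"
      using x norm_Pair_le[of "fst x" "snd x"] by (auto simp: mem_Times_iff)
    then have "norm x / real N \<le> 2 / real N" using N0 by (simp add: divide_right_mono)
    also have "\<dots> < d" using N N0 d(1) by (simp add: field_simps)
    finally show ?thesis .
  qed
  have step: "\<exists>g. continuous_on unit_square g \<and> (\<forall>x\<in>unit_square. g x \<in> SOn \<and> coset U1xU2 (g x) = H (?c k x))"
    if "k \<le> N" for k
    using that
  proof (induction k)
    case 0
    have "H (0, 0) \<in> cosets U1xU2" by (rule H) simp
    then obtain a where "a \<in> SOn" "H (0, 0) = coset U1xU2 a" by (auto simp: cosets_iff)
    then show ?case by (intro exI[of _ "\<lambda>x. a"]) (auto simp: zero_prod_def)
  next
    case (Suc k)
    then obtain g where g: "continuous_on unit_square g" "\<And>x. x \<in> unit_square \<Longrightarrow> g x \<in> SOn"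
      "\<And>x. x \<in> unit_square \<Longrightarrow> coset U1xU2 (g x) = H (?c k x)"
      by auto
    let ?y = "\<lambda>x. conj_pair (transpose (g x)) (?P (?c (Suc k) x))"
    have nb: "?y x \<in> section_nbhd" if x: "x \<in> unit_square" for x
    proof -
      have "conj_pair (transpose (g x)) (?P (?c k x)) = conj_pair (transpose (g x) ** g x) base"
        unfolding g(3)[OF x, symmetric] emb_eq[OF g(2)[OF x]] by (simp add: conj_pair_mult)
      then have b: "conj_pair (transpose (g x)) (?P (?c k x)) = base"
        using g(2)[OF x] by (simp add: SO_orthogonal) (simp add: conj_pair_def)
      have "dist (?P (?c (Suc k) x)) (?P (?c k x)) < e"
        using Suc.prems x by (intro d(2) cd cQ) auto
      then have "dist (?y x) base < e"
        unfolding b[symmetric] dist_conj_pair[OF SO_closed(3)[OF g(2)[OF x]]] .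
      then show ?thesis using e(2) by (auto simp: dist_commute)
    qed
    let ?g = "\<lambda>x. g x ** section_map (?y x)"
    have "continuous_on unit_square (\<lambda>x. ?P (?c (Suc k) x))"
      by (rule continuous_on_compose2[OF cP]) (use cQ[OF Suc.prems] in \<open>auto intro!: continuous_intros\<close>)
    then have "continuous_on unit_square ?y"
      unfolding conj_pair_def
      by (intro continuous_on_Pair continuous_on_matrix_mul continuous_on_transpose g(1) continuous_on_fst continuous_on_snd)
    then have "continuous_on unit_square (\<lambda>x. section_map (?y x))"
      by (rule continuous_on_compose2[OF continuous_on_section_map]) (use nb in \<open>auto simp: section_nbhd_def\<close>)
    then have c: "continuous_on unit_square ?g" by (intro continuous_on_matrix_mul g(1))
    have "?g x \<in> SOn \<and> coset U1xU2 (?g x) = H (?c (Suc k) x)" if x: "x \<in> unit_square" for x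
    proof -
      obtain a where a: "a \<in> SOn" "H (?c (Suc k) x) = coset U1xU2 a"
        using H[OF cQ[OF Suc.prems x]] by (auto simp: cosets_iff)
      have ga: "transpose (g x) ** a \<in> SOn" using a(1) g(2)[OF x] by (simp add: SO_closed)
      have y: "?y x = conj_pair (transpose (g x) ** a) base"
        unfolding a(2) emb_eq[OF a(1)] by (simp add: conj_pair_mult)
      note s = section_nbhd_coset[OF ga nb[OF x, unfolded y], folded y]
      have "coset U1xU2 (?g x) = coset (coset U1xU2 (transpose (g x) ** a)) (g x)"
        unfolding s(2)[symmetric] by (simp only: coset_assoc)
      also have "\<dots> = coset U1xU2 a" using g(2)[OF x] by (simp add: coset_assoc SO_orthogonal)
      finally show ?thesis using s(1) g(2)[OF x] a(2) by (simp add: SO_closed)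
    qed
    then show ?case using c by (intro exI[of _ ?g]) auto
  qed
  from step[of N] obtain g where "continuous_on unit_square g"
    "\<And>x. x \<in> unit_square \<Longrightarrow> g x \<in> SOn \<and> coset U1xU2 (g x) = H (?c N x)" by auto
  moreover have "?c N x = x" for x using N0 by simp
  ultimately show thesis using that by metis
qed

subsection \<open>Complex coordinates on the isotropy representation\<close>

definition cmat :: "real^'n^'m \<Rightarrow> complex^'n^'m" where
  "cmat A = (\<chi> i j. of_real (A $ i $ j))"

lemma cmat_mul: "cmat (A ** B) = cmat A ** cmat B"
  by (simp add: cmat_def vec_eq_iff matrix_matrix_mult_def)

lemma cmat_transpose: "cmat (transpose A) = transpose (cmat A)"
  by (simp add: cmat_def vec_eq_iff transpose_def)

lemma cmat_1: "cmat (mat 1) = mat 1"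
  by (simp add: cmat_def vec_eq_iff mat_def)

text \<open>Bilinear rather than Hermitian: coordinates are to be complex linear in both vectors,
  and a real matrix then moves across as its transpose.\<close>

definition cdot :: "complex^'n \<Rightarrow> complex^'n \<Rightarrow> complex" where
  "cdot u w = (\<Sum>i\<in>UNIV. u $ i * w $ i)"

lemma cdot_transpose: "cdot u (transpose A *v w) = cdot (A *v u) w"
  unfolding cdot_def matrix_vector_mult_def transpose_def vec_lambda_beta sum_distrib_left sum_distrib_right
  by (subst sum.swap) (simp add: mult_ac)

definition cform :: "real^'n^'n \<Rightarrow> complex^'n \<Rightarrow> complex^'n \<Rightarrow> complex" where
  "cform X u w = cdot u (cmat X *v w)"

lemma cform_conj: "cform (transpose k ** X ** k) u w = cform X (cmat k *v u) (cmat k *v w)"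
  by (simp only: cform_def cmat_mul cmat_transpose matrix_vector_mul_assoc[symmetric] cdot_transpose)

lemma cform_sum: "cform X u w = (\<Sum>i\<in>UNIV. \<Sum>j\<in>UNIV. u $ i * (of_real (X $ i $ j) * w $ j))"
  by (simp add: cform_def cdot_def cmat_def matrix_vector_mult_def sum_distrib_left)

lemma cform_linear:
  "cform (X + Y) u w = cform X u w + cform Y u w" "cform (X - Y) u w = cform X u w - cform Y u w"
  "cform (c *\<^sub>R X) u w = of_real c * cform X u w"
  "cform X (u + u') w = cform X u w + cform X u' w" "cform X u (w + w') = cform X u w + cform X u w'"
  "cform X (a *s u) w = a * cform X u w" "cform X u (a *s w) = a * cform X u w"
  by (simp_all add: cform_sum algebra_simps sum.distrib sum_subtractf sum_distrib_left)

lemma cform_skew: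
  assumes "skew X"
  shows "cform X w u = - cform X u w"
proof -
  have "cform X w u = (\<Sum>i\<in>UNIV. \<Sum>j\<in>UNIV. w $ j * (of_real (X $ j $ i) * u $ i))"
    unfolding cform_sum by (rule sum.swap)
  also have "\<dots> = (\<Sum>i\<in>UNIV. \<Sum>j\<in>UNIV. - (u $ i * (of_real (X $ i $ j) * w $ j)))"
    by (intro sum.cong refl) (subst skew_nth[OF assms], simp)
  finally show ?thesis by (simp add: cform_sum sum_negf)
qed

text \<open>Eigenvectors with eigenvalue -\<i> of \<open>C0\<close> (for \<open>ua\<close>) and of
  \<open>B0\<close> (for \<open>ub\<close> and \<open>uc\<close>), and with eigenvalue \<i> of
  \<open>C0\<close> (for \<open>va\<close>).\<close>

abbreviation ua :: "complex^((1 + 2) + (1 + 2))" where "ua \<equiv> \<chi> i. Complex (xa $ i) (ya $ i)"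
abbreviation va :: "complex^((1 + 2) + (1 + 2))" where "va \<equiv> \<chi> i. Complex (xa $ i) (- (ya $ i))"
abbreviation ub :: "complex^((1 + 2) + (1 + 2))" where "ub \<equiv> \<chi> i. Complex (xb $ i) (yb $ i)"
abbreviation uc :: "complex^((1 + 2) + (1 + 2))" where "uc \<equiv> \<chi> i. Complex (xc $ i) (yc $ i)"

text \<open>\<open>J_acs 1 0\<close> is multiplication by \<open>\<i>\<close> in these coordinates.\<close>

definition coord :: "mat6 \<Rightarrow> complex^5" where
  "coord X = (\<chi> j. if j = 1 then cform X ub uc else if j = 2 then cform X ua ub
     else if j = 3 then cform X ua uc else if j = 4 then cform X va ub else cform X va uc)"

lemma coord_nth:
  "coord X $ 1 = cform X ub uc" "coord X $ 2 = cform X ua ub" "coord X $ 3 = cform X ua uc"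
  "coord X $ 4 = cform X va ub" "coord X $ 5 = cform X va uc"
  by (simp_all add: coord_def)

lemma coord_linear:
  "coord (X + Y) = coord X + coord Y" "coord (X - Y) = coord X - coord Y" "coord (c *\<^sub>R X) = of_real c *s coord X"
  unfolding vec_eq_iff forall_5 by (simp_all add: coord_nth cform_linear)

lemma cform_explicit:
  "cform X ub uc = Complex (X $ Inl (Inr 1) $ Inl (Inr 2) - X $ Inr (Inr 1) $ Inr (Inr 2))
      (X $ Inl (Inr 1) $ Inr (Inr 2) + X $ Inr (Inr 1) $ Inl (Inr 2))"
  "cform X ua ub = Complex (X $ Inl (Inl 1) $ Inl (Inr 1) - X $ Inr (Inl 1) $ Inr (Inr 1))
      (X $ Inl (Inl 1) $ Inr (Inr 1) + X $ Inr (Inl 1) $ Inl (Inr 1))"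
  "cform X ua uc = Complex (X $ Inl (Inl 1) $ Inl (Inr 2) - X $ Inr (Inl 1) $ Inr (Inr 2))
      (X $ Inl (Inl 1) $ Inr (Inr 2) + X $ Inr (Inl 1) $ Inl (Inr 2))"
  "cform X va ub = Complex (X $ Inl (Inl 1) $ Inl (Inr 1) + X $ Inr (Inl 1) $ Inr (Inr 1))
      (X $ Inl (Inl 1) $ Inr (Inr 1) - X $ Inr (Inl 1) $ Inl (Inr 1))"
  "cform X va uc = Complex (X $ Inl (Inl 1) $ Inl (Inr 2) + X $ Inr (Inl 1) $ Inr (Inr 2))
      (X $ Inl (Inl 1) $ Inr (Inr 2) - X $ Inr (Inl 1) $ Inl (Inr 2))"
  by (simp_all add: cform_sum sum_6 axis_def complex_eq_iff)

lemma coord_J0: "coord (J0 1 0 X) = \<i> *s coord X"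
  unfolding vec_eq_iff forall_5 J0_eq
  by (simp add: coord_nth cform_explicit base_mult_nth base_proj_nth complex_eq_iff) (simp add: field_simps)

lemma coord_commutant:
  assumes "X ** B0 = B0 ** X" "X ** C0 = C0 ** X"
  shows "coord X = 0"
  unfolding vec_eq_iff forall_5
  by (simp add: coord_nth cform_explicit commutant_nth[OF assms] complex_eq_iff)

text \<open>On skew matrices the kernel of \<open>coord\<close> is the stabilizer algebra, by this
  and \<open>coord_commutant\<close>; so \<open>coord\<close> gives coordinates on the tangent
  space.\<close>

lemma coord_0_commutant:
  assumes X: "skew X" and z: "coord X = 0"
  shows "X ** B0 = B0 ** X" "X ** C0 = C0 ** X"
proof -
  have "coord X $ j = 0" for j by (simp add: z)
  from this[of 1] this[of 2] this[of 3] this[of 4] this[of 5]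
  have e: "X $ Inr (Inr 1) $ Inr (Inr 2) = X $ Inl (Inr 1) $ Inl (Inr 2)"
    "X $ Inr (Inr 1) $ Inl (Inr 2) = - X $ Inl (Inr 1) $ Inr (Inr 2)"
    "X $ Inl (Inl 1) $ Inl (Inr m) = 0" "X $ Inr (Inl 1) $ Inr (Inr m) = 0"
    "X $ Inl (Inl 1) $ Inr (Inr m) = 0" "X $ Inr (Inl 1) $ Inl (Inr m) = 0" for m
    using exhaust_2[of m] by (auto simp: coord_nth cform_explicit complex_eq_iff)
  note s = skew_nth[OF X]
  have d: "X $ i $ i = 0" for i using s[of i i] by simp
  have e': "X $ Inr (Inr 2) $ Inr (Inr 1) = - X $ Inl (Inr 1) $ Inl (Inr 2)"
    "X $ Inl (Inr 2) $ Inr (Inr 1) = X $ Inl (Inr 1) $ Inr (Inr 2)"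
    "X $ Inl (Inr 2) $ Inl (Inr 1) = - X $ Inl (Inr 1) $ Inl (Inr 2)"
    "X $ Inr (Inr 2) $ Inl (Inr 1) = - X $ Inl (Inr 1) $ Inr (Inr 2)"
    "X $ Inl (Inr m) $ Inl (Inl 1) = 0" "X $ Inr (Inr m) $ Inr (Inl 1) = 0"
    "X $ Inr (Inr m) $ Inl (Inl 1) = 0" "X $ Inl (Inr m) $ Inr (Inl 1) = 0"
    "X $ Inr (Inl 1) $ Inl (Inl 1) = - X $ Inl (Inl 1) $ Inr (Inl 1)"
    "X $ Inr (Inr m) $ Inl (Inr m) = - X $ Inl (Inr m) $ Inr (Inr m)" for m
    using e s[of "Inr (Inr 2)" "Inr (Inr 1)"] s[of "Inl (Inr 2)" "Inr (Inr 1)"] s[of "Inl (Inr 2)" "Inl (Inr 1)"]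
      s[of "Inr (Inr 2)" "Inl (Inr 1)"] s[of "Inl (Inr m)" "Inl (Inl 1)"] s[of "Inr (Inr m)" "Inr (Inl 1)"]
      s[of "Inr (Inr m)" "Inl (Inl 1)"] s[of "Inl (Inr m)" "Inr (Inl 1)"] s[of "Inr (Inl 1)" "Inl (Inl 1)"]
      s[of "Inr (Inr m)" "Inl (Inr m)"]
    by simp_all
  show "X ** B0 = B0 ** X" "X ** C0 = C0 ** X"
    by (rule mat6_eqI; auto simp: base_mult_nth e e' d)+
qed

text \<open>Only the four permutations preserving the blocks {1}, {2, 3} and {4, 5} contribute to
  the Leibniz formula.\<close>

lemma det_blocks_1_2_2:
  fixes A :: "complex^5^5"
  assumes z: "\<And>j. j \<noteq> 1 \<Longrightarrow> A $ 1 $ j = 0" "\<And>i j. i \<in> {2, 3} \<Longrightarrow> j \<notin> {2, 3} \<Longrightarrow> A $ i $ j = 0"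
    "\<And>i j. i \<in> {4, 5} \<Longrightarrow> j \<notin> {4, 5} \<Longrightarrow> A $ i $ j = 0"
  shows "det A = A $ 1 $ 1 * (A $ 2 $ 2 * A $ 3 $ 3 - A $ 2 $ 3 * A $ 3 $ 2) * (A $ 4 $ 4 * A $ 5 $ 5 - A $ 4 $ 5 * A $ 5 $ 4)"
proof -
  let ?s = "Transposition.transpose (2 :: 5) 3" and ?t = "Transposition.transpose (4 :: 5) 5"
  let ?f = "\<lambda>p :: 5 \<Rightarrow> 5. of_int (sign p) * (\<Prod>i\<in>UNIV. A $ i $ p i)"
  let ?T = "{id, ?s, ?t, ?s \<circ> ?t}"
  have ps: "?s permutes UNIV" "?t permutes UNIV" by (simp_all add: permutes_swap_id)
  have TS: "?T \<subseteq> {p. p permutes UNIV}"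
    using ps by (auto simp: permutes_id intro!: permutes_compose)
  have out: "?f p = 0" if p: "p \<in> {p. p permutes UNIV} - ?T" for p
  proof (rule ccontr)
    assume "?f p \<noteq> 0"
    then have nz: "A $ i $ p i \<noteq> 0" for i by auto
    have inj: "p i = p j \<longleftrightarrow> i = j" for i j using p permutes_inj[of p UNIV] by (auto simp: inj_eq)
    have 1: "p 1 = 1" "p 2 \<in> {2, 3}" "p 3 \<in> {2, 3}" "p 4 \<in> {4, 5}" "p 5 \<in> {4, 5}"
      by (rule ccontr, use nz z in blast)+
    have ne: "p 2 \<noteq> p 3" "p 4 \<noteq> p 5" by (simp_all add: inj)
    have "p = q" if "p 1 = q 1" "p 2 = q 2" "p 3 = q 3" "p 4 = q 4" "p 5 = q 5" for q
    proof
      show "p i = q i" for i using exhaust_5[of i] that by auto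
    qed
    note eqI = this
    from 1(2-5) ne consider "p 2 = 2" "p 3 = 3" "p 4 = 4" "p 5 = 5" | "p 2 = 3" "p 3 = 2" "p 4 = 4" "p 5 = 5"
      | "p 2 = 2" "p 3 = 3" "p 4 = 5" "p 5 = 4" | "p 2 = 3" "p 3 = 2" "p 4 = 5" "p 5 = 4" by auto
    then have "p \<in> ?T"
    proof cases
      case 1 then have "p = id" using \<open>p 1 = 1\<close> by (intro eqI) auto
      then show ?thesis by blast
    next
      case 2 then have "p = ?s" using \<open>p 1 = 1\<close> by (intro eqI) (auto simp: Transposition.transpose_def)
      then show ?thesis by blast
    next
      case 3 then have "p = ?t" using \<open>p 1 = 1\<close> by (intro eqI) (auto simp: Transposition.transpose_def)
      then show ?thesis by blast
    next
      case 4 then have "p = ?s \<circ> ?t" using \<open>p 1 = 1\<close> by (intro eqI) (auto simp: Transposition.transpose_def)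
      then show ?thesis by blast
    qed
    then show False using p by blast
  qed
  have "det A = sum ?f ?T"
    unfolding det_def by (rule sum.mono_neutral_right[OF _ TS]) (use out in auto)
  also have "\<dots> = ?f id + ?f ?s + ?f ?t + ?f (?s \<circ> ?t)"
  proof -
    have "id \<noteq> ?s" "id \<noteq> ?t" "id \<noteq> ?s \<circ> ?t" "?s \<noteq> ?t" "?s \<noteq> ?s \<circ> ?t" "?t \<noteq> ?s \<circ> ?t"
      by ((rule notI, drule fun_cong[of _ _ 2], (simp add: Transposition.transpose_def; fail)) |
          (rule notI, drule fun_cong[of _ _ 4], (simp add: Transposition.transpose_def; fail)))+
    then show ?thesis by (simp add: add.assoc)
  qed
  finally have d: "det A = ?f id + ?f ?s + ?f ?t + ?f (?s \<circ> ?t)" .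
  have "sign ?s = - 1" "sign ?t = - 1" "sign (?s \<circ> ?t) = 1"
    by (simp_all add: sign_swap_id sign_compose permutation_swap_id)
  then show ?thesis
    unfolding d UNIV_5
    by (simp only: sign_id) (simp add: Transposition.transpose_def algebra_simps)
qed

subsection \<open>The winding obstruction for \<open>J_acs 1 0\<close>\<close>

text \<open>The ratio is a continuous function on an interval with values in the finite set of cube
  roots of unity.\<close>

lemma constant_root_ratio:
  fixes a b :: "real \<Rightarrow> 'i::finite \<Rightarrow> complex"
  assumes ca: "\<And>i. continuous_on {0..1} (\<lambda>t. a t i)" and cb: "\<And>i. continuous_on {0..1} (\<lambda>t. b t i)"
    and nz: "\<And>t. t \<in> {0..1} \<Longrightarrow> \<exists>i. b t i \<noteq> 0"
    and ratio: "\<And>t. t \<in> {0..1} \<Longrightarrow> \<exists>\<omega>. \<omega> ^ 3 = 1 \<and> (\<forall>i. a t i = \<omega> * b t i)"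
  shows "\<exists>\<omega>. \<forall>t\<in>{0..1}. \<forall>i. a t i = \<omega> * b t i"
proof -
  let ?n = "\<lambda>t. \<Sum>i\<in>UNIV. b t i * cnj (b t i)"
  \<comment> \<open>The Hermitian product with \<open>b t\<close> expresses the ratio by one
    continuous formula, although no single component of \<open>b t\<close> need be nonzero for all
    t.\<close>
  let ?R = "\<lambda>t. (\<Sum>i\<in>UNIV. a t i * cnj (b t i)) / ?n t"
  have n0: "?n t \<noteq> 0" if "t \<in> {0..1}" for t
  proof -
    have "?n t = of_real (\<Sum>i\<in>UNIV. (cmod (b t i))\<^sup>2)" by (simp only: of_real_sum complex_norm_square)
    moreover have "(\<Sum>i\<in>UNIV. (cmod (b t i))\<^sup>2) \<noteq> 0"
      using nz[OF that] by (auto simp: sum_nonneg_eq_0_iff)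
    ultimately show ?thesis by (metis of_real_eq_0_iff)
  qed
  have R: "?R t ^ 3 = 1 \<and> (\<forall>i. a t i = ?R t * b t i)" if t: "t \<in> {0..1}" for t
  proof -
    obtain \<omega> where w: "\<omega> ^ 3 = 1" "\<And>i. a t i = \<omega> * b t i" using ratio[OF t] by auto
    have "(\<Sum>i\<in>UNIV. a t i * cnj (b t i)) = \<omega> * ?n t" by (simp add: w(2) sum_distrib_left mult.assoc)
    then have "?R t = \<omega>" using n0[OF t] by simp
    then show ?thesis using w by simp
  qed
  have "finite (?R ` {0..1})"
    by (rule finite_subset[OF _ finite_roots_unity[of 3]]) (use R in blast, simp)
  then have "?R constant_on {0..1}"
    by (intro continuous_finite_range_constant continuous_on_divide continuous_on_sum continuous_on_mult
        continuous_on_cnj ca cb ballI n0 convex_connected convex_real_interval)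
  then obtain \<omega> where w: "\<And>t. t \<in> {0..1} \<Longrightarrow> ?R t = \<omega>" unfolding constant_on_def by blast
  have "a t i = \<omega> * b t i" if "t \<in> {0..1}" for t i using R[OF that] w[OF that] by simp
  then show ?thesis by blast
qed

text \<open>The right side closes up since its ratio is constant and 1 at t = 0. This fixes the
  constant ratio between the sides t = 1 and t = 0, hence the left side closes up as well. There the
  ratio is exp (-2 \<pi> \<i> d t / 3), whose value at t = 1 must be 1.\<close>

lemma winding_dvd_3:
  fixes \<zeta> :: "real \<times> real \<Rightarrow> 'i::finite \<Rightarrow> complex"
  assumes cont: "\<And>i. continuous_on unit_square (\<lambda>x. \<zeta> x i)"
    and nz: "\<And>x. x \<in> unit_square \<Longrightarrow> \<exists>i. \<zeta> x i \<noteq> 0"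
    and left: "\<And>t. t \<in> {0..1} \<Longrightarrow> \<exists>\<omega>. \<omega> ^ 3 = exp (- (\<i> * of_real (2 * pi * of_int d * t))) \<and> (\<forall>i. \<zeta> (0, t) i = \<omega> * \<zeta> (0, 0) i)"
    and ends: "\<And>t. t \<in> {0..1} \<Longrightarrow> \<exists>\<omega>. \<omega> ^ 3 = 1 \<and> (\<forall>i. \<zeta> (t, 1) i = \<omega> * \<zeta> (t, 0) i)"
    and right: "\<And>t. t \<in> {0..1} \<Longrightarrow> \<exists>\<omega>. \<omega> ^ 3 = 1 \<and> (\<forall>i. \<zeta> (1, t) i = \<omega> * \<zeta> (1, 0) i)"
  shows "3 dvd d"
proof -
  have c: "continuous_on {0..1} (\<lambda>t. \<zeta> (f t) i)" if "continuous_on {0..1} f" "f ` {0..1} \<subseteq> unit_square" for f :: "real \<Rightarrow> real \<times> real" and i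
    using continuous_on_compose2[OF cont that] .
  have one: "\<omega> = 1" if x: "x \<in> unit_square" and eq: "\<And>i. \<zeta> x i = \<omega> * \<zeta> x i" for \<omega> x
  proof -
    obtain i where "\<zeta> x i \<noteq> 0" using nz[OF x] by blast
    then show ?thesis using eq[of i] by simp
  qed
  have sides: "continuous_on {0..1} (\<lambda>t. \<zeta> (s, t) i)" "continuous_on {0..1} (\<lambda>t. \<zeta> (t, s) i)"
    if "s \<in> {0..1}" for s i
    by (rule c; use that in \<open>auto intro!: continuous_intros\<close>)+
  have n1: "\<exists>i. \<zeta> (1, 0) i \<noteq> 0" by (rule nz) simp
  have "\<exists>\<omega>. \<forall>t\<in>{0..1}. \<forall>i. \<zeta> (1, t) i = \<omega> * \<zeta> (1, 0) i"
  proof (rule constant_root_ratio[of "\<lambda>t. \<zeta> (1, t)" "\<lambda>t. \<zeta> (1, 0)"])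
    show "continuous_on {0..1} (\<lambda>t. \<zeta> (1, t) i)" for i by (rule sides) simp
  qed (rule continuous_on_const n1 right, assumption?)+
  then obtain \<omega>1 where w1: "\<And>t i. t \<in> {0..1} \<Longrightarrow> \<zeta> (1, t) i = \<omega>1 * \<zeta> (1, 0) i" by blast
  have "\<omega>1 = 1" by (rule one[of "(1, 0)"]) (use w1[of 0] in auto)
  then have r: "\<zeta> (1, 1) i = \<zeta> (1, 0) i" for i using w1[of 1] by simp
  have "\<exists>\<omega>. \<forall>t\<in>{0..1}. \<forall>i. \<zeta> (t, 1) i = \<omega> * \<zeta> (t, 0) i"
  proof (rule constant_root_ratio[of "\<lambda>t. \<zeta> (t, 1)" "\<lambda>t. \<zeta> (t, 0)"])
    show "continuous_on {0..1} (\<lambda>t. \<zeta> (t, 1) i)" "continuous_on {0..1} (\<lambda>t. \<zeta> (t, 0) i)" for i by (rule sides, simp)+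
    show "\<exists>i. \<zeta> (t, 0) i \<noteq> 0" if "t \<in> {0..1}" for t by (rule nz) (use that in simp)
  qed (rule ends, assumption)
  then obtain \<omega>2 where w2: "\<And>t i. t \<in> {0..1} \<Longrightarrow> \<zeta> (t, 1) i = \<omega>2 * \<zeta> (t, 0) i" by blast
  have "\<omega>2 = 1" by (rule one[of "(1, 0)"]) (use w2[of 1] r in auto)
  then have l: "\<zeta> (0, 1) i = \<zeta> (0, 0) i" for i using w2[of 0] by simp
  \<comment> \<open>This phase compensates the winding along the left side, so that only a cube root
    of unity remains as ratio.\<close>
  let ?e = "\<lambda>t. exp (\<i> * of_real (2 * pi * of_int d * t / 3))"
  have e3: "?e t ^ 3 = exp (\<i> * of_real (2 * pi * of_int d * t))" for t
    by (simp add: mult_ac flip: exp_of_nat_mult)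
  have "\<exists>\<omega>. \<forall>t\<in>{0..1}. \<forall>i. ?e t * \<zeta> (0, t) i = \<omega> * \<zeta> (0, 0) i"
  proof (rule constant_root_ratio[of "\<lambda>t i. ?e t * \<zeta> (0, t) i" "\<lambda>t. \<zeta> (0, 0)"])
    show "\<exists>\<omega>. \<omega> ^ 3 = 1 \<and> (\<forall>i. ?e t * \<zeta> (0, t) i = \<omega> * \<zeta> (0, 0) i)" if t: "t \<in> {0..1}" for t
    proof -
      obtain \<omega> where w: "\<omega> ^ 3 = exp (- (\<i> * of_real (2 * pi * of_int d * t)))" "\<And>i. \<zeta> (0, t) i = \<omega> * \<zeta> (0, 0) i"
        using left[OF t] by auto
      have "(?e t * \<omega>) ^ 3 = 1" unfolding power_mult_distrib e3 w(1) by (simp flip: exp_add)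
      then show ?thesis using w(2) by (intro exI[of _ "?e t * \<omega>"]) (simp add: mult.assoc)
    qed
    show "\<exists>i. \<zeta> (0, 0) i \<noteq> 0" by (rule nz) simp
    show "continuous_on {0..1} (\<lambda>t. ?e t * \<zeta> (0, t) i)" for i
      by (intro continuous_intros sides) auto
  qed simp
  then obtain \<omega>3 where w3: "\<And>t i. t \<in> {0..1} \<Longrightarrow> ?e t * \<zeta> (0, t) i = \<omega>3 * \<zeta> (0, 0) i" by blast
  have "\<omega>3 = 1" by (rule one[of "(0, 0)"]) (use w3[of 0] in auto)
  then have "?e 1 = 1" using w3[of 1] l by (intro one[of "(0, 0)"]) auto
  then obtain n :: int where "2 * pi * of_int d / 3 = of_int (2 * n) * pi" unfolding exp_eq_1 by auto
  then have "real_of_int d = real_of_int (3 * n)" by simp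
  then show ?thesis unfolding of_int_eq_iff by simp
qed

section \<open>Change of lift and the determinant of a frame\<close>

lemma cmat_commutant:
  fixes k :: mat6
  assumes k: "k \<in> SOn" "k ** B0 = B0 ** k" "k ** C0 = C0 ** k"
  obtains \<alpha> p q r s where "\<alpha> * cnj \<alpha> = 1" "cmat k *v ua = \<alpha> *s ua" "cmat k *v va = cnj \<alpha> *s va"
    "cmat k *v ub = p *s ub + q *s uc" "cmat k *v uc = r *s ub + s *s uc"
proof
  let ?\<alpha> = "Complex (k $ Inl (Inl 1) $ Inl (Inl 1)) (- (k $ Inr (Inl 1) $ Inl (Inl 1)))"
  let ?m = "\<lambda>i j. Complex (k $ Inl (Inr i) $ Inl (Inr j)) (- (k $ Inr (Inr i) $ Inl (Inr j)))"
  note n = commutant_nth[OF k(2,3)]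
  have "(transpose k ** k) $ Inl (Inl 1) $ Inl (Inl 1) = 1" using k(1) by (simp add: SO_orthogonal mat_def)
  then have "(k $ Inl (Inl 1) $ Inl (Inl 1))\<^sup>2 + (k $ Inr (Inl 1) $ Inl (Inl 1))\<^sup>2 = 1"
    by (simp add: matrix_matrix_mult_def transpose_def sum_6 n power2_eq_square)
  then show "?\<alpha> * cnj ?\<alpha> = 1" by (simp add: complex_eq_iff power2_eq_square)
  show "cmat k *v ua = ?\<alpha> *s ua" "cmat k *v va = cnj ?\<alpha> *s va"
    "cmat k *v ub = ?m 1 1 *s ub + ?m 2 1 *s uc" "cmat k *v uc = ?m 1 2 *s ub + ?m 2 2 *s uc"
    unfolding vec_eq_iff forall_6
    by (simp_all add: cmat_def matrix_vector_mult_def sum_6 n axis_def complex_eq_iff)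
qed

text \<open>Plucker coordinates of the complex plane spanned by the images of \<open>ub\<close> and
  \<open>uc\<close>. Another lift multiplies them by a character c of the stabilizer and
  \<open>frame_det\<close> by c^3; a cube root of \<open>frame_det\<close> can therefore be compared
  with them.\<close>

definition minors :: "mat6 \<Rightarrow> ((1 + 2) + (1 + 2)) \<times> ((1 + 2) + (1 + 2)) \<Rightarrow> complex" where
  "minors g = (\<lambda>(i, j). (cmat g *v ub) $ i * (cmat g *v uc) $ j - (cmat g *v uc) $ i * (cmat g *v ub) $ j)"

definition frame_det :: "mat6 \<Rightarrow> (5 \<Rightarrow> mat6) \<Rightarrow> complex" where
  "frame_det g V = det (\<chi> i. coord (transpose g ** V i ** g))"

text \<open>The inverse of \<open>g\<close> expresses the minors of \<open>ub\<close> and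
  \<open>uc\<close> linearly by those of their images, and one of the former is 1.\<close>

lemma minors_nonzero:
  assumes g: "g \<in> SOn"
  shows "\<exists>i. minors g i \<noteq> 0"
proof (rule ccontr)
  assume "\<not> ?thesis"
  then have z: "(cmat g *v ub) $ i * (cmat g *v uc) $ j = (cmat g *v uc) $ i * (cmat g *v ub) $ j" for i j
    by (auto simp: minors_def)
  have inverse: "cmat (transpose g) *v (cmat g *v u) = u" for u
    using g by (simp add: matrix_vector_mul_assoc SO_orthogonal cmat_1 flip: cmat_mul)
  have row: "u $ k = (\<Sum>i\<in>UNIV. cmat (transpose g) $ k $ i * (cmat g *v u) $ i)" for u k
    using arg_cong[OF inverse[of u], of "\<lambda>u. u $ k"] by (simp add: matrix_vector_mult_def)
  have pr: "u $ k * w $ l = (\<Sum>i\<in>UNIV. \<Sum>j\<in>UNIV. (cmat (transpose g) $ k $ i * cmat (transpose g) $ l $ j) *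
      ((cmat g *v u) $ i * (cmat g *v w) $ j))" for u w k l
    unfolding row[of u k] row[of w l] sum_product by (intro sum.cong refl) (simp only: mult_ac)
  have "ub $ k * uc $ l = uc $ k * ub $ l" for k l
    unfolding pr[of ub k uc l] pr[of uc k ub l] z ..
  from this[of "Inl (Inr 1)" "Inl (Inr 2)"] show False by (simp add: axis_def complex_eq_iff)
qed

text \<open>Here c is the determinant of the U(2) component. The coordinates transform by c, by
  \<alpha> times the U(2) block and by its conjugate \<open>cnj \<alpha>\<close> times the same
  block, with determinants c, \<alpha>^2 c and cnj \<alpha>^2 c. As \<alpha> has modulus 1, the
  product is c^3.\<close>

lemma lift_change:
  assumes g: "g \<in> SOn" "g' \<in> SOn" and eq: "coset U1xU2 g = coset U1xU2 g'"
  shows "\<exists>c. (\<forall>i. minors g' i = c * minors g i) \<and>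
    (\<forall>V. (\<forall>i. skew (V i)) \<longrightarrow> frame_det g' V = c ^ 3 * frame_det g V)"
proof -
  let ?k = "transpose g ** g'"
  have k: "?k \<in> SOn" using g by (simp add: SO_closed)
  have gk: "g' = g ** ?k" using g by (simp add: matrix_mul_assoc SO_orthogonal)
  have comm: "?k ** A = A ** ?k" if "g ** A ** transpose g = g' ** A ** transpose g'" for A :: mat6
  proof -
    have "transpose g ** (g ** A ** transpose g) ** g' = transpose g ** (g' ** A ** transpose g') ** g'"
      by (simp only: that)
    then show ?thesis using g by (simp add: matrix_algebra SO_orthogonal)
  qed
  have "?k ** B0 = B0 ** ?k" "?k ** C0 = C0 ** ?k"
    using eq unfolding coset_eq_iff[OF g] by (auto intro: comm)
  then obtain \<alpha> p q r s where a: "\<alpha> * cnj \<alpha> = 1" and ka: "cmat ?k *v ua = \<alpha> *s ua" "cmat ?k *v va = cnj \<alpha> *s va"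
    and kb: "cmat ?k *v ub = p *s ub + q *s uc" "cmat ?k *v uc = r *s ub + s *s uc"
    by (rule cmat_commutant[OF k])
  let ?c = "p * s - q * r"
  show ?thesis
  proof (intro exI[of _ ?c] conjI allI impI)
    have "cmat g' *v u = cmat g *v (cmat ?k *v u)" for u
      by (subst gk) (simp only: cmat_mul matrix_vector_mul_assoc[symmetric])
    then show "minors g' i = ?c * minors g i" for i
      unfolding minors_def split_beta
      by (simp add: kb matrix_vector_right_distrib vector_scalar_commute) (simp add: algebra_simps)
  next
    fix V :: "5 \<Rightarrow> mat6" assume V: "\<forall>i. skew (V i)"
    let ?\<rho> = "\<chi> i j. if i = 1 then (if j = 1 then ?c else 0)
      else if i = 2 then (if j = 2 then \<alpha> * p else if j = 3 then \<alpha> * q else 0)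
      else if i = 3 then (if j = 2 then \<alpha> * r else if j = 3 then \<alpha> * s else 0)
      else if i = 4 then (if j = 4 then cnj \<alpha> * p else if j = 5 then cnj \<alpha> * q else 0)
      else (if j = 4 then cnj \<alpha> * r else if j = 5 then cnj \<alpha> * s else 0) :: complex^5^5"
    have cc: "coord (transpose ?k ** X ** ?k) = ?\<rho> *v coord X" if "skew X" for X
    proof -
      have sk: "cform X uc ub = - cform X ub uc" by (rule cform_skew[OF that])
      have "cform X u u = - cform X u u" for u by (rule cform_skew[OF that])
      then have uu: "cform X u u = 0" for u by simp
      have "(?\<rho> *v w) $ 1 = ?c * w $ 1" "(?\<rho> *v w) $ 2 = \<alpha> * (p * w $ 2 + q * w $ 3)"
        "(?\<rho> *v w) $ 3 = \<alpha> * (r * w $ 2 + s * w $ 3)" "(?\<rho> *v w) $ 4 = cnj \<alpha> * (p * w $ 4 + q * w $ 5)"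
        "(?\<rho> *v w) $ 5 = cnj \<alpha> * (r * w $ 4 + s * w $ 5)" for w
        by (simp_all add: matrix_vector_mult_def sum_5 algebra_simps)
      then show ?thesis
        unfolding vec_eq_iff forall_5
        by (simp only: coord_nth cform_conj ka kb cform_linear sk uu) (simp add: algebra_simps)
    qed
    have "coord (transpose g' ** V i ** g') = ?\<rho> *v coord (transpose g ** V i ** g)" for i
    proof -
      have "transpose g' ** V i ** g' = transpose ?k ** (transpose g ** V i ** g) ** ?k"
        using g by (subst gk, subst (2) gk) (simp only: matrix_transpose_mul_real matrix_mul_assoc)
      then show ?thesis using cc[of "transpose g ** V i ** g"] skew_conj[OF V[rule_format], of "transpose g"] by simp
    qed
    then have "frame_det g' V = det ((\<chi> i. coord (transpose g ** V i ** g)) ** transpose ?\<rho>)"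
      unfolding frame_det_def
      by (intro arg_cong[of _ _ det]) (simp add: vec_eq_iff matrix_matrix_mult_def matrix_vector_mult_def transpose_def mult.commute)
    also have "\<dots> = frame_det g V * det ?\<rho>" by (simp only: det_mul det_transpose frame_det_def)
    also have "det ?\<rho> = (\<alpha> * cnj \<alpha>)\<^sup>2 * ?c ^ 3"
      by (subst det_blocks_1_2_2) (auto simp: power2_eq_square power3_eq_cube algebra_simps)
    finally show "frame_det g' V = ?c ^ 3 * frame_det g V" by (simp add: a)
  qed
qed

lemma coord_sum: "coord (\<Sum>i\<in>I. X i) = (\<Sum>i\<in>I. coord (X i))"
  by (induction I rule: infinite_finite_induct) (simp_all add: coord_linear coord_commutant)

lemma Re_Im_smult: "of_real (Re z) *s u + of_real (Im z) *s (\<i> *s u) = z *s (u :: complex^'n)"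
proof -
  have "of_real (Re z) * x + of_real (Im z) * (\<i> * x) = (of_real (Re z) + \<i> * of_real (Im z)) * x" for x
    by (simp add: algebra_simps)
  then show ?thesis
    unfolding vec_eq_iff by (simp only: vector_add_component vector_smult_component complex_eq[symmetric] simp_thms)
qed

text \<open>A complex dependence between the coordinate rows, with coefficients split into real and
  imaginary parts, gives a real dependence between the vectors and their images under
  \<open>J_acs 1 0\<close>, because the latter acts as \<i> in these coordinates.\<close>

lemma frame_det_nonzero:
  assumes g: "g \<in> SOn" and V: "\<And>i. skew (V i)"
    and indep: "\<And>a b i. \<forall>f\<in>smooth_on_cosets U1xU2. (\<Sum>i\<in>UNIV. a i * fund U1xU2 (V i) (coset U1xU2 g) f +
        b i * J_acs 1 0 (coset U1xU2 g) (fund U1xU2 (V i) (coset U1xU2 g)) f) = 0 \<Longrightarrow> a i = 0 \<and> b i = 0"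
  shows "frame_det g V \<noteq> 0"
proof
  assume z: "frame_det g V = 0"
  let ?p = "coset U1xU2 g" and ?X = "\<lambda>i. transpose g ** V i ** g"
  have p: "?p \<in> cosets U1xU2" by (rule coset_mem[OF g])
  have X: "skew (?X i)" for i using skew_conj[OF V, of "transpose g"] by simp
  have VX: "g ** ?X i ** transpose g = V i" for i using g by (simp add: matrix_algebra SO_orthogonal)
  have "\<not> (\<exists>B. (\<chi> i. coord (?X i)) ** B = mat 1)"
    using z unfolding frame_det_def by (simp add: invertible_det_nz flip: invertible_right_inverse)
  then obtain c i0 where c: "(\<Sum>i\<in>UNIV. c i *s coord (?X i)) = 0" and c0: "c i0 \<noteq> 0"
    unfolding matrix_right_invertible_independent_rows by (auto simp: row_def)
  let ?T = "\<lambda>i. Re (c i) *\<^sub>R ?X i + Im (c i) *\<^sub>R J0 1 0 (?X i)"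
  let ?Y = "\<Sum>i\<in>UNIV. ?T i"
  have Y: "skew ?Y" by (intro skew_sum skew_add skew_scaleR skew_J0 X)
  have "coord ?Y = 0" by (simp only: coord_sum coord_linear coord_J0 Re_Im_smult c)
  note comm = coord_0_commutant[OF Y this]
  have "fund U1xU2 (g ** ?Y ** transpose g) ?p = fund U1xU2 (g ** 0 ** transpose g) ?p"
    by (rule fund_conj_eqI[OF Y skew_0 g]) (simp_all only: diff_0_right comm)
  then have f0: "fund U1xU2 (g ** ?Y ** transpose g) ?p f = 0" for f
    by (simp add: fund_0[OF p])
  have lin: "linear (\<lambda>M. g ** M ** transpose g)" by (intro linearI) (simp_all add: matrix_algebra)
  have "g ** ?Y ** transpose g = (\<Sum>i\<in>UNIV. Re (c i) *\<^sub>R V i + Im (c i) *\<^sub>R (g ** J0 1 0 (?X i) ** transpose g))"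
    by (simp only: linear_sum[OF lin] linear_add[OF lin] linear_scale[OF lin] VX)
  then have "(\<Sum>i\<in>UNIV. Re (c i) * fund U1xU2 (V i) ?p f + Im (c i) * fund U1xU2 (g ** J0 1 0 (?X i) ** transpose g) ?p f) = 0" for f
    using f0[of f] by (simp only: fund_sum[OF p] fund_add[OF _ _ p] fund_scaleR[OF _ p] skew_add skew_scaleR V skew_conj skew_J0 X)
  then have "Re (c i0) = 0 \<and> Im (c i0) = 0"
    by (intro indep ballI) (simp only: J_fund_coset[OF X g, unfolded VX])
  then show False using c0 by (simp add: complex_eq_iff)
qed

lemma coord_velocity_rotate:
  assumes g: "g \<in> SOn" and v: "v \<in> tangents U1xU2 (coset U1xU2 g)" "v' \<in> tangents U1xU2 (coset U1xU2 g)"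
    and eq: "v' = (\<lambda>f. cos \<theta> * v f + sin \<theta> * J_acs 1 0 (coset U1xU2 g) v f)"
  shows "coord (transpose g ** velocity (coset U1xU2 g) v' ** g) =
    exp (\<i> * of_real \<theta>) *s coord (transpose g ** velocity (coset U1xU2 g) v ** g)"
proof -
  let ?p = "coset U1xU2 g"
  have p: "?p \<in> cosets U1xU2" by (rule coset_mem[OF g])
  let ?V = "velocity ?p v" and ?V' = "velocity ?p v'"
  let ?X = "transpose g ** ?V ** g" and ?X' = "transpose g ** ?V' ** g"
  note V = velocity[OF p v(1)] and V' = velocity[OF p v(2)]
  have X: "skew ?X" using skew_conj[OF V(1), of "transpose g"] by simp
  have VX: "g ** ?X ** transpose g = ?V" using g by (simp add: matrix_algebra SO_orthogonal)
  let ?Z = "cos \<theta> *\<^sub>R ?X + sin \<theta> *\<^sub>R J0 1 0 ?X"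
  have Z: "skew ?Z" by (intro skew_add skew_scaleR skew_J0 X)
  have gZ: "g ** ?Z ** transpose g = cos \<theta> *\<^sub>R ?V + sin \<theta> *\<^sub>R (g ** J0 1 0 ?X ** transpose g)"
  proof -
    have lin: "linear (\<lambda>M. g ** M ** transpose g)" by (intro linearI) (simp_all add: matrix_algebra)
    show ?thesis by (simp only: linear_add[OF lin] linear_scale[OF lin] VX)
  qed
  have "fund U1xU2 (g ** ?Z ** transpose g) ?p f = v' f" for f
    unfolding gZ
    by (simp only: fund_add[OF _ _ p] fund_scaleR[OF _ p] skew_scaleR V skew_conj skew_J0 X
        J_fund_coset[OF X g, unfolded VX, symmetric] eq)
  then have "fund U1xU2 ?V' ?p = fund U1xU2 (g ** ?Z ** transpose g) ?p" unfolding V'(2) by auto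
  note d = fund_eqD[OF V'(1) skew_conj[OF Z] p this, unfolded emb_coset[OF g]]
  have comm: "(?X' - ?Z) ** A = A ** (?X' - ?Z)"
    if "(?V' - g ** ?Z ** transpose g) ** (g ** A ** transpose g) = (g ** A ** transpose g) ** (?V' - g ** ?Z ** transpose g)"
    for A :: mat6
  proof -
    have W: "transpose g ** (?V' - g ** Z ** transpose g) ** g = ?X' - Z" for Z :: mat6
      using g by (simp add: matrix_algebra SO_orthogonal)
    have "transpose g ** (W ** (g ** A ** transpose g)) ** g = transpose g ** ((g ** A ** transpose g) ** W) ** g
        \<Longrightarrow> (transpose g ** W ** g) ** A = A ** (transpose g ** W ** g)" for W :: mat6
      using g by (simp add: matrix_algebra SO_orthogonal)
    from this[OF arg_cong[OF that, of "\<lambda>M. transpose g ** M ** g"]] show ?thesis unfolding W .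
  qed
  have "coord (?X' - ?Z) = 0" by (rule coord_commutant; rule comm; rule d)
  then have "coord ?X' = coord ?Z" by (simp only: coord_linear(2) right_minus_eq)
  also have "\<dots> = of_real (cos \<theta>) *s coord ?X + of_real (sin \<theta>) *s (\<i> *s coord ?X)"
    by (simp only: coord_linear coord_J0)
  also have "\<dots> = exp (\<i> * of_real \<theta>) *s coord ?X"
    using Re_Im_smult[of "exp (\<i> * of_real \<theta>)" "coord ?X"] by (simp add: Re_exp Im_exp)
  finally show ?thesis .
qed

lemma continuous_on_coord:
  "continuous_on S A \<Longrightarrow> continuous_on S (\<lambda>x. coord (A x))"
proof -
  assume "continuous_on S A"
  then have "continuous_on S (\<lambda>x. cform (A x) u w)" for u w
    unfolding cform_sum by (intro continuous_intros continuous_on_component) auto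
  then have "continuous_on S (\<lambda>x. coord (A x) $ j)" for j
    using exhaust_5[of j] by (elim disjE) (simp_all add: coord_nth)
  then have "continuous_on S (\<lambda>x. \<chi> j. coord (A x) $ j)" by (intro continuous_on_vec_lambda)
  then show ?thesis by simp
qed

lemma continuous_on_frame_det:
  assumes "continuous_on S g" "\<And>i. continuous_on S (\<lambda>x. V x i)"
  shows "continuous_on S (\<lambda>x. frame_det (g x) (V x))"
proof -
  have "continuous_on S (\<lambda>x. coord (transpose (g x) ** V x i ** g x))" for i
    by (intro continuous_on_coord continuous_on_matrix_mul continuous_on_transpose assms)
  then show ?thesis
    unfolding frame_det_def det_def by (simp add: continuous_intros continuous_on_component)
qed

lemma continuous_on_minors:
  assumes "continuous_on S g"
  shows "continuous_on S (\<lambda>x. minors (g x) i)"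
  unfolding minors_def split_beta cmat_def matrix_vector_mult_def vec_lambda_beta
  by (intro continuous_intros continuous_on_component assms)

lemma continuous_on_velocity:
  assumes H: "\<And>f. f \<in> smooth_on_cosets U1xU2 \<Longrightarrow> continuous_on S (\<lambda>x. f (H x))"
    and v: "\<And>f. f \<in> smooth_on_cosets U1xU2 \<Longrightarrow> continuous_on S (\<lambda>x. v x f)"
  shows "continuous_on S (\<lambda>x. velocity (H x) (v x))"
proof -
  have sm: "(\<lambda>q. embB q $ i $ j) \<in> smooth_on_cosets U1xU2" "(\<lambda>q. embC q $ i $ j) \<in> smooth_on_cosets U1xU2" for i j
    using smooth_mat_emb by (simp_all add: smooth_mat_def)
  have "continuous_on S (\<lambda>x. embB (H x))" "continuous_on S (\<lambda>x. embC (H x))"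
    unfolding continuous_on_mat_iff by (intro allI H[OF sm(1)] H[OF sm(2)])+
  moreover have "continuous_on S (\<lambda>x. deriv_mat (v x) embB)" "continuous_on S (\<lambda>x. deriv_mat (v x) embC)"
    unfolding continuous_on_mat_iff deriv_mat_def vec_lambda_beta by (intro allI v[OF sm(1)] v[OF sm(2)])+
  ultimately show ?thesis
    unfolding velocity_def kato_def
    by (intro continuous_on_diff continuous_on_add continuous_on_scaleR continuous_on_const continuous_on_matrix_mul)
qed

lemma J2_no_nullhomotopic_frame: "\<not> has_nullhomotopic_frame U1xU2 (J_acs 1 0)"
proof
  assume "has_nullhomotopic_frame U1xU2 (J_acs 1 0)"
  then obtain w H v where F: "frame_family U1xU2 (J_acs 1 0) w H v" and nd: "\<not> 3 dvd (\<Sum>i\<in>UNIV. w i)"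
    unfolding has_nullhomotopic_frame_def by (elim exE conjE)
  note D = frame_familyD[OF F]
  obtain g where cg: "continuous_on unit_square g" and g: "\<And>x. x \<in> unit_square \<Longrightarrow> g x \<in> SOn"
    and gH: "\<And>x. x \<in> unit_square \<Longrightarrow> coset U1xU2 (g x) = H x"
    by (rule continuous_lift[of H, OF D(1) D(4)]) (assumption, assumption, rule that, assumption, blast, blast)
  define V where "V x i = velocity (H x) (v i x)" for x i
  have V: "skew (V x i)" "fund U1xU2 (V x i) (H x) = v i x" if "x \<in> unit_square" for x i
    unfolding V_def using velocity[OF D(1)[OF that] D(2)[OF that]] by simp_all
  let ?D = "\<lambda>x. frame_det (g x) (V x)"
  have "continuous_on unit_square ?D"
    by (intro continuous_on_frame_det cg, unfold V_def) (rule continuous_on_velocity[OF D(4) D(5)])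
  moreover have "contractible unit_square"
    by (intro convex_imp_contractible convex_Times convex_real_interval)
  moreover have D0: "?D x \<noteq> 0" if x: "x \<in> unit_square" for x
    by (rule frame_det_nonzero[OF g[OF x] V(1)[OF x]], unfold gH[OF x] V(2)[OF x]) (rule D(3)[OF x])
  \<comment> \<open>The square is contractible, so the nonvanishing determinant has a continuous
    logarithm and with it a continuous cube root.\<close>
  ultimately obtain l where cl: "continuous_on unit_square l" and l: "\<And>x. x \<in> unit_square \<Longrightarrow> ?D x = exp (l x)"
    by (rule continuous_logarithm_on_contractible) (assumption, rule that, assumption, blast)
  \<comment> \<open>The Plucker vector divided by the cube root of the frame determinant. The
    character of a change of lift cancels, leaving a cube root of unity.\<close>
  define \<zeta> where "\<zeta> x i = exp (- (l x / 3)) * minors (g x) i" for x i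
  \<comment> \<open>One statement for all sides of the square: the angles \<theta> are 2 \<pi> w_i t
    on the side s = 0 and vanish on the others.\<close>
  have rel: "\<exists>\<omega>. \<omega> ^ 3 = exp (- (\<i> * of_real (\<Sum>i\<in>UNIV. \<theta> i))) \<and> (\<forall>i. \<zeta> x i = \<omega> * \<zeta> y i)"
    if x: "x \<in> unit_square" and y: "y \<in> unit_square" and H: "H x = H y"
      and vxy: "\<And>i. v i x = (\<lambda>f. cos (\<theta> i) * v i y f + sin (\<theta> i) * J_acs 1 0 (H y) (v i y) f)" for x y \<theta>
  proof -
    have "coset U1xU2 (g y) = coset U1xU2 (g x)" using x y H by (simp add: gH)
    from lift_change[OF g[OF y] g[OF x] this] obtain c where c: "\<forall>i. minors (g x) i = c * minors (g y) i"
        "\<forall>V. (\<forall>i. skew (V i)) \<longrightarrow> frame_det (g x) V = c ^ 3 * frame_det (g y) V"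
      by (elim exE conjE)
    note m = c(1)[rule_format] and d = c(2)[rule_format]
    have "coord (transpose (g x) ** V x i ** g x) = exp (\<i> * of_real (\<theta> i)) *s coord (transpose (g x) ** V y i ** g x)" for i
      using coord_velocity_rotate[OF g[OF x], unfolded gH[OF x], of "v i y" "v i x" "\<theta> i"] D(2)[OF x, of i] D(2)[OF y, of i]
      unfolding V_def H by (simp only: vxy)
    then have "?D x = (\<Prod>i\<in>UNIV. exp (\<i> * of_real (\<theta> i))) * frame_det (g x) (V y)"
      unfolding frame_det_def by (simp only: det_rows_mul)
    also have "(\<Prod>i\<in>UNIV. exp (\<i> * of_real (\<theta> i))) = exp (\<i> * of_real (\<Sum>i\<in>UNIV. \<theta> i))"
      by (simp add: exp_sum sum_distrib_left)
    also have "frame_det (g x) (V y) = c ^ 3 * ?D y" by (rule d) (rule V(1)[OF y])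
    finally have E: "exp (l x) = exp (\<i> * of_real (\<Sum>i\<in>UNIV. \<theta> i)) * (c ^ 3 * exp (l y))"
      by (simp only: l[OF x] l[OF y])
    let ?w = "exp (l y / 3 - l x / 3) * c"
    have "?w ^ 3 = exp (l y - l x) * c ^ 3"
      by (simp add: power_mult_distrib right_diff_distrib flip: exp_of_nat_mult)
    also have "\<dots> = exp (- (\<i> * of_real (\<Sum>i\<in>UNIV. \<theta> i)))"
      unfolding exp_diff exp_minus E by (simp add: field_simps E[symmetric]) (use E in \<open>auto simp: field_simps\<close>)
    finally have "?w ^ 3 = exp (- (\<i> * of_real (\<Sum>i\<in>UNIV. \<theta> i)))" .
    moreover have "\<zeta> x i = ?w * \<zeta> y i" for i
    proof -
      have "exp (- (l x / 3)) = exp (l y / 3 - l x / 3) * exp (- (l y / 3))" by (simp flip: exp_add)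
      then show ?thesis unfolding \<zeta>_def m by (simp only: mult_ac)
    qed
    ultimately show ?thesis by blast
  qed
  have "3 dvd (\<Sum>i\<in>UNIV. w i)"
  proof (rule winding_dvd_3[of \<zeta>])
    show "continuous_on unit_square (\<lambda>x. \<zeta> x i)" for i
      unfolding \<zeta>_def by (intro continuous_intros cl continuous_on_minors cg) auto
    show "\<exists>i. \<zeta> x i \<noteq> 0" if "x \<in> unit_square" for x
      using minors_nonzero[OF g[OF that]] by (simp add: \<zeta>_def)
    show "\<exists>\<omega>. \<omega> ^ 3 = exp (- (\<i> * of_real (2 * pi * of_int (\<Sum>i\<in>UNIV. w i) * t))) \<and> (\<forall>i. \<zeta> (0, t) i = \<omega> * \<zeta> (0, 0) i)"
      if t: "t \<in> {0..1}" for t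
    proof -
      have "2 * pi * of_int (\<Sum>i\<in>UNIV. w i) * t = (\<Sum>i\<in>UNIV. 2 * pi * w i * t)"
        by (simp add: sum_distrib_left sum_distrib_right)
      then show ?thesis
        by (simp only:) (rule rel; use t in \<open>simp add: D(6)[OF t] D(7)[OF t] del: of_int_sum\<close>)
    qed
    show "\<exists>\<omega>. \<omega> ^ 3 = 1 \<and> (\<forall>i. \<zeta> (t, 1) i = \<omega> * \<zeta> (t, 0) i)" if t: "t \<in> {0..1}" for t
      using rel[of "(t, 1)" "(t, 0)" "\<lambda>_. 0"] t by (simp add: D(8)[OF t] D(9)[OF t])
    show "\<exists>\<omega>. \<omega> ^ 3 = 1 \<and> (\<forall>i. \<zeta> (1, t) i = \<omega> * \<zeta> (1, 0) i)" if t: "t \<in> {0..1}" for t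
      using rel[of "(1, t)" "(1, 0)" "\<lambda>_. 0"] t by (simp add: D(10)[OF t] D(11)[OF t])
  qed
  then show False using nd by blast
qed

section \<open>Three distinct classes\<close>

lemma has_nullhomotopic_frame_acs_relation:
  assumes "(J, J') \<in> acs_relation SO K"
  shows "has_nullhomotopic_frame K J \<longleftrightarrow> has_nullhomotopic_frame K J'"
proof (rule acs_relation_invariant[OF _ _ assms])
  fix J1 J2 assume "J1 \<in> invariant_acs SO K"
  then have "almost_complex_structure (cosets K) (smooth_on_cosets K) J1" by (simp add: invariant_acs_def)
  then show "equivalent_acs (cosets K) (smooth_on_cosets K) J1 J2 \<Longrightarrow> has_nullhomotopic_frame K J1 \<Longrightarrow> has_nullhomotopic_frame K J2"
    by (rule has_nullhomotopic_frame_equivalent[rotated])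
qed (rule has_nullhomotopic_frame_conjugate)

lemma has_holomorphic_quotient_acs_relation:
  assumes "(J, J') \<in> acs_relation SO K"
  shows "has_holomorphic_quotient K J \<longleftrightarrow> has_holomorphic_quotient K J'"
proof (rule acs_relation_invariant[OF _ _ assms])
  fix J1 J2 assume J1: "J1 \<in> invariant_acs SO K" and eq: "equivalent_acs (cosets K) (smooth_on_cosets K) J1 J2"
    and h: "has_holomorphic_quotient K J1"
  have "almost_complex_structure (cosets K) (smooth_on_cosets K) J1"
    using J1 by (simp add: invariant_acs_def)
  from has_holomorphic_quotient_pullback[OF equivalent_acs_sym[OF this eq] h] show "has_holomorphic_quotient K J2" .
qed (rule has_holomorphic_quotient_conjugate)

theorem proposition8p7:
  shows "\<exists>S. S \<subseteq> invariant_acs SO6 U1xU2 // acs_relation SO6 U1xU2 \<and> card S = 3"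
proof -
  let ?R = "acs_relation SO6 U1xU2" and ?J1 = "J_acs 0 1" and ?J2 = "J_acs 1 0" and ?J3 = "J_acs (- 1) 0"
  have inv: "?J1 \<in> invariant_acs SO6 U1xU2" "?J2 \<in> invariant_acs SO6 U1xU2" "?J3 \<in> invariant_acs SO6 U1xU2"
    by (rule J_acs_invariant; simp)+
  \<comment> \<open>The total winding of the frame family is 2 + 2 m + 2 m', that is 2 for
    \<open>?J1\<close> and -2 for \<open>?J3\<close>; the signs of \<open>?J2\<close> would give
    6.\<close>
  have frame: "has_nullhomotopic_frame U1xU2 ?J1" "has_nullhomotopic_frame U1xU2 ?J3"
    unfolding has_nullhomotopic_frame_def
    by ((intro exI conjI, rule J_frame_family[where m = 1 and m' = "- 1"]; simp add: sum_5),
      (intro exI conjI, rule J_frame_family[where m = "- 1" and m' = "- 1"]; simp add: sum_5))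
  have ne: "?R `` {J} \<noteq> ?R `` {J'}" if "J' \<in> invariant_acs SO6 U1xU2" "(J, J') \<notin> ?R" for J J'
  proof -
    have "(J', J') \<in> ?R" using that(1) by (simp add: acs_relation_def)
    then show ?thesis using that(2) by blast
  qed
  have out: "(?J1, ?J2) \<notin> ?R" "(?J3, ?J2) \<notin> ?R" "(?J1, ?J3) \<notin> ?R"
    using has_nullhomotopic_frame_acs_relation[of ?J1 ?J2 U1xU2] has_nullhomotopic_frame_acs_relation[of ?J3 ?J2 U1xU2]
      has_holomorphic_quotient_acs_relation[of ?J1 ?J3 U1xU2] frame J2_no_nullhomotopic_frame
      J1_has_holomorphic_quotient J3_no_holomorphic_quotient
    unfolding SO6_def by blast+
  have "card {?R `` {?J1}, ?R `` {?J2}, ?R `` {?J3}} = 3"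
    using ne[OF inv(2) out(1)] ne[OF inv(2) out(2)] ne[OF inv(3) out(3)] by (simp add: eq_commute)
  moreover have "{?R `` {?J1}, ?R `` {?J2}, ?R `` {?J3}} \<subseteq> invariant_acs SO6 U1xU2 // ?R"
    using inv by (auto intro: quotientI)
  ultimately show ?thesis by blast
qed

end
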